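(* Let $\beta_1,\beta_2,\beta_3\in(0,1]$, $L_1,L_2,L_3\in(0,\infty)$ and $\beta_\wedge=\min(\beta_1,\beta_2,\beta_3)$. Suppose that $\|a\|_\infty<\infty$, that $c\le\bar r_S(x_S)\le C$ for all $x_S\in\mathbb R^S$ and $S\in\mathbb S$, where $0<c\le C<\infty$, and that: (A1) for all $x,x'\in\mathbb R^d$ with $\|x-x'\|_\infty\le 1$, $|a(x)-a(x')|\le L_1\|x-x'\|_\infty^{\beta_1}$; (A2) for all $S\in\mathbb S$ and $x_S,x_S'\in\mathbb R^S$ with $\|x_S-x_S'\|_\infty\le 1$, the total variation distance between the conditional distributions of $X_{S^c}$ given $X_S=x_S$ and given $X_S=x_S'$ is at most $L_2\|x_S-x_S'\|_\infty^{\beta_2}$; (A3) for all $S\in\mathbb S$ and $x_S,x_S'\in\mathbb R^S$ with $\|x_S-x_S'\|_\infty\le 1$, $|\bar r_S(x_S)-\bar r_S(x_S')|\le L_3\|x_S-x_S'\|_\infty^{\beta_3}$. Suppose further that $|n\lambda_S/n_S-1|\le 1/n$ for all $S\in\mathbb S$, that $h\in[T(M/n)^{1/d},1]$, and that $\inf_{\alpha_{\mathbb S}\in H_{\mathbb S}}\mathcal L(\alpha_{\mathbb S})\ge V_0>0$. Let $\lambda_{\min}=\min_{S\in\mathbb S}\lambda_S$, $A=28(C/c+2^d)$, $B=16\max(\|a\|_\infty^2,1)\max\{(C/c)^2,(L_1+L_2+L_3)^2,8^d\}$ and $D=200|\mathbb S|^2(C/c)(1+\lambda_{\min}^{-1})B$.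 Let $\hat\theta$, $\hat V$, $C_\alpha$ be as defined in the context (with step size $\eta=|\mathbb S|^{-1}$) and let $Z\sim N(0,1)$. Then $$d_{\mathrm K}\Bigl(\frac{n^{1/2}(\hat\theta-\theta)}{\hat V^{1/2}}\mathbf 1_{\{\hat V>0\}},Z\Bigr)\le\frac{7A^{M/2}D}{V_0}\Bigl\{\frac{MT^d}{nh^d}+h^{2\beta_\wedge}+\mathbb P(\|X\|_\infty\ge T)\Bigr\}^{1/4}.$$ In particular, $\mathbb P(C_\alpha\ni\theta)\to 1-\alpha$ uniformly over $\alpha\in(0,1)$ whenever this right-hand side converges to zero.
   Context: Setting. Let $d\ge 2$, $[d]=\{1,\dots,d\}$, let $f$ be a probability density on $\mathbb R^d$ and $X\sim f$. For $x\in\mathbb R^d$, $S\subseteq[d]$ write $x_S=(x_j:j\in S)\in\mathbb R^S$, $S^c=[d]\setminus S$, and $f_S$ for the density of $X_S$. Let $\mathbb S\subseteq 2^{[d]}\setminus\{[d]\}$ be a nonempty collection, and for $S\in\mathbb S$ let $r_S:\mathbb R^S\to(0,\infty)$ be a known measurable function with normalised version $\bar r_S=r_S/\int r_Sf_S$. Functions of $x_S$ are also regarded as functions of $x$. Let $a:\mathbb R^d\to\mathbb R$ be a known measurable function, $\|a\|_\infty=\sup_x|a(x)|$, and $\theta=\int af=\mathbb E\{a(X)\}$. $d_{\mathrm K}$ is the Kolmogorov distance, $d_{\mathrm K}(U,V)=\sup_{x\in\mathbb R}|\mathbb P(U\le x)-\mathbb P(V\le x)|$. Data. For sample sizes $n$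 and $n_S\ge 1$ ($S\in\mathbb S$; $n_S/n\to\lambda_S\in(0,\infty)$ as $n\to\infty$) we observe mutually independent samples: $X_1,\dots,X_n$ i.i.d. with density $f$; and, for each $S\in\mathbb S$, $X_{S,1},\dots,X_{S,n_S}$ for which only the coordinates in $S$ are observed, with $(X_{S,i})_S$ i.i.d. with density $\bar r_Sf_S$. Functions of $x_S$ may be evaluated at $X_{S,i}$. Objective. $L^2=\{\alpha:\mathbb R^d\to\mathbb R:\int\alpha^2f<\infty\}$, $H_S=\{\alpha_S\in L^2:\alpha_S(x)\equiv\alpha_S(x_S),\int\alpha_Sf=0\}$, $H_{\mathbb S}=\prod_{S\in\mathbb S}H_S$, and for $\alpha_{\mathbb S}\in H_{\mathbb S}$ $$\mathcal L(\alpha_{\mathbb S})=\mathrm{Var}\Bigl(a(X)-\sum_{S\in\mathbb S}\alpha_S(X_S)\Bigr)+\sum_{S\in\mathbb S}\mathbb E\Bigl[\frac{\alpha_S(X_S)^2}{\lambda_S\bar r_S(X_S)}\Bigr].$$ Cross-fitting estimator. Let $M\in\mathbb N$ with $n\ge 2M$, $h>0$ a bandwidth, $T\ge 1$ and $\eta=|\mathbb S|^{-1}$. Let $\mathcal D_1=\{X_1,\dots,X_{\lceil n/2\rceil}\}$, $\mathcal D_2=\{X_{\lceil n/2\rceil+1},\dots,X_n\}$, and split each $\mathcal D_\ell$ into $M$ disjoint pieces $\mathcal D_{\ell,1},\dots,\mathcal D_{\ell,M}$ of sizes as equal as possible. Let $K_h^S(u_S)=(2h)^{-|S|}\mathbf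 1\{\|u_S\|_\infty\le h\}$, $B_T=\{x\in\mathbb R^d:\|x\|_\infty\le T\}$, $\hat r_{S,(\ell)}=|\mathcal D_\ell|^{-1}\sum_{x\in\mathcal D_\ell}r_S(x)$. For fixed $\ell\in\{1,2\}$ put $\hat r_S^{(m)}=|\mathcal D_{\ell,m}|^{-1}\sum_{y\in\mathcal D_{\ell,m}}r_S(y)$, $\hat f_S^{(m)}(x_S)=|\mathcal D_{\ell,m}|^{-1}\sum_{y\in\mathcal D_{\ell,m}}K_h^S(x_S-y_S)$ and $\hat w_S^{(m)}(x_S)=\lambda_Sr_S(x_S)/\{\hat r_S^{(m)}+\lambda_Sr_S(x_S)\}$. Set $\hat\alpha_{S,(\ell)}^{(0)}\equiv 0$ and, for $m=1,\dots,M$, $S\in\mathbb S$, $\|x_S\|_\infty\le T$, $$\hat\alpha_{S,(\ell)}^{(m)}(x_S)=(1-\eta)\hat\alpha_{S,(\ell)}^{(m-1)}(x_S)+\eta\,\hat w_S^{(m)}(x_S)\Bigl[\frac1{|\mathcal D_{\ell,m}|}\sum_{y\in\mathcal D_{\ell,m}}g_S(y)\mathbf 1_{B_T}(y)\frac{K_h^S(x_S-y_S)}{\hat f_S^{(m)}(x_S)}-\frac{\sum_{y\in\mathcal D_{\ell,m}}\hat w_S^{(m)}(y)g_S(y)\mathbf 1_{B_T}(y)}{\sum_{y\in\mathcal D_{\ell,m}}\hat w_S^{(m)}(y)}\Bigr],$$ where $g_S(y)=a(y)-\sum_{S'\in\mathbb S\setminus\{S\}}\hat\alpha_{S',(\ell)}^{(m-1)}(y)$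 and $0/0=0$; set $\hat\alpha_{S,(\ell)}^{(m)}(x_S)=0$ if $\|x_S\|_\infty>T$. Then $$\hat\theta_{(\ell)}^{(M)}=\frac1{|\mathcal D_{3-\ell}|}\sum_{x\in\mathcal D_{3-\ell}}\Bigl\{a(x)-\sum_{S\in\mathbb S}\hat\alpha_{S,(\ell)}^{(M)}(x)\Bigr\}+\sum_{S\in\mathbb S}\frac1{n_S}\sum_{j=1}^{n_S}\frac{\hat\alpha_{S,(\ell)}^{(M)}(X_{S,j})\,\hat r_{S,(3-\ell)}}{r_S(X_{S,j})},$$ and $\hat\theta=(|\mathcal D_2|\hat\theta_{(1)}^{(M)}+|\mathcal D_1|\hat\theta_{(2)}^{(M)})/n$. Variance estimator and interval. For $\ell=1,2$ and $S\in\mathbb S$, $$\hat V^{(\ell)}=\frac1{|\mathcal D_{3-\ell}|}\sum_{x\in\mathcal D_{3-\ell}}\Bigl\{a(x)-\sum_{S\in\mathbb S}\hat\alpha_{S,(\ell)}^{(M)}(x)\Bigr\}^2-(\hat\theta)^2,\qquad \hat V_S^{(\ell)}=\frac n{|\mathcal D_{3-\ell}|}\sum_{x\in\mathcal D_{3-\ell}}\frac{\hat r_{S,(\ell)}\hat\alpha_{S,(\ell)}^{(M)}(x)^2}{n_Sr_S(x)},$$ $\hat V=\max\bigl[\frac12\{\hat V^{(1)}+\hat V^{(2)}+\sum_{S\in\mathbb S}(\hat V_S^{(1)}+\hat V_S^{(2)})\},0\bigr]$. For a level $\alpha\in(0,1)$ let $z_{\alpha/2}$ satisfy $\mathbb P(Z\le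 z_{\alpha/2})=1-\alpha/2$ for $Z\sim N(0,1)$, and $C_\alpha=[\hat\theta-n^{-1/2}\hat V^{1/2}z_{\alpha/2},\ \hat\theta+n^{-1/2}\hat V^{1/2}z_{\alpha/2}]$. *)

theory Defs
  imports "HOL-Probability.Probability"
begin

section \<open>Coordinate spaces\<close>

text \<open>
  Coordinates are indexed by \<open>{1..d}\<close>. For a set \<open>S\<close> of indices, the space of real vectors
  indexed by \<open>S\<close> is the space \<open>S \<rightarrow>\<^sub>E UNIV\<close> of the product measure below, so that \<open>x\<^sub>S\<close> is
  \<^term>\<open>restrict x S\<close>. The functions written with a subscript \<open>S\<close> (\<open>r\<^sub>S\<close>, \<open>\<alpha>\<^sub>S\<close>, ...) are
  represented as functions of \<open>x\<^sub>S\<close> and composed with \<^term>\<open>\<lambda>x. restrict x S\<close> when they are regarded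
  as functions of \<open>x\<close>.
\<close>

type_synonym point = "nat \<Rightarrow> real"

abbreviation leb :: "nat set \<Rightarrow> point measure" where
  "leb S \<equiv> Pi\<^sub>M S (\<lambda>_. lborel)"

text \<open>The inserted \<open>0\<close> only matters for \<open>S = {}\<close>.\<close>

definition sup_norm :: "nat set \<Rightarrow> point \<Rightarrow> real" where
  "sup_norm S u = Max (insert 0 ((\<lambda>j. \<bar>u j\<bar>) ` S))"

definition sup_dist :: "nat set \<Rightarrow> point \<Rightarrow> point \<Rightarrow> real" where
  "sup_dist S u v = sup_norm S (\<lambda>j. u j - v j)"

definition average :: "'i set \<Rightarrow> ('i \<Rightarrow> real) \<Rightarrow> real" where
  "average I g = (\<Sum>i\<in>I. g i) / real (card I)"


section \<open>Distances between distributions, normal quantiles\<close>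

definition kolmogorov_dist :: "real measure \<Rightarrow> real measure \<Rightarrow> real" where
  "kolmogorov_dist \<mu> \<nu> = (SUP x. \<bar>cdf \<mu> x - cdf \<nu> x\<bar>)"

definition tv_dist :: "'b measure \<Rightarrow> 'b measure \<Rightarrow> real" where
  "tv_dist \<mu> \<nu> = (SUP B\<in>sets \<mu>. \<bar>measure \<mu> B - measure \<nu> B\<bar>)"

definition normal_quantile :: "real \<Rightarrow> real" where
  "normal_quantile p = (THE z. cdf std_normal_distribution z = p)"


section \<open>The design\<close>

text \<open>
  One value of this record contains everything needed to define the estimator at one sample size,
  so that an asymptotic regime is a sequence of records. The number \<open>n\<^sub>S\<close> of incomplete
  observations is a function of the sample size \<open>n\<close>, as it has to satisfy \<open>n\<^sub>S / n \<longlonglongrightarrow> \<lambda>\<^sub>S\<close>; the data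
  consist of \<open>n\<^sub>S\<close> observations for the actual sample size. Of the \<open>j\<close>-th incomplete observation with
  pattern \<open>S\<close>, only the observed part, a point indexed by \<open>S\<close>, is recorded.
\<close>

record 'w design =
  ndim :: nat                                     \<comment> \<open>\<open>d\<close>\<close>
  dens :: "point \<Rightarrow> real"                         \<comment> \<open>\<open>f\<close>\<close>
  patterns :: "nat set set"                       \<comment> \<open>the collection of observation patterns \<open>S\<close>\<close>
  ratio :: "nat set \<Rightarrow> point \<Rightarrow> real"             \<comment> \<open>\<open>r\<^sub>S\<close>\<close>
  target :: "point \<Rightarrow> real"                       \<comment> \<open>\<open>a\<close>\<close>
  lam :: "nat set \<Rightarrow> real"                        \<comment> \<open>\<open>\<lambda>\<^sub>S\<close>\<close>
  ssize :: nat                                    \<comment> \<open>\<open>n\<close>\<close>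
  ssize_inc :: "nat \<Rightarrow> nat set \<Rightarrow> nat"            \<comment> \<open>\<open>n\<^sub>S\<close>, depending on \<open>n\<close>\<close>
  nsteps :: nat                                   \<comment> \<open>\<open>M\<close>\<close>
  bandwidth :: real                               \<comment> \<open>\<open>h\<close>\<close>
  trunc :: real                                   \<comment> \<open>\<open>T\<close>\<close>
  piece :: "nat \<Rightarrow> nat \<Rightarrow> nat set"                \<comment> \<open>indices of the data in the \<open>m\<close>-th piece of half \<open>\<ell>\<close>\<close>
  Omega :: "'w measure"
  Xfull :: "nat \<Rightarrow> 'w \<Rightarrow> point"                   \<comment> \<open>\<open>X\<^sub>i\<close>\<close>
  Xinc :: "nat set \<Rightarrow> nat \<Rightarrow> 'w \<Rightarrow> point"         \<comment> \<open>observed part of the \<open>j\<close>-th point with pattern \<open>S\<close>\<close>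

abbreviation coords :: "'w design \<Rightarrow> nat set" where
  "coords E \<equiv> {1..ndim E}"

abbreviation nS :: "'w design \<Rightarrow> nat set \<Rightarrow> nat" where
  "nS E S \<equiv> ssize_inc E (ssize E) S"

text \<open>The distribution of \<open>X\<close>.\<close>

definition law :: "'w design \<Rightarrow> point measure" where
  "law E = density (leb (coords E)) (\<lambda>x. ennreal (dens E x))"

definition marg :: "'w design \<Rightarrow> nat set \<Rightarrow> point \<Rightarrow> real" where
  "marg E S u = (\<integral>v. dens E (merge S (coords E - S) (u, v)) \<partial>leb (coords E - S))"

text \<open>
  If the integral below were infinite it would be \<open>0\<close> as a Bochner integral and so would \<open>rbar\<close>; this is
  excluded by the lower bound \<open>c > 0\<close> on \<open>rbar\<close> assumed later.
\<close>

definition rbar :: "'w design \<Rightarrow> nat set \<Rightarrow> point \<Rightarrow> real" where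
  "rbar E S u = ratio E S u / (\<integral>v. ratio E S v * marg E S v \<partial>leb S)"

definition theta :: "'w design \<Rightarrow> real" where
  "theta E = (\<integral>x. target E x \<partial>law E)"

definition target_norm :: "'w design \<Rightarrow> real" where
  "target_norm E = (SUP x\<in>space (leb (coords E)). \<bar>target E x\<bar>)"

definition half :: "'w design \<Rightarrow> nat \<Rightarrow> nat set" where
  "half E l = (if l = 1 then {1..nat \<lceil>real (ssize E) / 2\<rceil>}
               else {nat \<lceil>real (ssize E) / 2\<rceil> + 1..ssize E})"

definition setting :: "'w design \<Rightarrow> bool" where
  "setting E \<longleftrightarrow>
     2 \<le> ndim E \<and>
     dens E \<in> borel_measurable (leb (coords E)) \<and>
     (\<forall>x\<in>space (leb (coords E)). 0 \<le> dens E x) \<and>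
     prob_space (law E) \<and>
     patterns E \<noteq> {} \<and> patterns E \<subseteq> Pow (coords E) - {coords E} \<and>
     (\<forall>S\<in>patterns E. ratio E S \<in> borel_measurable (leb S) \<and> (\<forall>u\<in>space (leb S). 0 < ratio E S u)) \<and>
     target E \<in> borel_measurable (leb (coords E)) \<and>
     (\<forall>S\<in>patterns E. 0 < lam E S \<and> (\<lambda>k. real (ssize_inc E k S) / real k) \<longlonglongrightarrow> lam E S) \<and>
     (\<forall>S\<in>patterns E. 1 \<le> nS E S) \<and>
     1 \<le> nsteps E \<and> 2 * nsteps E \<le> ssize E \<and>
     0 < bandwidth E \<and> 1 \<le> trunc E \<and>
     (\<forall>l\<in>{1,2}. disjoint_family_on (piece E l) {1..nsteps E} \<and>
        (\<Union>m\<in>{1..nsteps E}. piece E l m) = half E l \<and>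
        (\<forall>m\<in>{1..nsteps E}. \<forall>m'\<in>{1..nsteps E}. card (piece E l m) \<le> card (piece E l m') + 1)) \<and>
     prob_space (Omega E) \<and>
     (\<forall>i\<in>{1..ssize E}. distributed (Omega E) (leb (coords E)) (Xfull E i) (\<lambda>x. ennreal (dens E x))) \<and>
     (\<forall>S\<in>patterns E. \<forall>j\<in>{1..nS E S}.
        distributed (Omega E) (leb S) (Xinc E S j) (\<lambda>u. ennreal (rbar E S u * marg E S u))) \<and>
     prob_space.indep_vars (Omega E)
       (case_sum (\<lambda>i. leb (coords E)) (\<lambda>(S, j). leb S))
       (case_sum (Xfull E) (\<lambda>(S, j). Xinc E S j))
       ({1..ssize E} <+> (SIGMA S:patterns E. {1..nS E S}))"


section \<open>The objective\<close>

definition Lsq :: "'w design \<Rightarrow> (point \<Rightarrow> real) set" where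
  "Lsq E = {\<alpha> \<in> borel_measurable (leb (coords E)). integrable (law E) (\<lambda>x. (\<alpha> x)\<^sup>2)}"

definition H :: "'w design \<Rightarrow> nat set \<Rightarrow> (point \<Rightarrow> real) set" where
  "H E S = {\<alpha> \<in> borel_measurable (leb S).
     (\<lambda>x. \<alpha> (restrict x S)) \<in> Lsq E \<and> (\<integral>x. \<alpha> (restrict x S) \<partial>law E) = 0}"

definition objective :: "'w design \<Rightarrow> (nat set \<Rightarrow> point \<Rightarrow> real) \<Rightarrow> real" where
  "objective E \<alpha> =
     prob_space.variance (law E) (\<lambda>x. target E x - (\<Sum>S\<in>patterns E. \<alpha> S (restrict x S))) +
     (\<Sum>S\<in>patterns E. \<integral>x. (\<alpha> S (restrict x S))\<^sup>2 / (lam E S * rbar E S (restrict x S)) \<partial>law E)"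


section \<open>The cross-fitting estimator\<close>

text \<open>All estimators are functions of the data and hence of the sample point \<open>\<omega>\<close>.\<close>

definition kern :: "real \<Rightarrow> nat set \<Rightarrow> point \<Rightarrow> real" where
  "kern h S u = of_bool (sup_norm S u \<le> h) / (2 * h) ^ card S"

definition rhat :: "'w design \<Rightarrow> 'w \<Rightarrow> nat set \<Rightarrow> nat set \<Rightarrow> real" where
  "rhat E \<omega> I S = average I (\<lambda>i. ratio E S (restrict (Xfull E i \<omega>) S))"

definition fhat :: "'w design \<Rightarrow> 'w \<Rightarrow> nat set \<Rightarrow> nat set \<Rightarrow> point \<Rightarrow> real" where
  "fhat E \<omega> I S u = average I (\<lambda>i. kern (bandwidth E) S (\<lambda>j. u j - Xfull E i \<omega> j))"

definition what :: "'w design \<Rightarrow> 'w \<Rightarrow> nat set \<Rightarrow> nat set \<Rightarrow> point \<Rightarrow> real" where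
  "what E \<omega> I S u = lam E S * ratio E S u / (rhat E \<omega> I S + lam E S * ratio E S u)"

text \<open>
  One step of the iteration for the component \<open>S\<close>, based on the data with indices in \<open>I\<close>, starting
  from the functions \<open>\<alpha>\<close>; \<open>gT y\<close> is \<open>g\<^sub>S(y)\<close> times the indicator of the cube with
  half-width \<open>T\<close>. Division by zero yields zero in HOL.
\<close>

definition update ::
  "'w design \<Rightarrow> 'w \<Rightarrow> nat set \<Rightarrow> (nat set \<Rightarrow> point \<Rightarrow> real) \<Rightarrow> nat set \<Rightarrow> point \<Rightarrow> real" where
  "update E \<omega> I \<alpha> S u =
     (let \<eta> = 1 / real (card (patterns E));
          gT = (\<lambda>y. (target E y - (\<Sum>S'\<in>patterns E - {S}. \<alpha> S' (restrict y S'))) *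
                    of_bool (sup_norm (coords E) y \<le> trunc E))
      in if sup_norm S u \<le> trunc E then
           (1 - \<eta>) * \<alpha> S u + \<eta> * what E \<omega> I S u *
             (average I (\<lambda>i. gT (Xfull E i \<omega>) *
                (kern (bandwidth E) S (\<lambda>j. u j - Xfull E i \<omega> j) / fhat E \<omega> I S u)) -
              (\<Sum>i\<in>I. what E \<omega> I S (restrict (Xfull E i \<omega>) S) * gT (Xfull E i \<omega>)) /
              (\<Sum>i\<in>I. what E \<omega> I S (restrict (Xfull E i \<omega>) S)))
         else 0)"

primrec alpha_hat :: "'w design \<Rightarrow> 'w \<Rightarrow> nat \<Rightarrow> nat \<Rightarrow> nat set \<Rightarrow> point \<Rightarrow> real" where
  "alpha_hat E \<omega> l 0 = (\<lambda>S u. 0)"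
| "alpha_hat E \<omega> l (Suc m) = update E \<omega> (piece E l (Suc m)) (alpha_hat E \<omega> l m)"

abbreviation alpha_fin :: "'w design \<Rightarrow> 'w \<Rightarrow> nat \<Rightarrow> nat set \<Rightarrow> point \<Rightarrow> real" where
  "alpha_fin E \<omega> l \<equiv> alpha_hat E \<omega> l (nsteps E)"

definition residual :: "'w design \<Rightarrow> 'w \<Rightarrow> nat \<Rightarrow> point \<Rightarrow> real" where
  "residual E \<omega> l x = target E x - (\<Sum>S\<in>patterns E. alpha_fin E \<omega> l S (restrict x S))"

definition theta_fold :: "'w design \<Rightarrow> 'w \<Rightarrow> nat \<Rightarrow> real" where
  "theta_fold E \<omega> l =
     average (half E (3 - l)) (\<lambda>i. residual E \<omega> l (Xfull E i \<omega>)) +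
     (\<Sum>S\<in>patterns E. average {1..nS E S}
        (\<lambda>j. alpha_fin E \<omega> l S (Xinc E S j \<omega>) * rhat E \<omega> (half E (3 - l)) S /
             ratio E S (Xinc E S j \<omega>)))"

definition theta_hat :: "'w design \<Rightarrow> 'w \<Rightarrow> real" where
  "theta_hat E \<omega> =
     (real (card (half E 2)) * theta_fold E \<omega> 1 + real (card (half E 1)) * theta_fold E \<omega> 2) /
     real (ssize E)"

definition V_fold :: "'w design \<Rightarrow> 'w \<Rightarrow> nat \<Rightarrow> real" where
  "V_fold E \<omega> l =
     average (half E (3 - l)) (\<lambda>i. (residual E \<omega> l (Xfull E i \<omega>))\<^sup>2) - (theta_hat E \<omega>)\<^sup>2"

definition VS_fold :: "'w design \<Rightarrow> 'w \<Rightarrow> nat \<Rightarrow> nat set \<Rightarrow> real" where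
  "VS_fold E \<omega> l S =
     real (ssize E) * average (half E (3 - l))
       (\<lambda>i. rhat E \<omega> (half E l) S * (alpha_fin E \<omega> l S (restrict (Xfull E i \<omega>) S))\<^sup>2 /
            (real (nS E S) * ratio E S (restrict (Xfull E i \<omega>) S)))"

definition V_hat :: "'w design \<Rightarrow> 'w \<Rightarrow> real" where
  "V_hat E \<omega> =
     max ((V_fold E \<omega> 1 + V_fold E \<omega> 2 +
           (\<Sum>S\<in>patterns E. VS_fold E \<omega> 1 S + VS_fold E \<omega> 2 S)) / 2) 0"

definition studentised :: "'w design \<Rightarrow> 'w \<Rightarrow> real" where
  "studentised E \<omega> =
     sqrt (real (ssize E)) * (theta_hat E \<omega> - theta E) / sqrt (V_hat E \<omega>) * of_bool (V_hat E \<omega> > 0)"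

definition conf_int :: "'w design \<Rightarrow> real \<Rightarrow> 'w \<Rightarrow> real set" where
  "conf_int E \<alpha> \<omega> =
     (let w = sqrt (V_hat E \<omega>) * normal_quantile (1 - \<alpha> / 2) / sqrt (real (ssize E))
      in {theta_hat E \<omega> - w .. theta_hat E \<omega> + w})"


section \<open>Regularity conditions and the error bound\<close>

definition regular_cond_dist :: "'w design \<Rightarrow> nat set \<Rightarrow> (point \<Rightarrow> point measure) \<Rightarrow> bool" where
  "regular_cond_dist E S \<kappa> \<longleftrightarrow>
     \<kappa> \<in> measurable (leb S) (prob_algebra (leb (coords E - S))) \<and>
     (\<forall>A\<in>sets (leb S). \<forall>B\<in>sets (leb (coords E - S)).
        emeasure (law E) {x \<in> space (law E). restrict x S \<in> A \<and> restrict x (coords E - S) \<in> B} =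
        (\<integral>\<^sup>+u. emeasure (\<kappa> u) B * indicator A u \<partial>distr (law E) (leb S) (\<lambda>x. restrict x S)))"

record constants =
  beta1 :: real
  beta2 :: real
  beta3 :: real
  L1 :: real
  L2 :: real
  L3 :: real
  clow :: real                                    \<comment> \<open>\<open>c\<close>\<close>
  cupp :: real                                    \<comment> \<open>\<open>C\<close>\<close>
  V0 :: real

definition A1 :: "'w design \<Rightarrow> constants \<Rightarrow> bool" where
  "A1 E K \<longleftrightarrow> (\<forall>x\<in>space (leb (coords E)). \<forall>x'\<in>space (leb (coords E)).
     sup_dist (coords E) x x' \<le> 1 \<longrightarrow>
     \<bar>target E x - target E x'\<bar> \<le> L1 K * sup_dist (coords E) x x' powr beta1 K)"

text \<open>
  Conditional distributions are determined up to null sets only; the condition is read as one on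
  some version.
\<close>

definition A2 :: "'w design \<Rightarrow> constants \<Rightarrow> bool" where
  "A2 E K \<longleftrightarrow> (\<forall>S\<in>patterns E. \<exists>\<kappa>. regular_cond_dist E S \<kappa> \<and>
     (\<forall>u\<in>space (leb S). \<forall>u'\<in>space (leb S). sup_dist S u u' \<le> 1 \<longrightarrow>
        tv_dist (\<kappa> u) (\<kappa> u') \<le> L2 K * sup_dist S u u' powr beta2 K))"

definition A3 :: "'w design \<Rightarrow> constants \<Rightarrow> bool" where
  "A3 E K \<longleftrightarrow> (\<forall>S\<in>patterns E. \<forall>u\<in>space (leb S). \<forall>u'\<in>space (leb S). sup_dist S u u' \<le> 1 \<longrightarrow>
     \<bar>rbar E S u - rbar E S u'\<bar> \<le> L3 K * sup_dist S u u' powr beta3 K)"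

definition hypotheses :: "'w design \<Rightarrow> constants \<Rightarrow> bool" where
  "hypotheses E K \<longleftrightarrow>
     {beta1 K, beta2 K, beta3 K} \<subseteq> {0<..1} \<and>
     0 < L1 K \<and> 0 < L2 K \<and> 0 < L3 K \<and>
     bdd_above ((\<lambda>x. \<bar>target E x\<bar>) ` space (leb (coords E))) \<and>
     0 < clow K \<and> clow K \<le> cupp K \<and>
     (\<forall>S\<in>patterns E. \<forall>u\<in>space (leb S). clow K \<le> rbar E S u \<and> rbar E S u \<le> cupp K) \<and>
     A1 E K \<and> A2 E K \<and> A3 E K \<and>
     (\<forall>S\<in>patterns E. \<bar>real (ssize E) * lam E S / real (nS E S) - 1\<bar> \<le> 1 / real (ssize E)) \<and>
     trunc E * (real (nsteps E) / real (ssize E)) powr (1 / real (ndim E)) \<le> bandwidth E \<and>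
     bandwidth E \<le> 1 \<and>
     (INF \<alpha>\<in>Pi\<^sub>E (patterns E) (H E). objective E \<alpha>) \<ge> V0 K \<and> 0 < V0 K"

definition A_const :: "'w design \<Rightarrow> constants \<Rightarrow> real" where
  "A_const E K = 28 * (cupp K / clow K + 2 ^ ndim E)"

definition B_const :: "'w design \<Rightarrow> constants \<Rightarrow> real" where
  "B_const E K = 16 * max ((target_norm E)\<^sup>2) 1 *
     Max {(cupp K / clow K)\<^sup>2, (L1 K + L2 K + L3 K)\<^sup>2, 8 ^ ndim E}"

definition D_const :: "'w design \<Rightarrow> constants \<Rightarrow> real" where
  "D_const E K = 200 * (real (card (patterns E)))\<^sup>2 * (cupp K / clow K) *
     (1 + 1 / Min (lam E ` patterns E)) * B_const E K"

definition error_bound :: "'w design \<Rightarrow> constants \<Rightarrow> real" where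
  "error_bound E K =
     7 * A_const E K powr (real (nsteps E) / 2) * D_const E K / V0 K *
     (real (nsteps E) * trunc E ^ ndim E / (real (ssize E) * bandwidth E ^ ndim E) +
      bandwidth E powr (2 * Min {beta1 K, beta2 K, beta3 K}) +
      measure (law E) {x \<in> space (law E). trunc E \<le> sup_norm (coords E) x}) powr (1 / 4)"

end

theory Submission
  imports Defs
begin

text \<open>The cross-fitted iterates are compared with the iterates of the population problem, obtained by
  replacing all averages by expectations. One step of the iteration loses at most a constant factor in mean square,
  plus the error of kernel regression, which is controlled by exchangeability of the test point and the data; this
  gives the factor \<open>A\<^sup>M\<close>. Since each half of the data is independent of the functions fitted on the other one,
  replacing the fitted functions by the population iterates changes the estimator by a centred
  average of small functions. What is left is a sum of independent bounded variables whose variance is, up to a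
  factor, the objective at the population iterate and hence bounded below; Lindeberg's method yields a crude rate
  for it, which suffices because the bound is never smaller than \<open>n powr (-1/8)\<close>. Markov's inequality for
  the remainder and for the variance estimator completes the proof.\<close>

section \<open>Bounded measurable functions\<close>

text \<open>No lower bound on the density is assumed, so neighbour counts may vanish and kernel
  estimates have no pointwise error bound. Errors are therefore measured at an extra observation
  with index 0, outside the data, which can be exchanged with any observation of a piece; the
  denominators are then controlled by counting cells, and this is the origin of the power of 2 in
  \<open>A_const\<close>. The iteration is never shown to converge. Every population iterate is
  centred and yields an unbiased leading term; minimisation enters only through the infimum that
  bounds its variance below. The step size, one over the number of patterns, keeps the growth per
  step free of that number: bounds at most triple, and squared errors are multiplied by at most a
  third of \<open>A_const\<close>. Given the fitting half, the fitting error enters the complete and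
  the incomplete averages with cancelling means, which removes the first-order bias. The exponent
  1/4 stems from the variance estimator: its mean absolute error is of order
  \<open>\<delta> powr (1/2)\<close>, and Markov's inequality splits this evenly between a threshold
  and a probability.\<close>

definition bdm :: "'a measure \<Rightarrow> ('a \<Rightarrow> real) \<Rightarrow> bool" where
  "bdm M f \<longleftrightarrow> f \<in> borel_measurable M \<and> (\<exists>B. \<forall>x\<in>space M. \<bar>f x\<bar> \<le> B)"

lemma bdmI: "f \<in> borel_measurable M \<Longrightarrow> (\<And>x. x \<in> space M \<Longrightarrow> \<bar>f x\<bar> \<le> B) \<Longrightarrow> bdm M f"
  by (auto simp: bdm_def)

lemma bdm_measurable: "bdm M f \<Longrightarrow> f \<in> borel_measurable M"
  by (auto simp: bdm_def)

lemma bdmE: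
  assumes "bdm M f"
  obtains B where "B \<ge> 0" "\<And>x. x \<in> space M \<Longrightarrow> \<bar>f x\<bar> \<le> B"
proof -
  from assms obtain B where "\<And>x. x \<in> space M \<Longrightarrow> \<bar>f x\<bar> \<le> B" by (auto simp: bdm_def)
  then show ?thesis by (intro that[of "\<bar>B\<bar>"]) (fastforce intro: order_trans[OF _ abs_ge_self])+
qed

lemma bdm_const: "bdm M (\<lambda>x. c)"
  by (auto simp: bdm_def)

lemma bdm_add: assumes "bdm M f" "bdm M g" shows "bdm M (\<lambda>x. f x + g x)"
proof -
  obtain B C where "\<And>x. x \<in> space M \<Longrightarrow> \<bar>f x\<bar> \<le> B" "\<And>x. x \<in> space M \<Longrightarrow> \<bar>g x\<bar> \<le> C"
    using assms by (auto simp: bdm_def)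
  then show ?thesis using assms by (intro bdmI[where B="B + C"]) (auto simp: bdm_def intro!: order_trans[OF abs_triangle_ineq] add_mono)
qed

lemma bdm_mult: assumes "bdm M f" "bdm M g" shows "bdm M (\<lambda>x. f x * g x)"
proof -
  obtain B where "B \<ge> 0" "\<And>x. x \<in> space M \<Longrightarrow> \<bar>f x\<bar> \<le> B" using bdmE[OF assms(1)] by blast
  moreover obtain C where "\<And>x. x \<in> space M \<Longrightarrow> \<bar>g x\<bar> \<le> C" using bdmE[OF assms(2)] by blast
  ultimately
  show ?thesis using assms by (intro bdmI[where B="B * C"]) (auto simp: bdm_def abs_mult intro!: mult_mono)
qed

lemma bdm_uminus: "bdm M f \<Longrightarrow> bdm M (\<lambda>x. - f x)"
  by (auto simp: bdm_def)

lemma bdm_diff: "bdm M f \<Longrightarrow> bdm M g \<Longrightarrow> bdm M (\<lambda>x. f x - g x)"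
  using bdm_add[OF _ bdm_uminus, of M f g] by simp

lemma bdm_abs: "bdm M f \<Longrightarrow> bdm M (\<lambda>x. \<bar>f x\<bar>)"
  by (auto simp: bdm_def)

lemma bdm_power: "bdm M f \<Longrightarrow> bdm M (\<lambda>x. f x ^ n)"
  by (induction n) (auto intro: bdm_const bdm_mult)

lemma bdm_sum: "(\<And>i. i \<in> I \<Longrightarrow> bdm M (f i)) \<Longrightarrow> bdm M (\<lambda>x. \<Sum>i\<in>I. f i x)"
  by (induction I rule: infinite_finite_induct) (auto intro: bdm_const bdm_add)

lemma bdm_divide_const: "bdm M f \<Longrightarrow> bdm M (\<lambda>x. f x / c)"
  using bdm_mult[OF _ bdm_const, of M f "1/c"] by simp

lemma bdm_of_bool: "Measurable.pred M P \<Longrightarrow> bdm M (\<lambda>x. of_bool (P x))"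
  by (rule bdmI[where B=1]) (auto simp: of_bool_def)

lemma bdm_comp: "bdm N f \<Longrightarrow> g \<in> measurable M N \<Longrightarrow> bdm M (\<lambda>x. f (g x))"
  unfolding bdm_def by (intro conjI measurable_compose[of g M N f borel]) (auto dest: measurable_space)

lemmas bdm_intros = bdm_const bdm_add bdm_mult bdm_diff bdm_uminus bdm_abs bdm_power bdm_sum bdm_divide_const

text \<open>Target, normalised ratios, weights and iterates are all bounded, and boundedness
  survives sums, products and integration over one factor. Integrability and Fubini obligations thus
  become structural instead of analytic.\<close>

lemma (in prob_space) integrable_bdm: "bdm M f \<Longrightarrow> integrable M f"
  unfolding bdm_def using integrable_const_bound[of f] by fastforce

lemma (in prob_space) bdm_integral_le:
  assumes "bdm M f" "bdm M g" "\<And>x. x \<in> space M \<Longrightarrow> f x \<le> g x"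
  shows "(\<integral>x. f x \<partial>M) \<le> (\<integral>x. g x \<partial>M)"
  using assms by (intro integral_mono) (auto intro: integrable_bdm)

lemma (in prob_space) integral_le_const_bdm:
  assumes "bdm M f" "\<And>x. x \<in> space M \<Longrightarrow> f x \<le> c"
  shows "(\<integral>x. f x \<partial>M) \<le> c"
  using bdm_integral_le[OF assms(1) bdm_const[of M c] assms(2)] by (simp add: prob_space)

lemma (in prob_space) abs_integral_le_const:
  assumes "bdm M f" "\<And>x. x \<in> space M \<Longrightarrow> \<bar>f x\<bar> \<le> c"
  shows "\<bar>\<integral>x. f x \<partial>M\<bar> \<le> c"
proof -
  have "\<bar>\<integral>x. f x \<partial>M\<bar> \<le> (\<integral>x. \<bar>f x\<bar> \<partial>M)" by (rule integral_abs_bound)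
  also have "\<dots> \<le> c" using assms by (intro integral_le_const_bdm bdm_abs)
  finally show ?thesis .
qed

lemma (in prob_space) bdm_integral_add:
  "bdm M f \<Longrightarrow> bdm M g \<Longrightarrow> (\<integral>x. f x + g x \<partial>M) = (\<integral>x. f x \<partial>M) + (\<integral>x. g x \<partial>M)"
  by (intro Bochner_Integration.integral_add integrable_bdm)

lemma (in prob_space) bdm_integral_diff:
  "bdm M f \<Longrightarrow> bdm M g \<Longrightarrow> (\<integral>x. f x - g x \<partial>M) = (\<integral>x. f x \<partial>M) - (\<integral>x. g x \<partial>M)"
  by (intro Bochner_Integration.integral_diff integrable_bdm)

lemma (in prob_space) bdm_integral_sum:
  "(\<And>i. i \<in> I \<Longrightarrow> bdm M (f i)) \<Longrightarrow> (\<integral>x. (\<Sum>i\<in>I. f i x) \<partial>M) = (\<Sum>i\<in>I. \<integral>x. f i x \<partial>M)"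
  by (intro Bochner_Integration.integral_sum integrable_bdm)

lemma (in prob_space) square_expectation_le:
  assumes "bdm M f"
  shows "(\<integral>x. f x \<partial>M)\<^sup>2 \<le> (\<integral>x. (f x)\<^sup>2 \<partial>M)"
proof -
  have i: "integrable M f" "integrable M (\<lambda>x. (f x)\<^sup>2)"
    using assms by (auto intro!: integrable_bdm bdm_intros)
  have "0 \<le> variance f" by (rule variance_positive)
  also have "\<dots> = (\<integral>x. (f x)\<^sup>2 \<partial>M) - (\<integral>x. f x \<partial>M)\<^sup>2" by (rule variance_eq[OF i])
  finally show ?thesis by simp
qed

lemma (in prob_space) expectation_abs_le_sqrt:
  assumes "bdm M f" "(\<integral>x. (f x)\<^sup>2 \<partial>M) \<le> e"
  shows "(\<integral>x. \<bar>f x\<bar> \<partial>M) \<le> sqrt e"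
  using square_expectation_le[OF bdm_abs[OF assms(1)]] assms(2)
  by (intro real_le_rsqrt) simp

text \<open>Lets a conditional mean given the data, such as an integral over a fresh point, be
  treated as a statistic again.\<close>

lemma bdm_integral:
  assumes "prob_space N" "bdm (M \<Otimes>\<^sub>M N) (\<lambda>(x, y). f x y)"
  shows "bdm M (\<lambda>x. \<integral>y. f x y \<partial>N)"
proof -
  interpret N: prob_space N by fact
  obtain B where B: "\<And>z. z \<in> space (M \<Otimes>\<^sub>M N) \<Longrightarrow> \<bar>(\<lambda>(x, y). f x y) z\<bar> \<le> B"
    using bdmE[OF assms(2)] by blast
  have [measurable]: "(\<lambda>(x, y). f x y) \<in> borel_measurable (M \<Otimes>\<^sub>M N)" by (rule bdm_measurable[OF assms(2)])
  show ?thesis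
  proof (rule bdmI)
    show "(\<lambda>x. \<integral>y. f x y \<partial>N) \<in> borel_measurable M" by (rule N.borel_measurable_lebesgue_integral) simp
    fix x assume x: "x \<in> space M"
    have m: "f x \<in> borel_measurable N" using x by (intro measurable_Pair2[of "\<lambda>(x, y). f x y", simplified]) auto
    show "\<bar>\<integral>y. f x y \<partial>N\<bar> \<le> B"
      by (rule N.abs_integral_le_const) (use B[of "(x, _)"] x m in \<open>auto simp: space_pair_measure intro!: bdmI\<close>)
  qed
qed

lemma sum_squared_le_card:
  fixes f :: "'a \<Rightarrow> real"
  shows "(\<Sum>i\<in>I. f i)\<^sup>2 \<le> real (card I) * (\<Sum>i\<in>I. (f i)\<^sup>2)"
  using sum_squared_le_sum_of_squares[of f I] by (simp add: mult.commute)

section \<open>Independent samples\<close>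

text \<open>The product runs over the whole index type, so it has coordinates beyond those of the
  data; one of them serves as the test point. Independence is used in two forms: a coordinate may be
  redrawn, and coordinates with equal factors may be exchanged.\<close>

locale samples =
  fixes M :: "'i \<Rightarrow> 'a measure"
  assumes prob_M: "\<And>i. prob_space (M i)"
begin

abbreviation Q :: "('i \<Rightarrow> 'a) measure" where "Q \<equiv> PiM UNIV M"

sublocale Q: prob_space Q
  by (rule prob_space_PiM) (rule prob_M)

lemma upd_measurable [measurable]:
  "(\<lambda>(y, D). D(k := y)) \<in> measurable (M k \<Otimes>\<^sub>M Q) Q"
proof (rule measurable_PiM_single')
  fix i show "(\<lambda>p. (case p of (y, D) \<Rightarrow> D(k := y)) i) \<in> measurable (M k \<Otimes>\<^sub>M Q) (M i)"
    by (cases "i = k") (simp_all add: case_prod_unfold)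
qed (auto simp: space_pair_measure space_PiM split: if_splits)

lemma coord_space: "D \<in> space Q \<Longrightarrow> D k \<in> space (M k)"
  by (auto simp: space_PiM)

lemma distr_upd: "distr (M k \<Otimes>\<^sub>M Q) Q (\<lambda>(y, D). D(k := y)) = Q"
  using distr_pair_PiM_eq_PiM[of UNIV M k] prob_M by simp

lemma distr_coord: "distr Q (M k) (\<lambda>D. D k) = M k"
  by (rule distr_PiM_component) (auto simp: prob_M)

lemma bdm_upd:
  assumes "bdm Q \<phi>"
  shows "bdm (M k \<Otimes>\<^sub>M Q) (\<lambda>(y, D). \<phi> (D(k := y)))"
  using bdm_comp[OF assms upd_measurable[of k]] by (simp add: case_prod_unfold)

text \<open>Replaces conditioning on all coordinates but \<open>k\<close>: redrawing coordinate
  \<open>k\<close> independently does not change the law (\<open>distr_upd\<close>), and Fubini does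
  the rest. Here the new value is integrated last, in \<open>resample\<close> it is integrated
  first.\<close>

lemma resample':
  assumes "bdm Q \<phi>"
  shows "(\<integral>D. \<phi> D \<partial>Q) = (\<integral>y. (\<integral>D. \<phi> (D(k := y)) \<partial>Q) \<partial>M k)"
proof -
  interpret Mk: prob_space "M k" by (rule prob_M)
  interpret pair_prob_space "M k" Q ..
  have "(\<integral>D. \<phi> D \<partial>Q) = (\<integral>D. \<phi> D \<partial>distr (M k \<Otimes>\<^sub>M Q) Q (\<lambda>(y, D). D(k := y)))"
    by (simp add: distr_upd)
  also have "\<dots> = (\<integral>p. \<phi> ((\<lambda>(y, D). D(k := y)) p) \<partial>(M k \<Otimes>\<^sub>M Q))"
    by (rule integral_distr[OF upd_measurable bdm_measurable[OF assms]])
  also have "\<dots> = (\<integral>y. (\<integral>D. \<phi> (D(k := y)) \<partial>Q) \<partial>M k)"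
    using integral_fst'[OF integrable_bdm[OF bdm_upd[OF assms, of k]]] by (simp add: case_prod_unfold)
  finally show ?thesis .
qed

lemma resample:
  assumes "bdm Q \<phi>"
  shows "(\<integral>D. \<phi> D \<partial>Q) = (\<integral>D. (\<integral>y. \<phi> (D(k := y)) \<partial>M k) \<partial>Q)"
proof -
  interpret Mk: prob_space "M k" by (rule prob_M)
  interpret pair_prob_space "M k" Q ..
  show ?thesis
    unfolding resample'[OF assms, of k]
    by (rule Fubini_integral[symmetric]) (rule integrable_bdm[OF bdm_upd[OF assms]])
qed

lemma integral_coord:
  assumes "f \<in> borel_measurable (M k)"
  shows "(\<integral>D. f (D k) \<partial>Q) = (\<integral>y. f y \<partial>M k :: real)"
  using integral_distr[of "\<lambda>D. D k" Q "M k" f] assms by (simp add: distr_coord)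

text \<open>Exchangeability: the product measure is invariant under reindexing by the transposition
  of two indices with the same factor.\<close>

lemma integral_swap:
  assumes "bdm Q \<phi>" "M i = M j"
  shows "(\<integral>D. \<phi> D \<partial>Q) = (\<integral>D. \<phi> (D(i := D j, j := D i)) \<partial>Q)"
proof -
  define f where "f = Transposition.transpose i j"
  have Mf: "(\<lambda>k. M (f k)) = M" using assms(2) by (auto simp: f_def Transposition.transpose_def)
  have "distr Q Q (\<lambda>D. \<lambda>n\<in>UNIV. D (f n)) = Q"
    using distr_PiM_reindex[of UNIV M f UNIV] prob_M Mf by (simp add: f_def)
  moreover have "(\<lambda>D. \<lambda>n\<in>UNIV. D (f n)) = (\<lambda>D::'i \<Rightarrow> 'a. D(i := D j, j := D i))"
    by (auto simp: f_def Transposition.transpose_def fun_eq_iff)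
  ultimately have d: "distr Q Q (\<lambda>D. D(i := D j, j := D i)) = Q" by simp
  have [measurable]: "(\<lambda>D. D(i := D j, j := D i)) \<in> measurable Q Q"
  proof (rule measurable_PiM_single')
    fix k
    have "(\<lambda>D. D j) \<in> measurable Q (M i)" using measurable_component_singleton[of j UNIV M] by (simp add: assms(2))
    moreover have "(\<lambda>D. D i) \<in> measurable Q (M j)" using measurable_component_singleton[of i UNIV M] by (simp add: assms(2))
    ultimately show "(\<lambda>D. (D(i := D j, j := D i)) k) \<in> measurable Q (M k)"
      by (cases "k = j"; cases "k = i") simp_all
  next
    show "(\<lambda>D. D(i := D j, j := D i)) \<in> space Q \<rightarrow> (\<Pi>\<^sub>E i\<in>UNIV. space (M i))"
      using assms(2) by (auto simp: space_PiM PiE_iff) metis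
  qed
  show ?thesis
    using integral_distr[of "\<lambda>D. D(i := D j, j := D i)" Q Q \<phi>] bdm_measurable[OF assms(1)] by (simp add: d)
qed

text \<open>The summands need not be independent: it suffices that every cross term vanishes after
  redrawing one coordinate, which may depend on the pair. Kernel weights, whose denominator involves
  all observations, require this generality.\<close>

lemma centred_sum:
  assumes "finite J" "\<And>i. i \<in> J \<Longrightarrow> bdm Q (\<xi> i)"
    and "\<And>i j. i \<in> J \<Longrightarrow> j \<in> J \<Longrightarrow> i \<noteq> j \<Longrightarrow>
      \<exists>k. \<forall>D\<in>space Q. (\<integral>y. \<xi> i (D(k := y)) * \<xi> j (D(k := y)) \<partial>M k) = 0"
  shows "(\<integral>D. (\<Sum>i\<in>J. \<xi> i D)\<^sup>2 \<partial>Q) = (\<Sum>i\<in>J. \<integral>D. (\<xi> i D)\<^sup>2 \<partial>Q)"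
proof -
  have z: "(\<integral>D. \<xi> i D * \<xi> j D \<partial>Q) = 0" if ij: "i \<in> J" "j \<in> J" "i \<noteq> j" for i j
  proof -
    obtain k where k: "\<And>D. D \<in> space Q \<Longrightarrow> (\<integral>y. \<xi> i (D(k := y)) * \<xi> j (D(k := y)) \<partial>M k) = 0"
      using assms(3)[OF ij] by blast
    have "(\<integral>D. \<xi> i D * \<xi> j D \<partial>Q) = (\<integral>D. (\<integral>y. \<xi> i (D(k := y)) * \<xi> j (D(k := y)) \<partial>M k) \<partial>Q)"
      using assms(2) ij by (intro resample bdm_mult) auto
    also have "\<dots> = (\<integral>D. 0 \<partial>Q)" by (rule Bochner_Integration.integral_cong) (auto simp: k)
    finally show ?thesis by simp
  qed
  have "(\<integral>D. (\<Sum>i\<in>J. \<xi> i D)\<^sup>2 \<partial>Q) = (\<integral>D. (\<Sum>i\<in>J. \<Sum>j\<in>J. \<xi> i D * \<xi> j D) \<partial>Q)"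
    by (simp add: power2_eq_square sum_product)
  also have "\<dots> = (\<Sum>i\<in>J. \<Sum>j\<in>J. \<integral>D. \<xi> i D * \<xi> j D \<partial>Q)"
    using assms(2) by (simp add: Q.bdm_integral_sum bdm_sum bdm_mult)
  also have "\<dots> = (\<Sum>i\<in>J. \<Sum>j\<in>J. if j = i then (\<integral>D. (\<xi> i D)\<^sup>2 \<partial>Q) else 0)"
    by (intro sum.cong) (auto simp: z power2_eq_square)
  also have "\<dots> = (\<Sum>i\<in>J. \<integral>D. (\<xi> i D)\<^sup>2 \<partial>Q)" using assms(1) by simp
  finally show ?thesis .
qed

text \<open>The common special case: each summand is centred in a coordinate of its own that the
  other summands ignore.\<close>

lemma centred_sum_coords:
  assumes "finite J" "\<And>i. i \<in> J \<Longrightarrow> bdm Q (\<xi> i)"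
    and "\<And>i D. i \<in> J \<Longrightarrow> D \<in> space Q \<Longrightarrow> (\<integral>y. \<xi> i (D(idx i := y)) \<partial>M (idx i)) = 0"
    and "\<And>i j D y. i \<in> J \<Longrightarrow> j \<in> J \<Longrightarrow> i \<noteq> j \<Longrightarrow> \<xi> j (D(idx i := y)) = \<xi> j D"
  shows "(\<integral>D. (\<Sum>i\<in>J. \<xi> i D)\<^sup>2 \<partial>Q) = (\<Sum>i\<in>J. \<integral>D. (\<xi> i D)\<^sup>2 \<partial>Q)"
proof (rule centred_sum[OF assms(1,2)])
  fix i j assume ij: "i \<in> J" "j \<in> J" "i \<noteq> j"
  show "\<exists>k. \<forall>D\<in>space Q. (\<integral>y. \<xi> i (D(k := y)) * \<xi> j (D(k := y)) \<partial>M k) = 0"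
    using ij by (intro exI[of _ "idx i"]) (simp add: assms(3,4))
qed

end

section \<open>The normal distribution function\<close>

abbreviation Phi :: "real \<Rightarrow> real" where "Phi \<equiv> cdf std_normal_distribution"

interpretation std_normal: real_distribution std_normal_distribution
  by (rule real_dist_normal_dist)

lemma Phi_diff:
  assumes "a \<le> b"
  shows "Phi b - Phi a = (LBINT x=ereal a..ereal b. std_normal_density x)"
proof (cases "a = b")
  case False
  with assms have "a < b" by simp
  then have "Phi b - Phi a = measure std_normal_distribution {a<..b}"
    by (rule std_normal.cdf_diff_eq)
  also have "\<dots> = (\<integral>x. indicator {a<..b} x \<partial>std_normal_distribution)" by simp
  also have "\<dots> = (\<integral>x. std_normal_density x *\<^sub>R indicator {a<..b} x \<partial>lborel)"
    by (rule integral_density) auto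
  also have "\<dots> = (LBINT x:{a<..b}. std_normal_density x)"
    by (simp add: set_lebesgue_integral_def mult.commute)
  finally show ?thesis using assms by (simp add: interval_integral_Ioc)
qed simp

lemma continuous_std_normal_density: "continuous_on A std_normal_density"
  unfolding std_normal_density_def by (intro continuous_intros) auto

lemma Phi_deriv: "(Phi has_real_derivative std_normal_density x) (at x)"
proof -
  have "((\<lambda>u. LBINT y=ereal (x - 1)..ereal u. std_normal_density y) has_vector_derivative std_normal_density x)
      (at x within {x - 1..x + 1})"
    by (rule interval_integral_FTC2) (auto intro: continuous_std_normal_density)
  then have "((\<lambda>u. LBINT y=ereal (x - 1)..ereal u. std_normal_density y) has_real_derivative std_normal_density x) (at x)"
    by (simp add: has_real_derivative_iff_has_vector_derivative at_within_Icc_at)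
  then have "((\<lambda>u. Phi (x - 1) + (LBINT y=ereal (x - 1)..ereal u. std_normal_density y)) has_real_derivative std_normal_density x) (at x)"
    by (auto intro!: derivative_eq_intros)
  then show ?thesis
  proof (rule has_field_derivative_transform_within_open[where S="{x - 1<..}"])
    fix u assume "u \<in> {x - 1<..}"
    then show "Phi (x - 1) + (LBINT y=ereal (x - 1)..ereal u. std_normal_density y) = Phi u"
      using Phi_diff[of "x - 1" u] by simp
  qed auto
qed

lemma Phi_deriv_compose [derivative_intros]:
  "(f has_real_derivative f') (at x within A) \<Longrightarrow>
   ((\<lambda>x. Phi (f x)) has_real_derivative std_normal_density (f x) * f') (at x within A)"
  by (rule DERIV_chain2[OF Phi_deriv])

lemma std_normal_density_deriv [derivative_intros]:
  "(f has_real_derivative f') (at x within A) \<Longrightarrow>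
   ((\<lambda>x. std_normal_density (f x)) has_real_derivative - f x * std_normal_density (f x) * f') (at x within A)"
  unfolding std_normal_density_def
  by (auto intro!: derivative_eq_intros simp: field_simps power2_eq_square)

lemma Phi_measurable [measurable]: "Phi \<in> borel_measurable borel"
  using Phi_deriv by (intro borel_measurable_continuous_onI continuous_at_imp_continuous_on ballI DERIV_isCont) blast

lemma Phi_nonneg: "0 \<le> Phi x" and Phi_le_1: "Phi x \<le> 1"
  by (auto simp: cdf_def std_normal.prob_le_1)

lemma Phi_abs_le: "\<bar>Phi x\<bar> \<le> 1"
  using Phi_nonneg[of x] Phi_le_1[of x] by simp

lemma Phi_mono: "x \<le> y \<Longrightarrow> Phi x \<le> Phi y"
  by (rule std_normal.cdf_nondecreasing)

text \<open>Replaces the exponential by its Taylor polynomial of degree 4 and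
  \<open>sqrt (2 * pi)\<close> by 2, so that the bounds below become polynomial
  inequalities.\<close>

lemma std_normal_density_le:
  "std_normal_density y \<le> 1 / (2 * (1 + y\<^sup>2 / 2 + y ^ 4 / 8))"
proof -
  have "1 + y\<^sup>2 / 2 + (y\<^sup>2 / 2)\<^sup>2 / 2 \<le> exp (y\<^sup>2 / 2)"
    by (rule exp_lower_Taylor_quadratic) simp
  then have e: "1 + y\<^sup>2 / 2 + y ^ 4 / 8 \<le> exp (y\<^sup>2 / 2)"
    by (simp add: power_divide flip: power_mult)
  have "sqrt (2 * 2) \<le> sqrt (2 * pi)" using pi_ge_two by (intro real_sqrt_le_mono) simp
  then have p: "2 \<le> sqrt (2 * pi)" by (simp add: real_sqrt_mult)
  have "0 < 1 + y\<^sup>2 / 2 + y ^ 4 / 8" by (simp add: add_pos_nonneg)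
  have "std_normal_density y = 1 / (sqrt (2 * pi) * exp (y\<^sup>2 / 2))"
    by (simp add: std_normal_density_def exp_minus inverse_eq_divide)
  also have "\<dots> \<le> 1 / (2 * (1 + y\<^sup>2 / 2 + y ^ 4 / 8))"
    using e p \<open>0 < 1 + y\<^sup>2 / 2 + y ^ 4 / 8\<close> by (intro divide_left_mono mult_mono mult_pos_pos) auto
  finally show ?thesis .
qed

text \<open>The first four bounds concern the first four derivatives of \<open>Phi\<close>, as
  needed for Taylor's formula in space and in variance; the last one compensates for shifts growing
  like \<open>\<bar>y\<bar> + 1\<close>.\<close>

lemma std_normal_density_bounds:
  shows "std_normal_density y \<le> 1 / 2"
    and "\<bar>y * std_normal_density y\<bar> \<le> 1"
    and "\<bar>(y\<^sup>2 - 1) * std_normal_density y\<bar> \<le> 1"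
    and "\<bar>(3 * y - y ^ 3) * std_normal_density y\<bar> \<le> 2"
    and "(\<bar>y\<bar> + 1) * std_normal_density y \<le> 1"
proof -
  define s where "s = \<bar>y\<bar>"
  define w where "w = 1 + s\<^sup>2 / 2 + s ^ 4 / 8"
  have s: "0 \<le> s" and w: "0 < w" by (simp_all add: s_def w_def add_pos_nonneg)
  have d: "std_normal_density y \<le> 1 / (2 * w)"
    using std_normal_density_le[of y] by (simp add: w_def s_def)
  have d0: "0 \<le> std_normal_density y" by simp
  have key: "\<bar>p * std_normal_density y\<bar> \<le> c" if "\<bar>p\<bar> \<le> c * (2 * w)" for p c
  proof -
    have "\<bar>p * std_normal_density y\<bar> = \<bar>p\<bar> * std_normal_density y" using d0 by (simp add: abs_mult)
    also have "\<dots> \<le> \<bar>p\<bar> * (1 / (2 * w))" using d by (rule mult_left_mono) simp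
    also have "\<dots> \<le> c" using that w by (simp add: field_simps)
    finally show ?thesis .
  qed
  have w2: "1 \<le> w" "1 + s\<^sup>2 / 2 \<le> w" using s by (simp_all add: w_def)
  show "std_normal_density y \<le> 1 / 2" using key[of 1 "1/2"] w2 by simp
  have "0 \<le> (s - 1)\<^sup>2" by simp
  then have a: "2 * s \<le> s\<^sup>2 + 1" by (simp add: power2_eq_square algebra_simps)
  then show "\<bar>y * std_normal_density y\<bar> \<le> 1" using w2 by (intro key) (simp add: s_def)
  have "\<bar>y\<^sup>2 - 1\<bar> \<le> s\<^sup>2 + 1" by (simp add: s_def abs_if)
  then show "\<bar>(y\<^sup>2 - 1) * std_normal_density y\<bar> \<le> 1" using w2 by (intro key) simp
  have "\<bar>3 * y - y ^ 3\<bar> \<le> 3 * s + s ^ 3"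
    unfolding s_def by (rule order_trans[OF abs_triangle_ineq4]) (simp add: abs_mult power_abs)
  \<comment> \<open>This is \<open>8 * w - 6 * s - 2 * s ^ 3\<close> written as a sum of squares
    plus a constant.\<close>
  moreover have "0 \<le> s\<^sup>2 * (s - 1)\<^sup>2 + 3 * (s - 1)\<^sup>2 + 5" by simp
  then have "6 * s + 2 * s ^ 3 \<le> 8 * w"
    by (simp add: w_def power2_eq_square power3_eq_cube power4_eq_xxxx algebra_simps)
  ultimately show "\<bar>(3 * y - y ^ 3) * std_normal_density y\<bar> \<le> 2" using w by (intro key) simp
  show "(\<bar>y\<bar> + 1) * std_normal_density y \<le> 1"
    using key[of "\<bar>y\<bar> + 1" 1] a w2 by (simp add: s_def)
qed

text \<open>Mean value theorem, with a hypothesis on the product of length and density: for long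
  intervals far from the origin only this product is small.\<close>

lemma Phi_diff_le:
  assumes "a \<le> b" "\<And>y. a \<le> y \<Longrightarrow> y \<le> b \<Longrightarrow> (b - a) * std_normal_density y \<le> c" "0 \<le> c"
  shows "Phi b - Phi a \<le> c"
proof (cases "a = b")
  case False
  then obtain y where "a < y" "y < b" "Phi b - Phi a = (b - a) * std_normal_density y"
    using MVT2[of a b Phi std_normal_density] Phi_deriv assms(1) by force
  then show ?thesis using assms(2)[of y] by simp
qed (use assms in simp)

lemma Phi_lipschitz: "a \<le> b \<Longrightarrow> Phi b - Phi a \<le> (b - a) / 2"
  using std_normal_density_bounds(1) by (intro Phi_diff_le) (auto intro: mult_left_mono[of _ "1/2" "b - a", simplified])

text \<open>Chebyshev's inequality with the second moment 1. These quadratic tails suffice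
  everywhere, including for the limits of \<open>Phi\<close> at infinity.\<close>

lemma Phi_tails:
  assumes "0 < t"
  shows "1 - Phi t \<le> 1 / t\<^sup>2" "Phi (- t) \<le> 1 / t\<^sup>2"
proof -
  have m: "(\<integral>x. x\<^sup>2 \<partial>std_normal_distribution) = 1"
    using std_normal_distribution_even_moments(1)[of 1] by simp
  have i: "integrable std_normal_distribution (\<lambda>x. x\<^sup>2 / t\<^sup>2)"
    using integrable_std_normal_distribution_moment[of 2] by simp
  have *: "measure std_normal_distribution A \<le> 1 / t\<^sup>2" if "A \<in> sets borel" "\<And>x. x \<in> A \<Longrightarrow> t \<le> \<bar>x\<bar>" for A
  proof -
    have "measure std_normal_distribution A = (\<integral>x. indicator A x \<partial>std_normal_distribution)" using that by simp
    also have "\<dots> \<le> (\<integral>x. x\<^sup>2 / t\<^sup>2 \<partial>std_normal_distribution)"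
    proof (rule integral_mono[OF _ i])
      show "indicator A x \<le> x\<^sup>2 / t\<^sup>2" for x
        using that(2)[of x] assms power_mono[of t "\<bar>x\<bar>" 2] by (auto simp: indicator_def)
    qed (rule std_normal.integrable_const_bound[where B=1], use that in auto)
    finally show ?thesis using m by simp
  qed
  have "1 - Phi t = measure std_normal_distribution (space std_normal_distribution - {..t})"
    by (subst std_normal.prob_compl) (auto simp: cdf_def)
  also have "\<dots> = measure std_normal_distribution {t<..}" by (rule arg_cong[where f="measure _"]) auto
  also have "\<dots> \<le> 1 / t\<^sup>2" by (rule *) auto
  finally show "1 - Phi t \<le> 1 / t\<^sup>2" .
  show "Phi (- t) \<le> 1 / t\<^sup>2" unfolding cdf_def by (rule *) auto
qed

section \<open>Lindeberg's method along the heat flow\<close>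

text \<open>Second-order expansion in the space variable; the third derivative of
  \<open>z \<mapsto> Phi (z / sqrt v)\<close> is at most \<open>1 / (v * sqrt v)\<close>.\<close>

lemma Phi_taylor:
  assumes "0 < v"
  shows "\<bar>Phi ((x - y) / sqrt v) - (Phi (x / sqrt v) - y * (std_normal_density (x / sqrt v) / sqrt v)
      - y\<^sup>2 / 2 * ((x / sqrt v) * std_normal_density (x / sqrt v) / v))\<bar> \<le> \<bar>y\<bar> ^ 3 / (6 * (v * sqrt v))"
proof (cases "y = 0")
  case False
  define s where "s = sqrt v"
  have s: "0 < s" "v = s * s" "sqrt v = s" using assms by (simp_all add: s_def)
  \<comment> \<open>\<open>G m\<close> is the \<open>m\<close>-th derivative of
    \<open>z \<mapsto> Phi (z / s)\<close>, for \<open>m\<close> up to 3.\<close>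
  define G where "G = (\<lambda>m::nat. \<lambda>z. if m = 0 then Phi (z / s) else if m = 1 then std_normal_density (z / s) / s
    else if m = 2 then - (z / s) * std_normal_density (z / s) / (s * s)
    else ((z / s)\<^sup>2 - 1) * std_normal_density (z / s) / (s * s * s))"
  have "\<exists>t. (if x - y < x then x - y < t \<and> t < x else x < t \<and> t < x - y) \<and>
      Phi ((x - y) / s) = (\<Sum>m<3. G m x / fact m * (x - y - x) ^ m) + G 3 t / fact 3 * (x - y - x) ^ 3"
  proof (rule Taylor[where a="min x (x - y)" and b="max x (x - y)" and f="\<lambda>z. Phi (z / s)"])
    show "\<forall>m t. m < 3 \<and> min x (x - y) \<le> t \<and> t \<le> max x (x - y) \<longrightarrow> (G m has_real_derivative G (Suc m) t) (at t)"
    proof (intro allI impI)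
      fix m t assume "m < (3::nat) \<and> min x (x - y) \<le> t \<and> t \<le> max x (x - y)"
      then consider "m = 0" | "m = 1" | "m = 2" by linarith
      then show "(G m has_real_derivative G (Suc m) t) (at t)"
        by cases (auto simp: G_def power2_eq_square field_simps s(1)[THEN less_imp_neq, symmetric] intro!: derivative_eq_intros)
    qed
  qed (use False in \<open>auto simp: G_def\<close>)
  then obtain t where t: "Phi ((x - y) / s) = (\<Sum>m<3. G m x / fact m * (x - y - x) ^ m) + G 3 t / fact 3 * (x - y - x) ^ 3"
    by blast
  have "\<bar>G 3 t\<bar> \<le> 1 / (s * s * s)"
    using std_normal_density_bounds(3)[of "t / s"] s(1) by (simp add: G_def abs_mult divide_right_mono)
  then have "\<bar>G 3 t / fact 3 * (x - y - x) ^ 3\<bar> \<le> 1 / (s * s * s) / 6 * \<bar>y\<bar> ^ 3"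
    unfolding abs_mult using s(1) by (intro mult_mono) (auto simp: fact_numeral power_abs)
  moreover have "(\<Sum>m<3::nat. G m x / fact m * (x - y - x) ^ m) =
      Phi (x / s) - y * (std_normal_density (x / s) / s) - y\<^sup>2 / 2 * ((x / s) * std_normal_density (x / s) / (s * s))"
    using s(1) by (simp add: numeral_3_eq_3 G_def field_simps power2_eq_square)
  ultimately have "\<bar>Phi ((x - y) / s) - (Phi (x / s) - y * (std_normal_density (x / s) / s)
      - y\<^sup>2 / 2 * ((x / s) * std_normal_density (x / s) / (s * s)))\<bar> \<le> 1 / (s * s * s) / 6 * \<bar>y\<bar> ^ 3"
    using t by linarith
  moreover have "1 / (s * s * s) / 6 * \<bar>y\<bar> ^ 3 = \<bar>y\<bar> ^ 3 / (6 * (v * sqrt v))"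
    unfolding s(3) unfolding s(2) by simp
  ultimately show ?thesis unfolding s(3) unfolding s(2) by argo
qed simp

text \<open>\<open>(v, x) \<mapsto> Phi (x / sqrt v)\<close> solves the heat equation, so the second-order term of the Taylor
  expansion in \<open>x\<close> is matched by an increment of \<open>v\<close>.\<close>

lemma Phi_heat:
  assumes "0 < v" "0 \<le> c"
  shows "\<bar>Phi (x / sqrt (v + c)) - (Phi (x / sqrt v) - c / 2 * ((x / sqrt v) * std_normal_density (x / sqrt v) / v))\<bar> \<le> c\<^sup>2 / v\<^sup>2"
proof (cases "c = 0")
  case False
  then have c: "0 < c" using assms by simp
  \<comment> \<open>\<open>g u\<close> is the second derivative in \<open>x\<close> of
    \<open>Phi (x / sqrt u)\<close>; by the heat equation it is twice the derivative in
    \<open>u\<close>, which is what \<open>dv\<close> checks.\<close>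
  define g where "g = (\<lambda>u. - ((x / sqrt u) * std_normal_density (x / sqrt u) / u))"
  have dv: "((\<lambda>u. Phi (x / sqrt u)) has_real_derivative g u / 2) (at u)" if "0 < u" for u
  proof -
    have "((\<lambda>u. Phi (x / sqrt u)) has_real_derivative std_normal_density (x / sqrt u) * (- (x * (inverse (sqrt u) / 2)) / (sqrt u * sqrt u))) (at u)"
      using that by (auto intro!: derivative_eq_intros)
    moreover have "std_normal_density (x / sqrt u) * (- (x * (inverse (sqrt u) / 2)) / (sqrt u * sqrt u)) = g u / 2"
      using that by (simp add: g_def field_simps)
    ultimately show ?thesis by (rule DERIV_cong)
  qed
  have dg: "(g has_real_derivative ((3 * (x / sqrt u) - (x / sqrt u) ^ 3) * std_normal_density (x / sqrt u) / (2 * u\<^sup>2))) (at u)" if "0 < u" for u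
  proof -
    define s where "s = sqrt u"
    have s: "0 < s" "u = s * s" using that by (simp_all add: s_def)
    have y: "((\<lambda>u. x / sqrt u) has_real_derivative - (x * (inverse s / 2)) / (s * s)) (at u)"
      using that by (auto intro!: derivative_eq_intros simp: s_def)
    have "(g has_real_derivative - (((- (x * (inverse s / 2)) / (s * s) * std_normal_density (x / s) +
        (- (x / s) * std_normal_density (x / s) * (- (x * (inverse s / 2)) / (s * s))) * (x / s)) * u - (x / s * std_normal_density (x / s)) * 1) / (u * u))) (at u)"
      unfolding g_def s_def using that
      by (intro DERIV_minus DERIV_divide DERIV_mult std_normal_density_deriv DERIV_ident y[unfolded s_def]) auto
    moreover have "- (((- (x * (inverse s / 2)) / (s * s) * std_normal_density (x / s) +
        (- (x / s) * std_normal_density (x / s) * (- (x * (inverse s / 2)) / (s * s))) * (x / s)) * u - (x / s * std_normal_density (x / s)) * 1) / (u * u))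
      = (3 * (x / s) - (x / s) ^ 3) * std_normal_density (x / s) / (2 * u\<^sup>2)"
      using s(1) unfolding s(2) by (simp add: field_simps power2_eq_square power3_eq_cube)
    ultimately show ?thesis by (simp add: s_def)
  qed
  obtain u where u: "v < u" "u < v + c" "Phi (x / sqrt (v + c)) - Phi (x / sqrt v) = c * (g u / 2)"
    using MVT2[of v "v + c" "\<lambda>u. Phi (x / sqrt u)" "\<lambda>u. g u / 2"] dv c assms by force
  obtain u' where u': "v < u'" "u' < u" "g u - g v = (u - v) * ((3 * (x / sqrt u') - (x / sqrt u') ^ 3) * std_normal_density (x / sqrt u') / (2 * u'\<^sup>2))"
    using MVT2[OF u(1), of g "\<lambda>u. (3 * (x / sqrt u) - (x / sqrt u) ^ 3) * std_normal_density (x / sqrt u) / (2 * u\<^sup>2)"] dg assms by force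
  have "\<bar>(3 * (x / sqrt u') - (x / sqrt u') ^ 3) * std_normal_density (x / sqrt u')\<bar> / (2 * u'\<^sup>2) \<le> 2 / (2 * v\<^sup>2)"
    using std_normal_density_bounds(4)[of "x / sqrt u'"] u'(1) assms by (intro frac_le mult_left_mono power_mono) auto
  then have "\<bar>g u - g v\<bar> \<le> c * (1 / v\<^sup>2)"
    unfolding u'(3) abs_mult[of "u - v"] using u u' by (intro mult_mono) auto
  then have "\<bar>c * ((g u - g v) / 2)\<bar> \<le> c * (c * (1 / v\<^sup>2) / 2)"
    unfolding abs_mult using c by (intro mult_mono) auto
  also have "\<dots> = c\<^sup>2 / v\<^sup>2 / 2" by (simp add: power2_eq_square)
  also have "\<dots> \<le> c\<^sup>2 / v\<^sup>2"
  proof -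
    have "x / 2 \<le> x" if "0 \<le> x" for x :: real using that by simp
    from this[of "c\<^sup>2 / v\<^sup>2"] show ?thesis by simp
  qed
  finally have b: "\<bar>c * ((g u - g v) / 2)\<bar> \<le> c\<^sup>2 / v\<^sup>2" .
  define q where "q = (x / sqrt v) * std_normal_density (x / sqrt v) / v"
  have "g v = - q" by (simp add: g_def q_def)
  then have "Phi (x / sqrt (v + c)) - (Phi (x / sqrt v) - c / 2 * q) = c * ((g u - g v) / 2)"
    using u(3) by (simp add: field_simps)
  then show ?thesis using b unfolding q_def by presburger
qed simp

text \<open>The error of replacing one summand is of order \<open>c / (v * sqrt v)\<close>. Bounding
  it by an increment of \<open>- 4 / sqrt v\<close> makes the errors of successive replacements
  telescope; \<open>c \<le> v\<close> keeps both ends of the increment comparable.\<close>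

lemma inverse_sqrt_telescope:
  assumes "0 < v" "0 \<le> c" "c \<le> v"
  shows "c / (v * sqrt v) \<le> 4 * (1 / sqrt v - 1 / sqrt (v + c))"
proof -
  define s t where "s = sqrt v" and "t = sqrt (v + c)"
  have s: "0 < s" "v = s * s" and t: "0 < t" "c = t * t - s * s" using assms by (simp_all add: s_def t_def)
  have "s \<le> t" using assms by (simp add: s_def t_def)
  have t2: "t * t \<le> 2 * (s * s)" using assms(3) unfolding t(2) s(2) by simp
  have "0 \<le> (t - s) * (t - s)" by simp
  then have "2 * (t * s) \<le> t * t + s * s" by (simp add: algebra_simps)
  moreover have "(t + s) * t = t * t + t * s" by (simp add: algebra_simps)
  ultimately have "(t + s) * t \<le> 4 * (s * s)" using t2 zero_le_square[of s] by linarith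
  then have "(t - s) * ((t + s) * t) \<le> (t - s) * (4 * (s * s))" using \<open>s \<le> t\<close> by (intro mult_left_mono) auto
  then have "(t * t - s * s) * t \<le> 4 * (t - s) * (s * s)" by (simp add: algebra_simps)
  then have "(t * t - s * s) * t * s \<le> 4 * (t - s) * (s * s) * s"
    using s(1) by (intro mult_right_mono) auto
  then have "(t * t - s * s) / (s * s * s) \<le> 4 * (1 / s - 1 / t)"
    using s(1) t(1) by (simp add: field_simps)
  then show ?thesis unfolding s_def[symmetric] t_def[symmetric] using s t by simp
qed

text \<open>A centred bounded variable is traded for an increase of the Gaussian variance by its own
  variance. The terms of first and second order agree; \<open>Phi_taylor\<close> and
  \<open>Phi_heat\<close> leave at most \<open>2 * \<kappa> * c / (v * sqrt v)\<close>, since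
  \<open>c \<le> \<kappa>\<^sup>2 \<le> \<kappa> * sqrt v\<close>.\<close>

lemma lindeberg_step:
  assumes "prob_space N" "bdm N \<zeta>" "\<And>y. y \<in> space N \<Longrightarrow> \<bar>\<zeta> y\<bar> \<le> \<kappa>" "(\<integral>y. \<zeta> y \<partial>N) = 0"
    and "0 < \<kappa>" "\<kappa>\<^sup>2 \<le> v"
  defines "c \<equiv> (\<integral>y. (\<zeta> y)\<^sup>2 \<partial>N)"
  shows "\<bar>(\<integral>y. Phi ((x - \<zeta> y) / sqrt v) \<partial>N) - Phi (x / sqrt (v + c))\<bar>
    \<le> 8 * \<kappa> * (1 / sqrt v - 1 / sqrt (v + c))"
proof -
  interpret prob_space N by fact
  have v: "0 < v" using assms(5,6) by (smt (verit) zero_less_power)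
  have kv: "\<kappa> \<le> sqrt v" using assms(5,6) by (intro real_le_rsqrt) simp
  have c0: "0 \<le> c" unfolding c_def by simp
  have ck: "c \<le> \<kappa>\<^sup>2" unfolding c_def
  proof (rule integral_le_const_bdm[OF bdm_power[OF assms(2)]])
    fix y assume "y \<in> space N"
    from power_mono[OF assms(3)[OF this], of 2] show "(\<zeta> y)\<^sup>2 \<le> \<kappa>\<^sup>2" by simp
  qed
  define g1 where "g1 = std_normal_density (x / sqrt v) / sqrt v"
  define g2 where "g2 = (x / sqrt v) * std_normal_density (x / sqrt v) / v"
  have mz [measurable]: "\<zeta> \<in> borel_measurable N" using assms(2) by (rule bdm_measurable)
  have bP: "bdm N (\<lambda>y. Phi ((x - \<zeta> y) / sqrt v))"
    by (rule bdmI[where B=1]) (auto simp: Phi_abs_le)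
  have bT: "bdm N (\<lambda>y. Phi (x / sqrt v) - \<zeta> y * g1)" "bdm N (\<lambda>y. (\<zeta> y)\<^sup>2 / 2 * g2)" "bdm N (\<lambda>y. \<zeta> y * g1)"
    by (intro bdm_intros assms(2))+
  have "(\<integral>y. Phi (x / sqrt v) - \<zeta> y * g1 - (\<zeta> y)\<^sup>2 / 2 * g2 \<partial>N) = Phi (x / sqrt v) - c / 2 * g2"
    unfolding bdm_integral_diff[OF bT(1,2)] bdm_integral_diff[OF bdm_const bT(3)]
    by (simp add: assms(4) prob_space c_def)
  then have eq: "(\<integral>y. Phi ((x - \<zeta> y) / sqrt v) \<partial>N) - (Phi (x / sqrt v) - c / 2 * g2) =
     (\<integral>y. Phi ((x - \<zeta> y) / sqrt v) - (Phi (x / sqrt v) - \<zeta> y * g1 - (\<zeta> y)\<^sup>2 / 2 * g2) \<partial>N)"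
    using bdm_integral_diff[OF bP bdm_diff[OF bT(1,2)]] by simp
  have "\<bar>(\<integral>y. Phi ((x - \<zeta> y) / sqrt v) \<partial>N) - (Phi (x / sqrt v) - c / 2 * g2)\<bar> \<le> (\<integral>y. \<kappa> * (\<zeta> y)\<^sup>2 / (6 * (v * sqrt v)) \<partial>N)"
    unfolding eq
  proof (rule order_trans[OF integral_abs_bound], rule bdm_integral_le)
    show "bdm N (\<lambda>y. \<bar>Phi ((x - \<zeta> y) / sqrt v) - (Phi (x / sqrt v) - \<zeta> y * g1 - (\<zeta> y)\<^sup>2 / 2 * g2)\<bar>)"
      by (rule bdm_abs[OF bdm_diff[OF bP bdm_diff[OF bT(1,2)]]])
    show "bdm N (\<lambda>y. \<kappa> * (\<zeta> y)\<^sup>2 / (6 * (v * sqrt v)))"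
      by (rule bdm_divide_const[OF bdm_mult[OF bdm_const bdm_power[OF assms(2)]]])
    fix y assume y: "y \<in> space N"
    have "\<bar>\<zeta> y\<bar> * \<bar>\<zeta> y\<bar>\<^sup>2 \<le> \<kappa> * \<bar>\<zeta> y\<bar>\<^sup>2"
      using assms(3)[OF y] by (rule mult_right_mono) simp
    moreover have "\<bar>\<zeta> y\<bar> ^ 3 = \<bar>\<zeta> y\<bar> * \<bar>\<zeta> y\<bar>\<^sup>2" by (simp add: numeral_3_eq_3 power2_eq_square)
    ultimately have "\<bar>\<zeta> y\<bar> ^ 3 / (6 * (v * sqrt v)) \<le> \<kappa> * (\<zeta> y)\<^sup>2 / (6 * (v * sqrt v))"
      using v by (intro divide_right_mono) simp_all
    with Phi_taylor[OF v, of x "\<zeta> y"]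
    show "\<bar>Phi ((x - \<zeta> y) / sqrt v) - (Phi (x / sqrt v) - \<zeta> y * g1 - (\<zeta> y)\<^sup>2 / 2 * g2)\<bar> \<le> \<kappa> * (\<zeta> y)\<^sup>2 / (6 * (v * sqrt v))"
      unfolding g1_def g2_def by (rule order_trans)
  qed
  also have "\<dots> = \<kappa> * c / (6 * (v * sqrt v))" by (simp add: c_def)
  finally have 1: "\<bar>(\<integral>y. Phi ((x - \<zeta> y) / sqrt v) \<partial>N) - (Phi (x / sqrt v) - c / 2 * g2)\<bar> \<le> \<kappa> * c / (6 * (v * sqrt v))" .
  have 2: "\<bar>Phi (x / sqrt (v + c)) - (Phi (x / sqrt v) - c / 2 * g2)\<bar> \<le> c\<^sup>2 / v\<^sup>2"
    unfolding g2_def by (rule Phi_heat[OF v c0])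
  have "\<kappa>\<^sup>2 \<le> \<kappa> * sqrt v" using kv assms(5) by (simp add: power2_eq_square)
  then have "c\<^sup>2 \<le> c * (\<kappa> * sqrt v)"
    unfolding power2_eq_square[of c] using ck c0 by (intro mult_left_mono) linarith+
  then have "c\<^sup>2 / v\<^sup>2 \<le> c * (\<kappa> * sqrt v) / v\<^sup>2" by (rule divide_right_mono) simp
  also have "\<dots> = \<kappa> * (c / (v * sqrt v))" using v by (simp add: field_simps power2_eq_square)
  finally have 3: "c\<^sup>2 / v\<^sup>2 \<le> \<kappa> * (c / (v * sqrt v))" .
  have 4: "\<kappa> * c / (6 * (v * sqrt v)) \<le> \<kappa> * (c / (v * sqrt v))"
    using v c0 assms(5) by (simp add: field_simps)
  have "\<kappa> * (c / (v * sqrt v)) \<le> \<kappa> * (4 * (1 / sqrt v - 1 / sqrt (v + c)))"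
    using assms(5,6) ck c0 v by (intro mult_left_mono inverse_sqrt_telescope) auto
  with 1 2 3 4 show ?thesis by argo
qed

context samples
begin

text \<open>The new coordinate is held fixed, the induction hypothesis is applied at the shifted
  point, and one further replacement follows at the variance \<open>V\<close> accumulated so far.
  The bounds telescope, so their sum is independent of the number of summands.\<close>

lemma lindeberg:
  assumes "finite J" "\<And>j. j \<in> J \<Longrightarrow> bdm (M j) (\<zeta> j)"
    and "\<And>j y. j \<in> J \<Longrightarrow> y \<in> space (M j) \<Longrightarrow> \<bar>\<zeta> j y\<bar> \<le> \<kappa>"
    and "\<And>j. j \<in> J \<Longrightarrow> (\<integral>y. \<zeta> j y \<partial>M j) = 0" "0 < \<kappa>" "\<kappa>\<^sup>2 \<le> v"
  shows "\<bar>(\<integral>D. Phi ((x - (\<Sum>j\<in>J. \<zeta> j (D j))) / sqrt v) \<partial>Q) - Phi (x / sqrt (v + (\<Sum>j\<in>J. \<integral>y. (\<zeta> j y)\<^sup>2 \<partial>M j)))\<bar>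
    \<le> 8 * \<kappa> * (1 / sqrt v - 1 / sqrt (v + (\<Sum>j\<in>J. \<integral>y. (\<zeta> j y)\<^sup>2 \<partial>M j)))"
  using assms(1-4)
proof (induction J arbitrary: x rule: finite_induct)
  case empty
  then show ?case by (simp add: Q.prob_space)
next
  case (insert k J)
  define V where "V = v + (\<Sum>j\<in>J. \<integral>y. (\<zeta> j y)\<^sup>2 \<partial>M j)"
  define \<sigma> where "\<sigma> = (\<integral>y. (\<zeta> k y)\<^sup>2 \<partial>M k)"
  interpret Mk: prob_space "M k" by (rule prob_M)
  have V: "v \<le> V" by (simp add: V_def sum_nonneg)
  have meas: "(\<lambda>D. \<zeta> j (D j)) \<in> borel_measurable Q" if "j \<in> insert k J" for j
    using insert.prems(1)[OF that] by (intro measurable_compose[OF _ bdm_measurable]) auto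
  have [measurable]: "(\<lambda>D. \<Sum>j\<in>insert k J. \<zeta> j (D j)) \<in> borel_measurable Q"
    by (rule borel_measurable_sum) (rule meas)
  have b: "bdm Q (\<lambda>D. Phi ((x - (\<Sum>j\<in>insert k J. \<zeta> j (D j))) / sqrt v))"
    by (rule bdmI[where B=1]) (auto simp: Phi_abs_le)
  have [measurable]: "\<zeta> k \<in> borel_measurable (M k)" using insert.prems(1) by (simp add: bdm_measurable)
  have upd: "(\<Sum>j\<in>insert k J. \<zeta> j ((D(k := y)) j)) = \<zeta> k y + (\<Sum>j\<in>J. \<zeta> j (D j))" for D y
    using insert.hyps by (auto intro: sum.cong)
  let ?I = "\<lambda>y. \<integral>D. Phi ((x - \<zeta> k y - (\<Sum>j\<in>J. \<zeta> j (D j))) / sqrt v) \<partial>Q"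
  have "(\<integral>D. Phi ((x - (\<Sum>j\<in>insert k J. \<zeta> j (D j))) / sqrt v) \<partial>Q) = (\<integral>y. ?I y \<partial>M k)"
    by (subst resample'[OF b, of k], subst upd) (simp add: algebra_simps)
  have bI: "bdm (M k) ?I"
    using bdm_integral[OF Q.prob_space_axioms bdm_upd[OF b, of k], unfolded upd] by (simp add: algebra_simps)
  have bP: "bdm (M k) (\<lambda>y. Phi ((x - \<zeta> k y) / sqrt V))"
    by (rule bdmI[where B=1]) (auto simp: Phi_abs_le)
  have "\<bar>(\<integral>y. ?I y \<partial>M k) - (\<integral>y. Phi ((x - \<zeta> k y) / sqrt V) \<partial>M k)\<bar>
     = \<bar>\<integral>y. ?I y - Phi ((x - \<zeta> k y) / sqrt V) \<partial>M k\<bar>"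
    using bI bP by (simp add: Mk.bdm_integral_diff)
  also have "\<dots> \<le> 8 * \<kappa> * (1 / sqrt v - 1 / sqrt V)"
    using insert.IH insert.prems bI bP unfolding V_def by (intro Mk.abs_integral_le_const bdm_diff) auto
  finally have 1: "\<bar>(\<integral>y. ?I y \<partial>M k) - (\<integral>y. Phi ((x - \<zeta> k y) / sqrt V) \<partial>M k)\<bar> \<le> 8 * \<kappa> * (1 / sqrt v - 1 / sqrt V)" .
  have 2: "\<bar>(\<integral>y. Phi ((x - \<zeta> k y) / sqrt V) \<partial>M k) - Phi (x / sqrt (V + \<sigma>))\<bar> \<le> 8 * \<kappa> * (1 / sqrt V - 1 / sqrt (V + \<sigma>))"
    unfolding \<sigma>_def using insert.prems V assms(5,6) by (intro lindeberg_step Mk.prob_space_axioms) auto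
  have "v + (\<Sum>j\<in>insert k J. \<integral>y. (\<zeta> j y)\<^sup>2 \<partial>M j) = V + \<sigma>"
    using insert.hyps by (simp add: V_def \<sigma>_def)
  moreover have "\<bar>(\<integral>y. ?I y \<partial>M k) - Phi (x / sqrt (V + \<sigma>))\<bar> \<le> 8 * \<kappa> * (1 / sqrt v - 1 / sqrt (V + \<sigma>))"
    using 1 2 by (simp add: right_diff_distrib)
  ultimately show ?case
    using \<open>(\<integral>D. Phi ((x - (\<Sum>j\<in>insert k J. \<zeta> j (D j))) / sqrt v) \<partial>Q) = (\<integral>y. ?I y \<partial>M k)\<close>
    by simp
qed

text \<open>The indicator is compared with its Gaussian smoothing of variance
  \<open>\<kappa>\<close>. Smoothing costs \<open>8 * sqrt \<kappa>\<close> by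
  \<open>lindeberg\<close>, removing it costs a shift by \<open>\<kappa> powr (1/4)\<close>. The
  rate is crude, but no third-moment or characteristic-function argument is needed. For
  \<open>\<kappa> > 1\<close> the bound is trivial.\<close>

lemma clt_rate:
  assumes "finite J" "\<And>j. j \<in> J \<Longrightarrow> bdm (M j) (\<zeta> j)"
    and "\<And>j y. j \<in> J \<Longrightarrow> y \<in> space (M j) \<Longrightarrow> \<bar>\<zeta> j y\<bar> \<le> \<kappa>"
    and "\<And>j. j \<in> J \<Longrightarrow> (\<integral>y. \<zeta> j y \<partial>M j) = 0" "0 < \<kappa>"
    and var: "(\<Sum>j\<in>J. \<integral>y. (\<zeta> j y)\<^sup>2 \<partial>M j) = 1"
  shows "\<bar>measure Q {D \<in> space Q. (\<Sum>j\<in>J. \<zeta> j (D j)) \<le> z} - Phi z\<bar> \<le> 12 * \<kappa> powr (1/4)"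
proof (cases "\<kappa> \<le> 1")
  case False
  have "1 \<le> \<kappa> powr (1/4)" using False by (simp add: ge_one_powr_ge_zero)
  moreover have "\<bar>measure Q {D \<in> space Q. (\<Sum>j\<in>J. \<zeta> j (D j)) \<le> z} - Phi z\<bar> \<le> 1"
    using Phi_nonneg[of z] Phi_le_1[of z] Q.prob_le_1[of "{D \<in> space Q. (\<Sum>j\<in>J. \<zeta> j (D j)) \<le> z}"]
      measure_nonneg[of Q "{D \<in> space Q. (\<Sum>j\<in>J. \<zeta> j (D j)) \<le> z}"] by linarith
  ultimately show ?thesis by linarith
next
  case True
  define W where "W = (\<lambda>D. \<Sum>j\<in>J. \<zeta> j (D j))"
  \<comment> \<open>The noise has standard deviation \<open>sqrt \<kappa> = p\<^sup>2\<close>. A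
    shift by \<open>p\<close> therefore amounts to \<open>1 / p\<close> standard deviations, and the
    tail beyond is at most \<open>p\<^sup>2\<close>.\<close>
  define p where "p = \<kappa> powr (1/4)"
  have p: "0 < p" "p \<le> 1" using assms(5) True by (auto simp: p_def intro: powr_le1)
  have "p * p = \<kappa> powr (1/2)" unfolding p_def by (simp flip: powr_add)
  then have p2: "sqrt \<kappa> = p\<^sup>2" using assms(5) by (simp add: powr_half_sqrt power2_eq_square)
  have "\<kappa> = sqrt \<kappa> * sqrt \<kappa>" using assms(5) by simp
  then have p4: "\<kappa> = p ^ 4" unfolding p2 by (simp add: power2_eq_square power4_eq_xxxx)
  have [measurable]: "W \<in> borel_measurable Q" unfolding W_def
    by (intro borel_measurable_sum measurable_compose[OF _ bdm_measurable[OF assms(2)]]) auto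
  define P where "P = measure Q {D \<in> space Q. W D \<le> z}"
  have P: "P = (\<integral>D. of_bool (W D \<le> z) \<partial>Q)"
  proof -
    have "P = (\<integral>D. indicator {D \<in> space Q. W D \<le> z} D \<partial>Q)" by (simp add: P_def)
    also have "\<dots> = (\<integral>D. of_bool (W D \<le> z) \<partial>Q)"
      by (rule Bochner_Integration.integral_cong) (auto simp: indicator_def)
    finally show ?thesis .
  qed
  have bP: "bdm Q (\<lambda>D. Phi ((x - W D) / sqrt \<kappa>))" for x
    by (rule bdmI[where B=1]) (auto simp: Phi_abs_le)
  have bb: "bdm Q (\<lambda>D. of_bool (W D \<le> z))" by (rule bdm_of_bool) simp
  \<comment> \<open>As the total variance is 1, \<open>lindeberg\<close> leads to a Gaussian of
    variance \<open>\<kappa> + 1\<close>; the heat estimate at variance 1 then removes the excess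
    \<open>\<kappa>\<close>.\<close>
  have sm: "\<bar>(\<integral>D. Phi ((x - W D) / sqrt \<kappa>) \<partial>Q) - Phi x\<bar> \<le> 10 * p\<^sup>2" for x
  proof -
    have "\<kappa>\<^sup>2 \<le> \<kappa>" using assms(5) True by (simp add: power2_eq_square)
    then have "\<bar>(\<integral>D. Phi ((x - W D) / sqrt \<kappa>) \<partial>Q) - Phi (x / sqrt (\<kappa> + 1))\<bar> \<le> 8 * \<kappa> * (1 / sqrt \<kappa> - 1 / sqrt (\<kappa> + 1))"
      using lindeberg[OF assms(1-5), of \<kappa> x] var by (simp add: W_def)
    also have "\<dots> \<le> 8 * \<kappa> * (1 / sqrt \<kappa>)" using assms(5) by (intro mult_left_mono) auto
    also have "\<dots> = 8 * p\<^sup>2" using p unfolding p2 unfolding p4 by (simp add: field_simps power2_eq_square power4_eq_xxxx)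
    finally have 1: "\<bar>(\<integral>D. Phi ((x - W D) / sqrt \<kappa>) \<partial>Q) - Phi (x / sqrt (\<kappa> + 1))\<bar> \<le> 8 * p\<^sup>2" .
    have "\<bar>Phi (x / sqrt (1 + \<kappa>)) - (Phi x - \<kappa> / 2 * (x * std_normal_density x))\<bar> \<le> \<kappa>\<^sup>2"
      using Phi_heat[of 1 \<kappa> x] assms(5) by simp
    moreover have "\<bar>\<kappa> / 2 * (x * std_normal_density x)\<bar> \<le> \<kappa> / 2 * 1"
      unfolding abs_mult[of "\<kappa> / 2"] using std_normal_density_bounds(2)[of x] assms(5) by (intro mult_mono) auto
    moreover have "\<kappa> \<le> p\<^sup>2" unfolding p4 using p by (intro power_decreasing) auto
    ultimately show ?thesis using 1 \<open>\<kappa>\<^sup>2 \<le> \<kappa>\<close> by (simp add: add.commute)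
  qed
  have "P \<le> Phi z + p / 2 + 10 * p\<^sup>2 + p\<^sup>2"
  proof -
    have "P \<le> (\<integral>D. Phi ((z + p - W D) / sqrt \<kappa>) + p\<^sup>2 \<partial>Q)" unfolding P
    proof (rule Q.bdm_integral_le[OF bb bdm_add[OF bP bdm_const]])
      fix D
      show "of_bool (W D \<le> z) \<le> Phi ((z + p - W D) / sqrt \<kappa>) + p\<^sup>2"
      proof (cases "W D \<le> z")
        case True
        have "1 / p \<le> (z + p - W D) / sqrt \<kappa>" unfolding p2 using p True by (simp add: field_simps power2_eq_square)
        then have "Phi (1 / p) \<le> Phi ((z + p - W D) / sqrt \<kappa>)" by (rule Phi_mono)
        moreover have "1 - Phi (1 / p) \<le> p\<^sup>2" using Phi_tails(1)[of "1 / p"] p by (simp add: power_divide)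
        ultimately show ?thesis using True by simp
      qed (simp add: Phi_nonneg)
    qed
    also have "\<dots> = (\<integral>D. Phi ((z + p - W D) / sqrt \<kappa>) \<partial>Q) + p\<^sup>2"
      by (simp add: Q.bdm_integral_add[OF bP bdm_const] Q.prob_space)
    also have "\<dots> \<le> Phi (z + p) + 10 * p\<^sup>2 + p\<^sup>2" using sm[of "z + p"] by linarith
    also have "Phi (z + p) \<le> Phi z + p / 2" using Phi_lipschitz[of z "z + p"] p by simp
    finally show ?thesis by simp
  qed
  moreover have "Phi z - p / 2 - 10 * p\<^sup>2 - p\<^sup>2 \<le> P"
  proof -
    have "Phi z - p / 2 \<le> Phi (z - p)" using Phi_lipschitz[of "z - p" z] p by simp
    also have "\<dots> \<le> (\<integral>D. Phi ((z - p - W D) / sqrt \<kappa>) \<partial>Q) + 10 * p\<^sup>2" using sm[of "z - p"] by linarith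
    also have "(\<integral>D. Phi ((z - p - W D) / sqrt \<kappa>) \<partial>Q) \<le> (\<integral>D. of_bool (W D \<le> z) + p\<^sup>2 \<partial>Q)"
    proof (rule Q.bdm_integral_le[OF bP bdm_add[OF bb bdm_const]])
      fix D
      show "Phi ((z - p - W D) / sqrt \<kappa>) \<le> of_bool (W D \<le> z) + p\<^sup>2"
      proof (cases "W D \<le> z")
        case False
        then have "(z - p - W D) / sqrt \<kappa> \<le> - (1 / p)" unfolding p2 using p by (simp add: field_simps power2_eq_square)
        then have "Phi ((z - p - W D) / sqrt \<kappa>) \<le> Phi (- (1 / p))" by (rule Phi_mono)
        also have "\<dots> \<le> p\<^sup>2" using Phi_tails(2)[of "1 / p"] p by (simp add: power_divide)
        finally show ?thesis by simp
      qed (simp add: Phi_le_1 add_increasing2)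
    qed
    also have "\<dots> = P + p\<^sup>2" unfolding P by (simp add: Q.bdm_integral_add[OF bb bdm_const] Q.prob_space)
    finally show ?thesis by simp
  qed
  moreover have "p\<^sup>2 \<le> p" using p by (simp add: power2_eq_square)
  ultimately show ?thesis unfolding P_def W_def p_def[symmetric] by linarith
qed

end

section \<open>Kernels and total variation\<close>

text \<open>Disintegration of a joint law along a regular conditional distribution that is known on
  rectangles only. Binding the marginal \<open>N\<close> with \<open>L u\<close>, the law of
  \<open>(u, v)\<close> for \<open>v\<close> drawn from \<open>\<kappa> u\<close>, gives a measure
  that agrees with \<open>\<mu>\<close> on this intersection-stable generator.\<close>

lemma kernel_integral:
  assumes "prob_space N" "prob_space \<mu>" and \<kappa>: "\<kappa> \<in> measurable N (prob_algebra B)"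
    and sets_\<mu>: "sets \<mu> = sets (N \<Otimes>\<^sub>M B)"
    and rect: "\<And>A A'. A \<in> sets N \<Longrightarrow> A' \<in> sets B \<Longrightarrow>
      emeasure \<mu> (A \<times> A') = (\<integral>\<^sup>+u. emeasure (\<kappa> u) A' * indicator A u \<partial>N)"
    and F: "bdm (N \<Otimes>\<^sub>M B) (\<lambda>(u, v). F u v)"
  shows "bdm N (\<lambda>u. \<integral>v. F u v \<partial>\<kappa> u)"
    and "(\<integral>(u, v). F u v \<partial>\<mu>) = (\<integral>u. (\<integral>v. F u v \<partial>\<kappa> u) \<partial>N)"
proof -
  interpret N: prob_space N by fact
  interpret \<mu>: prob_space \<mu> by fact
  have \<kappa>s [measurable]: "\<kappa> \<in> measurable N (subprob_algebra B)"
    using \<kappa> by (rule measurable_prob_algebraD)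
  have pk: "prob_space (\<kappa> u)" "sets (\<kappa> u) = sets B" "space (\<kappa> u) = space B" if "u \<in> space N" for u
    using measurable_space[OF \<kappa> that] by (auto simp: space_prob_algebra dest: sets_eq_imp_space_eq)
  have [measurable]: "(\<lambda>(u, v). F u v) \<in> borel_measurable (N \<Otimes>\<^sub>M B)" using F by (rule bdm_measurable)
  obtain C where C: "0 \<le> C" "\<And>z. z \<in> space (N \<Otimes>\<^sub>M B) \<Longrightarrow> \<bar>(\<lambda>(u, v). F u v) z\<bar> \<le> C"
    using bdmE[OF F] by blast
  have C': "\<bar>F u v\<bar> \<le> C" if "u \<in> space N" "v \<in> space B" for u v
    using C(2)[of "(u, v)"] that by (simp add: space_pair_measure)
  have mF: "F u \<in> borel_measurable (\<kappa> u)" if "u \<in> space N" for u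
  proof -
    have "(\<lambda>v. (\<lambda>(u, v). F u v) (u, v)) \<in> borel_measurable B" using that by measurable
    then show ?thesis using pk(2)[OF that] by (simp cong: measurable_cong_sets)
  qed
  define L where "L = (\<lambda>u. distr (\<kappa> u) (N \<Otimes>\<^sub>M B) (Pair u))"
  have L [measurable]: "L \<in> measurable N (subprob_algebra (N \<Otimes>\<^sub>M B))"
    unfolding L_def
  proof (rule measurable_distr2[OF _ \<kappa>s])
    have "case_prod Pair = (\<lambda>x::'a \<times> 'b. x)" by auto
    then show "case_prod Pair \<in> measurable (N \<Otimes>\<^sub>M B) (N \<Otimes>\<^sub>M B)" by simp
  qed
  define G where "G = {A \<times> A' | A A'. A \<in> sets N \<and> A' \<in> sets B}"
  have G1: "Int_stable G" unfolding G_def by (rule Int_stable_pair_measure_generator)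
  have G2: "G \<subseteq> Pow (space N \<times> space B)"
    unfolding G_def by (auto dest: sets.sets_into_space)
  have sG: "sets \<mu> = sigma_sets (space N \<times> space B) G" unfolding sets_\<mu> sets_pair_measure G_def ..
  have "sets (N \<bind> L) = sets (N \<Otimes>\<^sub>M B)"
    by (rule sets_bind[OF _ N.not_empty]) (simp add: L_def)
  then have sL: "sets (N \<bind> L) = sigma_sets (space N \<times> space B) G" unfolding sets_pair_measure G_def .
  have eqG: "emeasure \<mu> X = emeasure (N \<bind> L) X" if "X \<in> G" for X
  proof -
    from that obtain A A' where X: "X = A \<times> A'" and A [measurable]: "A \<in> sets N" "A' \<in> sets B" unfolding G_def by blast
    have "emeasure (N \<bind> L) X = (\<integral>\<^sup>+u. emeasure (L u) X \<partial>N)"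
      using N.not_empty unfolding X by (intro emeasure_bind[OF _ L]) auto
    also have "\<dots> = (\<integral>\<^sup>+u. emeasure (\<kappa> u) A' * indicator A u \<partial>N)"
    proof (rule nn_integral_cong)
      fix u assume u: "u \<in> space N"
      have "Pair u \<in> measurable (\<kappa> u) (N \<Otimes>\<^sub>M B)" using u pk(2)[OF u] by (simp cong: measurable_cong_sets)
      then have 1: "emeasure (L u) X = emeasure (\<kappa> u) (Pair u -` X \<inter> space (\<kappa> u))"
        unfolding L_def X by (intro emeasure_distr) auto
      have 2: "Pair u -` X \<inter> space (\<kappa> u) = (if u \<in> A then A' else {})"
        using sets.sets_into_space[OF A(2)] pk(3)[OF u] by (auto simp: X)
      show "emeasure (L u) X = emeasure (\<kappa> u) A' * indicator A u" unfolding 1 2 by simp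
    qed
    finally show ?thesis using rect[OF A] unfolding X by simp
  qed
  have "\<mu> = N \<bind> L"
    by (rule measure_eqI_generator_eq[OF G1 G2 eqG sG sL, where A="\<lambda>_. space N \<times> space B"]) (auto simp: G_def)
  have m1 [measurable]: "(\<lambda>u. \<integral>v. F u v \<partial>\<kappa> u) \<in> borel_measurable N"
  proof -
    have *: "(\<lambda>u. \<integral>z. (\<lambda>(u, v). F u v) z \<partial>L u) \<in> borel_measurable N"
      by (rule measurable_compose[OF L integral_measurable_subprob_algebra]) simp
    have "(\<integral>z. (\<lambda>(u, v). F u v) z \<partial>L u) = (\<integral>v. F u v \<partial>\<kappa> u)" if u: "u \<in> space N" for u
    proof -
      have "Pair u \<in> measurable (\<kappa> u) (N \<Otimes>\<^sub>M B)" using u pk(2)[OF u] by (simp cong: measurable_cong_sets)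
      then have "(\<integral>z. (\<lambda>(u, v). F u v) z \<partial>L u) = (\<integral>v. (\<lambda>(u, v). F u v) (u, v) \<partial>\<kappa> u)"
        unfolding L_def by (rule integral_distr) measurable
      then show ?thesis by simp
    qed
    note eq = this
    have "(\<lambda>u. \<integral>z. (\<lambda>(u, v). F u v) z \<partial>L u) \<in> borel_measurable N \<longleftrightarrow> (\<lambda>u. \<integral>v. F u v \<partial>\<kappa> u) \<in> borel_measurable N"
      by (rule measurable_cong) (rule eq)
    with * show ?thesis by (rule iffD1[rotated])
  qed
  have b: "\<bar>\<integral>v. F u v \<partial>\<kappa> u\<bar> \<le> C" and b': "bdm (\<kappa> u) (F u)" if u: "u \<in> space N" for u
  proof -
    interpret prob_space "\<kappa> u" by (rule pk(1)[OF u])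
    show "bdm (\<kappa> u) (F u)" using C' u pk(3)[OF u] by (intro bdmI[OF mF[OF u]]) auto
    then show "\<bar>\<integral>v. F u v \<partial>\<kappa> u\<bar> \<le> C" using C' u pk(3)[OF u] by (intro abs_integral_le_const) auto
  qed
  show bN: "bdm N (\<lambda>u. \<integral>v. F u v \<partial>\<kappa> u)" by (rule bdmI[OF m1 b])
  have b\<mu>: "bdm \<mu> (\<lambda>(u, v). F u v)"
    using F C(2) unfolding bdm_def measurable_cong_sets[OF sets_\<mu> refl] sets_eq_imp_space_eq[OF sets_\<mu>] by blast
  have F0: "0 \<le> (\<lambda>(u, v). F u v) z + C" if "z \<in> space \<mu>" for z
    using C(2)[of z] that unfolding sets_eq_imp_space_eq[OF sets_\<mu>] by linarith
  have I0: "0 \<le> (\<integral>v. F u v \<partial>\<kappa> u) + C" if "u \<in> space N" for u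
    using b[OF that] by linarith
  \<comment> \<open>Integration against a bind is done for nonnegative functions, so
    \<open>F\<close> is raised by its bound \<open>C\<close>, which is subtracted again at the
    end.\<close>
  have nn: "(\<integral>\<^sup>+z. ennreal ((\<lambda>(u, v). F u v) z + C) \<partial>\<mu>) = (\<integral>\<^sup>+u. ennreal ((\<integral>v. F u v \<partial>\<kappa> u) + C) \<partial>N)"
  proof -
    have "(\<integral>\<^sup>+z. ennreal ((\<lambda>(u, v). F u v) z + C) \<partial>\<mu>) = (\<integral>\<^sup>+u. (\<integral>\<^sup>+z. ennreal ((\<lambda>(u, v). F u v) z + C) \<partial>L u) \<partial>N)"
      unfolding \<open>\<mu> = N \<bind> L\<close> by (rule nn_integral_bind[OF _ L]) simp
    also have "\<dots> = (\<integral>\<^sup>+u. ennreal ((\<integral>v. F u v \<partial>\<kappa> u) + C) \<partial>N)"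
    proof (rule nn_integral_cong)
      fix u assume u: "u \<in> space N"
      interpret ku: prob_space "\<kappa> u" by (rule pk(1)[OF u])
      have "Pair u \<in> measurable (\<kappa> u) (N \<Otimes>\<^sub>M B)" using u pk(2)[OF u] by (simp cong: measurable_cong_sets)
      then have "(\<integral>\<^sup>+z. ennreal ((\<lambda>(u, v). F u v) z + C) \<partial>L u) = (\<integral>\<^sup>+v. ennreal ((\<lambda>(u, v). F u v) (u, v) + C) \<partial>\<kappa> u)"
        unfolding L_def by (rule nn_integral_distr) measurable
      then have "(\<integral>\<^sup>+z. ennreal ((\<lambda>(u, v). F u v) z + C) \<partial>L u) = (\<integral>\<^sup>+v. ennreal (F u v + C) \<partial>\<kappa> u)" by simp
      also have "\<dots> = ennreal (\<integral>v. F u v + C \<partial>\<kappa> u)"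
      proof (rule nn_integral_eq_integral)
        show "integrable (\<kappa> u) (\<lambda>v. F u v + C)" by (intro ku.integrable_bdm bdm_add b' u bdm_const)
        show "AE v in \<kappa> u. 0 \<le> F u v + C"
        proof (rule AE_I2)
          fix v assume "v \<in> space (\<kappa> u)"
          then show "0 \<le> F u v + C" using C'[OF u, of v] pk(3)[OF u] by simp
        qed
      qed
      also have "(\<integral>v. F u v + C \<partial>\<kappa> u) = (\<integral>v. F u v \<partial>\<kappa> u) + C"
        by (simp add: ku.bdm_integral_add[OF b'[OF u] bdm_const] ku.prob_space)
      finally show "(\<integral>\<^sup>+z. ennreal ((\<lambda>(u, v). F u v) z + C) \<partial>L u) = ennreal ((\<integral>v. F u v \<partial>\<kappa> u) + C)" .
    qed
    finally show ?thesis .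
  qed
  have "ennreal (\<integral>z. (\<lambda>(u, v). F u v) z + C \<partial>\<mu>) = (\<integral>\<^sup>+z. ennreal ((\<lambda>(u, v). F u v) z + C) \<partial>\<mu>)"
  proof (rule nn_integral_eq_integral[symmetric])
    show "integrable \<mu> (\<lambda>z. (\<lambda>(u, v). F u v) z + C)" by (intro \<mu>.integrable_bdm bdm_add b\<mu> bdm_const)
    show "AE z in \<mu>. 0 \<le> (\<lambda>(u, v). F u v) z + C"
      by (intro AE_I2 F0)
  qed
  moreover have "ennreal (\<integral>u. (\<integral>v. F u v \<partial>\<kappa> u) + C \<partial>N) = (\<integral>\<^sup>+u. ennreal ((\<integral>v. F u v \<partial>\<kappa> u) + C) \<partial>N)"
  proof (rule nn_integral_eq_integral[symmetric])
    show "integrable N (\<lambda>u. (\<integral>v. F u v \<partial>\<kappa> u) + C)" by (intro N.integrable_bdm bdm_add bN bdm_const)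
    show "AE u in N. 0 \<le> (\<integral>v. F u v \<partial>\<kappa> u) + C" by (intro AE_I2 I0)
  qed
  ultimately have "ennreal (\<integral>z. (\<lambda>(u, v). F u v) z + C \<partial>\<mu>) = ennreal (\<integral>u. (\<integral>v. F u v \<partial>\<kappa> u) + C \<partial>N)" using nn by simp
  moreover have "0 \<le> (\<integral>z. (\<lambda>(u, v). F u v) z + C \<partial>\<mu>)"
    by (intro Bochner_Integration.integral_nonneg F0)
  moreover have "0 \<le> (\<integral>u. (\<integral>v. F u v \<partial>\<kappa> u) + C \<partial>N)"
    by (intro Bochner_Integration.integral_nonneg I0)
  ultimately have "(\<integral>z. (\<lambda>(u, v). F u v) z + C \<partial>\<mu>) = (\<integral>u. (\<integral>v. F u v \<partial>\<kappa> u) + C \<partial>N)" by simp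
  then show "(\<integral>(u, v). F u v \<partial>\<mu>) = (\<integral>u. (\<integral>v. F u v \<partial>\<kappa> u) \<partial>N)"
    by (simp add: \<mu>.bdm_integral_add[OF b\<mu> bdm_const] N.bdm_integral_add[OF bN bdm_const] \<mu>.prob_space N.prob_space)
qed

text \<open>Fubini with an independent uniform threshold: a function with values in the unit
  interval is the mean of the indicators of its superlevel sets. This reduces integrals to events,
  on which \<open>tv_dist\<close> is defined.\<close>

lemma layer_cake:
  assumes "prob_space \<mu>" "\<psi> \<in> borel_measurable \<mu>" "\<And>x. x \<in> space \<mu> \<Longrightarrow> 0 \<le> \<psi> x \<and> \<psi> x \<le> 1"
  shows "(\<integral>x. \<psi> x \<partial>\<mu>) = (\<integral>t. measure \<mu> {x \<in> space \<mu>. t < \<psi> x} \<partial>uniform_measure lborel {0..1})"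
    and "bdm (uniform_measure lborel {0..1::real}) (\<lambda>t. measure \<mu> {x \<in> space \<mu>. t < \<psi> x})"
proof -
  define U where "U = uniform_measure lborel {0..1::real}"
  interpret U: prob_space U unfolding U_def by (rule prob_space_uniform_measure) auto
  interpret \<mu>: prob_space \<mu> by fact
  interpret pair_prob_space \<mu> U ..
  have [measurable]: "\<psi> \<in> borel_measurable \<mu>" by fact
  have [measurable_cong]: "sets U = sets borel" by (simp add: U_def)
  have b: "bdm (\<mu> \<Otimes>\<^sub>M U) (\<lambda>(x, t). of_bool (t < \<psi> x))"
    using bdm_of_bool[where M="\<mu> \<Otimes>\<^sub>M U" and P="\<lambda>z. snd z < \<psi> (fst z)"] by (simp add: case_prod_unfold)
  have b': "bdm (U \<Otimes>\<^sub>M \<mu>) (\<lambda>(t, x). of_bool (t < \<psi> x))"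
    using bdm_of_bool[where M="U \<Otimes>\<^sub>M \<mu>" and P="\<lambda>z. fst z < \<psi> (snd z)"] by (simp add: case_prod_unfold)
  have m: "(\<integral>x. of_bool (t < \<psi> x) \<partial>\<mu>) = measure \<mu> {x \<in> space \<mu>. t < \<psi> x}" for t
  proof -
    have "(\<integral>x. of_bool (t < \<psi> x) \<partial>\<mu>) = (\<integral>x. indicator {x \<in> space \<mu>. t < \<psi> x} x \<partial>\<mu>)"
      by (rule Bochner_Integration.integral_cong) (auto simp: indicator_def)
    also have "\<dots> = measure \<mu> ({x \<in> space \<mu>. t < \<psi> x} \<inter> space \<mu>)" by (rule Bochner_Integration.integral_indicator)
    also have "{x \<in> space \<mu>. t < \<psi> x} \<inter> space \<mu> = {x \<in> space \<mu>. t < \<psi> x}" by auto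
    finally show ?thesis .
  qed
  have i: "(\<integral>t. of_bool (t < \<psi> x) \<partial>U) = \<psi> x" if x: "x \<in> space \<mu>" for x
  proof -
    have "(\<integral>t. of_bool (t < \<psi> x) \<partial>U) = (\<integral>t. indicator {..<\<psi> x} t \<partial>U)"
      by (rule Bochner_Integration.integral_cong) (auto simp: indicator_def)
    also have "\<dots> = measure U {..<\<psi> x}" by (simp add: U_def)
    also have "\<dots> = measure lborel ({0..1} \<inter> {..<\<psi> x}) / measure lborel {0..1::real}"
      unfolding U_def by (rule measure_uniform_measure) auto
    also have "{0..1} \<inter> {..<\<psi> x} = {0..<\<psi> x}" using assms(3)[OF x] by auto
    finally show ?thesis using assms(3)[OF x] by simp
  qed
  have "(\<integral>x. \<psi> x \<partial>\<mu>) = (\<integral>x. (\<integral>t. of_bool (t < \<psi> x) \<partial>U) \<partial>\<mu>)"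
    by (rule Bochner_Integration.integral_cong) (auto simp: i)
  also have "\<dots> = (\<integral>t. (\<integral>x. of_bool (t < \<psi> x) \<partial>\<mu>) \<partial>U)"
    by (rule Fubini_integral[symmetric]) (rule integrable_bdm[OF b])
  finally show "(\<integral>x. \<psi> x \<partial>\<mu>) = (\<integral>t. measure \<mu> {x \<in> space \<mu>. t < \<psi> x} \<partial>uniform_measure lborel {0..1})"
    unfolding m U_def .
  show "bdm (uniform_measure lborel {0..1::real}) (\<lambda>t. measure \<mu> {x \<in> space \<mu>. t < \<psi> x})"
    using bdm_integral[OF \<mu>.prob_space_axioms b'] unfolding m U_def .
qed

text \<open>Since \<open>tv_dist\<close> is a supremum over events, it controls functions with
  values in the unit interval with constant 1; the factor \<open>2 * G\<close> is the length of the
  range of \<open>\<phi>\<close>.\<close>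

lemma integral_diff_le_tv_dist:
  assumes \<mu>: "prob_space \<mu>" and \<nu>: "prob_space \<nu>" and s: "sets \<mu> = sets \<nu>"
    and \<phi>: "\<phi> \<in> borel_measurable \<mu>" "\<And>x. x \<in> space \<mu> \<Longrightarrow> \<bar>\<phi> x\<bar> \<le> G" and G: "0 < G"
  shows "\<bar>(\<integral>x. \<phi> x \<partial>\<mu>) - (\<integral>x. \<phi> x \<partial>\<nu>)\<bar> \<le> 2 * G * tv_dist \<mu> \<nu>"
proof -
  interpret U: prob_space "uniform_measure lborel {0..1::real}" by (rule prob_space_uniform_measure) auto
  interpret \<mu>: prob_space \<mu> by fact
  interpret \<nu>: prob_space \<nu> by fact
  have sp: "space \<mu> = space \<nu>" using s by (rule sets_eq_imp_space_eq)
  have \<phi>': "\<phi> \<in> borel_measurable \<nu>" using \<phi>(1) by (simp add: measurable_cong_sets[OF s])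
  define \<psi> where "\<psi> = (\<lambda>x. (\<phi> x + G) / (2 * G))"
  have r: "0 \<le> \<psi> x \<and> \<psi> x \<le> 1" if "x \<in> space \<mu>" for x
    using \<phi>(2)[OF that] G by (auto simp: \<psi>_def field_simps)
  have m: "\<psi> \<in> borel_measurable \<mu>" "\<psi> \<in> borel_measurable \<nu>" using \<phi>(1) \<phi>' by (simp_all add: \<psi>_def)
  note a = layer_cake[OF \<mu> m(1) r] layer_cake[OF \<nu> m(2) r[unfolded sp]]
  have tv: "\<bar>measure \<mu> A - measure \<nu> A\<bar> \<le> tv_dist \<mu> \<nu>" if "A \<in> sets \<mu>" for A
    unfolding tv_dist_def
  proof (rule cSUP_upper[OF that])
    have "\<bar>measure \<mu> A - measure \<nu> A\<bar> \<le> 1" for A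
      using \<mu>.prob_le_1[of A] \<nu>.prob_le_1[of A] measure_nonneg[of \<mu> A] measure_nonneg[of \<nu> A] by linarith
    then show "bdd_above ((\<lambda>B. \<bar>measure \<mu> B - measure \<nu> B\<bar>) ` sets \<mu>)" by (intro bdd_aboveI2[where M=1])
  qed
  have "(\<integral>x. \<psi> x \<partial>\<mu>) - (\<integral>x. \<psi> x \<partial>\<nu>) =
      (\<integral>t. measure \<mu> {x \<in> space \<mu>. t < \<psi> x} - measure \<nu> {x \<in> space \<nu>. t < \<psi> x} \<partial>uniform_measure lborel {0..1})"
    by (simp add: a U.bdm_integral_diff)
  moreover have "\<bar>\<integral>t. measure \<mu> {x \<in> space \<mu>. t < \<psi> x} - measure \<nu> {x \<in> space \<nu>. t < \<psi> x} \<partial>uniform_measure lborel {0..1}\<bar> \<le> tv_dist \<mu> \<nu>"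
  proof (rule U.abs_integral_le_const[OF bdm_diff[OF a(2,4)]])
    fix t :: real
    have [measurable]: "\<psi> \<in> borel_measurable \<mu>" by (rule m)
    show "\<bar>measure \<mu> {x \<in> space \<mu>. t < \<psi> x} - measure \<nu> {x \<in> space \<nu>. t < \<psi> x}\<bar> \<le> tv_dist \<mu> \<nu>"
      using tv[of "{x \<in> space \<mu>. t < \<psi> x}"] by (simp add: sp[symmetric])
  qed
  ultimately have 1: "\<bar>(\<integral>x. \<psi> x \<partial>\<mu>) - (\<integral>x. \<psi> x \<partial>\<nu>)\<bar> \<le> tv_dist \<mu> \<nu>" by simp
  have b: "bdm \<mu> \<phi>" "bdm \<nu> \<phi>" using \<phi> \<phi>' sp by (auto intro: bdmI)
  have "(\<integral>x. \<psi> x \<partial>\<mu>) = ((\<integral>x. \<phi> x \<partial>\<mu>) + G) / (2 * G)"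
    unfolding \<psi>_def by (simp add: \<mu>.bdm_integral_add[OF b(1) bdm_const] \<mu>.prob_space)
  moreover have "(\<integral>x. \<psi> x \<partial>\<nu>) = ((\<integral>x. \<phi> x \<partial>\<nu>) + G) / (2 * G)"
    unfolding \<psi>_def by (simp add: \<nu>.bdm_integral_add[OF b(2) bdm_const] \<nu>.prob_space)
  ultimately have "(\<integral>x. \<psi> x \<partial>\<mu>) - (\<integral>x. \<psi> x \<partial>\<nu>) = ((\<integral>x. \<phi> x \<partial>\<mu>) - (\<integral>x. \<phi> x \<partial>\<nu>)) / (2 * G)"
    by (simp add: diff_divide_distrib add_divide_distrib)
  then show ?thesis using 1 G by (simp add: abs_divide pos_divide_le_eq mult.commute)
qed

section \<open>The design on its product space\<close>

declare One_nat_def [simp del]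

lemma sup_norm_le_iff: "finite S \<Longrightarrow> sup_norm S u \<le> h \<longleftrightarrow> 0 \<le> h \<and> (\<forall>j\<in>S. \<bar>u j\<bar> \<le> h)"
  by (auto simp: sup_norm_def)

lemma sup_norm_nonneg: "finite S \<Longrightarrow> 0 \<le> sup_norm S u"
  by (simp add: sup_norm_def)

lemma sup_norm_cong: "(\<And>j. j \<in> S \<Longrightarrow> u j = v j) \<Longrightarrow> sup_norm S u = sup_norm S v"
  unfolding sup_norm_def by (metis (mono_tags, lifting) image_cong)

lemma sup_norm_mono: "finite S \<Longrightarrow> S' \<subseteq> S \<Longrightarrow> sup_norm S' u \<le> sup_norm S u"
  unfolding sup_norm_def by (intro Max_mono) auto

lemma sup_norm_measurable [measurable]:
  assumes "finite S" "\<And>j. j \<in> S \<Longrightarrow> (\<lambda>x. g x j) \<in> borel_measurable M"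
  shows "(\<lambda>x. sup_norm S (g x)) \<in> borel_measurable M"
proof (rule borel_measurable_iff_le[THEN iffD2, rule_format])
  fix a
  show "{x \<in> space M. sup_norm S (g x) \<le> a} \<in> sets M"
  proof (cases "0 \<le> a")
    case True
    have "{x \<in> space M. \<forall>j\<in>S. \<bar>g x j\<bar> \<le> a} \<in> sets M"
    proof (rule sets.sets_Collect_finite_All[OF _ assms(1)])
      fix j assume "j \<in> S"
      with assms(2) have [measurable]: "(\<lambda>x. g x j) \<in> borel_measurable M" by blast
      show "{x \<in> space M. \<bar>g x j\<bar> \<le> a} \<in> sets M" by measurable
    qed
    then show ?thesis using True by (simp add: sup_norm_le_iff[OF assms(1)])
  qed (simp add: sup_norm_le_iff[OF assms(1)])
qed

lemma sup_dist_mono: "finite S \<Longrightarrow> S' \<subseteq> S \<Longrightarrow> sup_dist S' u v \<le> sup_dist S u v"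
  unfolding sup_dist_def by (rule sup_norm_mono)

lemma sup_dist_nonneg: "finite S \<Longrightarrow> 0 \<le> sup_dist S u v"
  unfolding sup_dist_def by (rule sup_norm_nonneg)

text \<open>The design in canonical form: a sample point is a family \<open>D\<close> of
  observations and the observations are its coordinates. Statistics are then functions of
  \<open>D\<close> that can be evaluated after altering or exchanging coordinates. The coordinate
  \<open>Inl 0\<close> is available as a test point because the data are numbered from 1.\<close>

locale model =
  fixes E :: "(nat + nat set \<times> nat \<Rightarrow> point) design" and K :: constants
  assumes Xfull_eq: "Xfull E = (\<lambda>i D. D (Inl i))"
    and Xinc_eq: "Xinc E = (\<lambda>S j D. D (Inr (S, j)))"
    and ndim: "2 \<le> ndim E"
    and dens_meas [measurable]: "dens E \<in> borel_measurable (leb (coords E))"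
    and dens_nonneg: "\<And>x. x \<in> space (leb (coords E)) \<Longrightarrow> 0 \<le> dens E x"
    and prob_law: "prob_space (law E)"
    and patterns_ne: "patterns E \<noteq> {}"
    and patterns_sub: "patterns E \<subseteq> Pow (coords E) - {coords E}"
    and ratio_meas [measurable]: "\<And>S. S \<in> patterns E \<Longrightarrow> ratio E S \<in> borel_measurable (leb S)"
    and ratio_pos: "\<And>S u. S \<in> patterns E \<Longrightarrow> u \<in> space (leb S) \<Longrightarrow> 0 < ratio E S u"
    and target_meas [measurable]: "target E \<in> borel_measurable (leb (coords E))"
    and lam_pos: "\<And>S. S \<in> patterns E \<Longrightarrow> 0 < lam E S"
    and nS_pos: "\<And>S. S \<in> patterns E \<Longrightarrow> 1 \<le> nS E S"
    and nsteps_pos: "1 \<le> nsteps E" and nsteps_le: "2 * nsteps E \<le> ssize E"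
    and h_pos: "0 < bandwidth E" and trunc_ge: "1 \<le> trunc E"
    and pieces: "\<And>l. l \<in> {1, 2} \<Longrightarrow> disjoint_family_on (piece E l) {1..nsteps E}"
      "\<And>l. l \<in> {1, 2} \<Longrightarrow> (\<Union>m\<in>{1..nsteps E}. piece E l m) = half E l"
      "\<And>l m m'. l \<in> {1, 2} \<Longrightarrow> m \<in> {1..nsteps E} \<Longrightarrow> m' \<in> {1..nsteps E} \<Longrightarrow>
        card (piece E l m) \<le> card (piece E l m') + 1"
    and hyp: "hypotheses E K"
begin

abbreviation "P \<equiv> law E"
abbreviation "\<S> \<equiv> patterns E"
abbreviation "n \<equiv> ssize E"
abbreviation "N \<equiv> real (card (patterns E))"

sublocale P: prob_space "law E" by (rule prob_law)

sublocale product_sigma_finite "\<lambda>_::nat. lborel :: real measure" ..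

lemma finite_patterns: "finite \<S>"
  using patterns_sub by (rule finite_subset) auto

lemma patternD: assumes "S \<in> \<S>" shows "S \<subseteq> coords E" "finite S" "card S \<le> ndim E"
proof -
  show 1: "S \<subseteq> coords E" using assms patterns_sub by auto
  show "finite S" using 1 by (rule finite_subset) simp
  show "card S \<le> ndim E" using card_mono[OF _ 1] by simp
qed

lemma N_ge_1: "1 \<le> N"
proof -
  have "0 < card \<S>" using patterns_ne finite_patterns by (simp add: card_gt_0_iff)
  then show ?thesis by linarith
qed

lemma n_pos: "2 \<le> n"
  using nsteps_pos nsteps_le by linarith

lemma sets_law [simp, measurable_cong]: "sets P = sets (leb (coords E))"
  by (simp add: law_def)

lemma space_law [simp]: "space P = space (leb (coords E))"
  by (simp add: law_def)

lemma coord_measurable [measurable]: "j \<in> S \<Longrightarrow> (\<lambda>u. u j) \<in> borel_measurable (leb S)"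
  using measurable_component_singleton[of j S "\<lambda>_. lborel"] by simp

lemma restr_space: "S \<in> \<S> \<Longrightarrow> x \<in> space (leb (coords E)) \<Longrightarrow> restrict x S \<in> space (leb S)"
  using patternD(1)[of S] by (auto simp: space_PiM)

lemma restr_measurable [measurable]: "S \<in> \<S> \<Longrightarrow> (\<lambda>x. restrict x S) \<in> measurable (leb (coords E)) (leb S)"
  using patternD(1)[of S] by (rule measurable_restrict_subset)

lemma restr_measurable_law [measurable]: "S \<in> \<S> \<Longrightarrow> (\<lambda>x. restrict x S) \<in> measurable P (leb S)"
  using restr_measurable[of S] by simp

lemma prob_law_space [simp]: "P.prob (space (leb (coords E))) = 1"
  using P.prob_space by simp

lemma hyps:
  shows beta: "0 < beta1 K" "beta1 K \<le> 1" "0 < beta2 K" "beta2 K \<le> 1" "0 < beta3 K" "beta3 K \<le> 1"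
    and L_pos: "0 < L1 K" "0 < L2 K" "0 < L3 K"
    and target_bdd: "bdd_above ((\<lambda>x. \<bar>target E x\<bar>) ` space (leb (coords E)))"
    and c_pos: "0 < clow K" and c_le_C: "clow K \<le> cupp K"
    and rbar_bounds: "\<And>S u. S \<in> \<S> \<Longrightarrow> u \<in> space (leb S) \<Longrightarrow> clow K \<le> rbar E S u"
      "\<And>S u. S \<in> \<S> \<Longrightarrow> u \<in> space (leb S) \<Longrightarrow> rbar E S u \<le> cupp K"
    and A1: "A1 E K" and A2: "A2 E K" and A3: "A3 E K"
    and nlam: "\<And>S. S \<in> \<S> \<Longrightarrow> \<bar>real n * lam E S / real (nS E S) - 1\<bar> \<le> 1 / real n"
    and h_ge: "trunc E * (real (nsteps E) / real n) powr (1 / real (ndim E)) \<le> bandwidth E"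
    and h_le: "bandwidth E \<le> 1"
    and V0: "V0 K \<le> (INF \<alpha>\<in>Pi\<^sub>E \<S> (H E). objective E \<alpha>)" "0 < V0 K"
  using hyp unfolding hypotheses_def by auto

subsection \<open>Marginals\<close>

lemma distr_restrict_law:
  assumes S: "S \<in> \<S>"
  shows "distr P (leb S) (\<lambda>x. restrict x S) = density (leb S) (\<lambda>u. ennreal (marg E S u))"
    and "marg E S \<in> borel_measurable (leb S)"
proof -
  let ?C = "coords E - S"
  have C: "S \<union> ?C = coords E" "S \<inter> ?C = {}" using patternD(1)[OF S] by auto
  have fin: "finite S" "finite ?C" using patternD(2)[OF S] by auto
  have [measurable]: "merge S ?C \<in> measurable (leb S \<Otimes>\<^sub>M leb ?C) (leb (coords E))"
    using measurable_merge[of S ?C "\<lambda>_. lborel"] C(1) by simp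
  interpret c: sigma_finite_measure "leb ?C" by (rule sigma_finite[OF fin(2)])
  show m [measurable]: "marg E S \<in> borel_measurable (leb S)"
    unfolding marg_def by measurable
  define G where "G = (\<lambda>u. \<integral>\<^sup>+v. ennreal (dens E (merge S ?C (u, v))) \<partial>leb ?C)"
  have [measurable]: "G \<in> borel_measurable (leb S)" unfolding G_def by measurable
  have fold: "emeasure (distr P (leb S) (\<lambda>x. restrict x S)) A = (\<integral>\<^sup>+u. G u * indicator A u \<partial>leb S)" if [measurable]: "A \<in> sets (leb S)" for A
  proof -
    have rA: "(\<lambda>x. restrict x S) \<in> measurable (leb (coords E)) (leb S)" by (rule restr_measurable[OF S])
    have rP: "(\<lambda>x. restrict x S) \<in> measurable P (leb S)" by (rule restr_measurable_law[OF S])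
    have "emeasure (distr P (leb S) (\<lambda>x. restrict x S)) A = (\<integral>\<^sup>+x. indicator A x \<partial>distr P (leb S) (\<lambda>x. restrict x S))"
      by simp
    also have "\<dots> = (\<integral>\<^sup>+x. indicator A (restrict x S) \<partial>P)"
      by (rule nn_integral_distr[OF rP]) simp
    also have "\<dots> = (\<integral>\<^sup>+x. ennreal (dens E x) * indicator A (restrict x S) \<partial>leb (coords E))"
      unfolding law_def by (rule nn_integral_density) (use rA in measurable)
    also have "\<dots> = (\<integral>\<^sup>+u. (\<integral>\<^sup>+v. ennreal (dens E (merge S ?C (u, v))) * indicator A (restrict (merge S ?C (u, v)) S) \<partial>leb ?C) \<partial>leb S)"
      using product_nn_integral_fold[OF C(2) fin, of "\<lambda>x. ennreal (dens E x) * indicator A (restrict x S)"] rA unfolding C(1) by simp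
    also have "\<dots> = (\<integral>\<^sup>+u. G u * indicator A u \<partial>leb S)"
    proof (rule nn_integral_cong)
      fix u assume u: "u \<in> space (leb S)"
      have "restrict (merge S ?C (u, v)) S = u" for v
        using u by (auto simp: merge_def space_PiM PiE_iff fun_eq_iff extensional_def)
      moreover have "(\<lambda>v. ennreal (dens E (merge S ?C (u, v)))) \<in> borel_measurable (leb ?C)" using u by measurable
      ultimately show "(\<integral>\<^sup>+v. ennreal (dens E (merge S ?C (u, v))) * indicator A (restrict (merge S ?C (u, v)) S) \<partial>leb ?C) = G u * indicator A u"
        unfolding G_def by (simp add: nn_integral_multc)
    qed
    finally show ?thesis .
  qed
  have "(\<integral>\<^sup>+u. G u \<partial>leb S) = (\<integral>\<^sup>+u. G u * indicator (space (leb S)) u \<partial>leb S)"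
    by (rule nn_integral_cong) simp
  also have "\<dots> = emeasure (distr P (leb S) (\<lambda>x. restrict x S)) (space (leb S))"
    by (rule fold[symmetric]) simp
  also have "\<dots> = emeasure P ((\<lambda>x. restrict x S) -` space (leb S) \<inter> space P)"
    by (rule emeasure_distr[OF restr_measurable_law[OF S]]) simp
  also have "(\<lambda>x. restrict x S) -` space (leb S) \<inter> space P = space P"
    using restr_space[OF S] by auto
  finally have "(\<integral>\<^sup>+u. G u \<partial>leb S) = 1" by (simp only: P.emeasure_space_1)
  \<comment> \<open>\<open>marg\<close> is a Bochner integral, hence 0 where the fibre integral
    diverges. As the total mass is 1 this happens on a null set only, so the density is
    unaffected.\<close>
  then have ae: "AE u in leb S. G u \<noteq> \<infinity>" by (intro nn_integral_PInf_AE) auto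
  have marg_G: "G u = ennreal (marg E S u)" if u: "u \<in> space (leb S)" "G u \<noteq> \<infinity>" for u
  proof -
    have ms: "merge S ?C (u, v) \<in> space (leb (coords E))" if "v \<in> space (leb ?C)" for v
      using u that C(1) by (auto simp: space_PiM merge_def PiE_iff extensional_def)
    have mm: "(\<lambda>v. dens E (merge S ?C (u, v))) \<in> borel_measurable (leb ?C)" using u by measurable
    have "marg E S u = enn2real (G u)"
      unfolding marg_def G_def by (rule integral_eq_nn_integral[OF mm]) (auto intro!: AE_I2 dens_nonneg ms)
    then show ?thesis using u(2) by (simp add: less_top)
  qed
  show "distr P (leb S) (\<lambda>x. restrict x S) = density (leb S) (\<lambda>u. ennreal (marg E S u))"
  proof (rule measure_eqI)
    fix A assume "A \<in> sets (distr P (leb S) (\<lambda>x. restrict x S))"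
    then have A: "A \<in> sets (leb S)" by simp
    have "(\<integral>\<^sup>+u. G u * indicator A u \<partial>leb S) = (\<integral>\<^sup>+u. ennreal (marg E S u) * indicator A u \<partial>leb S)"
    proof (rule nn_integral_cong_AE)
      from ae AE_space show "AE u in leb S. G u * indicator A u = ennreal (marg E S u) * indicator A u"
        by eventually_elim (simp add: marg_G)
    qed
    also have "\<dots> = emeasure (density (leb S) (\<lambda>u. ennreal (marg E S u))) A"
      by (rule emeasure_density[symmetric]) (use A m in auto)
    finally show "emeasure (distr P (leb S) (\<lambda>x. restrict x S)) A = emeasure (density (leb S) (\<lambda>u. ennreal (marg E S u))) A"
      using fold[OF A] by simp
  qed simp
qed

lemma marg_nonneg: assumes "S \<in> \<S>" "u \<in> space (leb S)" shows "0 \<le> marg E S u"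
  unfolding marg_def
proof (rule Bochner_Integration.integral_nonneg)
  fix v assume "v \<in> space (leb (coords E - S))"
  then have "merge S (coords E - S) (u, v) \<in> space (leb (coords E))"
    using assms patternD(1)[OF assms(1)] by (auto simp: space_PiM merge_def PiE_iff extensional_def)
  then show "0 \<le> dens E (merge S (coords E - S) (u, v))" by (rule dens_nonneg)
qed

lemma integral_restrict:
  assumes "S \<in> \<S>" "f \<in> borel_measurable (leb S)"
  shows "(\<integral>x. f (restrict x S) \<partial>P) = (\<integral>u. marg E S u * f u \<partial>leb S :: real)"
proof -
  have "(\<integral>x. f (restrict x S) \<partial>P) = (\<integral>u. f u \<partial>distr P (leb S) (\<lambda>x. restrict x S))"
    by (rule integral_distr[OF restr_measurable_law[OF assms(1)] assms(2), symmetric])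
  also have "\<dots> = (\<integral>u. marg E S u * f u \<partial>leb S)"
    unfolding distr_restrict_law(1)[OF assms(1)]
    by (subst integral_density) (use assms distr_restrict_law(2) marg_nonneg in auto)
  finally show ?thesis .
qed

section \<open>Normalised ratios and the law of an incomplete observation\<close>

definition "Rn S = (\<integral>u. ratio E S u * marg E S u \<partial>leb S)"

lemma leb_space_ne: "\<exists>u. u \<in> space (leb S)"
  by (auto simp: space_PiM PiE_eq_empty_iff intro!: exI[of _ "\<lambda>j\<in>S. 0"])

text \<open>A vanishing or divergent normalising integral would make \<open>rbar\<close> identically
  zero, against its positive lower bound; the sign follows from that of the ratio.\<close>

lemma Rn_pos: assumes "S \<in> \<S>" shows "0 < Rn S"
proof -
  obtain u where u: "u \<in> space (leb S)" using leb_space_ne by blast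
  have "0 < ratio E S u / Rn S"
    using rbar_bounds(1)[OF assms u] c_pos by (simp add: rbar_def Rn_def)
  then show ?thesis using ratio_pos[OF assms u] by (simp add: zero_less_divide_iff)
qed

lemma ratio_eq: "S \<in> \<S> \<Longrightarrow> ratio E S u = Rn S * rbar E S u"
  using Rn_pos[of S] by (simp add: rbar_def Rn_def)

lemma rbar_measurable [measurable]: "S \<in> \<S> \<Longrightarrow> rbar E S \<in> borel_measurable (leb S)"
  unfolding rbar_def by measurable

lemma rbar_pos: "S \<in> \<S> \<Longrightarrow> u \<in> space (leb S) \<Longrightarrow> 0 < rbar E S u"
  using rbar_bounds(1)[of S u] c_pos by simp

lemma rbar_bdm: "S \<in> \<S> \<Longrightarrow> bdm (leb S) (rbar E S)"
  using rbar_bounds(2) rbar_pos by (intro bdmI[where B="cupp K"]) (auto simp: less_imp_le)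

lemma bdm_restrict: "S \<in> \<S> \<Longrightarrow> bdm (leb S) f \<Longrightarrow> bdm P (\<lambda>x. f (restrict x S))"
  by (rule bdm_comp[OF _ restr_measurable_law])

lemma integral_rbar: assumes "S \<in> \<S>" shows "(\<integral>x. rbar E S (restrict x S) \<partial>P) = 1"
proof -
  have "(\<integral>x. rbar E S (restrict x S) \<partial>P) = (\<integral>u. (ratio E S u * marg E S u) / Rn S \<partial>leb S)"
    unfolding integral_restrict[OF assms rbar_measurable[OF assms]] by (simp add: rbar_def Rn_def mult.commute)
  also have "\<dots> = 1" using Rn_pos[OF assms] by (simp add: Rn_def)
  finally show ?thesis .
qed

text \<open>\<open>rbar\<close> has mean 1 under the law of \<open>X\<close>, so its bounds must
  enclose 1. Consequently \<open>1 / clow K\<close> and \<open>cupp K\<close> are both at most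
  \<open>\<rho>\<close>.\<close>

lemma c_le_1: "clow K \<le> 1" and C_ge_1: "1 \<le> cupp K"
proof -
  obtain S where S: "S \<in> \<S>" using patterns_ne by blast
  have "(\<integral>x. clow K \<partial>P) \<le> (\<integral>x. rbar E S (restrict x S) \<partial>P)" "(\<integral>x. rbar E S (restrict x S) \<partial>P) \<le> (\<integral>x. cupp K \<partial>P)"
    using rbar_bounds[OF S restr_space[OF S]] by (intro P.bdm_integral_le bdm_restrict S rbar_bdm bdm_const; simp)+
  then show "clow K \<le> 1" "1 \<le> cupp K" using integral_rbar[OF S] by (simp_all add: P.prob_space)
qed

definition "inc_law S = density (leb S) (\<lambda>u. ennreal (rbar E S u * marg E S u))"

text \<open>Relative to the distribution of \<open>x\<^sub>S\<close>, an incomplete observation has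
  density \<open>rbar\<close>. This is why dividing by \<open>rbar\<close> at incomplete
  observations reproduces means under the law of \<open>X\<close>.\<close>

lemma integral_inc_law:
  assumes "S \<in> \<S>" "f \<in> borel_measurable (leb S)"
  shows "(\<integral>u. f u \<partial>inc_law S) = (\<integral>x. f (restrict x S) * rbar E S (restrict x S) \<partial>P :: real)"
proof -
  have "(\<integral>u. f u \<partial>inc_law S) = (\<integral>u. (rbar E S u * marg E S u) * f u \<partial>leb S)"
    unfolding inc_law_def
  proof (subst integral_density)
    show "(\<lambda>u. rbar E S u * marg E S u) \<in> borel_measurable (leb S)"
      using rbar_measurable[OF assms(1)] distr_restrict_law(2)[OF assms(1)] by measurable
    show "AE u in leb S. 0 \<le> rbar E S u * marg E S u"
      by (intro AE_I2 mult_nonneg_nonneg less_imp_le[OF rbar_pos[OF assms(1)]] marg_nonneg[OF assms(1)])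
  qed (simp_all add: assms(2))
  also have "\<dots> = (\<integral>x. f (restrict x S) * rbar E S (restrict x S) \<partial>P)"
    using integral_restrict[OF assms(1), of "\<lambda>u. f u * rbar E S u"] assms by (simp add: ac_simps)
  finally show ?thesis .
qed

lemma sets_inc_law [simp, measurable_cong]: "sets (inc_law S) = sets (leb S)"
  and space_inc_law [simp]: "space (inc_law S) = space (leb S)"
  by (simp_all add: inc_law_def)

lemma prob_inc_law: assumes S: "S \<in> \<S>" shows "prob_space (inc_law S)"
proof (rule prob_spaceI)
  have [measurable]: "marg E S \<in> borel_measurable (leb S)" by (rule distr_restrict_law(2)[OF S])
  have "emeasure (inc_law S) (space (inc_law S)) = (\<integral>\<^sup>+u. ennreal (rbar E S u * marg E S u) * indicator (space (leb S)) u \<partial>leb S)"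
    unfolding space_inc_law unfolding inc_law_def using S by (subst emeasure_density) auto
  also have "\<dots> = (\<integral>\<^sup>+u. ennreal (marg E S u) * ennreal (rbar E S u) \<partial>leb S)"
    using marg_nonneg[OF S] rbar_pos[OF S] by (intro nn_integral_cong) (simp add: ennreal_mult less_imp_le mult.commute)
  also have "\<dots> = (\<integral>\<^sup>+u. ennreal (rbar E S u) \<partial>distr P (leb S) (\<lambda>x. restrict x S))"
    unfolding distr_restrict_law(1)[OF S] using S by (intro nn_integral_density[symmetric]) auto
  also have "\<dots> = (\<integral>\<^sup>+x. ennreal (rbar E S (restrict x S)) \<partial>P)"
    using S by (intro nn_integral_distr) auto
  also have "\<dots> = ennreal (\<integral>x. rbar E S (restrict x S) \<partial>P)"
  proof (rule nn_integral_eq_integral)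
    show "integrable P (\<lambda>x. rbar E S (restrict x S))" by (intro P.integrable_bdm bdm_restrict S rbar_bdm)
    show "AE x in P. 0 \<le> rbar E S (restrict x S)"
      using rbar_pos[OF S restr_space[OF S]] by (intro AE_I2) (simp add: less_imp_le)
  qed
  finally show "emeasure (inc_law S) (space (inc_law S)) = 1" by (simp add: integral_rbar[OF S])
qed

text \<open>The value \<open>P\<close> for index pairs whose set is no pattern is a default that
  makes every factor a probability measure.\<close>

definition Mf :: "nat + nat set \<times> nat \<Rightarrow> point measure" where
  "Mf k = (case k of Inl i \<Rightarrow> P | Inr (S, j) \<Rightarrow> if S \<in> \<S> then inc_law S else P)"

lemma Mf_simps [simp]: "Mf (Inl i) = P" "S \<in> \<S> \<Longrightarrow> Mf (Inr (S, j)) = inc_law S"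
  by (simp_all add: Mf_def)

lemma prob_Mf: "prob_space (Mf k)"
proof (cases k)
  case (Inl i)
  then show ?thesis using prob_law by simp
next
  case (Inr p)
  then show ?thesis using prob_inc_law[of "fst p"] prob_law by (cases p) (auto simp: Mf_def)
qed

sublocale samples Mf
  by (rule samples.intro) (rule prob_Mf)

subsection \<open>Conditional expectations given \<open>X\<^sub>S\<close>\<close>

text \<open>One version of the conditional distribution is fixed for which the Hoelder condition
  holds at every pair of close points, not merely almost everywhere.\<close>

definition "kap S = (SOME \<kappa>. regular_cond_dist E S \<kappa> \<and>
     (\<forall>u\<in>space (leb S). \<forall>u'\<in>space (leb S). sup_dist S u u' \<le> 1 \<longrightarrow>
        tv_dist (\<kappa> u) (\<kappa> u') \<le> L2 K * sup_dist S u u' powr beta2 K))"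

lemma kap:
  assumes "S \<in> \<S>"
  shows "regular_cond_dist E S (kap S)"
    and "\<And>u u'. u \<in> space (leb S) \<Longrightarrow> u' \<in> space (leb S) \<Longrightarrow> sup_dist S u u' \<le> 1 \<Longrightarrow>
        tv_dist (kap S u) (kap S u') \<le> L2 K * sup_dist S u u' powr beta2 K"
proof -
  have "\<exists>\<kappa>. regular_cond_dist E S \<kappa> \<and>
     (\<forall>u\<in>space (leb S). \<forall>u'\<in>space (leb S). sup_dist S u u' \<le> 1 \<longrightarrow>
        tv_dist (\<kappa> u) (\<kappa> u') \<le> L2 K * sup_dist S u u' powr beta2 K)"
    using A2 assms unfolding A2_def by blast
  from someI_ex[OF this] show "regular_cond_dist E S (kap S)"
    and "\<And>u u'. u \<in> space (leb S) \<Longrightarrow> u' \<in> space (leb S) \<Longrightarrow> sup_dist S u u' \<le> 1 \<Longrightarrow>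
        tv_dist (kap S u) (kap S u') \<le> L2 K * sup_dist S u u' powr beta2 K"
    unfolding kap_def by blast+
qed

lemma kap_measurable: "S \<in> \<S> \<Longrightarrow> kap S \<in> measurable (leb S) (prob_algebra (leb (coords E - S)))"
  using kap(1) unfolding regular_cond_dist_def by blast

lemma kap_prob:
  assumes "S \<in> \<S>" "u \<in> space (leb S)"
  shows "prob_space (kap S u)" "sets (kap S u) = sets (leb (coords E - S))" "space (kap S u) = space (leb (coords E - S))"
  using measurable_space[OF kap_measurable[OF assms(1)] assms(2)] by (auto simp: space_prob_algebra dest: sets_eq_imp_space_eq)

text \<open>The conditional mean of \<open>g(X)\<close> given \<open>x\<^sub>S = u\<close>, defined
  at every \<open>u\<close> through the chosen kernel, so that it has a modulus of continuity and
  not just an equivalence class.\<close>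

definition "condm S g u = (\<integral>v. g (merge S (coords E - S) (u, v)) \<partial>kap S u)"

lemma merge_meas: assumes "S \<in> \<S>"
  shows "merge S (coords E - S) \<in> measurable (leb S \<Otimes>\<^sub>M leb (coords E - S)) (leb (coords E))"
proof -
  have "S \<union> (coords E - S) = coords E" using patternD(1)[OF assms] by auto
  then show ?thesis using measurable_merge[of S "coords E - S" "\<lambda>_. lborel"] by simp
qed

lemma merge_space:
  assumes "S \<in> \<S>" "u \<in> space (leb S)" "v \<in> space (leb (coords E - S))"
  shows "merge S (coords E - S) (u, v) \<in> space (leb (coords E))"
  using measurable_space[OF merge_meas[OF assms(1)], of "(u, v)"] assms by (simp add: space_pair_measure)

text \<open>The second claim is the defining property of conditional expectation, tested against
  bounded functions of \<open>x\<^sub>S\<close>. It is \<open>kernel_integral\<close> for the pair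
  formed by the coordinates in \<open>S\<close> and those outside.\<close>

lemma condm:
  assumes S: "S \<in> \<S>" and g: "bdm (leb (coords E)) g"
  shows bdm_condm: "bdm (leb S) (condm S g)"
    and integral_condm: "bdm (leb S) \<phi> \<Longrightarrow> (\<integral>x. g x * \<phi> (restrict x S) \<partial>P) = (\<integral>x. condm S g (restrict x S) * \<phi> (restrict x S) \<partial>P)"
proof -
  let ?C = "coords E - S"
  define \<nu> where "\<nu> = distr P (leb S) (\<lambda>x. restrict x S)"
  define m where "m = (\<lambda>x::point. (restrict x S, restrict x ?C))"
  have rC: "(\<lambda>x. restrict x ?C) \<in> measurable (leb (coords E)) (leb ?C)" by (rule measurable_restrict_subset) auto
  have m [measurable]: "m \<in> measurable P (leb S \<Otimes>\<^sub>M leb ?C)"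
    unfolding m_def using S rC by (intro measurable_Pair) auto
  have rS: "(\<lambda>x. restrict x S) \<in> measurable P (leb S)" using S by simp
  have pN: "prob_space \<nu>" unfolding \<nu>_def by (rule P.prob_space_distr[OF rS])
  have pm: "prob_space (distr P (leb S \<Otimes>\<^sub>M leb ?C) m)" by (rule P.prob_space_distr[OF m])
  have sN: "sets \<nu> = sets (leb S)" by (simp add: \<nu>_def)
  have sNC: "sets (\<nu> \<Otimes>\<^sub>M leb ?C) = sets (leb S \<Otimes>\<^sub>M leb ?C)" by (rule sets_pair_measure_cong[OF sN refl])
  have kN: "kap S \<in> measurable \<nu> (prob_algebra (leb ?C))"
    using kap_measurable[OF S] unfolding measurable_cong_sets[OF sN refl] .
  have rect: "emeasure (distr P (leb S \<Otimes>\<^sub>M leb ?C) m) (A \<times> A') = (\<integral>\<^sup>+u. emeasure (kap S u) A' * indicator A u \<partial>\<nu>)"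
    if "A \<in> sets \<nu>" "A' \<in> sets (leb ?C)" for A A'
  proof -
    have "emeasure (distr P (leb S \<Otimes>\<^sub>M leb ?C) m) (A \<times> A') = emeasure P (m -` (A \<times> A') \<inter> space P)"
      using that sN by (intro emeasure_distr m) auto
    also have "m -` (A \<times> A') \<inter> space P = {x \<in> space P. restrict x S \<in> A \<and> restrict x ?C \<in> A'}"
      by (auto simp: m_def)
    finally show ?thesis using kap(1)[OF S] that sN unfolding regular_cond_dist_def \<nu>_def by auto
  qed
  have mg: "merge S ?C \<in> measurable (\<nu> \<Otimes>\<^sub>M leb ?C) (leb (coords E))"
    using merge_meas[OF S] unfolding measurable_cong_sets[OF sNC refl] .
  have bG: "bdm (\<nu> \<Otimes>\<^sub>M leb ?C) (\<lambda>(u, v). g (merge S ?C (u, v)))"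
    using bdm_comp[OF g mg] by (simp add: case_prod_unfold)
  have spN: "space \<nu> = space (leb S)" by (simp add: \<nu>_def)
  have bdmN: "bdm \<nu> f \<longleftrightarrow> bdm (leb S) f" for f
    unfolding bdm_def measurable_cong_sets[OF sN refl] spN ..
  have sets1: "sets (distr P (leb S \<Otimes>\<^sub>M leb ?C) m) = sets (\<nu> \<Otimes>\<^sub>M leb ?C)" by (simp only: sets_distr sNC)
  have "condm S g = (\<lambda>u. \<integral>v. g (merge S ?C (u, v)) \<partial>kap S u)" by (simp only: condm_def fun_eq_iff simp_thms)
  with kernel_integral(1)[OF pN pm kN sets1 rect bG] show b1: "bdm (leb S) (condm S g)" by (simp only: bdmN)
  assume \<phi>: "bdm (leb S) \<phi>"
  have bF: "bdm (\<nu> \<Otimes>\<^sub>M leb ?C) (\<lambda>(u, v). g (merge S ?C (u, v)) * \<phi> u)"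
    using bdm_mult[OF bdm_comp[OF g mg] bdm_comp[OF \<phi>[unfolded bdmN[symmetric]] measurable_fst]] by (simp add: case_prod_unfold)
  have mm: "merge S ?C (m x) = x" if "x \<in> space P" for x
    using that patternD(1)[OF S] by (auto simp: m_def merge_def fun_eq_iff space_PiM PiE_iff extensional_def)
  have "(\<integral>x. g x * \<phi> (restrict x S) \<partial>P) = (\<integral>x. (\<lambda>(u, v). g (merge S ?C (u, v)) * \<phi> u) (m x) \<partial>P)"
  proof (rule Bochner_Integration.integral_cong[OF refl])
    fix x assume "x \<in> space P"
    from mm[OF this] show "g x * \<phi> (restrict x S) = (\<lambda>(u, v). g (merge S ?C (u, v)) * \<phi> u) (m x)" by (simp add: m_def)
  qed
  also have "\<dots> = (\<integral>(u, v). g (merge S ?C (u, v)) * \<phi> u \<partial>distr P (leb S \<Otimes>\<^sub>M leb ?C) m)"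
    using bdm_measurable[OF bF] unfolding measurable_cong_sets[OF sNC refl] by (rule integral_distr[OF m, symmetric])
  also have "\<dots> = (\<integral>u. (\<integral>v. g (merge S ?C (u, v)) * \<phi> u \<partial>kap S u) \<partial>\<nu>)"
    by (rule kernel_integral(2)[OF pN pm kN sets1 rect bF])
  also have "\<dots> = (\<integral>u. condm S g u * \<phi> u \<partial>\<nu>)" by (simp add: condm_def)
  also have "\<dots> = (\<integral>x. condm S g (restrict x S) * \<phi> (restrict x S) \<partial>P)"
    unfolding \<nu>_def using bdm_measurable[OF bdm_mult[OF b1 \<phi>]] by (rule integral_distr[OF rS])
  finally show "(\<integral>x. g x * \<phi> (restrict x S) \<partial>P) = (\<integral>x. condm S g (restrict x S) * \<phi> (restrict x S) \<partial>P)" .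
qed

lemma condm_bound:
  assumes S: "S \<in> \<S>" and g: "g \<in> borel_measurable (leb (coords E))" "\<And>x. x \<in> space (leb (coords E)) \<Longrightarrow> \<bar>g x\<bar> \<le> G"
    and u: "u \<in> space (leb S)"
  shows "\<bar>condm S g u\<bar> \<le> G"
    and "bdm (kap S u) (\<lambda>v. g (merge S (coords E - S) (u, v)))"
proof -
  interpret prob_space "kap S u" by (rule kap_prob(1)[OF S u])
  have m: "(\<lambda>v. g (merge S (coords E - S) (u, v))) \<in> borel_measurable (kap S u)"
    unfolding measurable_cong_sets[OF kap_prob(2)[OF S u] refl]
    using measurable_compose[OF measurable_compose[OF measurable_Pair1'[OF u] merge_meas[OF S]] g(1)] .
  show b: "bdm (kap S u) (\<lambda>v. g (merge S (coords E - S) (u, v)))"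
    using g(2) merge_space[OF S u] kap_prob(3)[OF S u] by (intro bdmI[OF m]) auto
  show "\<bar>condm S g u\<bar> \<le> G"
    unfolding condm_def using g(2) merge_space[OF S u] kap_prob(3)[OF S u] by (intro abs_integral_le_const[OF b]) auto
qed

end

section \<open>The population iteration\<close>

context model
begin

definition "a0 = max (target_norm E) 1"
text \<open>Common bound for the population and the fitted iterates after \<open>m\<close> steps;
  its square grows by the factor 9, which \<open>A_const\<close> dominates.\<close>

definition "bnd m = 3 ^ m * a0" for m :: nat
definition "\<rho> = cupp K / clow K"
definition "LL = L1 K + L2 K + L3 K"
definition "\<beta> = Min {beta1 K, beta2 K, beta3 K}"

definition "w S u = lam E S * rbar E S u / (1 + lam E S * rbar E S u)"

definition "gpop \<alpha> S x = target E x - (\<Sum>S'\<in>\<S> - {S}. \<alpha> S' (restrict x S'))"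

definition "mu S g = (\<integral>x. w S (restrict x S) * g x \<partial>P) / (\<integral>x. w S (restrict x S) \<partial>P)"

text \<open>Damped simultaneous coordinate descent for the objective. With the other components
  fixed, the Lagrange condition for a centred minimiser in component \<open>S\<close> gives
  \<open>w S u * (condm S g u - mu S g)\<close>, where \<open>g\<close> is the residual and the
  multiplier is determined by centring; the step averages this with the old value.\<close>

primrec pa :: "nat \<Rightarrow> nat set \<Rightarrow> point \<Rightarrow> real" where
  "pa 0 = (\<lambda>S u. 0)"
| "pa (Suc m) = (\<lambda>S u. (1 - 1 / N) * pa m S u + 1 / N * w S u * (condm S (gpop (pa m) S) u - mu S (gpop (pa m) S)))"

abbreviation "gp m S \<equiv> gpop (pa m) S"

lemma a0_ge_1: "1 \<le> a0" and target_norm_le: "target_norm E \<le> a0"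
  by (auto simp: a0_def)

lemma bnd_pos: "1 \<le> bnd m" "a0 \<le> bnd m" "bnd (Suc m) = 3 * bnd m"
proof -
  have "1 * a0 \<le> 3 ^ m * a0" using a0_ge_1 by (intro mult_right_mono) auto
  then show "a0 \<le> bnd m" by (simp add: bnd_def)
  then show "1 \<le> bnd m" using a0_ge_1 by simp
qed (simp add: bnd_def)

lemma target_abs_le: assumes "x \<in> space (leb (coords E))" shows "\<bar>target E x\<bar> \<le> a0"
proof -
  have "\<bar>target E x\<bar> \<le> target_norm E"
    unfolding target_norm_def by (rule cSUP_upper[OF assms target_bdd])
  then show ?thesis using target_norm_le by simp
qed

lemma target_bdm: "bdm (leb (coords E)) (target E)"
  by (rule bdmI[OF target_meas target_abs_le])

lemma bdm_law: "bdm P f \<longleftrightarrow> bdm (leb (coords E)) f"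
  by (simp add: bdm_def measurable_cong_sets[OF sets_law refl])

lemma w_bounds: assumes "S \<in> \<S>" "u \<in> space (leb S)" shows "0 < w S u" "w S u < 1"
  using rbar_pos[OF assms] lam_pos[OF assms(1)] by (simp_all add: w_def divide_simps add_pos_pos)

lemma w_bdm: assumes S: "S \<in> \<S>" shows "bdm (leb S) (w S)"
proof (rule bdmI)
  show "w S \<in> borel_measurable (leb S)" using S unfolding w_def by measurable
  fix u assume "u \<in> space (leb S)"
  from w_bounds[OF S this] show "\<bar>w S u\<bar> \<le> 1" by simp
qed

lemma gpop_bdm: assumes "\<And>S. S \<in> \<S> \<Longrightarrow> bdm (leb S) (\<alpha> S)" shows "bdm (leb (coords E)) (gpop \<alpha> S)"
  unfolding gpop_def
  by (intro bdm_diff target_bdm bdm_sum bdm_comp[OF assms restr_measurable]) auto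

lemma gpop_bound:
  assumes "\<And>S u. S \<in> \<S> \<Longrightarrow> u \<in> space (leb S) \<Longrightarrow> \<bar>\<alpha> S u\<bar> \<le> b" "a0 \<le> b" "S \<in> \<S>" "x \<in> space (leb (coords E))"
  shows "\<bar>gpop \<alpha> S x\<bar> \<le> N * b"
proof -
  have "\<bar>\<Sum>S'\<in>\<S> - {S}. \<alpha> S' (restrict x S')\<bar> \<le> (\<Sum>S'\<in>\<S> - {S}. b)"
    by (rule order_trans[OF sum_abs sum_mono]) (use assms restr_space in auto)
  also have "\<dots> = (N - 1) * b" using card_Diff_singleton[OF assms(3)] N_ge_1 by (simp add: of_nat_diff)
  finally have "\<bar>\<Sum>S'\<in>\<S> - {S}. \<alpha> S' (restrict x S')\<bar> \<le> (N - 1) * b" .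
  then show ?thesis using target_abs_le[OF assms(4)] assms(2) unfolding gpop_def left_diff_distrib by argo
qed

lemma integral_w_pos: assumes S: "S \<in> \<S>" shows "0 < (\<integral>x. w S (restrict x S) \<partial>P)"
proof -
  have l: "lam E S * clow K / (1 + lam E S * clow K) \<le> w S u" if u: "u \<in> space (leb S)" for u
  proof -
    have "lam E S * clow K \<le> lam E S * rbar E S u" using rbar_bounds(1)[OF S u] lam_pos[OF S] by simp
    moreover have "0 < lam E S * clow K" using lam_pos[OF S] c_pos by simp
    ultimately show ?thesis unfolding w_def by (simp add: divide_simps add_pos_pos) argo
  qed
  have "0 < lam E S * clow K / (1 + lam E S * clow K)" using lam_pos[OF S] c_pos by (simp add: add_pos_pos)
  also have "\<dots> = (\<integral>x. lam E S * clow K / (1 + lam E S * clow K) \<partial>P)" by simp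
  also have "\<dots> \<le> (\<integral>x. w S (restrict x S) \<partial>P)"
    by (rule P.bdm_integral_le[OF bdm_const bdm_restrict[OF S w_bdm[OF S]]]) (use l restr_space[OF S] in auto)
  finally show ?thesis .
qed

lemma mu_bound:
  assumes S: "S \<in> \<S>" and g: "bdm (leb (coords E)) g" "\<And>x. x \<in> space (leb (coords E)) \<Longrightarrow> \<bar>g x\<bar> \<le> G"
  shows "\<bar>mu S g\<bar> \<le> G"
proof -
  have wP: "bdm P (\<lambda>x. w S (restrict x S))" by (rule bdm_restrict[OF S w_bdm[OF S]])
  have "\<bar>\<integral>x. w S (restrict x S) * g x \<partial>P\<bar> \<le> (\<integral>x. \<bar>w S (restrict x S) * g x\<bar> \<partial>P)" by (rule integral_abs_bound)
  also have "\<dots> \<le> (\<integral>x. w S (restrict x S) * G \<partial>P)"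
  proof (rule P.bdm_integral_le)
    show "bdm P (\<lambda>x. \<bar>w S (restrict x S) * g x\<bar>)" "bdm P (\<lambda>x. w S (restrict x S) * G)"
      using wP g(1) by (auto intro!: bdm_intros simp: bdm_law)
    fix x assume "x \<in> space P"
    then have x: "x \<in> space (leb (coords E))" by simp
    then show "\<bar>w S (restrict x S) * g x\<bar> \<le> w S (restrict x S) * G"
      using w_bounds(1)[OF S restr_space[OF S x]] g(2)[OF x] by (simp add: abs_mult)
  qed
  also have "\<dots> = G * (\<integral>x. w S (restrict x S) \<partial>P)" by simp
  finally show ?thesis using integral_w_pos[OF S] by (simp add: mu_def abs_divide pos_divide_le_eq)
qed

text \<open>The residual is at most \<open>N * bnd m\<close>, and so are its conditional and
  weighted means. The step size \<open>1 / N\<close> cancels \<open>N\<close>, leaving twice the old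
  bound for the increment and once for the old value.\<close>

lemma pa: assumes "S \<in> \<S>" shows "bdm (leb S) (pa m S)" "\<And>u. u \<in> space (leb S) \<Longrightarrow> \<bar>pa m S u\<bar> \<le> bnd m"
proof -
  have "\<forall>S\<in>\<S>. bdm (leb S) (pa m S) \<and> (\<forall>u\<in>space (leb S). \<bar>pa m S u\<bar> \<le> bnd m)"
  proof (induction m)
    case 0
    show ?case using bnd_pos(1)[of 0] by (auto intro: bdm_const)
  next
    case (Suc m)
    show ?case
    proof (intro ballI conjI)
      fix S assume S: "S \<in> \<S>"
      have g: "bdm (leb (coords E)) (gp m S)" using Suc by (intro gpop_bdm) auto
      have gb: "\<bar>gp m S x\<bar> \<le> N * bnd m" if "x \<in> space (leb (coords E))" for x
        using Suc by (intro gpop_bound bnd_pos S that) auto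
      show "bdm (leb S) (pa (Suc m) S)"
        unfolding pa.simps using Suc S by (intro bdm_intros w_bdm bdm_condm g) auto
      fix u assume u: "u \<in> space (leb S)"
      have "\<bar>condm S (gp m S) u - mu S (gp m S)\<bar> \<le> 2 * (N * bnd m)"
        using condm_bound(1)[OF S bdm_measurable[OF g] gb u] mu_bound[OF S g gb] by linarith
      then have "\<bar>w S u * (condm S (gp m S) u - mu S (gp m S))\<bar> \<le> 1 * (2 * (N * bnd m))"
        unfolding abs_mult using w_bounds[OF S u] by (intro mult_mono) auto
      then have "\<bar>1 / N * (w S u * (condm S (gp m S) u - mu S (gp m S)))\<bar> \<le> 1 / N * (1 * (2 * (N * bnd m)))"
        unfolding abs_mult[of "1 / N"] using N_ge_1 by (intro mult_mono) auto
      also have "\<dots> = 2 * bnd m" using N_ge_1 by simp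
      finally have 1: "\<bar>1 / N * (w S u * (condm S (gp m S) u - mu S (gp m S)))\<bar> \<le> 2 * bnd m" .
      have "\<bar>(1 - 1 / N) * pa m S u\<bar> \<le> 1 * bnd m"
        unfolding abs_mult using Suc S u N_ge_1 by (intro mult_mono) auto
      with 1 show "\<bar>pa (Suc m) S u\<bar> \<le> bnd (Suc m)" unfolding bnd_pos(3) pa.simps mult.assoc by argo
    qed
  qed
  then show "bdm (leb S) (pa m S)" "\<And>u. u \<in> space (leb S) \<Longrightarrow> \<bar>pa m S u\<bar> \<le> bnd m" using assms by auto
qed

lemma gp: assumes "S \<in> \<S>"
  shows "bdm (leb (coords E)) (gp m S)" "\<And>x. x \<in> space (leb (coords E)) \<Longrightarrow> \<bar>gp m S x\<bar> \<le> N * bnd m"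
  using assms by (auto intro!: gpop_bdm gpop_bound pa bnd_pos)

text \<open>\<open>mu\<close> is exactly the constant that centres the weighted increment: tested
  against the weight, the conditional mean may be replaced by the residual itself.\<close>

lemma pa_mean: assumes S: "S \<in> \<S>" shows "(\<integral>x. pa m S (restrict x S) \<partial>P) = 0"
proof (induction m)
  case (Suc m)
  let ?g = "gp m S"
  have g: "bdm (leb (coords E)) ?g" by (rule gp(1)[OF S])
  have wP: "bdm P (\<lambda>x. w S (restrict x S))" by (rule bdm_restrict[OF S w_bdm[OF S]])
  have cP: "bdm P (\<lambda>x. condm S ?g (restrict x S))" by (rule bdm_restrict[OF S bdm_condm[OF S g]])
  have pP: "bdm P (\<lambda>x. pa m S (restrict x S))" by (rule bdm_restrict[OF S pa(1)[OF S]])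
  have "(\<integral>x. w S (restrict x S) * (condm S ?g (restrict x S) - mu S ?g) \<partial>P)
     = (\<integral>x. condm S ?g (restrict x S) * w S (restrict x S) - mu S ?g * w S (restrict x S) \<partial>P)"
    by (simp add: algebra_simps)
  also have "\<dots> = (\<integral>x. condm S ?g (restrict x S) * w S (restrict x S) \<partial>P) - mu S ?g * (\<integral>x. w S (restrict x S) \<partial>P)"
    by (subst P.bdm_integral_diff[OF bdm_mult[OF cP wP] bdm_mult[OF bdm_const wP]]) simp
  also have "\<dots> = 0"
    unfolding integral_condm[OF S g w_bdm[OF S], symmetric] using integral_w_pos[OF S] by (simp add: mu_def mult.commute)
  finally have z: "(\<integral>x. w S (restrict x S) * (condm S ?g (restrict x S) - mu S ?g) \<partial>P) = 0" .
  have "(\<integral>x. pa (Suc m) S (restrict x S) \<partial>P) = (\<integral>x. (1 - 1 / N) * pa m S (restrict x S) + 1 / N * (w S (restrict x S) * (condm S ?g (restrict x S) - mu S ?g)) \<partial>P)"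
    by (simp add: mult.assoc)
  also have "\<dots> = (1 - 1 / N) * (\<integral>x. pa m S (restrict x S) \<partial>P) + 1 / N * (\<integral>x. w S (restrict x S) * (condm S ?g (restrict x S) - mu S ?g) \<partial>P)"
    by (subst P.bdm_integral_add[OF bdm_mult[OF bdm_const pP] bdm_mult[OF bdm_const bdm_mult[OF wP bdm_diff[OF cP bdm_const]]]]) simp
  finally show ?case by (simp only: Suc z mult_zero_right add_0_right)
qed simp

subsection \<open>Hoelder continuity of the population iterates\<close>

lemma beta_facts: "0 < \<beta>" "\<beta> \<le> beta1 K" "\<beta> \<le> beta2 K" "\<beta> \<le> beta3 K" "\<beta> \<le> 1"
  using beta by (auto simp: \<beta>_def)

lemma rho_facts: "1 \<le> \<rho>" "1 / clow K \<le> \<rho>" "cupp K \<le> \<rho>"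
  using c_pos c_le_C C_ge_1 c_le_1 by (simp_all add: \<rho>_def field_simps)

lemma LL_pos: "0 < LL" "L1 K \<le> LL" "L2 K \<le> LL" "L3 K \<le> LL"
  using L_pos by (simp_all add: LL_def)

lemma sup_dist_merge:
  assumes "S \<in> \<S>"
  shows "sup_dist (coords E) (merge S (coords E - S) (u, v)) (merge S (coords E - S) (u', v)) = sup_dist S u u'"
proof -
  have c: "coords E = S \<union> (coords E - S)" using patternD(1)[OF assms] by auto
  have "sup_dist (coords E) (merge S (coords E - S) (u, v)) (merge S (coords E - S) (u', v)) \<le> sup_dist S u u'"
    unfolding sup_dist_def
    by (subst sup_norm_le_iff) (use patternD[OF assms] in \<open>auto simp: merge_def sup_norm_nonneg sup_norm_def intro!: Max_ge\<close>)
  moreover have "sup_dist S u u' = sup_dist S (merge S (coords E - S) (u, v)) (merge S (coords E - S) (u', v))"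
    unfolding sup_dist_def by (rule sup_norm_cong) (simp add: merge_def)
  ultimately show ?thesis using sup_dist_mono[OF _ patternD(1)[OF assms]] by (metis antisym finite_atLeastAtMost)
qed

lemma sup_dist_restrict: "sup_dist S (restrict x S) (restrict y S) = sup_dist S x y"
  unfolding sup_dist_def by (rule sup_norm_cong) simp

text \<open>The constant must not depend on \<open>lam\<close>. Bounding the denominator
  \<open>(1 + a) * (1 + b)\<close> below by \<open>a\<close> leaves the relative difference of
  \<open>rbar\<close>, in which \<open>lam\<close> cancels.\<close>

lemma w_holder:
  assumes S: "S \<in> \<S>" "u \<in> space (leb S)" "u' \<in> space (leb S)" "sup_dist S u u' \<le> 1"
  shows "\<bar>w S u - w S u'\<bar> \<le> \<rho> * L3 K * sup_dist S u u' powr \<beta>"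
proof -
  define a b where "a = lam E S * rbar E S u" and "b = lam E S * rbar E S u'"
  have pos: "0 < a" "0 < b" using lam_pos[OF S(1)] rbar_pos[OF S(1)] S by (simp_all add: a_def b_def)
  have "w S u - w S u' = (a - b) / ((1 + a) * (1 + b))"
    using pos by (simp add: w_def a_def[symmetric] b_def[symmetric] field_simps)
  then have "\<bar>w S u - w S u'\<bar> = \<bar>a - b\<bar> / ((1 + a) * (1 + b))" using pos by (simp add: abs_divide abs_mult)
  also have "\<dots> \<le> \<bar>a - b\<bar> / a"
  proof (rule divide_left_mono)
    have "0 \<le> b + a * b" using pos by simp
    then show "a \<le> (1 + a) * (1 + b)" by (simp add: algebra_simps)
  qed (use pos in auto)
  also have "\<bar>a - b\<bar> / a = \<bar>rbar E S u - rbar E S u'\<bar> / rbar E S u"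
    using lam_pos[OF S(1)] by (simp add: a_def b_def abs_mult flip: right_diff_distrib)
  also have "\<dots> \<le> \<bar>rbar E S u - rbar E S u'\<bar> / clow K"
    using rbar_bounds(1)[OF S(1,2)] c_pos rbar_pos[OF S(1,2)] by (intro divide_left_mono) auto
  also have "\<dots> \<le> (L3 K * sup_dist S u u' powr \<beta>) * (1 / clow K)"
  proof -
    have "\<bar>rbar E S u - rbar E S u'\<bar> \<le> L3 K * sup_dist S u u' powr beta3 K"
      using A3 S unfolding A3_def by blast
    also have "\<dots> \<le> L3 K * sup_dist S u u' powr \<beta>"
      using beta_facts L_pos S sup_dist_nonneg[OF patternD(2)[OF S(1)]] by (intro mult_left_mono powr_mono') auto
    finally show ?thesis using c_pos by (simp add: divide_right_mono)
  qed
  also have "\<dots> \<le> (L3 K * sup_dist S u u' powr \<beta>) * \<rho>"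
    using rho_facts L_pos by (intro mult_left_mono) auto
  finally show ?thesis by (simp add: ac_simps)
qed

text \<open>Moving from \<open>u\<close> to \<open>u'\<close> changes the integrand, which is
  controlled by its own modulus \<open>Hg\<close>, and the kernel, which is controlled by total
  variation times the range \<open>2 * G\<close>.\<close>

lemma condm_holder:
  assumes S: "S \<in> \<S>" "u \<in> space (leb S)" "u' \<in> space (leb S)" "sup_dist S u u' \<le> 1"
    and g: "bdm (leb (coords E)) g" "\<And>x. x \<in> space (leb (coords E)) \<Longrightarrow> \<bar>g x\<bar> \<le> G" "0 < G" "0 \<le> Hg"
    and gh: "\<And>x x'. x \<in> space (leb (coords E)) \<Longrightarrow> x' \<in> space (leb (coords E)) \<Longrightarrow> sup_dist (coords E) x x' \<le> 1 \<Longrightarrow>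
      \<bar>g x - g x'\<bar> \<le> Hg * sup_dist (coords E) x x' powr \<beta>"
  shows "\<bar>condm S g u - condm S g u'\<bar> \<le> (Hg + 2 * G * L2 K) * sup_dist S u u' powr \<beta>"
proof -
  let ?C = "coords E - S"
  let ?d = "sup_dist S u u' powr \<beta>"
  interpret ku: prob_space "kap S u" by (rule kap_prob(1)[OF S(1,2)])
  note spu = kap_prob[OF S(1,2)] and spu' = kap_prob[OF S(1,3)]
  have b: "bdm (kap S u) (\<lambda>v. g (merge S ?C (u, v)))"
    by (rule condm_bound(2)[OF S(1) bdm_measurable[OF g(1)] g(2) S(2)])
  have b'': "bdm (kap S u') (\<lambda>v. g (merge S ?C (u', v)))"
    by (rule condm_bound(2)[OF S(1) bdm_measurable[OF g(1)] g(2) S(3)])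
  have ss: "sets (kap S u) = sets (kap S u')" using spu spu' by simp
  have b': "bdm (kap S u) (\<lambda>v. g (merge S ?C (u', v)))"
    using b'' unfolding bdm_def measurable_cong_sets[OF ss refl] sets_eq_imp_space_eq[OF ss] .
  have 1: "\<bar>(\<integral>v. g (merge S ?C (u, v)) \<partial>kap S u) - (\<integral>v. g (merge S ?C (u', v)) \<partial>kap S u)\<bar> \<le> Hg * ?d"
    unfolding ku.bdm_integral_diff[OF b b', symmetric]
  proof (rule ku.abs_integral_le_const[OF bdm_diff[OF b b']])
    fix v assume "v \<in> space (kap S u)"
    then have v: "v \<in> space (leb ?C)" using spu by simp
    show "\<bar>g (merge S ?C (u, v)) - g (merge S ?C (u', v))\<bar> \<le> Hg * ?d"
      using gh[OF merge_space[OF S(1,2) v] merge_space[OF S(1,3) v]] S(4) unfolding sup_dist_merge[OF S(1)] by simp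
  qed
  have "\<bar>(\<integral>v. g (merge S ?C (u', v)) \<partial>kap S u) - (\<integral>v. g (merge S ?C (u', v)) \<partial>kap S u')\<bar> \<le> 2 * G * tv_dist (kap S u) (kap S u')"
    by (rule integral_diff_le_tv_dist[OF spu(1) spu'(1) ss bdm_measurable[OF b'] _ g(3)])
       (use spu g(2) merge_space[OF S(1,3)] in auto)
  also have "tv_dist (kap S u) (kap S u') \<le> L2 K * ?d"
  proof -
    have "tv_dist (kap S u) (kap S u') \<le> L2 K * sup_dist S u u' powr beta2 K" by (rule kap(2)[OF S])
    also have "\<dots> \<le> L2 K * ?d"
      using beta_facts L_pos S(4) sup_dist_nonneg[OF patternD(2)[OF S(1)]] by (intro mult_left_mono powr_mono') auto
    finally show ?thesis .
  qed
  finally have 2: "\<bar>(\<integral>v. g (merge S ?C (u', v)) \<partial>kap S u) - (\<integral>v. g (merge S ?C (u', v)) \<partial>kap S u')\<bar> \<le> 2 * G * (L2 K * ?d)"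
    using g(3) by simp
  from 1 2 show ?thesis unfolding condm_def by (simp add: distrib_right mult.assoc)
qed

text \<open>The modulus of the iterates is a hypothesis here, because the estimate serves both
  inside the induction for \<open>pa_holder\<close> and after it.\<close>

lemma holder_step:
  assumes ph: "\<And>S u u'. S \<in> \<S> \<Longrightarrow> u \<in> space (leb S) \<Longrightarrow> u' \<in> space (leb S) \<Longrightarrow> sup_dist S u u' \<le> 1 \<Longrightarrow>
      \<bar>pa m S u - pa m S u'\<bar> \<le> 2 * bnd m * LL * \<rho> * sup_dist S u u' powr \<beta>"
    and S: "S \<in> \<S>" "u \<in> space (leb S)" "u' \<in> space (leb S)" "sup_dist S u u' \<le> 1"
  shows "\<bar>condm S (gp m S) u - condm S (gp m S) u'\<bar> \<le> (L1 K + (N - 1) * (2 * bnd m * LL * \<rho>) + 2 * (N * bnd m) * L2 K) * sup_dist S u u' powr \<beta>"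
proof (rule condm_holder[OF S gp[OF S(1)]])
  show "0 < N * bnd m" using N_ge_1 bnd_pos(1)[of m] by (intro mult_pos_pos) auto
  have h0: "0 \<le> 2 * bnd m * LL * \<rho>" using bnd_pos(1)[of m] LL_pos rho_facts by simp
  show "0 \<le> L1 K + (N - 1) * (2 * bnd m * LL * \<rho>)"
  proof (rule add_nonneg_nonneg)
    show "0 \<le> (N - 1) * (2 * bnd m * LL * \<rho>)" by (rule mult_nonneg_nonneg[OF _ h0]) (use N_ge_1 in simp)
  qed (use L_pos in simp)
  fix x x' assume x: "x \<in> space (leb (coords E))" "x' \<in> space (leb (coords E))" "sup_dist (coords E) x x' \<le> 1"
  let ?d = "sup_dist (coords E) x x'"
  have d0: "0 \<le> ?d" by (rule sup_dist_nonneg) simp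
  have "\<bar>target E x - target E x'\<bar> \<le> L1 K * ?d powr beta1 K" using A1 x unfolding A1_def by blast
  also have "\<dots> \<le> L1 K * ?d powr \<beta>" using beta_facts L_pos d0 x by (intro mult_left_mono powr_mono') auto
  finally have 1: "\<bar>target E x - target E x'\<bar> \<le> L1 K * ?d powr \<beta>" .
  have "\<bar>\<Sum>S'\<in>\<S> - {S}. pa m S' (restrict x S') - pa m S' (restrict x' S')\<bar> \<le> (\<Sum>S'\<in>\<S> - {S}. 2 * bnd m * LL * \<rho> * ?d powr \<beta>)"
  proof (rule order_trans[OF sum_abs sum_mono])
    fix S' assume "S' \<in> \<S> - {S}"
    then have S': "S' \<in> \<S>" by simp
    have d: "sup_dist S' (restrict x S') (restrict x' S') \<le> ?d"
      unfolding sup_dist_restrict by (rule sup_dist_mono) (use patternD[OF S'] in auto)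
    have "\<bar>pa m S' (restrict x S') - pa m S' (restrict x' S')\<bar> \<le> 2 * bnd m * LL * \<rho> * sup_dist S' (restrict x S') (restrict x' S') powr \<beta>"
      using d x by (intro ph S' restr_space) auto
    also have "\<dots> \<le> 2 * bnd m * LL * \<rho> * ?d powr \<beta>"
      using h0 d beta_facts sup_dist_nonneg[OF patternD(2)[OF S']] by (intro mult_left_mono powr_mono2) auto
    finally show "\<bar>pa m S' (restrict x S') - pa m S' (restrict x' S')\<bar> \<le> 2 * bnd m * LL * \<rho> * ?d powr \<beta>" .
  qed
  also have "\<dots> = (N - 1) * (2 * bnd m * LL * \<rho>) * ?d powr \<beta>"
    using card_Diff_singleton[OF S(1)] N_ge_1 by (simp add: of_nat_diff)
  finally have 2: "\<bar>(\<Sum>S'\<in>\<S> - {S}. pa m S' (restrict x S')) - (\<Sum>S'\<in>\<S> - {S}. pa m S' (restrict x' S'))\<bar> \<le> (N - 1) * (2 * bnd m * LL * \<rho>) * ?d powr \<beta>"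
    by (simp add: sum_subtractf)
  from 1 2 show "\<bar>gp m S x - gp m S x'\<bar> \<le> (L1 K + (N - 1) * (2 * bnd m * LL * \<rho>)) * ?d powr \<beta>"
    unfolding gpop_def distrib_right by linarith
qed

text \<open>The claimed constant \<open>h\<close> triples with \<open>bnd\<close>. The old value
  contributes at most \<open>h\<close>, the other components in the residual at most
  \<open>h\<close>, and the moduli of target, kernel and weight together at most
  \<open>2 * bnd m * LL * \<rho> = h\<close>.\<close>

lemma pa_holder:
  assumes "S \<in> \<S>" "u \<in> space (leb S)" "u' \<in> space (leb S)" "sup_dist S u u' \<le> 1"
  shows "\<bar>pa m S u - pa m S u'\<bar> \<le> 2 * bnd m * LL * \<rho> * sup_dist S u u' powr \<beta>"
  using assms
proof (induction m arbitrary: S u u')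
  case 0
  show ?case using LL_pos rho_facts bnd_pos(1)[of 0] by simp
next
  case (Suc m)
  note S = Suc.prems
  let ?d = "sup_dist S u u' powr \<beta>"
  let ?c = "\<lambda>u. condm S (gp m S) u - mu S (gp m S)"
  define h where "h = 2 * bnd m * LL * \<rho>"
  have d0: "0 \<le> ?d" by simp
  have 1: "\<bar>condm S (gp m S) u - condm S (gp m S) u'\<bar> \<le> (L1 K + (N - 1) * h + 2 * (N * bnd m) * L2 K) * ?d"
    unfolding h_def by (rule holder_step[OF Suc.IH S])
  have cb: "\<bar>?c u'\<bar> \<le> 2 * (N * bnd m)"
    using condm_bound(1)[OF S(1) bdm_measurable[OF gp(1)[OF S(1)]] gp(2)[OF S(1)] S(3)] mu_bound[OF S(1) gp[OF S(1)]] by (smt (verit))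
  have "w S u * ?c u - w S u' * ?c u' = w S u * (condm S (gp m S) u - condm S (gp m S) u') + (w S u - w S u') * ?c u'"
    by (simp add: algebra_simps)
  moreover have "\<bar>w S u * (condm S (gp m S) u - condm S (gp m S) u')\<bar> \<le> 1 * ((L1 K + (N - 1) * h + 2 * (N * bnd m) * L2 K) * ?d)"
    unfolding abs_mult using w_bounds[OF S(1,2)] 1 by (intro mult_mono) auto
  moreover have "\<bar>(w S u - w S u') * ?c u'\<bar> \<le> (\<rho> * L3 K * ?d) * (2 * (N * bnd m))"
    unfolding abs_mult using w_holder[OF S] cb rho_facts L_pos d0 by (intro mult_mono) auto
  ultimately have "\<bar>w S u * ?c u - w S u' * ?c u'\<bar> \<le> (L1 K + (N - 1) * h + 2 * (N * bnd m) * L2 K + 2 * (N * bnd m) * (\<rho> * L3 K)) * ?d"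
    by (simp add: algebra_simps)
  then have "1 / N * \<bar>w S u * ?c u - w S u' * ?c u'\<bar> \<le> 1 / N * ((L1 K + (N - 1) * h + 2 * (N * bnd m) * L2 K + 2 * (N * bnd m) * (\<rho> * L3 K)) * ?d)"
    using N_ge_1 by (intro mult_left_mono) auto
  also have "\<dots> = (L1 K / N + (1 - 1 / N) * h + 2 * bnd m * L2 K + 2 * bnd m * (\<rho> * L3 K)) * ?d"
    using N_ge_1 by (simp add: field_simps)
  finally have 2: "1 / N * \<bar>w S u * ?c u - w S u' * ?c u'\<bar> \<le> (L1 K / N + (1 - 1 / N) * h + 2 * bnd m * L2 K + 2 * bnd m * (\<rho> * L3 K)) * ?d" .
  have 3: "(1 - 1 / N) * \<bar>pa m S u - pa m S u'\<bar> \<le> (1 - 1 / N) * (h * ?d)"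
    using Suc.IH[OF S] N_ge_1 unfolding h_def by (intro mult_left_mono) auto
  have "pa (Suc m) S u - pa (Suc m) S u' = (1 - 1 / N) * (pa m S u - pa m S u') + 1 / N * (w S u * ?c u - w S u' * ?c u')"
    by (simp add: algebra_simps diff_divide_distrib)
  then have "\<bar>pa (Suc m) S u - pa (Suc m) S u'\<bar> \<le> (1 - 1 / N) * \<bar>pa m S u - pa m S u'\<bar> + 1 / N * \<bar>w S u * ?c u - w S u' * ?c u'\<bar>"
    using N_ge_1 abs_triangle_ineq[of "(1 - 1 / N) * (pa m S u - pa m S u')" "1 / N * (w S u * ?c u - w S u' * ?c u')"]
    by (simp add: abs_mult)
  also have "\<dots> \<le> ((1 - 1 / N) * h + (L1 K / N + (1 - 1 / N) * h + 2 * bnd m * L2 K + 2 * bnd m * (\<rho> * L3 K))) * ?d"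
    by (rule order_trans[OF add_mono[OF 3 2]]) (simp only: distrib_right mult.assoc order_refl)
  also have "\<dots> \<le> (2 * bnd (Suc m) * LL * \<rho>) * ?d"
  proof (rule mult_right_mono[OF _ d0])
    have b1: "1 \<le> bnd m" by (rule bnd_pos)
    have h0: "0 \<le> h" unfolding h_def using bnd_pos(1)[of m] LL_pos rho_facts by simp
    have "(1 - 1 / N) * h \<le> 1 * h" using N_ge_1 h0 by (intro mult_right_mono) auto
    moreover have "L1 K / N \<le> 2 * bnd m * (\<rho> * L1 K)"
    proof -
      have "L1 K / N \<le> L1 K / 1" using N_ge_1 L_pos by (intro divide_left_mono) auto
      also have "\<dots> = 1 * (1 * L1 K)" by simp
      also have "\<dots> \<le> 2 * bnd m * (\<rho> * L1 K)" using b1 rho_facts L_pos by (intro mult_mono) auto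
      finally show ?thesis .
    qed
    moreover have "2 * bnd m * (1 * L2 K) \<le> 2 * bnd m * (\<rho> * L2 K)"
      using b1 rho_facts L_pos by (intro mult_left_mono mult_right_mono) auto
    moreover have "2 * bnd m * (\<rho> * L1 K) + 2 * bnd m * (\<rho> * L2 K) + 2 * bnd m * (\<rho> * L3 K) = h"
      by (simp add: h_def LL_def algebra_simps)
    moreover have "2 * bnd (Suc m) * LL * \<rho> = 3 * h" by (simp add: bnd_pos(3) h_def)
    moreover have "2 * bnd m * (1 * L2 K) = 2 * bnd m * L2 K" by simp
    ultimately show "(1 - 1 / N) * h + (L1 K / N + (1 - 1 / N) * h + 2 * bnd m * L2 K + 2 * bnd m * (\<rho> * L3 K)) \<le> 2 * bnd (Suc m) * LL * \<rho>"
      by linarith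
  qed
  finally show ?case .
qed

lemma condm_gp_holder:
  assumes S: "S \<in> \<S>" "u \<in> space (leb S)" "u' \<in> space (leb S)" "sup_dist S u u' \<le> 1"
  shows "\<bar>condm S (gp m S) u - condm S (gp m S) u'\<bar> \<le> 4 * N * bnd m * LL * \<rho> * sup_dist S u u' powr \<beta>"
proof -
  define h where "h = 2 * bnd m * LL * \<rho>"
  have b1: "1 \<le> bnd m" by (rule bnd_pos)
  have "\<bar>condm S (gp m S) u - condm S (gp m S) u'\<bar> \<le> (L1 K + (N - 1) * h + 2 * (N * bnd m) * L2 K) * sup_dist S u u' powr \<beta>"
    unfolding h_def by (rule holder_step[OF pa_holder S])
  also have "\<dots> \<le> (4 * N * bnd m * LL * \<rho>) * sup_dist S u u' powr \<beta>"
  proof (rule mult_right_mono)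
    have "1 * 1 * L1 K \<le> (2 * bnd m) * \<rho> * L1 K" using b1 rho_facts L_pos by (intro mult_mono) auto
    also have "\<dots> = 1 * ((2 * bnd m) * \<rho> * L1 K)" by simp
    also have "\<dots> \<le> N * ((2 * bnd m) * \<rho> * L1 K)"
      using N_ge_1 b1 rho_facts L_pos by (intro mult_right_mono mult_nonneg_nonneg) auto
    finally have 1: "L1 K \<le> N * (2 * bnd m * \<rho> * L1 K)" by simp
    have 2: "2 * (N * bnd m) * (1 * L2 K) \<le> 2 * (N * bnd m) * (\<rho> * L2 K)"
      using N_ge_1 b1 rho_facts L_pos by (intro mult_left_mono mult_right_mono) auto
    have 3: "0 \<le> N * (2 * bnd m * \<rho> * L3 K)" "0 \<le> h" using N_ge_1 b1 rho_facts L_pos LL_pos by (auto simp: h_def)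
    have "4 * N * bnd m * LL * \<rho> = (N * (2 * bnd m * \<rho> * L1 K) + 2 * (N * bnd m) * (\<rho> * L2 K) + N * (2 * bnd m * \<rho> * L3 K)) + N * h"
      by (simp add: LL_def h_def algebra_simps)
    moreover have "(N - 1) * h = N * h - h" by (simp add: left_diff_distrib)
    moreover have "2 * (N * bnd m) * (1 * L2 K) = 2 * (N * bnd m) * L2 K" by simp
    ultimately show "L1 K + (N - 1) * h + 2 * (N * bnd m) * L2 K \<le> 4 * N * bnd m * LL * \<rho>"
      using 1 2 3 by linarith
  qed simp
  finally show ?thesis by simp
qed

end

section \<open>Kernel regression on one piece of the data\<close>

text \<open>If equal colours imply neighbourhood, each index has at least as many neighbours as its
  colour class has members. The inverse counts therefore sum to at most 1 over a class, and in total
  to at most the number of colours.\<close>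

lemma sum_inverse_class_size_le:
  fixes nb :: "'i \<Rightarrow> 'i \<Rightarrow> bool"
  assumes "finite I" "I0 \<subseteq> I" "finite C" "col ` I0 \<subseteq> C"
    and nb: "\<And>i j. i \<in> I0 \<Longrightarrow> j \<in> I0 \<Longrightarrow> col i = col j \<Longrightarrow> nb i j"
  shows "(\<Sum>i\<in>I0. 1 / (\<Sum>j\<in>I. of_bool (nb i j))) \<le> real (card C)"
proof -
  have fin: "finite I0" using assms(1,2) by (rule finite_subset[rotated])
  have "(\<Sum>i\<in>I0. 1 / (\<Sum>j\<in>I. of_bool (nb i j) :: real)) = (\<Sum>c\<in>C. \<Sum>i\<in>{i\<in>I0. col i = c}. 1 / (\<Sum>j\<in>I. of_bool (nb i j)))"
    by (rule sum.group[symmetric, OF fin assms(3,4)])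
  also have "\<dots> \<le> (\<Sum>c\<in>C. 1)"
  proof (rule sum_mono)
    fix c assume "c \<in> C"
    define J where "J = {i\<in>I0. col i = c}"
    have J: "finite J" "J \<subseteq> I" using fin assms(2) by (auto simp: J_def)
    have "(\<Sum>i\<in>J. 1 / (\<Sum>j\<in>I. of_bool (nb i j) :: real)) \<le> (\<Sum>i\<in>J. 1 / real (card J))"
    proof (rule sum_mono)
      fix i assume i: "i \<in> J"
      have "real (card J) = (\<Sum>j\<in>J. of_bool (nb i j))" using nb i by (simp add: J_def)
      also have "\<dots> \<le> (\<Sum>j\<in>I. of_bool (nb i j))" by (rule sum_mono2[OF assms(1) J(2)]) simp
      finally have "real (card J) \<le> (\<Sum>j\<in>I. of_bool (nb i j))" .
      moreover have "0 < real (card J)" using i J(1) by (auto simp: card_gt_0_iff)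
      ultimately show "1 / (\<Sum>j\<in>I. of_bool (nb i j)) \<le> 1 / real (card J)" by (intro divide_left_mono) auto
    qed
    also have "\<dots> \<le> 1" by simp
    finally show "(\<Sum>i\<in>{i\<in>I0. col i = c}. 1 / (\<Sum>j\<in>I. of_bool (nb i j) :: real)) \<le> 1" unfolding J_def .
  qed
  finally show ?thesis by simp
qed

text \<open>Nonnegativity of a weighted variance. With total weight 0 both sides are 0, in line with
  the convention for empty neighbourhoods.\<close>

lemma weighted_jensen:
  fixes a b :: "'i \<Rightarrow> real"
  assumes "\<And>i. i \<in> I \<Longrightarrow> 0 \<le> a i"
  shows "((\<Sum>i\<in>I. b i * a i) / (\<Sum>i\<in>I. a i))\<^sup>2 \<le> (\<Sum>i\<in>I. (b i)\<^sup>2 * a i) / (\<Sum>i\<in>I. a i)"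
proof (cases "(\<Sum>i\<in>I. a i) = 0")
  case False
  define A where "A = (\<Sum>i\<in>I. a i)"
  have A: "0 < A" using False sum_nonneg[of I a] assms by (simp add: A_def less_le)
  define m where "m = (\<Sum>i\<in>I. b i * a i) / A"
  have mA: "(\<Sum>i\<in>I. b i * a i) = m * A" using A by (simp add: m_def)
  have "0 \<le> (\<Sum>i\<in>I. (b i - m)\<^sup>2 * a i)" using assms by (intro sum_nonneg) auto
  also have "\<dots> = (\<Sum>i\<in>I. (b i)\<^sup>2 * a i) - 2 * m * (\<Sum>i\<in>I. b i * a i) + m\<^sup>2 * (\<Sum>i\<in>I. a i)"
    by (simp add: power2_diff left_diff_distrib distrib_right sum.distrib sum_subtractf sum_distrib_left mult.assoc mult.left_commute)
  also have "\<dots> = (\<Sum>i\<in>I. (b i)\<^sup>2 * a i) - m\<^sup>2 * A"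
    unfolding mA A_def[symmetric] by (simp add: power2_eq_square)
  finally have "m\<^sup>2 \<le> (\<Sum>i\<in>I. (b i)\<^sup>2 * a i) / A" using A by (simp add: pos_le_divide_eq)
  then show ?thesis unfolding m_def A_def .
qed simp

context model
begin

abbreviation X :: "nat \<Rightarrow> (nat + nat set \<times> nat \<Rightarrow> point) \<Rightarrow> point" where "X i D \<equiv> D (Inl i)"
abbreviation "h \<equiv> bandwidth E"
abbreviation "T \<equiv> trunc E"
abbreviation swp :: "nat \<Rightarrow> (nat + nat set \<times> nat \<Rightarrow> point) \<Rightarrow> nat + nat set \<times> nat \<Rightarrow> point" where
  "swp i D \<equiv> D(Inl 0 := D (Inl i), Inl i := D (Inl 0))"

text \<open>The kernel without its factor \<open>(2 * h) ^ card S\<close>, which cancels against the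
  density estimate.\<close>

definition nr :: "nat set \<Rightarrow> point \<Rightarrow> point \<Rightarrow> real" where
  "nr S x y = of_bool (sup_dist S x y \<le> h)"

definition cnt :: "nat set \<Rightarrow> nat set \<Rightarrow> (nat + nat set \<times> nat \<Rightarrow> point) \<Rightarrow> point \<Rightarrow> real" where
  "cnt I S D x = (\<Sum>i\<in>I. nr S x (X i D))"

text \<open>The Nadaraya-Watson regression estimate of \<open>q\<close> at \<open>x\<close>; it is 0
  when no observation of the piece is near \<open>x\<close>.\<close>

definition NW :: "nat set \<Rightarrow> nat set \<Rightarrow> (nat + nat set \<times> nat \<Rightarrow> point) \<Rightarrow> (point \<Rightarrow> real) \<Rightarrow> point \<Rightarrow> real" where
  "NW I S D q x = (\<Sum>i\<in>I. q (X i D) * nr S x (X i D)) / cnt I S D x"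

text \<open>The estimated normaliser relative to the true one, so with mean 1. In terms of it the
  estimator depends on the ratios only through \<open>rbar\<close>.\<close>

definition rho_hat :: "nat set \<Rightarrow> nat set \<Rightarrow> (nat + nat set \<times> nat \<Rightarrow> point) \<Rightarrow> real" where
  "rho_hat I S D = average I (\<lambda>i. rbar E S (restrict (X i D) S))"

definition Wav :: "nat set \<Rightarrow> nat set \<Rightarrow> (nat + nat set \<times> nat \<Rightarrow> point) \<Rightarrow> (point \<Rightarrow> real) \<Rightarrow> real" where
  "Wav I S D q = (\<Sum>i\<in>I. what E D I S (restrict (X i D) S) * q (X i D)) / (\<Sum>i\<in>I. what E D I S (restrict (X i D) S))"

lemma sup_dist_commute: "sup_dist S x y = sup_dist S y x"
  unfolding sup_dist_def sup_norm_def by (simp add: abs_minus_commute)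

lemma nr_commute: "nr S x y = nr S y x"
  unfolding nr_def by (simp add: sup_dist_commute)

lemma nr_bounds: "0 \<le> nr S x y" "nr S x y \<le> 1" "nr S x y = 0 \<or> nr S x y = 1"
  by (auto simp: nr_def)

lemma nr_refl: "nr S x x = 1"
proof -
  have "insert 0 ((\<lambda>j. \<bar>x j - x j\<bar>) ` S) = {0}" by auto
  then have "sup_dist S x x \<le> 0" unfolding sup_dist_def sup_norm_def by (simp only: Max_singleton order_refl)
  then show ?thesis using h_pos by (simp add: nr_def)
qed

lemma nr_restrict: "nr S (restrict x S) y = nr S x y"
  unfolding nr_def sup_dist_def by (subst sup_norm_cong[of S _ "\<lambda>j. x j - y j"]) auto

lemma cnt_nonneg: "0 \<le> cnt I S D x"
  unfolding cnt_def by (intro sum_nonneg nr_bounds)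

lemma nr_le_cnt: "finite I \<Longrightarrow> i \<in> I \<Longrightarrow> nr S x (X i D) \<le> cnt I S D x"
  unfolding cnt_def by (intro member_le_sum nr_bounds)

lemma X_measurable [measurable]: "X i \<in> measurable Q (leb (coords E))"
  using measurable_component_singleton[of "Inl i" UNIV Mf] unfolding Mf_simps measurable_cong_sets[OF refl sets_law] by simp

lemma X_coord_measurable: "j \<in> coords E \<Longrightarrow> (\<lambda>D. X i D j) \<in> borel_measurable Q"
  by (rule measurable_compose[OF X_measurable coord_measurable])

lemma X_space: "D \<in> space Q \<Longrightarrow> X i D \<in> space (leb (coords E))"
  using coord_space[of D "Inl i"] by simp

lemma nr_measurable:
  assumes "S \<in> \<S>"
    and "\<And>j. j \<in> S \<Longrightarrow> (\<lambda>z. f z j) \<in> borel_measurable M" "\<And>j. j \<in> S \<Longrightarrow> (\<lambda>z. g z j) \<in> borel_measurable M"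
  shows "(\<lambda>z. nr S (f z) (g z)) \<in> borel_measurable M"
proof -
  have [measurable]: "(\<lambda>z. sup_dist S (f z) (g z)) \<in> borel_measurable M"
    unfolding sup_dist_def by (rule sup_norm_measurable[OF patternD(2)[OF assms(1)]]) (use assms in measurable)
  show ?thesis unfolding nr_def by measurable
qed

lemma nr_X_measurable [measurable]: "S \<in> \<S> \<Longrightarrow> (\<lambda>D. nr S (X i D) (X j D)) \<in> borel_measurable Q"
  using patternD(1)[of S] by (intro nr_measurable X_coord_measurable) auto

lemma cnt_X_measurable [measurable]: "S \<in> \<S> \<Longrightarrow> (\<lambda>D. cnt I S D (X i D)) \<in> borel_measurable Q"
  unfolding cnt_def by measurable

lemma nr_div_cnt: assumes "finite I" "j \<in> I" shows "0 \<le> nr S x (X j D) / cnt I S D x" "nr S x (X j D) / cnt I S D x \<le> 1"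
  using nr_le_cnt[OF assms, of S x D] nr_bounds[of S x "X j D"] cnt_nonneg[of I S D x]
  by (auto simp: divide_le_eq_1 less_le)

lemma bdm_nr_div_cnt:
  assumes "S \<in> \<S>" "finite I" "j \<in> I"
  shows "bdm Q (\<lambda>D. nr S (X i D) (X j D) / cnt I S D (X i D))"
proof (rule bdmI[where B=1])
  show "(\<lambda>D. nr S (X i D) (X j D) / cnt I S D (X i D)) \<in> borel_measurable Q" using assms(1) by measurable
  fix D show "\<bar>nr S (X i D) (X j D) / cnt I S D (X i D)\<bar> \<le> 1"
    using nr_div_cnt[OF assms(2,3), of S "X i D" D] by linarith
qed

lemma bdm_joint_X:
  assumes "bdm (Q \<Otimes>\<^sub>M leb (coords E)) (\<lambda>(D, x). \<phi> D x)"
  shows "bdm Q (\<lambda>D. \<phi> D (X i D))"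
  using bdm_comp[OF assms, of "\<lambda>D. (D, X i D)" Q] by simp

lemma bdm_fixed_X: "bdm (leb (coords E)) g \<Longrightarrow> bdm Q (\<lambda>D. g (X i D))"
  by (rule bdm_comp[OF _ X_measurable])

lemma integral_X: fixes g :: "point \<Rightarrow> real" shows "g \<in> borel_measurable (leb (coords E)) \<Longrightarrow> (\<integral>D. g (X i D) \<partial>Q) = (\<integral>x. g x \<partial>P)"
  using integral_coord[of g "Inl i"] unfolding Mf_simps measurable_cong_sets[OF sets_law refl] by simp

text \<open>Exchanging the roles of the test point and of the \<open>i\<close>-th observation turns the averaged kernel weights
  into a sum bounded by a number of cells, whatever the density.\<close>

lemma sum_near_inverse_cnt_le:
  assumes S: "S \<in> \<S>" and "finite I"
  shows "(\<Sum>i\<in>I. nr S x (X i D) / cnt I S D (X i D)) \<le> 2 ^ ndim E"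
proof -
  define I0 where "I0 = {i\<in>I. nr S x (X i D) = 1}"
  have "(\<Sum>i\<in>I. nr S x (X i D) / cnt I S D (X i D)) = (\<Sum>i\<in>I0. nr S x (X i D) / cnt I S D (X i D))"
    using assms(2) nr_bounds(3)[of S x] by (intro sum.mono_neutral_right) (auto simp: I0_def)
  also have "\<dots> = (\<Sum>i\<in>I0. 1 / (\<Sum>j\<in>I. of_bool (sup_dist S (X i D) (X j D) \<le> h)))"
    by (intro sum.cong) (auto simp: I0_def cnt_def nr_def)
  also have "\<dots> \<le> real (card (Pow S))"
  \<comment> \<open>Colours are orthants around \<open>x\<close>. Two points within \<open>h\<close>
    of \<open>x\<close> that lie in the same orthant are within \<open>h\<close> of each other in
    the sup norm, which gives at most \<open>2 ^ card S\<close> classes.\<close>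
  proof (rule sum_inverse_class_size_le[where col="\<lambda>i. {j\<in>S. x j \<le> X i D j}"])
    fix i j assume ij: "i \<in> I0" "j \<in> I0" "{k\<in>S. x k \<le> X i D k} = {k\<in>S. x k \<le> X j D k}"
    have d: "\<bar>x k - X i D k\<bar> \<le> h" "\<bar>x k - X j D k\<bar> \<le> h" if "k \<in> S" for k
      using ij that patternD(2)[OF S] by (auto simp: I0_def nr_def sup_dist_def sup_norm_le_iff)
    have "\<bar>X i D k - X j D k\<bar> \<le> h" if k: "k \<in> S" for k
    proof -
      have "(x k \<le> X i D k) = (x k \<le> X j D k)" using ij(3) k by blast
      then show ?thesis using d[OF k] by (cases "x k \<le> X i D k") auto
    qed
    then show "sup_dist S (X i D) (X j D) \<le> h" using h_pos patternD(2)[OF S] by (simp add: sup_dist_def sup_norm_le_iff)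
  qed (use assms patternD(2)[OF S] in \<open>auto simp: I0_def\<close>)
  also have "\<dots> \<le> 2 ^ ndim E"
    using patternD[OF S] by (simp add: card_Pow power_increasing)
  finally show ?thesis .
qed

text \<open>Exchanging test point and observation \<open>i\<close> alters the neighbour count of the
  point \<open>X i D\<close> in the \<open>i\<close>-th term only: the point itself is replaced by
  \<open>X 0 D\<close>, and if these are near both terms count 1. Otherwise the numerators
  vanish.\<close>

lemma cnt_swp:
  assumes "finite I" "i \<in> I" "0 \<notin> I"
  shows "nr S (X i D) (X 0 D) / cnt I S (swp i D) (X i D) = nr S (X 0 D) (X i D) / cnt I S D (X i D)"
proof (cases "nr S (X i D) (X 0 D) = 0")
  case False
  then have 1: "nr S (X i D) (X 0 D) = 1" using nr_bounds(3) by blast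
  have "cnt I S (swp i D) (X i D) = (\<Sum>j\<in>I. nr S (X i D) (X j D))"
    unfolding cnt_def using assms 1 nr_refl[of S "X i D"] by (intro sum.cong) auto
  then show ?thesis by (simp add: cnt_def nr_commute)
qed (simp add: nr_commute)

text \<open>Stone's inequality: a local average at a fresh point costs at most a dimensional
  constant in mean, for every density. Each summand is transformed by exchanging the test point with
  observation \<open>i\<close>. The function may be random, provided that these exchanges leave it
  unchanged.\<close>

lemma stone:
  assumes S: "S \<in> \<S>" and I: "finite I" "0 \<notin> I"
    and \<phi>: "bdm (Q \<Otimes>\<^sub>M leb (coords E)) (\<lambda>(D, x). \<phi> D x)" "\<And>D x. D \<in> space Q \<Longrightarrow> x \<in> space (leb (coords E)) \<Longrightarrow> 0 \<le> \<phi> D x"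
    and inv: "\<And>D i. D \<in> space Q \<Longrightarrow> i \<in> I \<Longrightarrow> \<phi> (swp i D) = \<phi> D"
  shows "(\<integral>D. NW I S D (\<phi> D) (X 0 D) \<partial>Q) \<le> 2 ^ ndim E * (\<integral>D. \<phi> D (X 0 D) \<partial>Q)"
    and "bdm Q (\<lambda>D. NW I S D (\<phi> D) (X 0 D))"
proof -
  have b: "bdm Q (\<lambda>D. \<phi> D (X i D) * (nr S (X 0 D) (X i D) / cnt I S D (X 0 D)))" if "i \<in> I" for i
    by (intro bdm_mult bdm_joint_X[OF \<phi>(1)] bdm_nr_div_cnt S I that)
  have NW: "NW I S D (\<phi> D) (X 0 D) = (\<Sum>i\<in>I. \<phi> D (X i D) * (nr S (X 0 D) (X i D) / cnt I S D (X 0 D)))" for D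
    by (simp add: NW_def sum_divide_distrib)
  show "bdm Q (\<lambda>D. NW I S D (\<phi> D) (X 0 D))" unfolding NW by (intro bdm_sum b)
  have b2: "bdm Q (\<lambda>D. nr S (X 0 D) (X i D) / cnt I S D (X i D))" if "i \<in> I" for i
  proof (rule bdmI[where B=1])
    show "(\<lambda>D. nr S (X 0 D) (X i D) / cnt I S D (X i D)) \<in> borel_measurable Q" using S by measurable
    fix D
    have "1 \<le> cnt I S D (X i D)" using nr_le_cnt[OF I(1) that, of S "X i D" D] by (simp add: nr_refl)
    then show "\<bar>nr S (X 0 D) (X i D) / cnt I S D (X i D)\<bar> \<le> 1"
      using nr_bounds[of S "X 0 D" "X i D"] by (auto simp: divide_le_eq_1 abs_divide)
  qed
  have "(\<integral>D. NW I S D (\<phi> D) (X 0 D) \<partial>Q) = (\<Sum>i\<in>I. \<integral>D. \<phi> D (X i D) * (nr S (X 0 D) (X i D) / cnt I S D (X 0 D)) \<partial>Q)"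
    unfolding NW by (rule Q.bdm_integral_sum[OF b])
  also have "\<dots> = (\<Sum>i\<in>I. \<integral>D. \<phi> D (X 0 D) * (nr S (X 0 D) (X i D) / cnt I S D (X i D)) \<partial>Q)"
  proof (rule sum.cong[OF refl])
    fix i assume i: "i \<in> I"
    have i0: "i \<noteq> 0" using i I by metis
    have "(\<integral>D. \<phi> D (X i D) * (nr S (X 0 D) (X i D) / cnt I S D (X 0 D)) \<partial>Q)
      = (\<integral>D. \<phi> (swp i D) (X i (swp i D)) * (nr S (X 0 (swp i D)) (X i (swp i D)) / cnt I S (swp i D) (X 0 (swp i D))) \<partial>Q)"
      by (rule integral_swap[OF b[OF i]]) simp
    also have "\<dots> = (\<integral>D. \<phi> D (X 0 D) * (nr S (X 0 D) (X i D) / cnt I S D (X i D)) \<partial>Q)"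
    proof (rule Bochner_Integration.integral_cong[OF refl])
      fix D assume D: "D \<in> space Q"
      show "\<phi> (swp i D) (X i (swp i D)) * (nr S (X 0 (swp i D)) (X i (swp i D)) / cnt I S (swp i D) (X 0 (swp i D))) =
        \<phi> D (X 0 D) * (nr S (X 0 D) (X i D) / cnt I S D (X i D))"
        unfolding inv[OF D i] using i0 cnt_swp[OF I(1) i I(2), of S D] by simp
    qed
    finally show "(\<integral>D. \<phi> D (X i D) * (nr S (X 0 D) (X i D) / cnt I S D (X 0 D)) \<partial>Q) = (\<integral>D. \<phi> D (X 0 D) * (nr S (X 0 D) (X i D) / cnt I S D (X i D)) \<partial>Q)" .
  qed
  also have "\<dots> = (\<integral>D. (\<Sum>i\<in>I. \<phi> D (X 0 D) * (nr S (X 0 D) (X i D) / cnt I S D (X i D))) \<partial>Q)"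
    by (rule Q.bdm_integral_sum[symmetric]) (intro bdm_mult bdm_joint_X[OF \<phi>(1)] b2)
  also have "\<dots> \<le> (\<integral>D. \<phi> D (X 0 D) * 2 ^ ndim E \<partial>Q)"
  proof (rule Q.bdm_integral_le)
    show "bdm Q (\<lambda>D. \<Sum>i\<in>I. \<phi> D (X 0 D) * (nr S (X 0 D) (X i D) / cnt I S D (X i D)))"
      by (intro bdm_sum bdm_mult bdm_joint_X[OF \<phi>(1)] b2)
    show "bdm Q (\<lambda>D. \<phi> D (X 0 D) * 2 ^ ndim E)" by (intro bdm_mult bdm_joint_X[OF \<phi>(1)] bdm_const)
    fix D assume D: "D \<in> space Q"
    show "(\<Sum>i\<in>I. \<phi> D (X 0 D) * (nr S (X 0 D) (X i D) / cnt I S D (X i D))) \<le> \<phi> D (X 0 D) * 2 ^ ndim E"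
      unfolding sum_distrib_left[symmetric] by (intro mult_left_mono sum_near_inverse_cnt_le S I \<phi>(2) D X_space)
  qed
  finally show "(\<integral>D. NW I S D (\<phi> D) (X 0 D) \<partial>Q) \<le> 2 ^ ndim E * (\<integral>D. \<phi> D (X 0 D) \<partial>Q)" by (simp add: mult.commute)
qed

section \<open>Cells of the truncation cube and the mean-square error of kernel regression\<close>

definition inT :: "nat set \<Rightarrow> point \<Rightarrow> real" where
  "inT S x = of_bool (sup_norm S x \<le> T)"

lemma inT_bounds: "0 \<le> inT S x" "inT S x \<le> 1" "(inT S x)\<^sup>2 = inT S x"
  by (auto simp: inT_def)

lemma inT_measurable [measurable]: assumes "S \<subseteq> coords E" shows "inT S \<in> borel_measurable (leb (coords E))"
proof -
  have "finite S" using assms by (rule finite_subset) simp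
  then have [measurable]: "(\<lambda>x. sup_norm S x) \<in> borel_measurable (leb (coords E))"
    using assms by (intro sup_norm_measurable) auto
  show ?thesis unfolding inT_def[abs_def] by measurable
qed

lemma inT_bdm: "S \<subseteq> coords E \<Longrightarrow> bdm (leb (coords E)) (inT S)"
  by (rule bdmI[OF inT_measurable, where B=1]) (auto simp: inT_def)

lemma h_le_T: "h \<le> T" using h_le trunc_ge by simp

text \<open>The points inside the cube occupy at most \<open>(4 * T / h) ^ card S\<close> grid cells
  of side \<open>h\<close>, and any two points of one cell are neighbours.\<close>

lemma sum_inT_inverse_le:
  assumes S: "S \<in> \<S>" and "finite I"
  shows "(\<Sum>i\<in>I. inT S (X i D) / (\<Sum>j\<in>I. nr S (X i D) (X j D))) \<le> (4 * T / h) ^ ndim E"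
proof -
  define I0 where "I0 = {i\<in>I. sup_norm S (X i D) \<le> T}"
  define B where "B = {\<lfloor>- (T / h)\<rfloor>..\<lfloor>T / h\<rfloor>}"
  have Th: "1 \<le> T / h" using h_le_T h_pos by simp
  have "(\<Sum>i\<in>I. inT S (X i D) / (\<Sum>j\<in>I. nr S (X i D) (X j D))) = (\<Sum>i\<in>I0. inT S (X i D) / (\<Sum>j\<in>I. nr S (X i D) (X j D)))"
    using assms(2) by (intro sum.mono_neutral_right) (auto simp: I0_def inT_def)
  also have "\<dots> = (\<Sum>i\<in>I0. 1 / (\<Sum>j\<in>I. of_bool (sup_dist S (X i D) (X j D) \<le> h)))"
    by (intro sum.cong) (auto simp: I0_def inT_def nr_def)
  \<comment> \<open>In each coordinate the cell numbers range over \<open>B\<close>, which has at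
    most \<open>2 * (T / h) + 2\<close> elements; \<open>h \<le> T\<close> turns this into
    \<open>4 * T / h\<close>.\<close>
  also have "\<dots> \<le> real (card (S \<rightarrow>\<^sub>E B))"
  proof (rule sum_inverse_class_size_le[where col="\<lambda>i. \<lambda>k\<in>S. \<lfloor>X i D k / h\<rfloor>"])
    show "(\<lambda>i. \<lambda>k\<in>S. \<lfloor>X i D k / h\<rfloor>) ` I0 \<subseteq> (S \<rightarrow>\<^sub>E B)"
    proof (rule image_subsetI, rule restrict_PiE_iff[THEN iffD2], rule ballI)
      fix i k assume "i \<in> I0" "k \<in> S"
      then have "\<bar>X i D k\<bar> \<le> T" using patternD(2)[OF S] by (auto simp: I0_def sup_norm_le_iff)
      then have "- (T / h) \<le> X i D k / h" "X i D k / h \<le> T / h" using h_pos by (auto simp: field_simps)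
      then show "\<lfloor>X i D k / h\<rfloor> \<in> B" unfolding B_def by (auto intro: floor_mono)
    qed
    fix i j assume ij: "i \<in> I0" "j \<in> I0" "(\<lambda>k\<in>S. \<lfloor>X i D k / h\<rfloor>) = (\<lambda>k\<in>S. \<lfloor>X j D k / h\<rfloor>)"
    have "\<bar>X i D k - X j D k\<bar> \<le> h" if k: "k \<in> S" for k
    proof -
      have "\<lfloor>X i D k / h\<rfloor> = \<lfloor>X j D k / h\<rfloor>" using fun_cong[OF ij(3), of k] k by simp
      then have "\<bar>X i D k / h - X j D k / h\<bar> < 1" by linarith
      then have "\<bar>X i D k - X j D k\<bar> / h < 1" using h_pos by (simp add: abs_divide flip: diff_divide_distrib)
      then show ?thesis using h_pos by simp
    qed
    then show "sup_dist S (X i D) (X j D) \<le> h" using h_pos patternD(2)[OF S] by (simp add: sup_dist_def sup_norm_le_iff)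
  qed (use assms(2) patternD(2)[OF S] in \<open>auto simp: I0_def B_def intro!: finite_PiE\<close>)
  also have "\<dots> = real (card B) ^ card S" using patternD(2)[OF S] by (simp add: card_PiE)
  also have "\<dots> \<le> (4 * T / h) ^ card S"
  proof (rule power_mono)
    have "real (card B) = real_of_int (\<lfloor>T / h\<rfloor> - \<lfloor>- (T / h)\<rfloor> + 1)"
      using Th unfolding B_def by (simp add: nat_add_distrib) linarith
    also have "\<dots> \<le> 2 * (T / h) + 2" by linarith
    also have "\<dots> \<le> 4 * T / h" using Th by simp
    finally show "real (card B) \<le> 4 * T / h" .
  qed simp
  also have "\<dots> \<le> (4 * T / h) ^ ndim E"
    using patternD(3)[OF S] Th by (intro power_increasing) auto
  finally show ?thesis .
qed

text \<open>The test point is exchangeable with the observations, so the mean equals the average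
  over all \<open>card I + 1\<close> points, to which the cell count applies. The added 1 in the
  denominator is the test point counting itself.\<close>

lemma expectation_inT_inverse_cnt_le:
  assumes S: "S \<in> \<S>" and I: "finite I" "0 \<notin> I"
  shows "(\<integral>D. inT S (X 0 D) / (1 + cnt I S D (X 0 D)) \<partial>Q) \<le> (4 * T / h) ^ ndim E / (real (card I) + 1)"
    and "bdm Q (\<lambda>D. inT S (X 0 D) / (1 + cnt I S D (X 0 D)))"
proof -
  define J where "J = insert 0 I"
  define t where "t = (\<lambda>i D. inT S (X i D) / (\<Sum>j\<in>J. nr S (X i D) (X j D)))"
  have J: "finite J" "card J = card I + 1" using I by (simp_all add: J_def)
  have t0: "t 0 D = inT S (X 0 D) / (1 + cnt I S D (X 0 D))" for D
    using I by (simp add: t_def J_def cnt_def nr_refl)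
  have tm: "t i \<in> borel_measurable Q" for i
    using S patternD(1)[OF S] unfolding t_def by measurable
  have bt: "bdm Q (t i)" if "i \<in> J" for i
  proof (rule bdmI[OF tm])
    fix D
    have "nr S (X i D) (X i D) \<le> (\<Sum>j\<in>J. nr S (X i D) (X j D))" using that J by (intro member_le_sum nr_bounds)
    then have "1 \<le> (\<Sum>j\<in>J. nr S (X i D) (X j D))" by (simp add: nr_refl)
    then show "\<bar>t i D\<bar> \<le> 1" using inT_bounds[of S "X i D"] by (simp add: t_def abs_divide divide_le_eq_1)
  qed
  show "bdm Q (\<lambda>D. inT S (X 0 D) / (1 + cnt I S D (X 0 D)))" using bt[of 0] unfolding t0 J_def by simp
  have eq: "(\<integral>D. t i D \<partial>Q) = (\<integral>D. t 0 D \<partial>Q)" if "i \<in> J" for i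
  proof (cases "i = 0")
    case False
    have "(\<integral>D. t i D \<partial>Q) = (\<integral>D. t i (swp i D) \<partial>Q)" by (rule integral_swap[OF bt[OF that]]) simp
    also have "(\<lambda>D. t i (swp i D)) = t 0"
    proof
      fix D
      have "(\<Sum>j\<in>J. nr S (X 0 D) (X j (swp i D))) = (\<Sum>j\<in>J. nr S (X 0 D) (X j D))"
      proof (rule sum.reindex_bij_witness[where i="Transposition.transpose 0 i" and j="Transposition.transpose 0 i"])
        fix j assume "j \<in> J"
        then show "Transposition.transpose 0 i j \<in> J" using that by (auto simp: Transposition.transpose_def J_def)
        then show "Transposition.transpose 0 i j \<in> J" .
        show "nr S (X 0 D) (X (Transposition.transpose 0 i j) D) = nr S (X 0 D) (X j (swp i D))"
          using False by (auto simp: Transposition.transpose_def)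
      qed auto
      then show "t i (swp i D) = t 0 D" using False by (simp add: t_def)
    qed
    finally show ?thesis .
  qed simp
  have "(real (card I) + 1) * (\<integral>D. t 0 D \<partial>Q) = (\<Sum>i\<in>J. \<integral>D. t i D \<partial>Q)"
    using J eq by simp
  also have "\<dots> = (\<integral>D. (\<Sum>i\<in>J. t i D) \<partial>Q)" by (rule Q.bdm_integral_sum[OF bt, symmetric])
  also have "\<dots> \<le> (4 * T / h) ^ ndim E"
    unfolding t_def by (rule Q.integral_le_const_bdm[OF _ sum_inT_inverse_le[OF S J(1)]]) (use bt in \<open>auto intro!: bdm_sum simp: t_def\<close>)
  finally show "(\<integral>D. inT S (X 0 D) / (1 + cnt I S D (X 0 D)) \<partial>Q) \<le> (4 * T / h) ^ ndim E / (real (card I) + 1)"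
    unfolding t0 by (simp add: pos_le_divide_eq mult.commute)
qed

text \<open>A neighbour count is a natural number, hence at least 1 unless it vanishes.\<close>

lemma inverse_cnt_le: "(if cnt I S D x = 0 then 0 else 1 / cnt I S D x) \<le> 2 / (1 + cnt I S D x)"
proof (cases "cnt I S D x = 0")
  case False
  have "(\<Sum>i\<in>I. nr S x (X i D)) = real (card {i\<in>I. sup_dist S x (X i D) \<le> h})" if "finite I"
    using that by (simp add: nr_def of_bool_def sum.If_cases Int_def)
  then have "cnt I S D x \<in> \<nat>" by (cases "finite I") (auto simp: cnt_def)
  then have "1 \<le> cnt I S D x" using False by (auto elim!: Nats_cases)
  then show ?thesis by (simp add: divide_simps)
qed simp

text \<open>Split into noise, bias and empty neighbourhoods. The noise is centred given
  \<open>x\<^sub>S\<close> and its variance is at most \<open>4 * G\<^sup>2\<close> over the number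
  of neighbours; the bias is the modulus of \<open>condm\<close> at distance \<open>h\<close>; an
  empty neighbourhood costs \<open>G\<^sup>2\<close>. The constant is
  \<open>17 = 2 * 8 + 1\<close>.\<close>

lemma NW_error:
  assumes S: "S \<in> \<S>" and I: "finite I" "0 \<notin> I"
    and g: "bdm (leb (coords E)) g" "\<And>x. x \<in> space (leb (coords E)) \<Longrightarrow> \<bar>g x\<bar> \<le> G" and Hc: "0 \<le> Hc"
    and gh: "\<And>u u'. u \<in> space (leb S) \<Longrightarrow> u' \<in> space (leb S) \<Longrightarrow> sup_dist S u u' \<le> 1 \<Longrightarrow>
      \<bar>condm S g u - condm S g u'\<bar> \<le> Hc * sup_dist S u u' powr \<beta>"
  shows "(\<integral>D. inT S (X 0 D) * (NW I S D g (X 0 D) - condm S g (restrict (X 0 D) S))\<^sup>2 \<partial>Q)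
      \<le> 17 * G\<^sup>2 * ((4 * T / h) ^ ndim E / (real (card I) + 1)) + 2 * (Hc * h powr \<beta>)\<^sup>2"
    and "bdm Q (\<lambda>D. inT S (X 0 D) * (NW I S D g (X 0 D) - condm S g (restrict (X 0 D) S))\<^sup>2)"
proof -
  define m where "m = (\<lambda>x. condm S g (restrict x S))"
  define \<epsilon> where "\<epsilon> = (\<lambda>x. g x - m x)"
  define \<xi> where "\<xi> = (\<lambda>i D. inT S (X 0 D) * (\<epsilon> (X i D) * (nr S (X 0 D) (X i D) / cnt I S D (X 0 D))))"
  have G0: "0 \<le> G" using g(2)[OF X_space[of _ 0]] Q.not_empty by (meson abs_ge_zero all_not_in_conv order_trans)
  have SC: "S \<subseteq> coords E" using patternD(1)[OF S] .
  have bm: "bdm (leb (coords E)) m" unfolding m_def by (rule bdm_comp[OF bdm_condm[OF S g(1)] restr_measurable[OF S]])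
  have mb: "\<bar>m x\<bar> \<le> G" if "x \<in> space (leb (coords E))" for x
    unfolding m_def by (rule condm_bound(1)[OF S bdm_measurable[OF g(1)] g(2) restr_space[OF S that]])
  have b\<epsilon>: "bdm (leb (coords E)) \<epsilon>" unfolding \<epsilon>_def by (intro bdm_diff g bm)
  have \<epsilon>b: "(\<epsilon> x)\<^sup>2 \<le> 4 * G\<^sup>2" if "x \<in> space (leb (coords E))" for x
  proof -
    have "\<bar>\<epsilon> x\<bar> \<le> 2 * G" using g(2)[OF that] mb[OF that] unfolding \<epsilon>_def by linarith
    then have "\<bar>\<epsilon> x\<bar>\<^sup>2 \<le> (2 * G)\<^sup>2" by (intro power_mono) auto
    then show ?thesis by (simp add: power_mult_distrib)
  qed
  have bin: "bdm Q (\<lambda>D. inT S (X 0 D))" by (rule bdm_fixed_X[OF inT_bdm[OF SC]])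
  have b\<xi>: "bdm Q (\<xi> i)" if "i \<in> I" for i
    unfolding \<xi>_def by (intro bdm_mult bin bdm_fixed_X[OF b\<epsilon>] bdm_nr_div_cnt S I that)
  let ?r = "\<lambda>D. inT S (X 0 D) / (1 + cnt I S D (X 0 D))"
  note r = expectation_inT_inverse_cnt_le[OF S I]
  have orth: "\<exists>k. \<forall>D\<in>space Q. (\<integral>y. \<xi> i (D(k := y)) * \<xi> j (D(k := y)) \<partial>Mf k) = 0" if ij: "i \<in> I" "j \<in> I" "i \<noteq> j" for i j
  proof (intro exI ballI)
    fix D assume D: "D \<in> space Q"
    have i0: "i \<noteq> 0" "j \<noteq> 0" using ij I by metis+
    define A where "A = inT S (X 0 D) * inT S (X 0 D) * \<epsilon> (X j D) * nr S (X 0 D) (X j D)"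
    \<comment> \<open>Observation \<open>i\<close> enters both summands through the neighbour count,
      but there only through its coordinates in \<open>S\<close>. All of that is collected in
      \<open>\<phi>\<close>, against which the noise \<open>\<epsilon>\<close> integrates to
      zero.\<close>
    define \<phi> where "\<phi> = (\<lambda>u. A * (nr S (X 0 D) u * (1 / (nr S (X 0 D) u + cnt (I - {i}) S D (X 0 D)))\<^sup>2))"
    have c: "cnt I S (D(Inl i := y)) (X 0 D) = nr S (X 0 D) y + cnt (I - {i}) S D (X 0 D)" for y
    proof -
      have "cnt I S (D(Inl i := y)) (X 0 D) = nr S (X 0 D) y + (\<Sum>j\<in>I - {i}. nr S (X 0 D) (X j (D(Inl i := y))))"
        unfolding cnt_def using I ij by (subst sum.remove[of I i]) auto
      then show ?thesis unfolding cnt_def by simp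
    qed
    have nrr: "nr S (X 0 D) (restrict y S) = nr S (X 0 D) y" for y
      using nr_restrict[of S y "X 0 D"] by (simp add: nr_commute)
    have p: "\<xi> i (D(Inl i := y)) * \<xi> j (D(Inl i := y)) = \<epsilon> y * \<phi> (restrict y S)" for y
      using i0 ij(3) by (simp add: \<xi>_def c \<phi>_def A_def nrr power2_eq_square)
    have [measurable]: "(\<lambda>u. nr S (X 0 D) u) \<in> borel_measurable (leb S)"
      by (rule nr_measurable[OF S]) auto
    have b\<phi>: "bdm (leb S) \<phi>"
    proof (rule bdmI)
      show "\<phi> \<in> borel_measurable (leb S)" unfolding \<phi>_def by measurable
      fix u
      have "\<bar>nr S (X 0 D) u * (1 / (nr S (X 0 D) u + cnt (I - {i}) S D (X 0 D)))\<^sup>2\<bar> \<le> 1"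
      proof (cases "nr S (X 0 D) u = 0")
        case False
        then have 1: "nr S (X 0 D) u = 1" using nr_bounds(3) by blast
        have "1 / (1 + cnt (I - {i}) S D (X 0 D)) \<le> 1" "0 \<le> 1 / (1 + cnt (I - {i}) S D (X 0 D))"
          using cnt_nonneg[of "I - {i}" S D "X 0 D"] by (auto simp: divide_simps)
        then have "(1 / (1 + cnt (I - {i}) S D (X 0 D)))\<^sup>2 \<le> 1" by (simp only: power_le_one)
        then show ?thesis unfolding 1 by simp
      qed simp
      then show "\<bar>\<phi> u\<bar> \<le> \<bar>A\<bar> * 1" unfolding \<phi>_def abs_mult[of A] by (intro mult_left_mono) auto
    qed
    have "(\<integral>y. \<epsilon> y * \<phi> (restrict y S) \<partial>P) = (\<integral>y. g y * \<phi> (restrict y S) - m y * \<phi> (restrict y S) \<partial>P)"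
      by (simp add: \<epsilon>_def left_diff_distrib)
    also have "\<dots> = (\<integral>y. g y * \<phi> (restrict y S) \<partial>P) - (\<integral>y. m y * \<phi> (restrict y S) \<partial>P)"
      by (intro P.bdm_integral_diff bdm_mult bdm_restrict S b\<phi>) (use g(1) bm in \<open>simp_all add: bdm_law\<close>)
    also have "\<dots> = 0" using integral_condm[OF S g(1) b\<phi>] by (simp add: m_def)
    finally show "(\<integral>y. \<xi> i (D(Inl i := y)) * \<xi> j (D(Inl i := y)) \<partial>Mf (Inl i)) = 0" unfolding p by simp
  qed
  have "(\<integral>D. (\<Sum>i\<in>I. \<xi> i D)\<^sup>2 \<partial>Q) = (\<Sum>i\<in>I. \<integral>D. (\<xi> i D)\<^sup>2 \<partial>Q)"
    by (rule centred_sum[OF I(1) b\<xi> orth])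
  also have "\<dots> = (\<integral>D. (\<Sum>i\<in>I. (\<xi> i D)\<^sup>2) \<partial>Q)" by (rule Q.bdm_integral_sum[symmetric]) (intro bdm_power b\<xi>)
  also have "\<dots> \<le> (\<integral>D. 8 * G\<^sup>2 * ?r D \<partial>Q)"
  proof (rule Q.bdm_integral_le)
    show "bdm Q (\<lambda>D. \<Sum>i\<in>I. (\<xi> i D)\<^sup>2)" by (intro bdm_sum bdm_power b\<xi>)
    show "bdm Q (\<lambda>D. 8 * G\<^sup>2 * ?r D)" by (intro bdm_mult bdm_const r(2))
    fix D assume D: "D \<in> space Q"
    let ?c = "cnt I S D (X 0 D)" and ?t = "inT S (X 0 D)"
    have t: "0 \<le> ?t" by (rule inT_bounds)
    have "(\<Sum>i\<in>I. (\<xi> i D)\<^sup>2) \<le> (\<Sum>i\<in>I. ?t * (4 * G\<^sup>2 * (nr S (X 0 D) (X i D) / (?c * ?c))))"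
    proof (rule sum_mono)
      fix i assume "i \<in> I"
      have "(\<xi> i D)\<^sup>2 = ?t * ((\<epsilon> (X i D))\<^sup>2 * (nr S (X 0 D) (X i D) / (?c * ?c)))"
        using nr_bounds(3)[of S "X 0 D" "X i D"] inT_bounds(3)[of S "X 0 D"] unfolding \<xi>_def power_mult_distrib power_divide
        by (auto simp: power2_eq_square)
      also have "\<dots> \<le> ?t * (4 * G\<^sup>2 * (nr S (X 0 D) (X i D) / (?c * ?c)))"
        using t \<epsilon>b[OF X_space[OF D]] nr_bounds by (intro mult_left_mono mult_right_mono) auto
      finally show "(\<xi> i D)\<^sup>2 \<le> ?t * (4 * G\<^sup>2 * (nr S (X 0 D) (X i D) / (?c * ?c)))" .
    qed
    also have "\<dots> = ?t * (4 * G\<^sup>2 * (?c / (?c * ?c)))"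
      by (simp add: cnt_def sum_distrib_left sum_divide_distrib)
    also have "\<dots> \<le> ?t * (4 * G\<^sup>2 * (2 / (1 + ?c)))"
      using t inverse_cnt_le[of I S D "X 0 D"] by (intro mult_left_mono) (auto split: if_splits)
    finally show "(\<Sum>i\<in>I. (\<xi> i D)\<^sup>2) \<le> 8 * G\<^sup>2 * ?r D" by (simp add: mult.commute)
  qed
  also have "\<dots> = 8 * G\<^sup>2 * (\<integral>D. ?r D \<partial>Q)" by (rule Bochner_Integration.integral_mult_right_zero)
  finally have a: "(\<integral>D. (\<Sum>i\<in>I. \<xi> i D)\<^sup>2 \<partial>Q) \<le> 8 * G\<^sup>2 * (\<integral>D. ?r D \<partial>Q)" .
  have b1: "bdm Q (\<lambda>D. NW I S D g (X 0 D))"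
  proof -
    have "NW I S D g (X 0 D) = (\<Sum>i\<in>I. g (X i D) * (nr S (X 0 D) (X i D) / cnt I S D (X 0 D)))" for D
      by (simp add: NW_def sum_divide_distrib)
    note NWe = this
    show ?thesis unfolding NWe by (intro bdm_sum bdm_mult bdm_fixed_X[OF g(1)] bdm_nr_div_cnt S I)
  qed
  show bL: "bdm Q (\<lambda>D. inT S (X 0 D) * (NW I S D g (X 0 D) - condm S g (restrict (X 0 D) S))\<^sup>2)"
    using bdm_fixed_X[OF bm] by (intro bdm_mult bin bdm_power bdm_diff b1) (simp add: m_def)
  have "(\<integral>D. inT S (X 0 D) * (NW I S D g (X 0 D) - condm S g (restrict (X 0 D) S))\<^sup>2 \<partial>Q)
     \<le> (\<integral>D. 2 * (\<Sum>i\<in>I. \<xi> i D)\<^sup>2 + (2 * (Hc * h powr \<beta>)\<^sup>2 + G\<^sup>2 * ?r D) \<partial>Q)"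
  proof (rule Q.bdm_integral_le[OF bL])
    show "bdm Q (\<lambda>D. 2 * (\<Sum>i\<in>I. \<xi> i D)\<^sup>2 + (2 * (Hc * h powr \<beta>)\<^sup>2 + G\<^sup>2 * ?r D))"
      by (intro bdm_add bdm_mult bdm_const r(2) bdm_power bdm_sum b\<xi>)
    fix D assume D: "D \<in> space Q"
    let ?c = "cnt I S D (X 0 D)" and ?t = "inT S (X 0 D)" and ?m0 = "m (X 0 D)"
    have m0: "condm S g (restrict (X 0 D) S) = ?m0" by (simp add: m_def)
    show "?t * (NW I S D g (X 0 D) - condm S g (restrict (X 0 D) S))\<^sup>2 \<le> 2 * (\<Sum>i\<in>I. \<xi> i D)\<^sup>2 + (2 * (Hc * h powr \<beta>)\<^sup>2 + G\<^sup>2 * ?r D)"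
    proof (cases "?t = 0")
      case True
      then show ?thesis by simp
    next
      case False
      then have t1: "?t = 1" by (auto simp: inT_def)
      show ?thesis
      \<comment> \<open>Without neighbours the estimate is 0 and the squared error at most
        \<open>G\<^sup>2\<close>; the inverse count \<open>?r D\<close> equals 1 in this case and
        pays for it.\<close>
      proof (cases "?c = 0")
        case True
        have "?m0\<^sup>2 \<le> G\<^sup>2" using mb[OF X_space[OF D, of 0]] G0 by (simp add: abs_le_square_iff[symmetric])
        then show ?thesis unfolding m0 t1 using True by (simp add: NW_def add_increasing)
      next
        case False
        then have c: "0 < ?c" using cnt_nonneg[of I S D "X 0 D"] by simp
        define B where "B = (\<Sum>i\<in>I. (m (X i D) - ?m0) * nr S (X 0 D) (X i D)) / ?c"
        have "(\<Sum>i\<in>I. g (X i D) * nr S (X 0 D) (X i D)) = (\<Sum>i\<in>I. \<epsilon> (X i D) * nr S (X 0 D) (X i D)) + ((\<Sum>i\<in>I. (m (X i D) - ?m0) * nr S (X 0 D) (X i D)) + ?m0 * ?c)"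
          unfolding cnt_def sum_distrib_left sum.distrib[symmetric] by (intro sum.cong) (auto simp: \<epsilon>_def algebra_simps)
        then have "NW I S D g (X 0 D) = (\<Sum>i\<in>I. \<epsilon> (X i D) * nr S (X 0 D) (X i D)) / ?c + (B + ?m0)"
          unfolding NW_def B_def using c by (simp add: add_divide_distrib)
        moreover have "(\<Sum>i\<in>I. \<epsilon> (X i D) * nr S (X 0 D) (X i D)) / ?c = (\<Sum>i\<in>I. \<xi> i D)"
          by (simp add: \<xi>_def t1 sum_divide_distrib)
        ultimately have eq: "NW I S D g (X 0 D) - ?m0 = (\<Sum>i\<in>I. \<xi> i D) + B" by simp
        have "\<bar>\<Sum>i\<in>I. (m (X i D) - ?m0) * nr S (X 0 D) (X i D)\<bar> \<le> (\<Sum>i\<in>I. (Hc * h powr \<beta>) * nr S (X 0 D) (X i D))"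
        proof (rule order_trans[OF sum_abs sum_mono])
          fix i
          show "\<bar>(m (X i D) - ?m0) * nr S (X 0 D) (X i D)\<bar> \<le> Hc * h powr \<beta> * nr S (X 0 D) (X i D)"
          proof (cases "nr S (X 0 D) (X i D) = 0")
            case False
            then have n1: "nr S (X 0 D) (X i D) = 1" using nr_bounds(3) by blast
            then have d: "sup_dist S (restrict (X i D) S) (restrict (X 0 D) S) \<le> h"
              unfolding sup_dist_restrict by (subst sup_dist_commute) (simp add: nr_def)
            have "\<bar>m (X i D) - ?m0\<bar> \<le> Hc * sup_dist S (restrict (X i D) S) (restrict (X 0 D) S) powr \<beta>"
              unfolding m_def using d h_le by (intro gh restr_space S X_space D) auto
            also have "\<dots> \<le> Hc * h powr \<beta>"
              using d beta_facts Hc sup_dist_nonneg[OF patternD(2)[OF S]] by (intro mult_left_mono powr_mono2) auto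
            finally show ?thesis using n1 by simp
          qed simp
        qed
        also have "\<dots> = Hc * h powr \<beta> * ?c" by (simp add: cnt_def sum_distrib_left)
        finally have "\<bar>B\<bar> \<le> Hc * h powr \<beta>" using c by (simp add: B_def abs_divide pos_divide_le_eq)
        then have "B\<^sup>2 \<le> (Hc * h powr \<beta>)\<^sup>2" using power_mono[of "\<bar>B\<bar>" "Hc * h powr \<beta>" 2] by simp
        moreover have "0 \<le> G\<^sup>2 * ?r D" using c by (simp add: t1)
        moreover have "((\<Sum>i\<in>I. \<xi> i D) + B)\<^sup>2 \<le> 2 * (\<Sum>i\<in>I. \<xi> i D)\<^sup>2 + 2 * B\<^sup>2"
          using zero_le_power2[of "(\<Sum>i\<in>I. \<xi> i D) - B"] by (simp add: power2_sum power2_diff)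
        ultimately show ?thesis unfolding m0 eq t1 by linarith
      qed
    qed
  qed
  also have "\<dots> = 2 * (\<integral>D. (\<Sum>i\<in>I. \<xi> i D)\<^sup>2 \<partial>Q) + (2 * (Hc * h powr \<beta>)\<^sup>2 + G\<^sup>2 * (\<integral>D. ?r D \<partial>Q))"
  proof -
    have 1: "bdm Q (\<lambda>D. 2 * (\<Sum>i\<in>I. \<xi> i D)\<^sup>2)" by (intro bdm_mult bdm_const bdm_power bdm_sum b\<xi>)
    have 2: "bdm Q (\<lambda>D. G\<^sup>2 * ?r D)" by (intro bdm_mult bdm_const r(2))
    show ?thesis
      unfolding Q.bdm_integral_add[OF 1 bdm_add[OF bdm_const 2]] Q.bdm_integral_add[OF bdm_const 2]
      unfolding Bochner_Integration.integral_mult_right_zero by (simp add: Q.prob_space)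
  qed
  also have "\<dots> \<le> 17 * G\<^sup>2 * (\<integral>D. ?r D \<partial>Q) + 2 * (Hc * h powr \<beta>)\<^sup>2" using a by simp
  also have "\<dots> \<le> 17 * G\<^sup>2 * ((4 * T / h) ^ ndim E / (real (card I) + 1)) + 2 * (Hc * h powr \<beta>)\<^sup>2"
    using r(1) by (intro add_right_mono mult_left_mono) auto
  finally show "(\<integral>D. inT S (X 0 D) * (NW I S D g (X 0 D) - condm S g (restrict (X 0 D) S))\<^sup>2 \<partial>Q)
      \<le> 17 * G\<^sup>2 * ((4 * T / h) ^ ndim E / (real (card I) + 1)) + 2 * (Hc * h powr \<beta>)\<^sup>2" .
qed

end

section \<open>Weighted averages on one piece of the data\<close>

lemma frac_mono: "0 < r \<Longrightarrow> 0 \<le> a \<Longrightarrow> a \<le> b \<Longrightarrow> a / (r + a) \<le> b / (r + b)" for a b r :: real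
  using mult_right_mono[of a b r] by (simp add: divide_simps add_pos_nonneg algebra_simps)

context model
begin

lemma average_bounds:
  assumes "finite I" "I \<noteq> {}" "\<And>i. i \<in> I \<Longrightarrow> a \<le> f i" "\<And>i. i \<in> I \<Longrightarrow> f i \<le> b"
  shows "a \<le> average I f" "average I f \<le> b"
proof -
  have k: "0 < real (card I)" using assms by (simp add: card_gt_0_iff)
  have "real (card I) * a \<le> sum f I" "sum f I \<le> real (card I) * b"
    using sum_bounded_below[of I a f] sum_bounded_above[of I f b] assms by auto
  then show "a \<le> average I f" "average I f \<le> b" using k by (simp_all add: average_def pos_le_divide_eq pos_divide_le_eq mult.commute)
qed

lemma rhat_eq: "S \<in> \<S> \<Longrightarrow> rhat E D I S = Rn S * rho_hat I S D"
  unfolding rhat_def rho_hat_def average_def Xfull_eq by (simp add: ratio_eq sum_distrib_left)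

lemma rho_hat_bounds:
  assumes "S \<in> \<S>" "finite I" "I \<noteq> {}" "D \<in> space Q"
  shows "clow K \<le> rho_hat I S D" "rho_hat I S D \<le> cupp K" "0 < rho_hat I S D"
proof -
  show "clow K \<le> rho_hat I S D" "rho_hat I S D \<le> cupp K"
    unfolding rho_hat_def
    using average_bounds[OF assms(2,3), of "clow K" "\<lambda>i. rbar E S (restrict (X i D) S)" "cupp K"]
      rbar_bounds[OF assms(1) restr_space[OF assms(1) X_space[OF assms(4)]]] by auto
  then show "0 < rho_hat I S D" using c_pos by simp
qed

lemma rbar_X_bdm: "S \<in> \<S> \<Longrightarrow> bdm Q (\<lambda>D. rbar E S (restrict (X i D) S))"
  by (rule bdm_comp[OF rbar_bdm measurable_compose[OF X_measurable restr_measurable]])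

lemma rho_hat_bdm: "S \<in> \<S> \<Longrightarrow> bdm Q (rho_hat I S)"
  unfolding rho_hat_def average_def by (intro bdm_divide_const bdm_sum rbar_X_bdm)

lemma what_eq: "S \<in> \<S> \<Longrightarrow> what E D I S u = lam E S * rbar E S u / (rho_hat I S D + lam E S * rbar E S u)"
proof -
  assume S: "S \<in> \<S>"
  have "what E D I S u = Rn S * (lam E S * rbar E S u) / (Rn S * (rho_hat I S D + lam E S * rbar E S u))"
    unfolding what_def rhat_eq[OF S] ratio_eq[OF S] by (simp add: algebra_simps)
  then show ?thesis using Rn_pos[OF S] by simp
qed

lemma what_bounds:
  assumes "S \<in> \<S>" "finite I" "I \<noteq> {}" "D \<in> space Q" "u \<in> space (leb S)"
  shows "0 < what E D I S u" "what E D I S u \<le> 1"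
  using rho_hat_bounds[OF assms(1-4)] rbar_pos[OF assms(1,5)] lam_pos[OF assms(1)]
  by (simp_all add: what_eq[OF assms(1)] add_pos_pos)

text \<open>The weights vary by at most the factor \<open>\<rho>\<close>, uniformly in
  \<open>lam\<close>, so weighted averages are comparable with plain ones even when all weights are
  tiny.\<close>

lemma what_ratio:
  assumes "S \<in> \<S>" "finite I" "I \<noteq> {}" "D \<in> space Q" "u \<in> space (leb S)" "u' \<in> space (leb S)"
  shows "what E D I S u \<le> \<rho> * what E D I S u'"
proof -
  define r a a' where "r = rho_hat I S D" and "a = lam E S * rbar E S u" and "a' = lam E S * rbar E S u'"
  have r: "0 < r" using rho_hat_bounds[OF assms(1-4)] by (simp add: r_def)
  have l: "0 < lam E S" by (rule lam_pos[OF assms(1)])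
  have a: "0 < a" "0 < a'" using l rbar_pos[OF assms(1)] assms by (simp_all add: a_def a'_def)
  have w: "what E D I S u = a / (r + a)" "what E D I S u' = a' / (r + a')"
    by (simp_all add: what_eq[OF assms(1)] r_def a_def a'_def)
  show ?thesis
  proof (cases "a \<le> a'")
    case True
    have "a / (r + a) \<le> 1 * (a' / (r + a'))" using frac_mono[OF r _ True] a by simp
    also have "\<dots> \<le> \<rho> * (a' / (r + a'))" using rho_facts a r by (intro mult_right_mono) auto
    finally show ?thesis unfolding w .
  next
    case False
    have "rbar E S u * clow K \<le> cupp K * rbar E S u'"
      using rbar_bounds[OF assms(1)] assms c_pos rbar_pos[OF assms(1)] c_le_C by (intro mult_mono) (auto intro: less_imp_le order_trans[of 0 "clow K"])
    then have "rbar E S u \<le> \<rho> * rbar E S u'" using c_pos by (simp add: \<rho>_def field_simps)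
    then have "a \<le> \<rho> * a'" using l by (simp add: a_def a'_def mult.left_commute)
    moreover have "r + a' \<le> r + a" using False by simp
    ultimately have "a / (r + a) \<le> (\<rho> * a') / (r + a')" using r a by (intro frac_le) auto
    then show ?thesis unfolding w by simp
  qed
qed

text \<open>The error is stated relative to the weight: division by the sum of the weights then
  leaves \<open>\<bar>rho_hat I S D - 1\<bar>\<close>, whatever \<open>lam\<close> is.\<close>

lemma what_w_diff:
  assumes "S \<in> \<S>" "finite I" "I \<noteq> {}" "D \<in> space Q" "u \<in> space (leb S)"
  shows "\<bar>what E D I S u - w S u\<bar> \<le> \<bar>rho_hat I S D - 1\<bar> * what E D I S u"
proof -
  define r a where "r = rho_hat I S D" and "a = lam E S * rbar E S u"
  have r: "0 < r" using rho_hat_bounds[OF assms(1-4)] by (simp add: r_def)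
  have a: "0 < a" using lam_pos[OF assms(1)] rbar_pos[OF assms(1,5)] by (simp add: a_def)
  have "a / (r + a) - a / (1 + a) = (1 - r) * (a / (r + a)) * (1 / (1 + a))"
    using r a by (simp add: divide_simps) (simp add: algebra_simps)
  then have "\<bar>a / (r + a) - a / (1 + a)\<bar> = (\<bar>r - 1\<bar> * (a / (r + a))) * (1 / (1 + a))"
    using r a by (simp add: abs_mult abs_divide abs_minus_commute)
  also have "\<dots> \<le> (\<bar>r - 1\<bar> * (a / (r + a))) * 1"
    using r a by (intro mult_left_mono) auto
  finally show ?thesis by (simp add: what_eq[OF assms(1)] w_def r_def a_def)
qed

lemma what_X_bdm:
  assumes "S \<in> \<S>" "finite I" "I \<noteq> {}"
  shows "bdm Q (\<lambda>D. what E D I S (restrict (X i D) S))"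
proof (rule bdmI[where B=1])
  have [measurable]: "(\<lambda>D. rbar E S (restrict (X i D) S)) \<in> borel_measurable Q" "rho_hat I S \<in> borel_measurable Q"
    by (rule bdm_measurable[OF rbar_X_bdm[OF assms(1)]], rule bdm_measurable[OF rho_hat_bdm[OF assms(1)]])
  show "(\<lambda>D. what E D I S (restrict (X i D) S)) \<in> borel_measurable Q"
    unfolding what_eq[OF assms(1)] by measurable
  fix D assume D: "D \<in> space Q"
  show "\<bar>what E D I S (restrict (X i D) S)\<bar> \<le> 1"
    using what_bounds[OF assms D restr_space[OF assms(1) X_space[OF D, of i]]] by simp
qed

lemma sum_what_pos:
  assumes "S \<in> \<S>" "finite I" "I \<noteq> {}" "D \<in> space Q"
  shows "0 < (\<Sum>i\<in>I. what E D I S (restrict (X i D) S))"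
  using assms by (intro sum_pos what_bounds restr_space X_space) auto

text \<open>Jensen's inequality for the normalised weights, each of which is at most
  \<open>\<rho> / card I\<close> by \<open>what_ratio\<close>.\<close>

lemma Wav_square_le:
  assumes S: "S \<in> \<S>" and I: "finite I" "I \<noteq> {}" and D: "D \<in> space Q"
  shows "(Wav I S D q)\<^sup>2 \<le> \<rho> * average I (\<lambda>i. (q (X i D))\<^sup>2)"
proof -
  let ?w = "\<lambda>i. what E D I S (restrict (X i D) S)"
  have sp: "restrict (X i D) S \<in> space (leb S)" for i by (intro restr_space S X_space D)
  have W: "0 < (\<Sum>i\<in>I. ?w i)" by (rule sum_what_pos[OF S I D])
  have k: "0 < real (card I)" using I by (simp add: card_gt_0_iff)
  have "(Wav I S D q)\<^sup>2 = ((\<Sum>i\<in>I. q (X i D) * ?w i) / (\<Sum>i\<in>I. ?w i))\<^sup>2"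
    unfolding Wav_def by (simp add: mult.commute)
  also have "\<dots> \<le> (\<Sum>i\<in>I. (q (X i D))\<^sup>2 * ?w i) / (\<Sum>i\<in>I. ?w i)"
    by (rule weighted_jensen) (use what_bounds[OF S I D sp] in \<open>simp add: less_imp_le\<close>)
  also have "\<dots> = (\<Sum>i\<in>I. (q (X i D))\<^sup>2 * (?w i / (\<Sum>i\<in>I. ?w i)))" by (simp add: sum_divide_distrib)
  also have "\<dots> \<le> (\<Sum>i\<in>I. (q (X i D))\<^sup>2 * (\<rho> / card I))"
  proof (intro sum_mono mult_left_mono)
    fix i
    have "(\<Sum>j\<in>I. ?w i) \<le> (\<Sum>j\<in>I. \<rho> * ?w j)" by (intro sum_mono what_ratio S I D sp)
    then have "card I * ?w i \<le> \<rho> * (\<Sum>j\<in>I. ?w j)" by (simp add: sum_distrib_left)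
    then show "?w i / (\<Sum>i\<in>I. ?w i) \<le> \<rho> / card I" using W k by (simp add: field_simps)
  qed simp
  also have "\<dots> = \<rho> * average I (\<lambda>i. (q (X i D))\<^sup>2)"
    unfolding sum_distrib_right[symmetric] by (simp add: average_def)
  finally show ?thesis .
qed

lemma integral_swap_point:
  assumes \<phi>: "bdm (Q \<Otimes>\<^sub>M leb (coords E)) (\<lambda>(D, x). \<phi> D x)"
    and "i \<noteq> 0" "\<And>D. D \<in> space Q \<Longrightarrow> \<phi> (swp i D) = \<phi> D"
  shows "(\<integral>D. \<phi> D (X i D) \<partial>Q) = (\<integral>D. \<phi> D (X 0 D) \<partial>Q)"
proof -
  have "(\<integral>D. \<phi> D (X i D) \<partial>Q) = (\<integral>D. \<phi> (swp i D) (X i (swp i D)) \<partial>Q)"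
    by (rule integral_swap[OF bdm_joint_X[OF \<phi>]]) simp
  also have "\<dots> = (\<integral>D. \<phi> D (X 0 D) \<partial>Q)"
    by (rule Bochner_Integration.integral_cong[OF refl]) (use assms in simp)
  finally show ?thesis .
qed

lemma Wav_bdm:
  assumes S: "S \<in> \<S>" and I: "finite I" "I \<noteq> {}"
    and q: "bdm (Q \<Otimes>\<^sub>M leb (coords E)) (\<lambda>(D, x). q D x)"
  shows "bdm Q (\<lambda>D. Wav I S D (q D))"
proof -
  have [measurable]: "(\<lambda>D. what E D I S (restrict (X i D) S)) \<in> borel_measurable Q" for i
    by (rule bdm_measurable[OF what_X_bdm[OF S I]])
  have [measurable]: "(\<lambda>D. q D (X i D)) \<in> borel_measurable Q" for i by (rule bdm_measurable[OF bdm_joint_X[OF q]])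
  obtain B where B: "0 \<le> B" "\<And>z. z \<in> space (Q \<Otimes>\<^sub>M leb (coords E)) \<Longrightarrow> \<bar>(\<lambda>(D, x). q D x) z\<bar> \<le> B"
    using bdmE[OF q] by blast
  show ?thesis
  proof (rule bdmI)
    show "(\<lambda>D. Wav I S D (q D)) \<in> borel_measurable Q" unfolding Wav_def by measurable
    fix D assume D: "D \<in> space Q"
    have W: "0 < (\<Sum>i\<in>I. what E D I S (restrict (X i D) S))" by (rule sum_what_pos[OF S I D])
    have "\<bar>\<Sum>i\<in>I. what E D I S (restrict (X i D) S) * q D (X i D)\<bar> \<le> (\<Sum>i\<in>I. what E D I S (restrict (X i D) S) * B)"
    proof (rule order_trans[OF sum_abs sum_mono])
      fix i
      have "\<bar>q D (X i D)\<bar> \<le> B" using B(2)[of "(D, X i D)"] D X_space[OF D] by (simp add: space_pair_measure)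
      then show "\<bar>what E D I S (restrict (X i D) S) * q D (X i D)\<bar> \<le> what E D I S (restrict (X i D) S) * B"
        using what_bounds(1)[OF S I D restr_space[OF S X_space[OF D, of i]]] by (simp add: abs_mult)
    qed
    also have "\<dots> = B * (\<Sum>i\<in>I. what E D I S (restrict (X i D) S))" by (simp add: sum_distrib_left mult.commute)
    finally show "\<bar>Wav I S D (q D)\<bar> \<le> B" unfolding Wav_def using W by (simp add: abs_divide pos_divide_le_eq)
  qed
qed

lemma bdm_fixed: "bdm (leb (coords E)) g \<Longrightarrow> bdm (Q \<Otimes>\<^sub>M leb (coords E)) (\<lambda>(D, x). g x)"
  using bdm_comp[OF _ measurable_snd, of "leb (coords E)" g Q] by (simp add: case_prod_unfold)

text \<open>The counterpart of \<open>stone\<close> for the global average: each observation of the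
  piece is exchanged with the test point, on which \<open>q\<close> does not depend.\<close>

lemma Wav_expectation:
  assumes S: "S \<in> \<S>" and I: "finite I" "I \<noteq> {}" "0 \<notin> I"
    and q: "bdm (Q \<Otimes>\<^sub>M leb (coords E)) (\<lambda>(D, x). q D x)"
    and inv: "\<And>D i. D \<in> space Q \<Longrightarrow> i \<in> I \<Longrightarrow> q (swp i D) = q D"
  shows "(\<integral>D. (Wav I S D (q D))\<^sup>2 \<partial>Q) \<le> \<rho> * (\<integral>D. (q D (X 0 D))\<^sup>2 \<partial>Q)"
proof -
  have q2: "bdm (Q \<Otimes>\<^sub>M leb (coords E)) (\<lambda>(D, x). (q D x)\<^sup>2)"
    using bdm_power[OF q, of 2] by (simp add: case_prod_unfold)
  have b: "bdm Q (\<lambda>D. (q D (X i D))\<^sup>2)" for i by (intro bdm_power bdm_joint_X q)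
  have "(\<integral>D. (Wav I S D (q D))\<^sup>2 \<partial>Q) \<le> (\<integral>D. \<rho> * average I (\<lambda>i. (q D (X i D))\<^sup>2) \<partial>Q)"
    by (intro Q.bdm_integral_le bdm_power Wav_bdm S I q Wav_square_le) (auto simp: average_def intro!: bdm_mult bdm_const bdm_divide_const bdm_sum b)
  also have "\<dots> = \<rho> * ((\<Sum>i\<in>I. \<integral>D. (q D (X i D))\<^sup>2 \<partial>Q) / card I)"
    by (simp add: average_def Q.bdm_integral_sum[OF b])
  also have "(\<Sum>i\<in>I. \<integral>D. (q D (X i D))\<^sup>2 \<partial>Q) = (\<Sum>i\<in>I. \<integral>D. (q D (X 0 D))\<^sup>2 \<partial>Q)"
  proof (rule sum.cong[OF refl])
    fix i assume i: "i \<in> I"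
    have "i \<noteq> 0" using i I by metis
    then show "(\<integral>D. (q D (X i D))\<^sup>2 \<partial>Q) = (\<integral>D. (q D (X 0 D))\<^sup>2 \<partial>Q)"
      by (rule integral_swap_point[OF q2]) (use inv i in simp)
  qed
  also have "\<rho> * (\<dots> / card I) = \<rho> * (\<integral>D. (q D (X 0 D))\<^sup>2 \<partial>Q)" using I by simp
  finally show ?thesis .
qed

lemma average_centred:
  assumes I: "finite I" "I \<noteq> {}" and g: "bdm (leb (coords E)) g" "(\<integral>x. g x \<partial>P) = 0"
  shows "(\<integral>D. (average I (\<lambda>i. g (X i D)))\<^sup>2 \<partial>Q) = (\<integral>x. (g x)\<^sup>2 \<partial>P) / card I"
proof -
  have "(\<integral>D. (\<Sum>i\<in>I. g (X i D))\<^sup>2 \<partial>Q) = (\<Sum>i\<in>I. \<integral>D. (g (X i D))\<^sup>2 \<partial>Q)"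
    by (rule centred_sum_coords[where idx=Inl]) (use I g in \<open>auto intro!: bdm_fixed_X\<close>)
  also have "\<dots> = card I * (\<integral>x. (g x)\<^sup>2 \<partial>P)"
    using integral_X[of "\<lambda>x. (g x)\<^sup>2"] bdm_measurable[OF bdm_power[OF g(1)]] by simp
  finally show ?thesis using I by (simp add: average_def power_divide power2_eq_square)
qed

text \<open>Since \<open>rbar\<close> has mean 1 and is at most \<open>cupp K\<close>, its second
  moment is at most \<open>cupp K\<close>; the bound is linear in \<open>cupp K\<close>.\<close>

lemma rho_hat_variance:
  assumes S: "S \<in> \<S>" and I: "finite I" "I \<noteq> {}"
  shows "(\<integral>D. (rho_hat I S D - 1)\<^sup>2 \<partial>Q) \<le> cupp K / card I"
    and "bdm Q (\<lambda>D. (rho_hat I S D - 1)\<^sup>2)"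
proof -
  define g where "g = (\<lambda>x. rbar E S (restrict x S) - 1)"
  have br: "bdm (leb (coords E)) (\<lambda>x. rbar E S (restrict x S))" by (rule bdm_comp[OF rbar_bdm[OF S] restr_measurable[OF S]])
  then have brP: "bdm P (\<lambda>x. rbar E S (restrict x S))" by (simp add: bdm_law)
  have g: "bdm (leb (coords E)) g" unfolding g_def by (intro bdm_diff br bdm_const)
  have g0: "(\<integral>x. g x \<partial>P) = 0"
    unfolding g_def P.bdm_integral_diff[OF brP bdm_const] by (simp add: integral_rbar[OF S])
  have k: "real (card I) \<noteq> 0" using I by simp
  have eq: "rho_hat I S D - 1 = average I (\<lambda>i. g (X i D))" for D
    using k by (simp add: rho_hat_def average_def g_def sum_subtractf diff_divide_distrib)
  show "bdm Q (\<lambda>D. (rho_hat I S D - 1)\<^sup>2)" by (intro bdm_power bdm_diff rho_hat_bdm S bdm_const)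
  have "(\<integral>x. (g x)\<^sup>2 \<partial>P) \<le> (\<integral>x. (cupp K - 2) * rbar E S (restrict x S) + 1 \<partial>P)"
  proof (rule P.bdm_integral_le)
    show "bdm P (\<lambda>x. (g x)\<^sup>2)" using bdm_power[OF g] by (simp add: bdm_law)
    show "bdm P (\<lambda>x. (cupp K - 2) * rbar E S (restrict x S) + 1)" by (intro bdm_add bdm_mult bdm_const brP)
    fix x assume "x \<in> space P"
    then have x: "restrict x S \<in> space (leb S)" using restr_space[OF S] by simp
    have "rbar E S (restrict x S) * rbar E S (restrict x S) \<le> cupp K * rbar E S (restrict x S)"
      using rbar_bounds(2)[OF S x] rbar_pos[OF S x] by (intro mult_right_mono) auto
    then show "(g x)\<^sup>2 \<le> (cupp K - 2) * rbar E S (restrict x S) + 1"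
      by (simp add: g_def power2_eq_square algebra_simps)
  qed
  also have "\<dots> = cupp K - 1"
    unfolding P.bdm_integral_add[OF bdm_mult[OF bdm_const brP] bdm_const] by (simp add: integral_rbar[OF S])
  finally have "(\<integral>x. (g x)\<^sup>2 \<partial>P) \<le> cupp K" by simp
  then show "(\<integral>D. (rho_hat I S D - 1)\<^sup>2 \<partial>Q) \<le> cupp K / card I"
    unfolding eq average_centred[OF I g g0] by (rule divide_right_mono) simp
qed

text \<open>First the average is compared with \<open>s0\<close>, its error under the population
  weights, which costs the relative error of \<open>rho_hat\<close>; then \<open>s0\<close> is a
  ratio whose numerator is a centred average. Numerator and denominator scale with the lower bound
  \<open>wl\<close> of the weights, which cancels. The constant is
  \<open>40 = 8 + 32\<close>.\<close>

lemma Wav_error: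
  assumes S: "S \<in> \<S>" and I: "finite I" "I \<noteq> {}"
    and g: "bdm (leb (coords E)) g" "\<And>x. x \<in> space (leb (coords E)) \<Longrightarrow> \<bar>g x\<bar> \<le> G"
  shows "(\<integral>D. (Wav I S D g - mu S g)\<^sup>2 \<partial>Q) \<le> 40 * G\<^sup>2 * \<rho>\<^sup>2 / card I"
    and "bdm Q (\<lambda>D. (Wav I S D g - mu S g)\<^sup>2)"
proof -
  have k: "0 < real (card I)" using I by (simp add: card_gt_0_iff)
  define wl where "wl = lam E S * clow K / (1 + lam E S * clow K)"
  define \<mu> where "\<mu> = mu S g"
  define \<zeta> where "\<zeta> = (\<lambda>x. w S (restrict x S) * (g x - \<mu>))"
  have G0: "0 \<le> G" using g(2)[OF X_space[of _ 0]] Q.not_empty by (meson abs_ge_zero all_not_in_conv order_trans)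
  have lp: "0 < lam E S" by (rule lam_pos[OF S])
  have wl: "0 < wl" using lp c_pos by (simp add: wl_def add_pos_pos)
  have wb: "wl \<le> w S u \<and> w S u \<le> \<rho> * wl" if u: "u \<in> space (leb S)" for u
  proof
    have l: "lam E S * clow K \<le> lam E S * rbar E S u" using rbar_bounds(1)[OF S u] lp by simp
    have p: "0 < lam E S * clow K" using lp c_pos by simp
    show "wl \<le> w S u" unfolding wl_def w_def using p l by (intro frac_mono) auto
    have "lam E S * rbar E S u \<le> \<rho> * (lam E S * clow K)"
      using rbar_bounds(2)[OF S u] lp c_pos by (simp add: \<rho>_def)
    then have "lam E S * rbar E S u / (1 + lam E S * rbar E S u) \<le> \<rho> * (lam E S * clow K) / (1 + lam E S * clow K)"
      using p l rho_facts by (intro frac_le) auto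
    then show "w S u \<le> \<rho> * wl" by (simp add: w_def wl_def)
  qed
  have bw: "bdm (leb (coords E)) (\<lambda>x. w S (restrict x S))" by (rule bdm_comp[OF w_bdm[OF S] restr_measurable[OF S]])
  have b\<zeta>: "bdm (leb (coords E)) \<zeta>" unfolding \<zeta>_def by (intro bdm_mult bw bdm_diff g bdm_const)
  have \<zeta>0: "(\<integral>x. \<zeta> x \<partial>P) = 0"
  proof -
    have "(\<integral>x. \<zeta> x \<partial>P) = (\<integral>x. w S (restrict x S) * g x - w S (restrict x S) * \<mu> \<partial>P)"
      by (simp add: \<zeta>_def right_diff_distrib)
    also have "\<dots> = (\<integral>x. w S (restrict x S) * g x \<partial>P) - (\<integral>x. w S (restrict x S) * \<mu> \<partial>P)"
      by (intro P.bdm_integral_diff bdm_mult bdm_const) (use bw g(1) in \<open>simp_all add: bdm_law\<close>)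
    also have "\<dots> = 0" using integral_w_pos[OF S] by (simp add: \<mu>_def mu_def)
    finally show ?thesis .
  qed
  have g\<mu>: "\<bar>g x - \<mu>\<bar> \<le> 2 * G" if "x \<in> space (leb (coords E))" for x
    using g(2)[OF that] mu_bound[OF S g] unfolding \<mu>_def by linarith
  have \<zeta>2: "(\<integral>x. (\<zeta> x)\<^sup>2 \<partial>P) \<le> (\<rho> * wl * (2 * G))\<^sup>2"
  proof (rule P.integral_le_const_bdm)
    show "bdm P (\<lambda>x. (\<zeta> x)\<^sup>2)" using bdm_power[OF b\<zeta>] by (simp add: bdm_law)
    fix x assume "x \<in> space P"
    then have x: "x \<in> space (leb (coords E))" by simp
    have "\<bar>\<zeta> x\<bar> \<le> (\<rho> * wl) * (2 * G)"
      unfolding \<zeta>_def abs_mult using wb[OF restr_space[OF S x]] wl rho_facts by (intro mult_mono g\<mu> x) auto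
    then show "(\<zeta> x)\<^sup>2 \<le> (\<rho> * wl * (2 * G))\<^sup>2" using power_mono[of "\<bar>\<zeta> x\<bar>" "\<rho> * wl * (2 * G)" 2] by simp
  qed
  let ?V = "\<lambda>D. 8 * G\<^sup>2"
  have b1: "bdm Q (\<lambda>D. (average I (\<lambda>i. \<zeta> (X i D)))\<^sup>2)"
    unfolding average_def by (intro bdm_power bdm_divide_const bdm_sum bdm_fixed_X b\<zeta>)
  note rv = rho_hat_variance[OF S I]
  show bL: "bdm Q (\<lambda>D. (Wav I S D g - mu S g)\<^sup>2)"
    by (intro bdm_power bdm_diff bdm_const Wav_bdm[OF S I bdm_fixed[OF g(1)]])
  have "(\<integral>D. (Wav I S D g - mu S g)\<^sup>2 \<partial>Q) \<le> (\<integral>D. 2 / wl\<^sup>2 * (average I (\<lambda>i. \<zeta> (X i D)))\<^sup>2 + 32 * G\<^sup>2 * (rho_hat I S D - 1)\<^sup>2 \<partial>Q)"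
  proof (rule Q.bdm_integral_le[OF bL])
    show "bdm Q (\<lambda>D. 2 / wl\<^sup>2 * (average I (\<lambda>i. \<zeta> (X i D)))\<^sup>2 + 32 * G\<^sup>2 * (rho_hat I S D - 1)\<^sup>2)"
      by (intro bdm_add bdm_mult bdm_const b1 rv)
    fix D assume D: "D \<in> space Q"
    have sp: "restrict (X i D) S \<in> space (leb S)" for i by (intro restr_space S X_space D)
    let ?h = "\<lambda>i. what E D I S (restrict (X i D) S)" and ?w = "\<lambda>i. w S (restrict (X i D) S)"
    define s0 where "s0 = (\<Sum>i\<in>I. \<zeta> (X i D)) / (\<Sum>i\<in>I. ?w i)"
    have W: "0 < (\<Sum>i\<in>I. ?h i)" by (rule sum_what_pos[OF S I D])
    have w0: "card I * wl \<le> (\<Sum>i\<in>I. ?w i)" using sum_bounded_below[of I wl ?w] wb[OF sp] by simp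
    then have w1: "0 < (\<Sum>i\<in>I. ?w i)" using mult_pos_pos[OF k wl] by linarith
    have "\<bar>\<Sum>i\<in>I. \<zeta> (X i D)\<bar> \<le> (\<Sum>i\<in>I. ?w i * (2 * G))"
      using w_bounds[OF S sp] g\<mu>[OF X_space[OF D]]
      by (intro order_trans[OF sum_abs sum_mono]) (simp add: \<zeta>_def abs_mult mult_left_mono less_imp_le)
    also have "\<dots> = 2 * G * (\<Sum>i\<in>I. ?w i)" unfolding sum_distrib_right[symmetric] by simp
    finally have s0: "\<bar>s0\<bar> \<le> 2 * G"
      unfolding s0_def using w1 by (simp add: abs_divide pos_divide_le_eq)
    have "Wav I S D g - \<mu> - s0 = (\<Sum>i\<in>I. ?h i * (g (X i D) - \<mu> - s0)) / (\<Sum>i\<in>I. ?h i)"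
      unfolding Wav_def using W
      by (simp add: right_diff_distrib sum_subtractf diff_divide_distrib flip: sum_distrib_right)
    \<comment> \<open>By the choice of \<open>s0\<close> the deviations sum to zero under the
      population weights, so these may be subtracted from the estimated ones.\<close>
    also have "(\<Sum>i\<in>I. ?h i * (g (X i D) - \<mu> - s0)) = (\<Sum>i\<in>I. (?h i - ?w i) * (g (X i D) - \<mu> - s0))"
    proof -
      have "(\<Sum>i\<in>I. ?w i * (g (X i D) - \<mu> - s0)) = (\<Sum>i\<in>I. \<zeta> (X i D) - ?w i * s0)"
        by (intro sum.cong) (auto simp: \<zeta>_def right_diff_distrib)
      also have "\<dots> = (\<Sum>i\<in>I. \<zeta> (X i D)) - (\<Sum>i\<in>I. ?w i) * s0"
        by (simp add: sum_subtractf flip: sum_distrib_right)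
      also have "\<dots> = 0" using w1 by (simp add: s0_def)
      finally show ?thesis by (simp add: left_diff_distrib sum_subtractf)
    qed
    finally have e: "Wav I S D g - \<mu> - s0 = (\<Sum>i\<in>I. (?h i - ?w i) * (g (X i D) - \<mu> - s0)) / (\<Sum>i\<in>I. ?h i)" .
    have "\<bar>\<Sum>i\<in>I. (?h i - ?w i) * (g (X i D) - \<mu> - s0)\<bar> \<le> (\<Sum>i\<in>I. (\<bar>rho_hat I S D - 1\<bar> * ?h i) * (4 * G))"
    proof (rule order_trans[OF sum_abs sum_mono])
      fix i
      have "\<bar>g (X i D) - \<mu> - s0\<bar> \<le> 4 * G" using g\<mu>[OF X_space[OF D, of i]] s0 by linarith
      then show "\<bar>(?h i - ?w i) * (g (X i D) - \<mu> - s0)\<bar> \<le> (\<bar>rho_hat I S D - 1\<bar> * ?h i) * (4 * G)"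
        unfolding abs_mult using what_w_diff[OF S I D sp] what_bounds(1)[OF S I D sp, of i]
        by (intro mult_mono) (auto simp: less_imp_le)
    qed
    also have "\<dots> = \<bar>rho_hat I S D - 1\<bar> * (4 * G) * (\<Sum>i\<in>I. ?h i)"
      by (simp add: sum_distrib_left mult.assoc mult.left_commute mult.commute)
    finally have "\<bar>Wav I S D g - \<mu> - s0\<bar> \<le> \<bar>rho_hat I S D - 1\<bar> * (4 * G)"
      unfolding e using W by (simp add: abs_divide pos_divide_le_eq)
    then have 1: "(Wav I S D g - \<mu> - s0)\<^sup>2 \<le> 16 * G\<^sup>2 * (rho_hat I S D - 1)\<^sup>2"
      using power_mono[of "\<bar>Wav I S D g - \<mu> - s0\<bar>" "\<bar>rho_hat I S D - 1\<bar> * (4 * G)" 2] by (simp add: power_mult_distrib mult.commute)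
    have "\<bar>s0\<bar> \<le> \<bar>\<Sum>i\<in>I. \<zeta> (X i D)\<bar> / (card I * wl)"
      unfolding s0_def abs_divide using w0 w1 mult_pos_pos[OF k wl] by (intro divide_left_mono) auto
    also have "\<dots> = \<bar>average I (\<lambda>i. \<zeta> (X i D))\<bar> / wl" by (simp add: average_def abs_divide)
    finally have "s0\<^sup>2 \<le> (average I (\<lambda>i. \<zeta> (X i D)))\<^sup>2 / wl\<^sup>2"
      using power_mono[of "\<bar>s0\<bar>" "\<bar>average I (\<lambda>i. \<zeta> (X i D))\<bar> / wl" 2] by (simp add: power_divide)
    moreover have "(Wav I S D g - \<mu>)\<^sup>2 \<le> 2 * s0\<^sup>2 + 2 * (Wav I S D g - \<mu> - s0)\<^sup>2"
      using zero_le_power2[of "s0 - (Wav I S D g - \<mu> - s0)"] by (simp add: power2_eq_square algebra_simps)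
    ultimately show "(Wav I S D g - mu S g)\<^sup>2 \<le> 2 / wl\<^sup>2 * (average I (\<lambda>i. \<zeta> (X i D)))\<^sup>2 + 32 * G\<^sup>2 * (rho_hat I S D - 1)\<^sup>2"
      using 1 unfolding \<mu>_def by simp
  qed
  also have "\<dots> = 2 / wl\<^sup>2 * ((\<integral>x. (\<zeta> x)\<^sup>2 \<partial>P) / card I) + 32 * G\<^sup>2 * (\<integral>D. (rho_hat I S D - 1)\<^sup>2 \<partial>Q)"
    unfolding Q.bdm_integral_add[OF bdm_mult[OF bdm_const b1] bdm_mult[OF bdm_const rv(2)]]
    by (simp add: average_centred[OF I b\<zeta> \<zeta>0])
  also have "\<dots> \<le> 2 / wl\<^sup>2 * ((\<rho> * wl * (2 * G))\<^sup>2 / card I) + 32 * G\<^sup>2 * (cupp K / card I)"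
    using \<zeta>2 rv(1) by (intro add_mono mult_left_mono divide_right_mono) auto
  also have "\<dots> = 8 * G\<^sup>2 * \<rho>\<^sup>2 / card I + 32 * G\<^sup>2 * cupp K / card I"
    using wl by (simp add: power_mult_distrib)
  also have "\<dots> \<le> 8 * G\<^sup>2 * \<rho>\<^sup>2 / card I + 32 * G\<^sup>2 * \<rho>\<^sup>2 / card I"
  proof -
    have "cupp K \<le> \<rho>\<^sup>2" using rho_facts self_le_power[of \<rho> 2] by simp
    then show ?thesis by (intro add_left_mono divide_right_mono mult_left_mono) auto
  qed
  finally show "(\<integral>D. (Wav I S D g - mu S g)\<^sup>2 \<partial>Q) \<le> 40 * G\<^sup>2 * \<rho>\<^sup>2 / card I"
    by (simp add: add_divide_distrib[symmetric] distrib_right[symmetric])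
qed

end

section \<open>Error of the cross-fitted iterates\<close>

context model
begin

abbreviation "ah l m \<equiv> (\<lambda>S D u. alpha_hat E D l m S u)"

lemma half_facts:
  assumes "l \<in> {1, 2}"
  shows "half E l \<subseteq> {1..n}" "n \<le> 2 * card (half E l) + 1" "finite (half E l)" "half E l \<noteq> {}" "0 \<notin> half E l"
    "nsteps E \<le> card (half E l)"
proof -
  define c where "c = nat \<lceil>real n / 2\<rceil>"
  have c: "n \<le> 2 * c" "2 * c \<le> n + 1" "c \<le> n" unfolding c_def using n_pos by linarith+
  show 1: "half E l \<subseteq> {1..n}" using assms c by (auto simp: half_def c_def[symmetric])
  show 2: "n \<le> 2 * card (half E l) + 1" using assms c by (auto simp: half_def c_def[symmetric])
  show "finite (half E l)" using 1 by (rule finite_subset) simp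
  show "0 \<notin> half E l" using 1 by auto
  show 3: "nsteps E \<le> card (half E l)" using 2 nsteps_le by linarith
  show "half E l \<noteq> {}" using 3 nsteps_pos by auto
qed

lemma half_partition: "half E 1 \<union> half E 2 = {1..n}" "half E 1 \<inter> half E 2 = {}" "card (half E 1) + card (half E 2) = n"
proof -
  define c where "c = nat \<lceil>real n / 2\<rceil>"
  have c: "c \<le> n" unfolding c_def using n_pos by linarith
  have e: "half E 1 = {1..c}" "half E 2 = {c + 1..n}" by (auto simp: half_def c_def)
  show "half E 1 \<union> half E 2 = {1..n}" "half E 1 \<inter> half E 2 = {}" "card (half E 1) + card (half E 2) = n"
    unfolding e using c by auto
qed

text \<open>The other pieces exceed this one by at most 1, hence \<open>card (half E l) + 1\<close>
  is at most \<open>nsteps E\<close> times \<open>card + 1\<close>. The bound on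
  \<open>card + 1\<close> suits denominators that include the test point; the other needs nonempty
  pieces, which the size of the half guarantees.\<close>

lemma piece_facts:
  assumes l: "l \<in> {1, 2}" and m: "m \<in> {1..nsteps E}"
  shows "piece E l m \<subseteq> half E l" "finite (piece E l m)" "piece E l m \<noteq> {}" "0 \<notin> piece E l m"
    "real n / (2 * real (nsteps E)) \<le> real (card (piece E l m)) + 1" "real n / (4 * real (nsteps E)) \<le> real (card (piece E l m))"
proof -
  let ?M = "nsteps E" and ?k = "card (piece E l m)"
  show 1: "piece E l m \<subseteq> half E l" using pieces(2)[OF l] m by blast
  show fin: "finite (piece E l m)" using 1 half_facts(3)[OF l] by (rule finite_subset)
  show "0 \<notin> piece E l m" using 1 half_facts(5)[OF l] by blast
  have fin': "\<forall>m'\<in>{1..?M}. finite (piece E l m')"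
    using pieces(2)[OF l] half_facts(3)[OF l] by (metis UN_upper finite_subset)
  have "card (half E l) = (\<Sum>m'\<in>{1..?M}. card (piece E l m'))"
    unfolding pieces(2)[OF l, symmetric] using pieces(1)[OF l] fin' by (intro card_UN_disjoint') auto
  also have "\<dots> = ?k + (\<Sum>m'\<in>{1..?M} - {m}. card (piece E l m'))" using m by (intro sum.remove) auto
  also have "\<dots> \<le> ?k + (\<Sum>m'\<in>{1..?M} - {m}. ?k + 1)" using pieces(3)[OF l _ m] by (intro add_left_mono sum_mono) auto
  also have "\<dots> = ?k + (?M - 1) * (?k + 1)" using m by simp
  finally have "card (half E l) + 1 \<le> 1 * (?k + 1) + (?M - 1) * (?k + 1)" by simp
  also have "\<dots> = ?M * (?k + 1)" using nsteps_pos unfolding add_mult_distrib[symmetric] by simp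
  finally have h: "card (half E l) + 1 \<le> ?M * (?k + 1)" .
  have k: "1 \<le> ?k"
  proof (rule ccontr)
    assume "\<not> 1 \<le> ?k"
    then have "?k = 0" by simp
    with h half_facts(6)[OF l] show False by simp
  qed
  then show "piece E l m \<noteq> {}" by auto
  have "n \<le> 2 * (?M * (?k + 1))" using h half_facts(2)[OF l] by linarith
  then have "real n \<le> real (2 * (?M * (?k + 1)))" by (simp only: of_nat_le_iff)
  then have "real n \<le> (real ?k + 1) * (2 * real ?M)" by (simp add: algebra_simps)
  then show 2: "real n / (2 * real ?M) \<le> real ?k + 1" using nsteps_pos by (simp add: pos_divide_le_eq)
  have "real n / (4 * real ?M) = real n / (2 * real ?M) / 2" by simp
  also have "\<dots> \<le> (real ?k + 1) / 2" using 2 by (rule divide_right_mono) simp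
  also have "\<dots> \<le> real ?k" using k by simp
  finally show "real n / (4 * real ?M) \<le> real ?k" .
qed

text \<open>The kernel's normalising factor and the size of the piece cancel between numerator and
  density estimate, also when the latter is 0.\<close>

lemma update_eq:
  assumes S: "S \<in> \<S>" and I: "finite I" "I \<noteq> {}"
  shows "update E D I \<alpha> S u = inT S u * ((1 - 1 / N) * \<alpha> S u + 1 / N * what E D I S u *
    (NW I S D (\<lambda>y. gpop \<alpha> S y * inT (coords E) y) u - Wav I S D (\<lambda>y. gpop \<alpha> S y * inT (coords E) y)))"
proof -
  let ?g = "\<lambda>y. gpop \<alpha> S y * inT (coords E) y"
  have k: "0 < real (card I)" using I by (simp add: card_gt_0_iff)
  have h: "0 < (2 * h) ^ card S" using h_pos by simp
  have kern: "kern h S (\<lambda>j. u j - Xfull E i D j) = nr S u (X i D) / (2 * h) ^ card S" for i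
    unfolding kern_def nr_def sup_dist_def Xfull_eq by simp
  have f: "fhat E D I S u = cnt I S D u / ((2 * h) ^ card S * card I)"
    unfolding fhat_def average_def kern cnt_def by (simp add: sum_divide_distrib)
  have "kern h S (\<lambda>j. u j - Xfull E i D j) / fhat E D I S u = card I * (nr S u (X i D) / cnt I S D u)" for i
    unfolding kern f using h k h_pos by simp
  then have 1: "average I (\<lambda>i. ?g (Xfull E i D) * (kern h S (\<lambda>j. u j - Xfull E i D j) / fhat E D I S u)) = NW I S D ?g u"
    unfolding average_def NW_def Xfull_eq using k by (simp add: sum_divide_distrib mult.assoc)
  have 2: "(\<Sum>i\<in>I. what E D I S (restrict (Xfull E i D) S) * ?g (Xfull E i D)) / (\<Sum>i\<in>I. what E D I S (restrict (Xfull E i D) S)) = Wav I S D ?g"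
    unfolding Wav_def Xfull_eq ..
  show ?thesis
  proof (cases "sup_norm S u \<le> T")
    case True
    then show ?thesis
      unfolding update_def Let_def using 1 2 by (simp add: inT_def gpop_def)
  next
    case False
    then show ?thesis unfolding update_def Let_def by (simp add: inT_def)
  qed
qed

lemma NW_bound:
  assumes "finite I" "D \<in> space Q" "\<And>x. x \<in> space (leb (coords E)) \<Longrightarrow> \<bar>q x\<bar> \<le> G" "0 \<le> G"
  shows "\<bar>NW I S D q u\<bar> \<le> G"
proof (cases "cnt I S D u = 0")
  case False
  then have c: "0 < cnt I S D u" using cnt_nonneg[of I S D u] by simp
  have "\<bar>\<Sum>i\<in>I. q (X i D) * nr S u (X i D)\<bar> \<le> (\<Sum>i\<in>I. G * nr S u (X i D))"
    using assms X_space[OF assms(2)] nr_bounds by (intro order_trans[OF sum_abs sum_mono]) (simp add: abs_mult mult_right_mono)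
  then show ?thesis unfolding NW_def using c by (simp add: abs_divide pos_divide_le_eq cnt_def sum_distrib_left)
qed (simp add: NW_def assms)

lemma Wav_bound:
  assumes "S \<in> \<S>" "finite I" "I \<noteq> {}" "D \<in> space Q" "\<And>x. x \<in> space (leb (coords E)) \<Longrightarrow> \<bar>q x\<bar> \<le> G"
  shows "\<bar>Wav I S D q\<bar> \<le> G"
proof -
  have W: "0 < (\<Sum>i\<in>I. what E D I S (restrict (X i D) S))" by (rule sum_what_pos[OF assms(1-4)])
  have "\<bar>\<Sum>i\<in>I. what E D I S (restrict (X i D) S) * q (X i D)\<bar> \<le> (\<Sum>i\<in>I. what E D I S (restrict (X i D) S) * G)"
  proof (rule order_trans[OF sum_abs sum_mono])
    fix i
    show "\<bar>what E D I S (restrict (X i D) S) * q (X i D)\<bar> \<le> what E D I S (restrict (X i D) S) * G"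
      using what_bounds(1)[OF assms(1-4) restr_space[OF assms(1) X_space[OF assms(4), of i]]] assms(5)[OF X_space[OF assms(4)]]
      by (simp add: abs_mult)
  qed
  also have "\<dots> = G * (\<Sum>i\<in>I. what E D I S (restrict (X i D) S))" unfolding sum_distrib_right[symmetric] by simp
  finally show ?thesis unfolding Wav_def using W by (simp add: abs_divide pos_divide_le_eq)
qed

lemma gT_bound:
  assumes "\<And>S u. S \<in> \<S> \<Longrightarrow> u \<in> space (leb S) \<Longrightarrow> \<bar>\<alpha> S u\<bar> \<le> bnd m" "S \<in> \<S>" "x \<in> space (leb (coords E))"
  shows "\<bar>gpop \<alpha> S x * inT (coords E) x\<bar> \<le> N * bnd m"
proof -
  have "\<bar>gpop \<alpha> S x\<bar> \<le> N * bnd m" by (rule gpop_bound[OF assms(1) bnd_pos(2) assms(2,3)])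
  moreover have "\<bar>gpop \<alpha> S x * inT (coords E) x\<bar> \<le> \<bar>gpop \<alpha> S x\<bar> * 1"
    unfolding abs_mult using inT_bounds[of "coords E" x] by (intro mult_left_mono) auto
  ultimately show ?thesis by simp
qed

text \<open>The fitted iterates obey the bound of the population iterates for every data set, by the
  same count: local and weighted averages do not exceed the bound of the residual.\<close>

lemma ah_bound:
  assumes l: "l \<in> {1, 2}" and D: "D \<in> space Q"
  shows "m \<le> nsteps E \<Longrightarrow> S \<in> \<S> \<Longrightarrow> u \<in> space (leb S) \<Longrightarrow> \<bar>ah l m S D u\<bar> \<le> bnd m"
proof (induction m arbitrary: S u)
  case 0
  show ?case using bnd_pos(1)[of 0] by simp
next
  case (Suc m)
  let ?I = "piece E l (Suc m)"
  have I: "finite ?I" "?I \<noteq> {}" using piece_facts[OF l, of "Suc m"] Suc.prems by auto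
  let ?g = "\<lambda>y. gpop (alpha_hat E D l m) S y * inT (coords E) y"
  have gb: "\<bar>?g x\<bar> \<le> N * bnd m" if "x \<in> space (leb (coords E))" for x
    using Suc that by (intro gT_bound) auto
  have Nb: "0 \<le> N * bnd m" using bnd_pos(1)[of m] by simp
  have "\<bar>NW ?I S D ?g u - Wav ?I S D ?g\<bar> \<le> 2 * (N * bnd m)"
    using NW_bound[where q="?g", OF I(1) D gb Nb, where S=S and u=u] Wav_bound[where q="?g", OF Suc.prems(2) I D gb] by linarith
  then have "\<bar>what E D ?I S u * (NW ?I S D ?g u - Wav ?I S D ?g)\<bar> \<le> 1 * (2 * (N * bnd m))"
    unfolding abs_mult using what_bounds[OF Suc.prems(2) I D Suc.prems(3)] by (intro mult_mono) auto
  then have "\<bar>1 / N * (what E D ?I S u * (NW ?I S D ?g u - Wav ?I S D ?g))\<bar> \<le> 1 / N * (1 * (2 * (N * bnd m)))"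
    unfolding abs_mult[of "1 / N"] using N_ge_1 by (intro mult_mono) auto
  also have "\<dots> = 2 * bnd m" using N_ge_1 by simp
  finally have 1: "\<bar>1 / N * (what E D ?I S u * (NW ?I S D ?g u - Wav ?I S D ?g))\<bar> \<le> 2 * bnd m" .
  have "\<bar>(1 - 1 / N) * ah l m S D u\<bar> \<le> 1 * bnd m"
    unfolding abs_mult using Suc N_ge_1 by (intro mult_mono) auto
  with 1 have 2: "\<bar>(1 - 1 / N) * ah l m S D u + 1 / N * (what E D ?I S u * (NW ?I S D ?g u - Wav ?I S D ?g))\<bar> \<le> bnd (Suc m)"
    unfolding bnd_pos(3) by linarith
  have "\<bar>ah l (Suc m) S D u\<bar> \<le> 1 * bnd (Suc m)"
    unfolding alpha_hat.simps update_eq[OF Suc.prems(2) I] abs_mult[of "inT S u"] using 2 inT_bounds[of S u]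
    by (intro mult_mono) (auto simp: mult.assoc)
  then show ?case by simp
qed

text \<open>Each step spends a fresh piece, so the function entering step \<open>m + 1\<close> is
  independent of the piece used in it. This is what makes the exchange arguments applicable along
  the iteration.\<close>

lemma ah_cong_piece:
  assumes l: "l \<in> {1, 2}" and "\<And>i m'. m' \<in> {1..m} \<Longrightarrow> i \<in> piece E l m' \<Longrightarrow> X i D = X i D'"
  shows "alpha_hat E D l m = alpha_hat E D' l m"
  using assms(2)
proof (induction m)
  case (Suc m)
  let ?I = "piece E l (Suc m)"
  have X: "X i D = X i D'" if "i \<in> ?I" for i by (rule Suc.prems[OF _ that]) simp
  have r: "rhat E D ?I S = rhat E D' ?I S" for S
    unfolding rhat_def average_def Xfull_eq using X by (auto intro!: arg_cong2[where f="(/)"] sum.cong)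
  then have w: "what E D ?I S u = what E D' ?I S u" for S u unfolding what_def by simp
  have f: "fhat E D ?I S u = fhat E D' ?I S u" for S u
    unfolding fhat_def average_def Xfull_eq using X by (auto intro!: arg_cong2[where f="(/)"] sum.cong)
  have IH: "alpha_hat E D l m = alpha_hat E D' l m" by (rule Suc.IH, rule Suc.prems) auto
  show ?case
    unfolding alpha_hat.simps IH update_def Let_def w f average_def Xfull_eq
    using X by (intro ext) (simp cong: sum.cong)
qed simp

lemma ah_cong:
  assumes l: "l \<in> {1, 2}" and "\<And>i. i \<in> half E l \<Longrightarrow> X i D = X i D'" and "m \<le> nsteps E"
  shows "alpha_hat E D l m = alpha_hat E D' l m"
proof (rule ah_cong_piece[OF l])
  fix i m' assume "m' \<in> {1..m}" "i \<in> piece E l m'"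
  then show "X i D = X i D'" using piece_facts(1)[OF l, of m'] assms(2,3) by auto
qed

lemma ah_bdm:
  assumes l: "l \<in> {1, 2}"
  shows "m \<le> nsteps E \<Longrightarrow> S \<in> \<S> \<Longrightarrow> bdm (Q \<Otimes>\<^sub>M leb S) (\<lambda>(D, u). ah l m S D u)"
proof (induction m arbitrary: S)
  case 0
  show ?case by (simp add: case_prod_unfold bdm_const)
next
  case (Suc m)
  let ?I = "piece E l (Suc m)"
  have I: "finite ?I" "?I \<noteq> {}" using piece_facts[OF l, of "Suc m"] Suc.prems by auto
  note S = Suc.prems(2)
  let ?M = "Q \<Otimes>\<^sub>M leb S"
  let ?g = "\<lambda>D y. gpop (alpha_hat E D l m) S y * inT (coords E) y"
  have IHm: "(\<lambda>(D, u). ah l m S' D u) \<in> borel_measurable (Q \<Otimes>\<^sub>M leb S')" if "S' \<in> \<S>" for S'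
    using Suc.IH[OF _ that] Suc.prems by (intro bdm_measurable) auto
  have aX: "(\<lambda>D. ah l m S' D (restrict (X i D) S')) \<in> borel_measurable Q" if S': "S' \<in> \<S>" for S' i
  proof -
    have "(\<lambda>D. (D, restrict (X i D) S')) \<in> measurable Q (Q \<Otimes>\<^sub>M leb S')"
      by (intro measurable_Pair measurable_ident_sets refl measurable_compose[OF X_measurable restr_measurable[OF S']])
    from measurable_compose[OF this IHm[OF S']] show ?thesis by simp
  qed
  have gX: "(\<lambda>D. ?g D (X i D)) \<in> borel_measurable Q" for i
    unfolding gpop_def
    by (intro borel_measurable_times borel_measurable_diff borel_measurable_sum aX
        measurable_compose[OF X_measurable target_meas] measurable_compose[OF X_measurable inT_measurable]) auto
  have gX' [measurable]: "(\<lambda>z. ?g (fst z) (X i (fst z))) \<in> borel_measurable ?M" for i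
    by (rule measurable_compose[OF measurable_fst gX])
  have [measurable]: "rho_hat ?I S \<in> borel_measurable Q" by (rule bdm_measurable[OF rho_hat_bdm[OF S]])
  have [measurable]: "rbar E S \<in> borel_measurable (leb S)" by (rule rbar_measurable[OF S])
  have wX: "(\<lambda>D. what E D ?I S (restrict (X i D) S)) \<in> borel_measurable Q" for i
    by (rule bdm_measurable[OF what_X_bdm[OF S I]])
  have [measurable]: "(\<lambda>z. what E (fst z) ?I S (restrict (X i (fst z)) S)) \<in> borel_measurable ?M" for i
    by (rule measurable_compose[OF measurable_fst wX])
  have [measurable]: "(\<lambda>z. what E (fst z) ?I S (snd z)) \<in> borel_measurable ?M"
    unfolding what_eq[OF S] by measurable
  have [measurable]: "(\<lambda>z. nr S (snd z) (X i (fst z))) \<in> borel_measurable ?M" for i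
  proof (rule nr_measurable[OF S])
    fix j assume j: "j \<in> S"
    show "(\<lambda>z. snd z j) \<in> borel_measurable ?M" by (rule measurable_compose[OF measurable_snd coord_measurable[OF j]])
    have "j \<in> coords E" using j patternD(1)[OF S] by auto
    then show "(\<lambda>z. X i (fst z) j) \<in> borel_measurable ?M" by (rule measurable_compose[OF measurable_fst X_coord_measurable])
  qed
  have [measurable]: "(\<lambda>z. NW ?I S (fst z) (?g (fst z)) (snd z)) \<in> borel_measurable ?M"
    unfolding NW_def cnt_def by measurable
  have [measurable]: "(\<lambda>z. Wav ?I S (fst z) (?g (fst z))) \<in> borel_measurable ?M"
    unfolding Wav_def by measurable
  have [measurable]: "(\<lambda>u. inT S u) \<in> borel_measurable (leb S)"
  proof -
    have [measurable]: "(\<lambda>u. sup_norm S u) \<in> borel_measurable (leb S)"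
      using patternD(2)[OF S] by (intro sup_norm_measurable) auto
    show ?thesis unfolding inT_def by measurable
  qed
  have [measurable]: "(\<lambda>z. ah l m S (fst z) (snd z)) \<in> borel_measurable ?M"
    using IHm[OF S] by (simp add: case_prod_unfold)
  have "(\<lambda>z. ah l (Suc m) S (fst z) (snd z)) \<in> borel_measurable ?M"
    unfolding alpha_hat.simps update_eq[OF S I] by measurable
  then have "bdm ?M (\<lambda>z. ah l (Suc m) S (fst z) (snd z))"
    using ah_bound[OF l _ Suc.prems] by (intro bdmI[where B="bnd (Suc m)"]) (auto simp: space_pair_measure simp del: alpha_hat.simps)
  then show ?case by (simp add: case_prod_unfold)
qed

lemma ah_X_joint:
  assumes "l \<in> {1, 2}" "m \<le> nsteps E" "S \<in> \<S>"
  shows "bdm (Q \<Otimes>\<^sub>M leb (coords E)) (\<lambda>(D, x). ah l m S D (restrict x S))"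
proof -
  have "(\<lambda>z. (fst z, restrict (snd z) S)) \<in> measurable (Q \<Otimes>\<^sub>M leb (coords E)) (Q \<Otimes>\<^sub>M leb S)"
    by (intro measurable_Pair measurable_fst measurable_compose[OF measurable_snd restr_measurable[OF assms(3)]])
  from bdm_comp[OF ah_bdm[OF assms] this] show ?thesis by (simp add: case_prod_unfold)
qed

section \<open>Mean-square error of one step and of the whole iteration\<close>

definition "Del l m S D x = ah l m S D (restrict x S) - pa m S (restrict x S)"

definition "\<tau> = measure P {x \<in> space P. T \<le> sup_norm (coords E) x}"

text \<open>The expression in braces in the bound; \<open>\<mu>max\<close> below is the maximum
  inside \<open>B_const\<close>.\<close>

definition "\<delta> = real (nsteps E) * T ^ ndim E / (real n * h ^ ndim E) + h powr (2 * \<beta>) + \<tau>"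

definition "\<mu>max = Max {\<rho>\<^sup>2, LL\<^sup>2, 8 ^ ndim E}"

lemma mumax_facts: "\<rho>\<^sup>2 \<le> \<mu>max" "LL\<^sup>2 \<le> \<mu>max" "8 ^ ndim E \<le> \<mu>max" "1 \<le> \<mu>max" "\<rho> \<le> \<mu>max" "2 ^ ndim E \<le> \<mu>max" "4 ^ ndim E \<le> \<mu>max"
proof -
  show 1: "\<rho>\<^sup>2 \<le> \<mu>max" "LL\<^sup>2 \<le> \<mu>max" "8 ^ ndim E \<le> \<mu>max" by (auto simp: \<mu>max_def)
  have "\<rho> \<le> \<rho>\<^sup>2" using rho_facts by (intro self_le_power) auto
  then show "\<rho> \<le> \<mu>max" using 1 by simp
  have "(2::real) ^ ndim E \<le> 8 ^ ndim E" "(4::real) ^ ndim E \<le> 8 ^ ndim E" by (intro power_mono; simp)+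
  then show "2 ^ ndim E \<le> \<mu>max" "4 ^ ndim E \<le> \<mu>max" using 1 by simp_all
  have "(1::real) \<le> 8 ^ ndim E" by simp
  then show "1 \<le> \<mu>max" using 1 by linarith
qed

lemma Del_bdm:
  assumes "l \<in> {1, 2}" "m \<le> nsteps E" "S \<in> \<S>"
  shows "bdm (Q \<Otimes>\<^sub>M leb (coords E)) (\<lambda>(D, x). Del l m S D x)"
  using bdm_diff[OF ah_X_joint[OF assms] bdm_fixed[OF bdm_comp[OF pa(1)[OF assms(3)] restr_measurable[OF assms(3)]], of m]]
  by (simp add: Del_def case_prod_unfold)

lemma tail_indicator_le: assumes "S' \<subseteq> coords E" shows "(\<integral>D. 1 - inT S' (X 0 D) \<partial>Q) \<le> \<tau>" "bdm Q (\<lambda>D. 1 - inT S' (X 0 D))"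
proof -
  have m: "(\<lambda>x. sup_norm (coords E) x) \<in> borel_measurable (leb (coords E))" by (intro sup_norm_measurable) auto
  then have s: "{x \<in> space P. T \<le> sup_norm (coords E) x} \<in> sets P" by simp
  show "bdm Q (\<lambda>D. 1 - inT S' (X 0 D))" by (intro bdm_diff bdm_const bdm_fixed_X inT_bdm assms)
  have "(\<integral>D. 1 - inT S' (X 0 D) \<partial>Q) = (\<integral>x. 1 - inT S' x \<partial>P)"
    using inT_measurable[OF assms] by (intro integral_X) auto
  also have "\<dots> \<le> (\<integral>x. indicator {x \<in> space P. T \<le> sup_norm (coords E) x} x \<partial>P)"
  proof (rule P.bdm_integral_le)
    show "bdm P (\<lambda>x. 1 - inT S' x)" unfolding bdm_law by (intro bdm_diff bdm_const inT_bdm assms)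
    show "bdm P (indicator {x \<in> space P. T \<le> sup_norm (coords E) x})"
      by (rule bdmI[where B=1, OF borel_measurable_indicator[OF s]]) (auto simp: indicator_def)
    fix x assume "x \<in> space P"
    then show "1 - inT S' x \<le> indicator {x \<in> space P. T \<le> sup_norm (coords E) x} x"
      using sup_norm_mono[OF _ assms, of x] by (auto simp: inT_def indicator_def)
  qed
  also have "\<dots> = \<tau>" using s by (simp add: \<tau>_def)
  finally show "(\<integral>D. 1 - inT S' (X 0 D) \<partial>Q) \<le> \<tau>" .
qed

lemma delta_facts: "0 \<le> \<tau>" "0 < h powr (2 * \<beta>)" "real (nsteps E) / real n \<le> real (nsteps E) * T ^ ndim E / (real n * h ^ ndim E)"
  "\<tau> \<le> \<delta>" "h powr (2 * \<beta>) \<le> \<delta>" "real (nsteps E) * T ^ ndim E / (real n * h ^ ndim E) \<le> \<delta>" "1 / real n \<le> \<delta>" "0 < \<delta>"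
proof -
  let ?a = "real (nsteps E) * T ^ ndim E / (real n * h ^ ndim E)"
  show 1: "0 \<le> \<tau>" by (simp add: \<tau>_def)
  show 2: "0 < h powr (2 * \<beta>)" using h_pos by simp
  have "h ^ ndim E \<le> T ^ ndim E" using h_le_T h_pos by (intro power_mono) auto
  then have "1 \<le> T ^ ndim E / h ^ ndim E" using h_pos by simp
  then have "real (nsteps E) / real n * 1 \<le> real (nsteps E) / real n * (T ^ ndim E / h ^ ndim E)"
    by (intro mult_left_mono) auto
  then show 3: "real (nsteps E) / real n \<le> ?a" by simp
  have "1 / real n \<le> real (nsteps E) / real n" using nsteps_pos by (intro divide_right_mono) auto
  with 1 2 3 show "\<tau> \<le> \<delta>" "h powr (2 * \<beta>) \<le> \<delta>" "?a \<le> \<delta>" "1 / real n \<le> \<delta>" "0 < \<delta>"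
    unfolding \<delta>_def by (smt (verit) divide_nonneg_nonneg of_nat_0_le_iff)+
qed

end

lemma (in prob_space) bdm_integral_add5:
  assumes "bdm M f1" "bdm M f2" "bdm M f3" "bdm M f4" "bdm M f5"
  shows "(\<integral>x. f1 x + f2 x + f3 x + f4 x + c * f5 x \<partial>M) =
    (\<integral>x. f1 x \<partial>M) + (\<integral>x. f2 x \<partial>M) + (\<integral>x. f3 x \<partial>M) + (\<integral>x. f4 x \<partial>M) + c * (\<integral>x. f5 x \<partial>M)"
proof -
  note i = assms[THEN integrable_bdm]
  show ?thesis using i by simp
qed

context model
begin

text \<open>Supplies the invariance that \<open>stone\<close> and \<open>Wav_expectation\<close>
  require of the fitted residual.\<close>

lemma ah_swp:
  assumes l: "l \<in> {1, 2}" and m: "Suc m \<le> nsteps E" and i: "i \<in> piece E l (Suc m)"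
  shows "alpha_hat E (swp i D) l m = alpha_hat E D l m"
proof (rule ah_cong_piece[OF l])
  fix j m' assume j: "m' \<in> {1..m}" "j \<in> piece E l m'"
  have "piece E l m' \<inter> piece E l (Suc m) = {}"
    using pieces(1)[OF l] j m unfolding disjoint_family_on_def by auto
  then have "j \<noteq> i" using i j by auto
  moreover have "j \<noteq> 0" using piece_facts(4)[OF l, of m'] j m by (metis atLeastAtMost_iff order_trans Suc_leD)
  ultimately show "X j (swp i D) = X j D" by simp
qed

text \<open>In use, \<open>a\<close> is the fitted and \<open>a - \<Delta>\<close> the population
  function; \<open>p\<close>, \<open>q\<close> are the local and the weighted average of the fitted
  residual, \<open>r\<close>, \<open>s\<close> those of the population residual, \<open>c1\<close>,
  \<open>c2\<close> their targets, and \<open>wh\<close>, \<open>wo\<close> the two weights. The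
  factor 6 is Cauchy-Schwarz for six terms.\<close>

lemma update_error_decomp:
  fixes \<Delta> a p q r s t v wh wo c1 c2 :: real
  assumes "0 \<le> N'" "N' = 1 / N" "0 \<le> wh" "wh \<le> 1" "\<bar>t\<bar> \<le> 2 * G" "\<bar>wh - wo\<bar> \<le> v"
    and that: "t = c1 - c2" "N' \<le> 1"
  shows "(((1 - N') * a + N' * wh * (p - q)) - ((1 - N') * (a - \<Delta>) + N' * wo * t))\<^sup>2
    \<le> 6 * (\<Delta>\<^sup>2 + N'\<^sup>2 * ((p - r)\<^sup>2 + (q - s)\<^sup>2 + (r - c1)\<^sup>2 + (s - c2)\<^sup>2 + (2 * G)\<^sup>2 * v\<^sup>2))"
proof -
  have six: "(x1 + x2 + x3 + x4 + x5 + x6)\<^sup>2 \<le> 6 * (x1\<^sup>2 + x2\<^sup>2 + x3\<^sup>2 + x4\<^sup>2 + x5\<^sup>2 + x6\<^sup>2)" for x1 x2 x3 x4 x5 x6 :: real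
    using sum_squared_le_card[of "\<lambda>i::nat. [x1, x2, x3, x4, x5, x6] ! i" "{0, 1, 2, 3, 4, 5}"] by (simp add: add.assoc)
  have eq: "((1 - N') * a + N' * wh * (p - q)) - ((1 - N') * (a - \<Delta>) + N' * wo * t)
    = (1 - N') * \<Delta> + N' * (wh * (p - r)) + N' * (- (wh * (q - s))) + N' * (wh * (r - c1)) + N' * (- (wh * (s - c2))) + N' * ((wh - wo) * t)"
    unfolding that(1) by (simp add: algebra_simps)
  have w: "(wh * x)\<^sup>2 \<le> x\<^sup>2" for x
  proof -
    have "wh\<^sup>2 \<le> 1" using assms by (simp add: power_le_one)
    then show ?thesis using mult_right_mono[of "wh\<^sup>2" 1 "x\<^sup>2"] by (simp add: power_mult_distrib)
  qed
  have n: "(1 - N')\<^sup>2 \<le> 1" using assms(1) that(2) by (simp add: power_le_one)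
  have "\<bar>t * (wh - wo)\<bar> \<le> (2 * G) * v" unfolding abs_mult using assms by (intro mult_mono) auto
  then have "\<bar>t * (wh - wo)\<bar>\<^sup>2 \<le> ((2 * G) * v)\<^sup>2" by (rule power_mono) simp
  then have vt: "((wh - wo) * t)\<^sup>2 \<le> (2 * G)\<^sup>2 * v\<^sup>2"
    unfolding power_mult_distrib[of "2 * G"] power2_abs mult.commute[of t] .
  have d: "((1 - N') * \<Delta>)\<^sup>2 \<le> \<Delta>\<^sup>2" using mult_right_mono[OF n, of "\<Delta>\<^sup>2"] by (simp add: power_mult_distrib)
  have sm: "N'\<^sup>2 * ((wh * (p - r))\<^sup>2 + (wh * (q - s))\<^sup>2 + (wh * (r - c1))\<^sup>2 + (wh * (s - c2))\<^sup>2 + ((wh - wo) * t)\<^sup>2)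
     \<le> N'\<^sup>2 * ((p - r)\<^sup>2 + (q - s)\<^sup>2 + (r - c1)\<^sup>2 + (s - c2)\<^sup>2 + (2 * G)\<^sup>2 * v\<^sup>2)"
    using w vt by (intro mult_left_mono add_mono) auto
  show ?thesis
    unfolding eq
  proof (rule order_trans[OF six], rule mult_left_mono)
    have "(N' * (wh * (p - r)))\<^sup>2 + (N' * - (wh * (q - s)))\<^sup>2 + (N' * (wh * (r - c1)))\<^sup>2 + (N' * - (wh * (s - c2)))\<^sup>2 + (N' * ((wh - wo) * t))\<^sup>2
      = N'\<^sup>2 * ((wh * (p - r))\<^sup>2 + (wh * (q - s))\<^sup>2 + (wh * (r - c1))\<^sup>2 + (wh * (s - c2))\<^sup>2 + ((wh - wo) * t)\<^sup>2)"
      unfolding power_mult_distrib[of N'] power2_minus distrib_left ..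
    with d sm show "((1 - N') * \<Delta>)\<^sup>2 + (N' * (wh * (p - r)))\<^sup>2 + (N' * - (wh * (q - s)))\<^sup>2 + (N' * (wh * (r - c1)))\<^sup>2 + (N' * - (wh * (s - c2)))\<^sup>2 + (N' * ((wh - wo) * t))\<^sup>2
      \<le> \<Delta>\<^sup>2 + N'\<^sup>2 * ((p - r)\<^sup>2 + (q - s)\<^sup>2 + (r - c1)\<^sup>2 + (s - c2)\<^sup>2 + (2 * G)\<^sup>2 * v\<^sup>2)"
      by linarith
  qed simp
qed

text \<open>The dimension is at least 2 and \<open>\<rho>\<close> at least 1, so
  \<open>\<rho> + 2 ^ ndim E\<close> is at least 5. This gives \<open>140 = 28 * 5\<close> and
  absorbs the summand 1 into the other two.\<close>

lemma A_facts: "A_const E K = 28 * (\<rho> + 2 ^ ndim E)" "140 \<le> A_const E K" "6 * (1 + 2 ^ ndim E + \<rho>) \<le> A_const E K / 3"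
proof -
  have d: "(2::real) ^ 2 \<le> 2 ^ ndim E" using ndim by (intro power_increasing) auto
  show 1: "A_const E K = 28 * (\<rho> + 2 ^ ndim E)" by (simp add: A_const_def \<rho>_def)
  show "140 \<le> A_const E K" "6 * (1 + 2 ^ ndim E + \<rho>) \<le> A_const E K / 3"
    unfolding 1 using d rho_facts by simp_all
qed

text \<open>Old errors are carried on with factor 1 by the old value, \<open>2 ^ ndim E\<close> by
  the local average and \<open>\<rho>\<close> by the weighted one. The residual sums over patterns,
  which costs \<open>N\<^sup>2\<close>; the squared step size cancels it. The other terms are
  regression error, averaging error and tail.\<close>

lemma step_error:
  assumes l: "l \<in> {1, 2}" and m: "Suc m \<le> nsteps E"
    and e: "\<And>S. S \<in> \<S> \<Longrightarrow> (\<integral>D. (Del l m S D (X 0 D))\<^sup>2 \<partial>Q) \<le> e"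
    and S: "S \<in> \<S>"
  shows "(\<integral>D. (Del l (Suc m) S D (X 0 D))\<^sup>2 \<partial>Q) \<le> 6 * (1 + 2 ^ ndim E + \<rho>) * e + 1260 * (bnd m)\<^sup>2 * \<mu>max\<^sup>2 * \<delta>"
proof -
  define I where "I = piece E l (Suc m)"
  define b where "b = bnd m"
  have m1: "Suc m \<in> {1..nsteps E}" using m by simp
  note I = piece_facts[OF l m1, folded I_def]
  have b1: "1 \<le> b" unfolding b_def by (rule bnd_pos)
  define gT where "gT = (\<lambda>D y. gpop (alpha_hat E D l m) S y * inT (coords E) y)"
  define q where "q = (\<lambda>D y. gT D y - gp m S y)"
  have SC: "S \<subseteq> coords E" by (rule patternD(1)[OF S])
  have jgp: "bdm (Q \<Otimes>\<^sub>M leb (coords E)) (\<lambda>(D, x). gp m S x)" by (rule bdm_fixed[OF gp(1)[OF S]])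
  have jgT: "bdm (Q \<Otimes>\<^sub>M leb (coords E)) (\<lambda>(D, x). gT D x)"
  proof -
    have *: "bdm (Q \<Otimes>\<^sub>M leb (coords E)) (\<lambda>z. alpha_hat E (fst z) l m S' (restrict (snd z) S'))" if "S' \<in> \<S>" for S'
      using ah_X_joint[OF l _ that, of m] m by (simp add: case_prod_unfold)
    have "bdm (Q \<Otimes>\<^sub>M leb (coords E)) (\<lambda>z. gT (fst z) (snd z))"
      unfolding gT_def gpop_def
      by (intro bdm_mult bdm_diff bdm_sum * bdm_comp[OF target_bdm measurable_snd] bdm_comp[OF inT_bdm measurable_snd]) auto
    then show ?thesis by (simp add: case_prod_unfold)
  qed
  have jq: "bdm (Q \<Otimes>\<^sub>M leb (coords E)) (\<lambda>(D, x). q D x)"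
    using bdm_diff[OF jgT jgp] by (simp add: q_def case_prod_unfold)
  have jq2: "bdm (Q \<Otimes>\<^sub>M leb (coords E)) (\<lambda>(D, x). (q D x)\<^sup>2)"
    using bdm_power[OF jq, of 2] by (simp add: case_prod_unfold)
  have inv: "q (swp i D) = q D" if "i \<in> I" for D i
    unfolding q_def gT_def using ah_swp[OF l m that[unfolded I_def]] by simp
  have bD: "bdm Q (\<lambda>D. (Del l m' S' D (X 0 D))\<^sup>2)" if "m' \<le> nsteps E" "S' \<in> \<S>" for m' S'
    by (intro bdm_power bdm_joint_X[OF Del_bdm[OF l that]])
  have bS: "bdm Q (\<lambda>D. \<Sum>S'\<in>\<S>. (Del l m S' D (X 0 D))\<^sup>2)" using m by (intro bdm_sum bD) auto
  note tailC = tail_indicator_le[of "coords E", OF order_refl] and tailS = tail_indicator_le[OF SC]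
  \<comment> \<open>Inside the cube the target cancels and only errors of the other components
    remain. Outside, the fitted residual is cut to 0 while the population residual is not, which
    gives the tail term.\<close>
  have q_sq: "(q D x)\<^sup>2 \<le> N * (\<Sum>S'\<in>\<S>. (Del l m S' D x)\<^sup>2) + (N * b)\<^sup>2 * (1 - inT (coords E) x)"
    if x: "x \<in> space (leb (coords E))" for D x
  proof (cases "inT (coords E) x = 0")
    case True
    have "\<bar>gp m S x\<bar>\<^sup>2 \<le> (N * b)\<^sup>2" unfolding b_def by (intro power_mono gp S x) simp
    moreover have "0 \<le> N * (\<Sum>S'\<in>\<S>. (Del l m S' D x)\<^sup>2)" by (intro mult_nonneg_nonneg sum_nonneg) auto
    ultimately show ?thesis using True by (simp add: q_def gT_def)
  next
    case False
    then have t1: "inT (coords E) x = 1" by (auto simp: inT_def)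
    have "q D x = - (\<Sum>S'\<in>\<S> - {S}. Del l m S' D x)"
      by (simp add: q_def gT_def t1 gpop_def Del_def sum_subtractf)
    then have "(q D x)\<^sup>2 = (\<Sum>S'\<in>\<S> - {S}. Del l m S' D x)\<^sup>2" by simp
    also have "\<dots> \<le> real (card (\<S> - {S})) * (\<Sum>S'\<in>\<S> - {S}. (Del l m S' D x)\<^sup>2)" by (rule sum_squared_le_card)
    also have "\<dots> \<le> N * (\<Sum>S'\<in>\<S>. (Del l m S' D x)\<^sup>2)"
      using finite_patterns by (intro mult_mono sum_mono2 of_nat_mono card_mono sum_nonneg) auto
    finally show ?thesis by (simp add: t1)
  qed
  have qE: "(\<integral>D. (q D (X 0 D))\<^sup>2 \<partial>Q) \<le> N\<^sup>2 * e + (N * b)\<^sup>2 * \<tau>"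
  proof -
    have "(\<integral>D. (q D (X 0 D))\<^sup>2 \<partial>Q) \<le> (\<integral>D. N * (\<Sum>S'\<in>\<S>. (Del l m S' D (X 0 D))\<^sup>2) + (N * b)\<^sup>2 * (1 - inT (coords E) (X 0 D)) \<partial>Q)"
      by (intro Q.bdm_integral_le bdm_joint_X[OF jq2] bdm_add bdm_mult bdm_const bS tailC q_sq X_space)
    also have "\<dots> = N * (\<integral>D. (\<Sum>S'\<in>\<S>. (Del l m S' D (X 0 D))\<^sup>2) \<partial>Q) + (N * b)\<^sup>2 * (\<integral>D. 1 - inT (coords E) (X 0 D) \<partial>Q)"
      unfolding Q.bdm_integral_add[OF bdm_mult[OF bdm_const bS] bdm_mult[OF bdm_const tailC(2)]] Bochner_Integration.integral_mult_right_zero ..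
    also have "(\<integral>D. (\<Sum>S'\<in>\<S>. (Del l m S' D (X 0 D))\<^sup>2) \<partial>Q) = (\<Sum>S'\<in>\<S>. \<integral>D. (Del l m S' D (X 0 D))\<^sup>2 \<partial>Q)"
      using m by (intro Q.bdm_integral_sum bD) auto
    also have "N * \<dots> + (N * b)\<^sup>2 * (\<integral>D. 1 - inT (coords E) (X 0 D) \<partial>Q) \<le> N * (N * e) + (N * b)\<^sup>2 * \<tau>"
      using sum_bounded_above[of \<S> "\<lambda>S'. \<integral>D. (Del l m S' D (X 0 D))\<^sup>2 \<partial>Q" e] e tailC(1) by (intro add_mono mult_left_mono) auto
    finally show ?thesis by (simp add: power2_eq_square mult.assoc)
  qed
  have e0: "0 \<le> e" using e[OF S] by (rule order_trans[rotated]) simp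
  have t2b: "bdm Q (\<lambda>D. (NW I S D (q D) (X 0 D))\<^sup>2)" and t2: "(\<integral>D. (NW I S D (q D) (X 0 D))\<^sup>2 \<partial>Q) \<le> 2 ^ ndim E * (N\<^sup>2 * e + (N * b)\<^sup>2 * \<tau>)"
  proof -
    have "NW I S D (q D) (X 0 D) = (\<Sum>i\<in>I. q D (X i D) * (nr S (X 0 D) (X i D) / cnt I S D (X 0 D)))" for D
      by (simp add: NW_def sum_divide_distrib)
    note NWe = this
    show b2: "bdm Q (\<lambda>D. (NW I S D (q D) (X 0 D))\<^sup>2)"
      unfolding NWe by (intro bdm_power bdm_sum bdm_mult bdm_joint_X[OF jq] bdm_nr_div_cnt S I)
    have "(\<integral>D. (NW I S D (q D) (X 0 D))\<^sup>2 \<partial>Q) \<le> (\<integral>D. NW I S D (\<lambda>x. (q D x)\<^sup>2) (X 0 D) \<partial>Q)"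
    proof (rule Q.bdm_integral_le[OF b2])
      show "bdm Q (\<lambda>D. NW I S D (\<lambda>x. (q D x)\<^sup>2) (X 0 D))" by (rule stone(2)[OF S I(2,4) jq2]) (use inv in auto)
      show "(NW I S D (q D) (X 0 D))\<^sup>2 \<le> NW I S D (\<lambda>x. (q D x)\<^sup>2) (X 0 D)" for D
        unfolding NW_def cnt_def by (rule weighted_jensen) (rule nr_bounds)
    qed
    also have "\<dots> \<le> 2 ^ ndim E * (\<integral>D. (q D (X 0 D))\<^sup>2 \<partial>Q)" by (rule stone(1)[OF S I(2,4) jq2]) (use inv in auto)
    also have "\<dots> \<le> 2 ^ ndim E * (N\<^sup>2 * e + (N * b)\<^sup>2 * \<tau>)" using qE by (rule mult_left_mono) simp
    finally show "(\<integral>D. (NW I S D (q D) (X 0 D))\<^sup>2 \<partial>Q) \<le> 2 ^ ndim E * (N\<^sup>2 * e + (N * b)\<^sup>2 * \<tau>)" .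
  qed
  have t3b: "bdm Q (\<lambda>D. (Wav I S D (q D))\<^sup>2)" by (intro bdm_power Wav_bdm S I jq)
  have t3: "(\<integral>D. (Wav I S D (q D))\<^sup>2 \<partial>Q) \<le> \<rho> * (N\<^sup>2 * e + (N * b)\<^sup>2 * \<tau>)"
  proof -
    have "(\<integral>D. (Wav I S D (q D))\<^sup>2 \<partial>Q) \<le> \<rho> * (\<integral>D. (q D (X 0 D))\<^sup>2 \<partial>Q)" by (rule Wav_expectation[OF S I(2,3,4) jq inv])
    also have "\<dots> \<le> \<rho> * (N\<^sup>2 * e + (N * b)\<^sup>2 * \<tau>)" using qE rho_facts by (intro mult_left_mono) auto
    finally show ?thesis .
  qed
  let ?c1 = "\<lambda>D. condm S (gp m S) (restrict (X 0 D) S)"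
  have Hc0: "0 \<le> 4 * N * bnd m * LL * \<rho>" using bnd_pos(1)[of m] LL_pos rho_facts by simp
  note t4 = NW_error[OF S I(2,4) gp[OF S, where m=m] Hc0 condm_gp_holder[OF S, where m=m]]
  note t5 = Wav_error[OF S I(2,3) gp[OF S, where m=m]]
  note t6 = rho_hat_variance[OF S I(2,3)]
  define F where "F = (\<lambda>D. (NW I S D (q D) (X 0 D))\<^sup>2 + (Wav I S D (q D))\<^sup>2
      + inT S (X 0 D) * (NW I S D (gp m S) (X 0 D) - ?c1 D)\<^sup>2 + (Wav I S D (gp m S) - mu S (gp m S))\<^sup>2 + (2 * (N * b))\<^sup>2 * (rho_hat I S D - 1)\<^sup>2)"
  have pt: "(Del l (Suc m) S D (X 0 D))\<^sup>2 \<le> 6 * ((Del l m S D (X 0 D))\<^sup>2 + (1 / N)\<^sup>2 * F D) + (bnd (Suc m))\<^sup>2 * (1 - inT S (X 0 D))"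
    if D: "D \<in> space Q" for D
  proof (cases "inT S (X 0 D) = 0")
    \<comment> \<open>Outside the cube the fitted function is 0, so the error is the population
      iterate itself; its bound is charged to the tail probability.\<close>
    case True
    have x: "restrict (X 0 D) S \<in> space (leb S)" by (intro restr_space S X_space D)
    have iS: "inT S (restrict (X 0 D) S) = inT S (X 0 D)" unfolding inT_def by (subst sup_norm_cong[of S _ "X 0 D"]) auto
    have "Del l (Suc m) S D (X 0 D) = - pa (Suc m) S (restrict (X 0 D) S)"
      unfolding Del_def alpha_hat.simps using update_eq[OF S I(2,3), of D "alpha_hat E D l m" "restrict (X 0 D) S"] True iS by (simp add: I_def)
    then have "(Del l (Suc m) S D (X 0 D))\<^sup>2 = \<bar>pa (Suc m) S (restrict (X 0 D) S)\<bar>\<^sup>2" by (simp only: power2_minus power2_abs)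
    also have "\<dots> \<le> (bnd (Suc m))\<^sup>2" by (intro power_mono pa S x) simp
    also have "\<dots> = (bnd (Suc m))\<^sup>2 * (1 - inT S (X 0 D))" using True by simp
    also have "\<dots> \<le> 6 * ((Del l m S D (X 0 D))\<^sup>2 + (1 / N)\<^sup>2 * F D) + (bnd (Suc m))\<^sup>2 * (1 - inT S (X 0 D))"
      using True unfolding F_def by (intro le_add_same_cancel2[THEN iffD2]) auto
    finally show ?thesis .
  next
    case False
    then have t1: "inT S (X 0 D) = 1" by (auto simp: inT_def)
    have x: "restrict (X 0 D) S \<in> space (leb S)" by (intro restr_space S X_space D)
    have iS: "inT S (restrict (X 0 D) S) = 1" using t1 unfolding inT_def by (subst sup_norm_cong[of S _ "X 0 D"]) auto
    have nwr: "NW I S D g (restrict (X 0 D) S) = NW I S D g (X 0 D)" for g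
      unfolding NW_def cnt_def nr_restrict ..
    have a: "alpha_hat E D l (Suc m) S (restrict (X 0 D) S) = (1 - 1 / N) * alpha_hat E D l m S (restrict (X 0 D) S) + 1 / N * what E D I S (restrict (X 0 D) S) * (NW I S D (gT D) (X 0 D) - Wav I S D (gT D))"
      unfolding alpha_hat.simps I_def[symmetric] update_eq[OF S I(2,3)] iS nwr gT_def by simp
    have p: "pa (Suc m) S (restrict (X 0 D) S) = (1 - 1 / N) * (alpha_hat E D l m S (restrict (X 0 D) S) - Del l m S D (X 0 D)) + 1 / N * w S (restrict (X 0 D) S) * (?c1 D - mu S (gp m S))"
      by (simp add: Del_def)
    have tb: "\<bar>?c1 D - mu S (gp m S)\<bar> \<le> 2 * (N * b)"
      using condm_bound(1)[OF S bdm_measurable[OF gp(1)[OF S]] gp(2)[OF S] x, of m] mu_bound[OF S gp[OF S], of m] unfolding b_def by linarith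
    have wv: "\<bar>what E D I S (restrict (X 0 D) S) - w S (restrict (X 0 D) S)\<bar> \<le> \<bar>rho_hat I S D - 1\<bar>"
      using what_w_diff[OF S I(2,3) D x] what_bounds[OF S I(2,3) D x] mult_left_mono[of "what E D I S (restrict (X 0 D) S)" 1 "\<bar>rho_hat I S D - 1\<bar>"] by simp
    have nwq: "NW I S D (gT D) (X 0 D) - NW I S D (gp m S) (X 0 D) = NW I S D (q D) (X 0 D)"
      unfolding NW_def q_def by (simp add: left_diff_distrib sum_subtractf diff_divide_distrib)
    have waq: "Wav I S D (gT D) - Wav I S D (gp m S) = Wav I S D (q D)"
      unfolding Wav_def q_def by (simp add: right_diff_distrib sum_subtractf diff_divide_distrib)
    have "(Del l (Suc m) S D (X 0 D))\<^sup>2 = (alpha_hat E D l (Suc m) S (restrict (X 0 D) S) - pa (Suc m) S (restrict (X 0 D) S))\<^sup>2"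
      unfolding Del_def ..
    also have "\<dots> \<le> 6 * ((Del l m S D (X 0 D))\<^sup>2 + (1 / N)\<^sup>2 * ((NW I S D (gT D) (X 0 D) - NW I S D (gp m S) (X 0 D))\<^sup>2 + (Wav I S D (gT D) - Wav I S D (gp m S))\<^sup>2
        + (NW I S D (gp m S) (X 0 D) - ?c1 D)\<^sup>2 + (Wav I S D (gp m S) - mu S (gp m S))\<^sup>2 + (2 * (N * b))\<^sup>2 * \<bar>rho_hat I S D - 1\<bar>\<^sup>2))"
      unfolding a p using N_ge_1 what_bounds[OF S I(2,3) D x] tb wv by (intro update_error_decomp) (auto simp: less_imp_le)
    also have "\<dots> = 6 * ((Del l m S D (X 0 D))\<^sup>2 + (1 / N)\<^sup>2 * F D) + (bnd (Suc m))\<^sup>2 * (1 - inT S (X 0 D))"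
      unfolding nwq waq F_def t1 by simp
    finally show ?thesis .
  qed
  have bF: "bdm Q F" unfolding F_def by (intro bdm_add t2b t3b t4(2) t5(2) bdm_mult bdm_const t6(2))
  have bDm: "bdm Q (\<lambda>D. (Del l m S D (X 0 D))\<^sup>2)" using m by (intro bD S) auto
  have FE: "(\<integral>D. F D \<partial>Q) = (\<integral>D. (NW I S D (q D) (X 0 D))\<^sup>2 \<partial>Q) + (\<integral>D. (Wav I S D (q D))\<^sup>2 \<partial>Q)
      + (\<integral>D. inT S (X 0 D) * (NW I S D (gp m S) (X 0 D) - ?c1 D)\<^sup>2 \<partial>Q) + (\<integral>D. (Wav I S D (gp m S) - mu S (gp m S))\<^sup>2 \<partial>Q) + (2 * (N * b))\<^sup>2 * (\<integral>D. (rho_hat I S D - 1)\<^sup>2 \<partial>Q)"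
    unfolding F_def by (rule Q.bdm_integral_add5[OF t2b t3b t4(2) t5(2) t6(2)])
  have main: "(\<integral>D. (Del l (Suc m) S D (X 0 D))\<^sup>2 \<partial>Q) \<le> 6 * (e + (1 / N)\<^sup>2 * (\<integral>D. F D \<partial>Q)) + (bnd (Suc m))\<^sup>2 * \<tau>"
  proof -
    have b1: "bdm Q (\<lambda>D. (Del l m S D (X 0 D))\<^sup>2 + (1 / N)\<^sup>2 * F D)" by (intro bdm_add bDm bdm_mult bdm_const bF)
    have "(\<integral>D. (Del l (Suc m) S D (X 0 D))\<^sup>2 \<partial>Q) \<le> (\<integral>D. 6 * ((Del l m S D (X 0 D))\<^sup>2 + (1 / N)\<^sup>2 * F D) + (bnd (Suc m))\<^sup>2 * (1 - inT S (X 0 D)) \<partial>Q)"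
      by (intro Q.bdm_integral_le bD m S bdm_add[OF bdm_mult[OF bdm_const b1] bdm_mult[OF bdm_const tailS(2)]] pt)
    also have "\<dots> = 6 * ((\<integral>D. (Del l m S D (X 0 D))\<^sup>2 \<partial>Q) + (1 / N)\<^sup>2 * (\<integral>D. F D \<partial>Q)) + (bnd (Suc m))\<^sup>2 * (\<integral>D. 1 - inT S (X 0 D) \<partial>Q)"
      unfolding Q.bdm_integral_add[OF bdm_mult[OF bdm_const b1] bdm_mult[OF bdm_const tailS(2)]]
        Bochner_Integration.integral_mult_right_zero Q.bdm_integral_add[OF bDm bdm_mult[OF bdm_const bF]] ..
    also have "\<dots> \<le> 6 * (e + (1 / N)\<^sup>2 * (\<integral>D. F D \<partial>Q)) + (bnd (Suc m))\<^sup>2 * \<tau>"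
      using e[OF S] tailS(1) by (intro add_mono mult_left_mono) auto
    finally show ?thesis .
  qed
  define D1 where "D1 = real (nsteps E) * T ^ ndim E / (real n * h ^ ndim E)"
  have D10: "0 \<le> D1" unfolding D1_def using h_pos trunc_ge by (intro divide_nonneg_nonneg mult_nonneg_nonneg) auto
  have kM: "1 / (real (card I) + 1) \<le> 2 * real (nsteps E) / real n" "1 / real (card I) \<le> 4 * D1"
  proof -
    have np: "0 < real n" "0 < real (nsteps E)" using n_pos nsteps_pos by auto
    have "1 / (real (card I) + 1) \<le> 1 / (real n / (2 * real (nsteps E)))"
      using I(5) np by (intro divide_left_mono) auto
    then show "1 / (real (card I) + 1) \<le> 2 * real (nsteps E) / real n" by simp
    have "1 / real (card I) \<le> 1 / (real n / (4 * real (nsteps E)))"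
      using I(6) np I(2,3) by (intro divide_left_mono mult_pos_pos) (auto simp: card_gt_0_iff)
    also have "\<dots> = 4 * (real (nsteps E) / real n)" by simp
    also have "\<dots> \<le> 4 * D1" using delta_facts(3) unfolding D1_def by simp
    finally show "1 / real (card I) \<le> 4 * D1" .
  qed
  \<comment> \<open>The number of cells over the size of a piece is, up to
    \<open>2 * 4 ^ ndim E\<close>, the first summand of \<open>\<delta>\<close>.\<close>
  have cell: "(4 * T / h) ^ ndim E / (real (card I) + 1) \<le> 2 * 4 ^ ndim E * D1"
  proof -
    have "(4 * T / h) ^ ndim E * (1 / (real (card I) + 1)) \<le> (4 * T / h) ^ ndim E * (2 * real (nsteps E) / real n)"
      using kM(1) h_pos trunc_ge by (intro mult_left_mono) auto
    also have "\<dots> = 2 * 4 ^ ndim E * D1" unfolding D1_def power_mult_distrib power_divide by (simp add: ac_simps)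
    finally show ?thesis by simp
  qed
  have N0: "0 < N" using N_ge_1 by simp
  have c2: "(1 / N)\<^sup>2 * (2 ^ ndim E * (N\<^sup>2 * e + (N * b)\<^sup>2 * \<tau>)) = 2 ^ ndim E * (e + b\<^sup>2 * \<tau>)"
    using N0 by (simp add: power_mult_distrib power_divide field_simps)
  have c3: "(1 / N)\<^sup>2 * (\<rho> * (N\<^sup>2 * e + (N * b)\<^sup>2 * \<tau>)) = \<rho> * (e + b\<^sup>2 * \<tau>)"
    using N0 by (simp add: power_mult_distrib power_divide field_simps)
  define H2 where "H2 = h powr (2 * \<beta>)"
  have hp: "(h powr \<beta>)\<^sup>2 = H2" using h_pos unfolding H2_def by (simp add: power2_eq_square flip: powr_add)
  have c4: "(1 / N)\<^sup>2 * (\<integral>D. inT S (X 0 D) * (NW I S D (gp m S) (X 0 D) - ?c1 D)\<^sup>2 \<partial>Q) \<le> b\<^sup>2 * (34 * 4 ^ ndim E * D1 + 32 * LL\<^sup>2 * \<rho>\<^sup>2 * H2)"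
  proof -
    have "(1 / N)\<^sup>2 * (\<integral>D. inT S (X 0 D) * (NW I S D (gp m S) (X 0 D) - ?c1 D)\<^sup>2 \<partial>Q)
       \<le> (1 / N)\<^sup>2 * (17 * (N * b)\<^sup>2 * (2 * 4 ^ ndim E * D1) + 2 * (4 * N * b * LL * \<rho> * h powr \<beta>)\<^sup>2)"
      unfolding b_def using cell by (intro mult_left_mono order_trans[OF t4(1)] add_right_mono) auto
    also have "\<dots> = b\<^sup>2 * (34 * 4 ^ ndim E * D1 + 32 * LL\<^sup>2 * \<rho>\<^sup>2 * H2)"
      using N0 unfolding power_mult_distrib hp by (simp add: power_divide field_simps)
    finally show ?thesis .
  qed
  have c5: "(1 / N)\<^sup>2 * (\<integral>D. (Wav I S D (gp m S) - mu S (gp m S))\<^sup>2 \<partial>Q) \<le> b\<^sup>2 * (160 * \<rho>\<^sup>2 * D1)"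
  proof -
    have "(1 / N)\<^sup>2 * (\<integral>D. (Wav I S D (gp m S) - mu S (gp m S))\<^sup>2 \<partial>Q) \<le> (1 / N)\<^sup>2 * (40 * (N * b)\<^sup>2 * \<rho>\<^sup>2 * (1 / card I))"
      using t5(1) unfolding b_def by (intro mult_left_mono) auto
    also have "\<dots> \<le> (1 / N)\<^sup>2 * (40 * (N * b)\<^sup>2 * \<rho>\<^sup>2 * (4 * D1))" using kM(2) by (intro mult_left_mono) auto
    also have "\<dots> = b\<^sup>2 * (160 * \<rho>\<^sup>2 * D1)" using N0 by (simp add: power_mult_distrib power_divide field_simps)
    finally show ?thesis .
  qed
  have c6: "(1 / N)\<^sup>2 * ((2 * (N * b))\<^sup>2 * (\<integral>D. (rho_hat I S D - 1)\<^sup>2 \<partial>Q)) \<le> b\<^sup>2 * (16 * \<rho> * D1)"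
  proof -
    have "(\<integral>D. (rho_hat I S D - 1)\<^sup>2 \<partial>Q) \<le> cupp K * (1 / card I)" using t6(1) by simp
    also have "\<dots> \<le> \<rho> * (4 * D1)" using rho_facts C_ge_1 kM(2) by (intro mult_mono) auto
    finally have "(1 / N)\<^sup>2 * ((2 * (N * b))\<^sup>2 * (\<integral>D. (rho_hat I S D - 1)\<^sup>2 \<partial>Q)) \<le> (1 / N)\<^sup>2 * ((2 * (N * b))\<^sup>2 * (\<rho> * (4 * D1)))"
      by (intro mult_left_mono) auto
    also have "\<dots> = b\<^sup>2 * (16 * \<rho> * D1)" using N0 by (simp add: power_mult_distrib power_divide field_simps)
    finally show ?thesis .
  qed
  have "(1 / N)\<^sup>2 * (\<integral>D. F D \<partial>Q) \<le> 2 ^ ndim E * (e + b\<^sup>2 * \<tau>) + \<rho> * (e + b\<^sup>2 * \<tau>) + b\<^sup>2 * (34 * 4 ^ ndim E * D1 + 32 * LL\<^sup>2 * \<rho>\<^sup>2 * H2) + b\<^sup>2 * (160 * \<rho>\<^sup>2 * D1) + b\<^sup>2 * (16 * \<rho> * D1)"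
    unfolding FE distrib_left[of "(1 / N)\<^sup>2"]
    using mult_left_mono[OF t2, of "(1 / N)\<^sup>2"] mult_left_mono[OF t3, of "(1 / N)\<^sup>2"] c4 c5 c6 unfolding c2 c3
    by (intro add_mono) auto
  then have "(\<integral>D. (Del l (Suc m) S D (X 0 D))\<^sup>2 \<partial>Q) \<le> 6 * (e + (2 ^ ndim E * (e + b\<^sup>2 * \<tau>) + \<rho> * (e + b\<^sup>2 * \<tau>) + b\<^sup>2 * (34 * 4 ^ ndim E * D1 + 32 * LL\<^sup>2 * \<rho>\<^sup>2 * H2) + b\<^sup>2 * (160 * \<rho>\<^sup>2 * D1) + b\<^sup>2 * (16 * \<rho> * D1))) + (bnd (Suc m))\<^sup>2 * \<tau>"
    by (intro order_trans[OF main]) simp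
  also have "\<dots> = 6 * (1 + 2 ^ ndim E + \<rho>) * e + b\<^sup>2 * ((6 * 2 ^ ndim E + 6 * \<rho> + 9) * \<tau> + (204 * 4 ^ ndim E + 960 * \<rho>\<^sup>2 + 96 * \<rho>) * D1 + 192 * (LL\<^sup>2 * \<rho>\<^sup>2) * H2)"
    unfolding bnd_pos(3) b_def[symmetric] by (simp add: power_mult_distrib algebra_simps)
  also have "\<dots> \<le> 6 * (1 + 2 ^ ndim E + \<rho>) * e + b\<^sup>2 * ((1260 * \<mu>max\<^sup>2) * \<tau> + (1260 * \<mu>max\<^sup>2) * D1 + (1260 * \<mu>max\<^sup>2) * H2)"
  proof -
    note mf = mumax_facts
    have mm: "\<mu>max \<le> \<mu>max\<^sup>2" using mf(4) by (intro self_le_power) auto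
    have lr: "LL\<^sup>2 * \<rho>\<^sup>2 \<le> \<mu>max * \<mu>max" using mf by (intro mult_mono) auto
    \<comment> \<open>The largest of the three coefficients gives the constant:
      \<open>1260 = 204 + 960 + 96\<close>.\<close>
    have "6 * 2 ^ ndim E + 6 * \<rho> + 9 \<le> 1260 * \<mu>max\<^sup>2" "204 * 4 ^ ndim E + 960 * \<rho>\<^sup>2 + 96 * \<rho> \<le> 1260 * \<mu>max\<^sup>2" "192 * (LL\<^sup>2 * \<rho>\<^sup>2) \<le> 1260 * \<mu>max\<^sup>2"
      using mf mm lr unfolding power2_eq_square[of \<mu>max] by linarith+
    then show ?thesis using delta_facts(1,2) D10 unfolding H2_def
      by (intro add_left_mono mult_left_mono add_mono mult_right_mono) auto
  qed
  also have "\<dots> = 6 * (1 + 2 ^ ndim E + \<rho>) * e + 1260 * (bnd m)\<^sup>2 * \<mu>max\<^sup>2 * \<delta>"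
    unfolding \<delta>_def D1_def[symmetric] H2_def[symmetric] b_def by (simp add: algebra_simps)
  finally show ?thesis .
qed

text \<open>With the squared bound \<open>9 ^ m * a0\<^sup>2\<close> dominated by
  \<open>A_const E K ^ m\<close>, the recursion closes as soon as
  \<open>14 / 3 * A + 1260 \<le> 14 * A\<close>, that is for \<open>A \<ge> 135\<close>.\<close>

lemma Del_error:
  assumes l: "l \<in> {1, 2}"
  shows "m \<le> nsteps E \<Longrightarrow> S \<in> \<S> \<Longrightarrow> (\<integral>D. (Del l m S D (X 0 D))\<^sup>2 \<partial>Q) \<le> 14 * A_const E K ^ m * a0\<^sup>2 * \<mu>max\<^sup>2 * \<delta>"
proof (induction m arbitrary: S)
  case 0
  have "0 \<le> 14 * A_const E K ^ 0 * a0\<^sup>2 * \<mu>max\<^sup>2 * \<delta>" using delta_facts(8) by simp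
  then show ?case by (simp add: Del_def)
next
  case (Suc m)
  let ?A = "A_const E K"
  define y where "y = a0\<^sup>2 * \<mu>max\<^sup>2 * \<delta>"
  have y: "0 \<le> y" unfolding y_def using delta_facts(8) by simp
  have Ap: "0 \<le> ?A ^ m" using A_facts(2) by simp
  have "(\<integral>D. (Del l (Suc m) S D (X 0 D))\<^sup>2 \<partial>Q) \<le> 6 * (1 + 2 ^ ndim E + \<rho>) * (14 * ?A ^ m * a0\<^sup>2 * \<mu>max\<^sup>2 * \<delta>) + 1260 * (bnd m)\<^sup>2 * \<mu>max\<^sup>2 * \<delta>"
    by (rule step_error[OF l Suc.prems(1) Suc.IH Suc.prems(2)]) (use Suc.prems in auto)
  also have "\<dots> = 6 * (1 + 2 ^ ndim E + \<rho>) * (14 * ?A ^ m * y) + 1260 * 9 ^ m * y"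
    by (simp add: y_def bnd_def power_mult_distrib power2_eq_square flip: power_mult_distrib)
  also have "\<dots> \<le> ?A / 3 * (14 * ?A ^ m * y) + 1260 * ?A ^ m * y"
    using A_facts y Ap by (intro add_mono mult_right_mono mult_left_mono power_mono) auto
  also have "\<dots> \<le> 14 * ?A * (?A ^ m * y)"
  proof -
    have "140 * (?A ^ m * y) \<le> ?A * (?A ^ m * y)" using A_facts(2) y Ap by (intro mult_right_mono) auto
    moreover have "?A / 3 * (14 * ?A ^ m * y) = 14 / 3 * (?A * (?A ^ m * y))" by simp
    ultimately show ?thesis using mult_nonneg_nonneg[OF Ap y] by linarith
  qed
  finally show ?case unfolding y_def by (simp add: mult.assoc)
qed

end

section \<open>The remainder of the cross-fitting estimator\<close>

lemma bdm_cong_sets: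
  assumes "sets M = sets M'"
  shows "bdm M f \<longleftrightarrow> bdm M' f"
  unfolding bdm_def measurable_cong_sets[OF assms refl] sets_eq_imp_space_eq[OF assms] ..

context model
begin

abbreviation "MM \<equiv> nsteps E"
abbreviation Y :: "nat set \<Rightarrow> nat \<Rightarrow> (nat + nat set \<times> nat \<Rightarrow> point) \<Rightarrow> point" where "Y S j D \<equiv> D (Inr (S, j))"

definition "err = 14 * A_const E K ^ MM * a0\<^sup>2 * \<mu>max\<^sup>2 * \<delta>"
text \<open>The factor of \<open>D_const\<close> through which the smallest \<open>lam\<close>
  enters.\<close>

definition "\<Lambda> = 1 + 1 / Min (lam E ` \<S>)"
definition "b = bnd MM"

lemma b_pos: "1 \<le> b" "a0 \<le> b"
  unfolding b_def by (rule bnd_pos)+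

lemma Lambda_facts: "1 \<le> \<Lambda>" "S \<in> \<S> \<Longrightarrow> 1 / lam E S \<le> \<Lambda>"
proof -
  have fin: "finite (lam E ` \<S>)" "lam E ` \<S> \<noteq> {}" using finite_patterns patterns_ne by auto
  have m: "0 < Min (lam E ` \<S>)" using fin lam_pos by (subst Min_gr_iff) auto
  then show "1 \<le> \<Lambda>" by (simp add: \<Lambda>_def)
  assume S: "S \<in> \<S>"
  have "Min (lam E ` \<S>) \<le> lam E S" using fin S by (intro Min_le) auto
  then have "1 / lam E S \<le> 1 / Min (lam E ` \<S>)" using m lam_pos[OF S] by (intro divide_left_mono mult_pos_pos) auto
  then show "1 / lam E S \<le> \<Lambda>" by (simp add: \<Lambda>_def)
qed

text \<open>As \<open>n\<close> is at least 2, the assumed closeness puts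
  \<open>n * lam E S / nS E S\<close> between 1/2 and 3/2.\<close>

lemma nS_facts: assumes S: "S \<in> \<S>"
  shows "real n / real (nS E S) \<le> 3/2 * \<Lambda>" "1 / real (nS E S) \<le> 3/2 * \<Lambda> / real n" "1 / (2 * lam E S) \<le> real n / real (nS E S)"
    "0 < real (nS E S)"
proof -
  have np: "2 \<le> real n" "0 < real n" using n_pos by simp_all
  have l: "0 < lam E S" by (rule lam_pos[OF S])
  show k: "0 < real (nS E S)" using nS_pos[OF S] by simp
  have "1 / real n \<le> 1 / 2" using np by (intro divide_left_mono) auto
  then have h: "real n * lam E S / real (nS E S) \<le> 3 / 2" "1 / 2 \<le> real n * lam E S / real (nS E S)"
    using nlam[OF S] by linarith+
  have eq: "real n / real (nS E S) = (real n * lam E S / real (nS E S)) * (1 / lam E S)" using l by simp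
  have "real n / real (nS E S) \<le> 3/2 * (1 / lam E S)" unfolding eq using h l by (intro mult_right_mono) auto
  also have "\<dots> \<le> 3/2 * \<Lambda>" using Lambda_facts(2)[OF S] by simp
  finally show 1: "real n / real (nS E S) \<le> 3/2 * \<Lambda>" .
  have "1 / real (nS E S) = (real n / real (nS E S)) / real n" using np by simp
  also have "\<dots> \<le> 3/2 * \<Lambda> / real n" using 1 np by (intro divide_right_mono) auto
  finally show "1 / real (nS E S) \<le> 3/2 * \<Lambda> / real n" .
  have "1 / 2 * (1 / lam E S) \<le> real n / real (nS E S)" unfolding eq using h l by (intro mult_right_mono) auto
  then show "1 / (2 * lam E S) \<le> real n / real (nS E S)" by simp
qed

lemma half_card: assumes "l \<in> {1, 2}" shows "1 / real (card (half E l)) \<le> 3 / real n" "0 < real (card (half E l))"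
proof -
  have "1 \<le> card (half E l)" using half_facts(6)[OF assms] nsteps_pos by linarith
  moreover have "n \<le> 2 * card (half E l) + 1" by (rule half_facts(2)[OF assms])
  ultimately have "n \<le> 3 * card (half E l)" by linarith
  then have "real n \<le> 3 * real (card (half E l))" by linarith
  then show "0 < real (card (half E l))" "1 / real (card (half E l)) \<le> 3 / real n" using n_pos by (auto simp: field_simps)
qed

text \<open>The second bound lets \<open>err\<close> absorb every sampling error of parametric
  order: \<open>9 ^ MM\<close> is at most \<open>A_const E K ^ MM\<close> and \<open>1 / n\<close>
  at most \<open>\<delta>\<close>.\<close>

lemma err_facts: "0 \<le> err" "b\<^sup>2 / real n \<le> err"
proof -
  have A: "9 ^ MM \<le> A_const E K ^ MM" using A_facts(2) by (intro power_mono) auto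
  show 0: "0 \<le> err" unfolding err_def using A_facts(2) delta_facts(8) by simp
  have "b\<^sup>2 / real n = 1 * (9 ^ MM * a0\<^sup>2 * 1 * (1 / real n))"
    unfolding b_def bnd_def by (simp add: power_mult_distrib power2_eq_square flip: power_mult_distrib)
  also have "\<dots> \<le> 14 * (A_const E K ^ MM * a0\<^sup>2 * \<mu>max\<^sup>2 * \<delta>)"
  proof (intro mult_mono)
    show "1 \<le> \<mu>max\<^sup>2" using mumax_facts(4) by simp
  qed (use A delta_facts A_facts(2) in auto)
  finally show "b\<^sup>2 / real n \<le> err" by (simp add: err_def mult.assoc)
qed

lemma ah_upd:
  assumes l: "l \<in> {1, 2}" and k: "k \<notin> Inl ` half E l" and "m \<le> nsteps E"
  shows "alpha_hat E (D(k := y)) l m = alpha_hat E D l m"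
  by (rule ah_cong[OF l _ assms(3)]) (use k in auto)

lemma other_half: assumes "l \<in> {1, 2::nat}"
  shows "3 - l \<in> {1, 2}" "half E l \<inter> half E (3 - l) = {}" "Inl 0 \<notin> Inl ` half E l"
    "i \<in> half E (3 - l) \<Longrightarrow> Inl i \<notin> Inl ` half E l" "Inr z \<notin> Inl ` half E l"
proof -
  have l: "l = 1 \<or> l = 2" using assms by simp
  then show "3 - l \<in> {1, 2}" by auto
  have e: "(l = 1 \<and> 3 - l = 2) \<or> (l = 2 \<and> 3 - l = 1)" using l by auto
  show 1: "half E l \<inter> half E (3 - l) = {}" using e half_partition(2) by (metis Int_commute)
  show "Inl 0 \<notin> Inl ` half E l" using half_facts(5)[OF assms] by auto
  show "i \<in> half E (3 - l) \<Longrightarrow> Inl i \<notin> Inl ` half E l" using 1 by auto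
qed auto

lemma Y_measurable [measurable]: "S \<in> \<S> \<Longrightarrow> Y S j \<in> measurable Q (leb S)"
  using measurable_component_singleton[of "Inr (S, j)" UNIV Mf] by (simp add: measurable_cong_sets[OF refl sets_inc_law])

lemma bdm_joint_Y:
  assumes "S \<in> \<S>" "bdm (Q \<Otimes>\<^sub>M leb S) (\<lambda>(D, u). \<phi> D u)"
  shows "bdm Q (\<lambda>D. \<phi> D (Y S j D))"
  using bdm_comp[OF assms(2), of "\<lambda>D. (D, Y S j D)" Q] Y_measurable[OF assms(1)] by simp

lemma bdm_joint_restrict:
  assumes "S \<in> \<S>" "bdm (Q \<Otimes>\<^sub>M leb S) (\<lambda>(D, u). \<phi> D u)"
  shows "bdm (Q \<Otimes>\<^sub>M leb (coords E)) (\<lambda>(D, x). \<phi> D (restrict x S))"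
proof -
  have "(\<lambda>z. (fst z, restrict (snd z) S)) \<in> measurable (Q \<Otimes>\<^sub>M leb (coords E)) (Q \<Otimes>\<^sub>M leb S)"
    by (intro measurable_Pair measurable_fst measurable_compose[OF measurable_snd restr_measurable[OF assms(1)]])
  from bdm_comp[OF assms(2) this] show ?thesis by (simp add: case_prod_unfold)
qed

text \<open>A function of the data evaluated at the independent test point has the same mean as its
  population integral, which links the error bounds to conditional means given the data.\<close>

lemma integral_test_point:
  assumes "bdm (Q \<Otimes>\<^sub>M leb (coords E)) (\<lambda>(D, x). \<phi> D x)" "\<And>D y. \<phi> (D(Inl 0 := y)) = \<phi> D"
  shows "(\<integral>D. \<phi> D (X 0 D) \<partial>Q) = (\<integral>D. (\<integral>x. \<phi> D x \<partial>P) \<partial>Q)"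
  using resample[OF bdm_joint_X[OF assms(1), of 0], of "Inl 0"] assms(2) by simp

text \<open>Change of measure: an incomplete observation is replaced by the test point at the price
  of the density \<open>rbar\<close>, if the function involves neither of them.\<close>

lemma integral_Y:
  assumes S: "S \<in> \<S>" and \<phi>: "bdm (Q \<Otimes>\<^sub>M leb S) (\<lambda>(D, u). \<phi> D u)"
    and inv: "\<And>D y. \<phi> (D(Inl 0 := y)) = \<phi> D" "\<And>D y. \<phi> (D(Inr (S, j) := y)) = \<phi> D"
  shows "(\<integral>D. \<phi> D (Y S j D) \<partial>Q) = (\<integral>D. \<phi> D (restrict (X 0 D) S) * rbar E S (restrict (X 0 D) S) \<partial>Q)"
proof -
  have b: "bdm (Q \<Otimes>\<^sub>M leb S) (\<lambda>(D, u). \<phi> D u * rbar E S u)"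
    using bdm_mult[OF \<phi> bdm_comp[OF rbar_bdm[OF S] measurable_snd]] by (simp add: case_prod_unfold)
  have "(\<integral>D. \<phi> D (Y S j D) \<partial>Q) = (\<integral>D. (\<integral>u. \<phi> D u \<partial>inc_law S) \<partial>Q)"
    using resample[OF bdm_joint_Y[OF S \<phi>, of j], of "Inr (S, j)"] inv(2) S by simp
  also have "\<dots> = (\<integral>D. (\<integral>x. \<phi> D (restrict x S) * rbar E S (restrict x S) \<partial>P) \<partial>Q)"
  proof (rule Bochner_Integration.integral_cong[OF refl])
    fix D assume "D \<in> space Q"
    then have "\<phi> D \<in> borel_measurable (leb S)"
      using measurable_Pair2[OF bdm_measurable[OF \<phi>], of D] by simp
    then show "(\<integral>u. \<phi> D u \<partial>inc_law S) = (\<integral>x. \<phi> D (restrict x S) * rbar E S (restrict x S) \<partial>P)" by (rule integral_inc_law[OF S])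
  qed
  also have "\<dots> = (\<integral>D. \<phi> D (restrict (X 0 D) S) * rbar E S (restrict (X 0 D) S) \<partial>Q)"
    by (rule integral_test_point[OF bdm_joint_restrict[OF S b], symmetric]) (simp add: inv)
  finally show ?thesis .
qed

section \<open>Decomposition of the remainder given the fitting half\<close>

definition "DelY l S D u = alpha_hat E D l MM S u - pa MM S u"
text \<open>The mean of the fitting error at a fresh point, given the half used for fitting. Both
  averages of the estimator contain it, with opposite signs.\<close>

definition "dS l S D = (\<integral>x. Del l MM S D x \<partial>P)"

lemma Del_DelY: "Del l MM S D x = DelY l S D (restrict x S)"
  by (simp add: Del_def DelY_def)

lemma fix_u: "S \<in> \<S> \<Longrightarrow> bdm (leb S) g \<Longrightarrow> bdm (Q \<Otimes>\<^sub>M leb S) (\<lambda>(D, u). g u)"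
  using bdm_comp[OF _ measurable_snd, of "leb S" g Q] by (simp add: case_prod_unfold)

lemma DelY_bdm: assumes "l \<in> {1, 2}" "S \<in> \<S>" shows "bdm (Q \<Otimes>\<^sub>M leb S) (\<lambda>(D, u). DelY l S D u)"
  using bdm_diff[OF ah_bdm[OF assms(1) order_refl assms(2)] fix_u[OF assms(2) pa(1)[OF assms(2), of MM]]]
  by (simp add: DelY_def case_prod_unfold)

lemma DelY_upd: assumes "l \<in> {1, 2}" "k \<notin> Inl ` half E l" shows "DelY l S (D(k := y)) = DelY l S D" "Del l MM S (D(k := y)) = Del l MM S D"
  "dS l S (D(k := y)) = dS l S D"
  unfolding DelY_def dS_def Del_def ah_upd[OF assms order_refl] by simp_all

lemma inverse_rbar_bdm: assumes "S \<in> \<S>" shows "bdm (leb S) (\<lambda>u. 1 / rbar E S u)" "\<And>u. u \<in> space (leb S) \<Longrightarrow> 0 < 1 / rbar E S u \<and> 1 / rbar E S u \<le> \<rho>"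
proof -
  show b: "\<And>u. u \<in> space (leb S) \<Longrightarrow> 0 < 1 / rbar E S u \<and> 1 / rbar E S u \<le> \<rho>"
  proof
    fix u assume u: "u \<in> space (leb S)"
    have "1 / rbar E S u \<le> 1 / clow K" using rbar_bounds(1)[OF assms u] c_pos by (intro divide_left_mono mult_pos_pos) (auto intro: rbar_pos assms u)
    then show "1 / rbar E S u \<le> \<rho>" using rho_facts by simp
    show "0 < 1 / rbar E S u" using rbar_pos[OF assms u] by simp
  qed
  have [measurable]: "rbar E S \<in> borel_measurable (leb S)" by (rule rbar_measurable[OF assms])
  show "bdm (leb S) (\<lambda>u. 1 / rbar E S u)" by (rule bdmI[where B=\<rho>]) (use b in \<open>auto simp: less_imp_le\<close>)
qed

lemma DelX_sq: assumes l: "l \<in> {1, 2}" and S: "S \<in> \<S>" shows "(\<integral>D. (Del l MM S D (X 0 D))\<^sup>2 \<partial>Q) \<le> err"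
  unfolding err_def by (rule Del_error[OF l order_refl S])

lemma Del2_joint: assumes "l \<in> {1, 2}" "S \<in> \<S>" shows "bdm (Q \<Otimes>\<^sub>M leb (coords E)) (\<lambda>(D, x). (Del l MM S D x)\<^sup>2)"
  using bdm_power[OF Del_bdm[OF assms(1) order_refl assms(2)], of 2] by (simp add: case_prod_unfold)

lemma Del_section: assumes "l \<in> {1, 2}" "S \<in> \<S>" "D \<in> space Q" shows "bdm P (Del l MM S D)"
  using bdm_comp[OF Del_bdm[OF assms(1) order_refl assms(2)], of "\<lambda>x. (D, x)" "leb (coords E)"] assms(3) by (simp add: bdm_law)

lemma dS_sq: assumes l: "l \<in> {1, 2}" and S: "S \<in> \<S>"
  shows "bdm Q (dS l S)" "(\<integral>D. (dS l S D)\<^sup>2 \<partial>Q) \<le> err"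
proof -
  note QP = bdm_cong_sets[OF sets_pair_measure_cong[OF refl sets_law], of Q]
  have j: "bdm (Q \<Otimes>\<^sub>M P) (\<lambda>(D, x). Del l MM S D x)" "bdm (Q \<Otimes>\<^sub>M P) (\<lambda>(D, x). (Del l MM S D x)\<^sup>2)"
    unfolding QP by (rule Del_bdm[OF l order_refl S], rule Del2_joint[OF l S])
  show b: "bdm Q (dS l S)" unfolding dS_def by (rule bdm_integral[OF prob_law j(1)])
  have b2: "bdm Q (\<lambda>D. \<integral>x. (Del l MM S D x)\<^sup>2 \<partial>P)" by (rule bdm_integral[OF prob_law j(2)])
  have "(\<integral>D. (dS l S D)\<^sup>2 \<partial>Q) \<le> (\<integral>D. (\<integral>x. (Del l MM S D x)\<^sup>2 \<partial>P) \<partial>Q)"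
    by (rule Q.bdm_integral_le[OF bdm_power[OF b] b2]) (unfold dS_def, rule P.square_expectation_le, rule Del_section[OF l S])
  also have "\<dots> = (\<integral>D. (Del l MM S D (X 0 D))\<^sup>2 \<partial>Q)"
    by (rule integral_test_point[OF Del2_joint[OF l S], symmetric]) (simp add: DelY_upd[OF l other_half(3)[OF l]])
  also have "\<dots> \<le> err" by (rule DelX_sq[OF l S])
  finally show "(\<integral>D. (dS l S D)\<^sup>2 \<partial>Q) \<le> err" .
qed

lemma diff_square_le: "(x - y)\<^sup>2 \<le> 2 * x\<^sup>2 + 2 * y\<^sup>2" for x y :: real
  using zero_le_power2[of "x + y"] by (simp add: power2_eq_square algebra_simps)

lemma sum_square_le: "(x + y)\<^sup>2 \<le> 2 * x\<^sup>2 + 2 * y\<^sup>2" for x y :: real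
  using zero_le_power2[of "x - y"] by (simp add: power2_eq_square algebra_simps)

lemma centred_average_le:
  assumes J: "finite J" "J \<noteq> {}" and \<xi>: "\<And>i. i \<in> J \<Longrightarrow> bdm Q (\<xi> i)"
    and c: "\<And>i D. i \<in> J \<Longrightarrow> D \<in> space Q \<Longrightarrow> (\<integral>y. \<xi> i (D(idx i := y)) \<partial>Mf (idx i)) = 0"
    and inv: "\<And>i j D y. i \<in> J \<Longrightarrow> j \<in> J \<Longrightarrow> i \<noteq> j \<Longrightarrow> \<xi> j (D(idx i := y)) = \<xi> j D"
    and v: "\<And>i. i \<in> J \<Longrightarrow> (\<integral>D. (\<xi> i D)\<^sup>2 \<partial>Q) \<le> v"
  shows "(\<integral>D. (average J (\<lambda>i. \<xi> i D))\<^sup>2 \<partial>Q) \<le> v * (1 / real (card J))"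
proof -
  have k: "0 < real (card J)" using J by (simp add: card_gt_0_iff)
  have "(\<integral>D. (average J (\<lambda>i. \<xi> i D))\<^sup>2 \<partial>Q) = (\<integral>D. (\<Sum>i\<in>J. \<xi> i D)\<^sup>2 \<partial>Q) / (real (card J))\<^sup>2"
    by (simp add: average_def power_divide)
  also have "(\<integral>D. (\<Sum>i\<in>J. \<xi> i D)\<^sup>2 \<partial>Q) = (\<Sum>i\<in>J. \<integral>D. (\<xi> i D)\<^sup>2 \<partial>Q)"
    by (rule centred_sum_coords[where idx=idx, OF J(1) \<xi> c inv])
  also have "\<dots> / (real (card J))\<^sup>2 \<le> real (card J) * v / (real (card J))\<^sup>2"
    using sum_bounded_above[of J "\<lambda>i. \<integral>D. (\<xi> i D)\<^sup>2 \<partial>Q" v] v by (intro divide_right_mono) auto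
  also have "\<dots> = v * (1 / real (card J))" using k by (simp add: power2_eq_square)
  finally show ?thesis .
qed

text \<open>\<open>remA\<close> and \<open>remB\<close> are the fluctuations of the fitting error
  around \<open>dS\<close>, over the complete observations of the other half and over the incomplete
  ones; \<open>remC\<close> is the effect of estimating the normaliser.\<close>

definition "remA l S D = average (half E (3 - l)) (\<lambda>i. Del l MM S D (X i D) - dS l S D)"
definition "remB l S D = average {1..nS E S} (\<lambda>j. DelY l S D (Y S j D) * (1 / rbar E S (Y S j D)) - dS l S D)"
definition "remY l S D = average {1..nS E S} (\<lambda>j. alpha_hat E D l MM S (Y S j D) * (1 / rbar E S (Y S j D)))"
definition "remC l S D = (rho_hat (half E (3 - l)) S D - 1) * remY l S D"

lemma remA: assumes l: "l \<in> {1, 2}" and S: "S \<in> \<S>"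
  shows "bdm Q (remA l S)" "(\<integral>D. (remA l S D)\<^sup>2 \<partial>Q) \<le> 12 * err / real n"
proof -
  let ?H = "half E (3 - l)"
  note l' = other_half(1)[OF l] and H = half_facts[OF other_half(1)[OF l]]
  have bD: "bdm Q (\<lambda>D. Del l MM S D (X i D))" for i by (rule bdm_joint_X[OF Del_bdm[OF l order_refl S]])
  have b: "bdm Q (\<lambda>D. Del l MM S D (X i D) - dS l S D)" for i by (intro bdm_diff bD dS_sq l S)
  show "bdm Q (remA l S)" unfolding remA_def[abs_def] average_def by (intro bdm_divide_const bdm_sum b)
  have up: "k \<notin> Inl ` half E l \<Longrightarrow> Del l MM S (D(k := y)) = Del l MM S D \<and> dS l S (D(k := y)) = dS l S D" for k D y
    using DelY_upd[OF l] by blast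
  have "(\<integral>D. (remA l S D)\<^sup>2 \<partial>Q) \<le> 4 * err * (1 / real (card ?H))"
    unfolding remA_def
  proof (rule centred_average_le[where idx=Inl, OF H(3,4) b])
    fix i D assume i: "i \<in> ?H" and D: "D \<in> space Q"
    have "(\<integral>y. Del l MM S D y - dS l S D \<partial>P) = 0"
      using P.bdm_integral_diff[OF Del_section[OF l S D] bdm_const, of "dS l S D"] by (simp add: dS_def P.prob_space)
    then show "(\<integral>y. Del l MM S (D(Inl i := y)) (X i (D(Inl i := y))) - dS l S (D(Inl i := y)) \<partial>Mf (Inl i)) = 0"
      using up[OF other_half(4)[OF l i]] by simp
  next
    fix i j D y assume "i \<in> ?H" "j \<in> ?H" "i \<noteq> j"
    then show "Del l MM S (D(Inl i := y)) (X j (D(Inl i := y))) - dS l S (D(Inl i := y)) = Del l MM S D (X j D) - dS l S D"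
      using up[OF other_half(4)[OF l]] by simp
  next
    fix i assume i: "i \<in> ?H"
    have i0: "i \<noteq> 0" using i H(5) by metis
    have "(\<integral>D. (Del l MM S D (X i D) - dS l S D)\<^sup>2 \<partial>Q) \<le> (\<integral>D. 2 * (Del l MM S D (X i D))\<^sup>2 + 2 * (dS l S D)\<^sup>2 \<partial>Q)"
      by (intro Q.bdm_integral_le bdm_power b bdm_add bdm_mult bdm_const bD dS_sq l S diff_square_le)
    also have "\<dots> = 2 * (\<integral>D. (Del l MM S D (X i D))\<^sup>2 \<partial>Q) + 2 * (\<integral>D. (dS l S D)\<^sup>2 \<partial>Q)"
      using Q.integrable_bdm[OF bdm_power[OF bD]] Q.integrable_bdm[OF bdm_power[OF dS_sq(1)[OF l S]]] by simp
    also have "(\<integral>D. (Del l MM S D (X i D))\<^sup>2 \<partial>Q) = (\<integral>D. (Del l MM S D (X 0 D))\<^sup>2 \<partial>Q)"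
    proof (rule integral_swap_point[OF Del2_joint[OF l S] i0])
      fix D
      have "Del l MM S (swp i D) = Del l MM S D" using up[OF other_half(4)[OF l i]] up[OF other_half(3)[OF l]] by metis
      then show "(\<lambda>x. (Del l MM S (swp i D) x)\<^sup>2) = (\<lambda>x. (Del l MM S D x)\<^sup>2)" by simp
    qed
    finally show "(\<integral>D. (Del l MM S D (X i D) - dS l S D)\<^sup>2 \<partial>Q) \<le> 4 * err"
      using DelX_sq[OF l S] dS_sq(2)[OF l S] by linarith
  qed
  also have "\<dots> \<le> 4 * err * (3 / real n)" using half_card(1)[OF l'] err_facts by (intro mult_left_mono) auto
  finally show "(\<integral>D. (remA l S D)\<^sup>2 \<partial>Q) \<le> 12 * err / real n" by simp
qed

text \<open>Squaring brings \<open>1 / rbar\<close> twice and the density of the incomplete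
  observation removes one of them, so a single factor \<open>\<rho>\<close> is lost.\<close>

lemma DelY_weighted: assumes l: "l \<in> {1, 2}" and S: "S \<in> \<S>"
  shows "bdm (Q \<Otimes>\<^sub>M leb S) (\<lambda>(D, u). DelY l S D u * (1 / rbar E S u))"
    "(\<integral>D. (DelY l S D (Y S j D) * (1 / rbar E S (Y S j D)))\<^sup>2 \<partial>Q) \<le> \<rho> * err"
proof -
  show b: "bdm (Q \<Otimes>\<^sub>M leb S) (\<lambda>(D, u). DelY l S D u * (1 / rbar E S u))"
    using bdm_mult[OF DelY_bdm[OF l S] fix_u[OF S inverse_rbar_bdm(1)[OF S]]] by (simp add: case_prod_unfold)
  have b2: "bdm (Q \<Otimes>\<^sub>M leb S) (\<lambda>(D, u). (DelY l S D u * (1 / rbar E S u))\<^sup>2)"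
    using bdm_power[OF b, of 2] by (simp add: case_prod_unfold)
  have b3: "bdm (Q \<Otimes>\<^sub>M leb S) (\<lambda>(D, u). (DelY l S D u * (1 / rbar E S u))\<^sup>2 * rbar E S u)"
    using bdm_mult[OF b2 fix_u[OF S rbar_bdm[OF S]]] by (simp add: case_prod_unfold)
  have "(\<integral>D. (DelY l S D (Y S j D) * (1 / rbar E S (Y S j D)))\<^sup>2 \<partial>Q)
     = (\<integral>D. (DelY l S D (restrict (X 0 D) S) * (1 / rbar E S (restrict (X 0 D) S)))\<^sup>2 * rbar E S (restrict (X 0 D) S) \<partial>Q)"
    by (rule integral_Y[OF S b2]) (simp_all add: DelY_upd[OF l other_half(3)[OF l]] DelY_upd[OF l other_half(5)[OF l]])
  also have "\<dots> \<le> (\<integral>D. \<rho> * (Del l MM S D (X 0 D))\<^sup>2 \<partial>Q)"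
  proof (rule Q.bdm_integral_le)
    show "bdm Q (\<lambda>D. (DelY l S D (restrict (X 0 D) S) * (1 / rbar E S (restrict (X 0 D) S)))\<^sup>2 * rbar E S (restrict (X 0 D) S))"
      by (rule bdm_joint_X[OF bdm_joint_restrict[OF S b3]])
    show "bdm Q (\<lambda>D. \<rho> * (Del l MM S D (X 0 D))\<^sup>2)" by (intro bdm_mult bdm_const bdm_joint_X[OF Del2_joint[OF l S]])
    fix D assume D: "D \<in> space Q"
    let ?u = "restrict (X 0 D) S"
    have u: "?u \<in> space (leb S)" by (intro restr_space S X_space D)
    have "(DelY l S D ?u * (1 / rbar E S ?u))\<^sup>2 * rbar E S ?u = (DelY l S D ?u)\<^sup>2 * (1 / rbar E S ?u)"
      using rbar_pos[OF S u] by (simp add: power2_eq_square)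
    also have "\<dots> \<le> (DelY l S D ?u)\<^sup>2 * \<rho>" using inverse_rbar_bdm(2)[OF S u] by (intro mult_left_mono) auto
    finally show "(DelY l S D ?u * (1 / rbar E S ?u))\<^sup>2 * rbar E S ?u \<le> \<rho> * (Del l MM S D (X 0 D))\<^sup>2"
      by (simp add: Del_DelY mult.commute)
  qed
  also have "\<dots> = \<rho> * (\<integral>D. (Del l MM S D (X 0 D))\<^sup>2 \<partial>Q)" by simp
  also have "\<dots> \<le> \<rho> * err" using DelX_sq[OF l S] rho_facts by (intro mult_left_mono) auto
  finally show "(\<integral>D. (DelY l S D (Y S j D) * (1 / rbar E S (Y S j D)))\<^sup>2 \<partial>Q) \<le> \<rho> * err" .
qed

lemma inc_set: "S \<in> \<S> \<Longrightarrow> finite {1..nS E S} \<and> {1..nS E S} \<noteq> {} \<and> card {1..nS E S} = nS E S"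
  using nS_pos[of S] by auto

lemma remB: assumes l: "l \<in> {1, 2}" and S: "S \<in> \<S>"
  shows "bdm Q (remB l S)" "(\<integral>D. (remB l S D)\<^sup>2 \<partial>Q) \<le> 6 * \<rho> * \<Lambda> * err / real n"
proof -
  have bW: "bdm Q (\<lambda>D. DelY l S D (Y S j D) * (1 / rbar E S (Y S j D)))" for j
    using bdm_joint_Y[OF S DelY_weighted(1)[OF l S]] .
  have b: "bdm Q (\<lambda>D. DelY l S D (Y S j D) * (1 / rbar E S (Y S j D)) - dS l S D)" for j by (intro bdm_diff bW dS_sq l S)
  show "bdm Q (remB l S)" unfolding remB_def[abs_def] average_def by (intro bdm_divide_const bdm_sum b)
  have up: "DelY l S (D(Inr z := y)) = DelY l S D" "dS l S (D(Inr z := y)) = dS l S D" for z D y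
    using DelY_upd[OF l other_half(5)[OF l]] by blast+
  interpret I: prob_space "inc_law S" by (rule prob_inc_law[OF S])
  have "(\<integral>D. (remB l S D)\<^sup>2 \<partial>Q) \<le> 4 * \<rho> * err * (1 / real (card {1..nS E S}))"
    unfolding remB_def
  proof (rule centred_average_le[where idx="\<lambda>j. Inr (S, j)"])
    show "finite {1..nS E S}" "{1..nS E S} \<noteq> {}" using inc_set[OF S] by auto
    show "bdm Q (\<lambda>D. DelY l S D (Y S j D) * (1 / rbar E S (Y S j D)) - dS l S D)" for j by (rule b)
    fix j D assume D: "D \<in> space Q"
    have bs: "bdm (leb S) (\<lambda>u. DelY l S D u * (1 / rbar E S u))"
      using bdm_comp[OF DelY_weighted(1)[OF l S], of "\<lambda>u. (D, u)" "leb S"] D by simp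
    then have bI: "bdm (inc_law S) (\<lambda>u. DelY l S D u * (1 / rbar E S u))"
      by (simp add: bdm_def measurable_cong_sets[OF sets_inc_law refl])
    have "(\<integral>u. DelY l S D u * (1 / rbar E S u) \<partial>inc_law S) = (\<integral>x. DelY l S D (restrict x S) * (1 / rbar E S (restrict x S)) * rbar E S (restrict x S) \<partial>P)"
      by (rule integral_inc_law[OF S bdm_measurable[OF bs]])
    also have "\<dots> = dS l S D"
      unfolding dS_def
    proof (rule Bochner_Integration.integral_cong[OF refl])
      fix x assume "x \<in> space P"
      then have "restrict x S \<in> space (leb S)" using restr_space[OF S] by simp
      then show "DelY l S D (restrict x S) * (1 / rbar E S (restrict x S)) * rbar E S (restrict x S) = Del l MM S D x"
        using rbar_pos[OF S] by (simp add: Del_DelY less_imp_neq[symmetric])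
    qed
    finally have "(\<integral>u. DelY l S D u * (1 / rbar E S u) - dS l S D \<partial>inc_law S) = 0"
      using I.bdm_integral_diff[OF bI bdm_const, of "dS l S D"] by (simp add: I.prob_space[unfolded space_inc_law])
    then show "(\<integral>y. DelY l S (D(Inr (S, j) := y)) (Y S j (D(Inr (S, j) := y))) * (1 / rbar E S (Y S j (D(Inr (S, j) := y)))) - dS l S (D(Inr (S, j) := y)) \<partial>Mf (Inr (S, j))) = 0"
      using S by (simp add: up)
  next
    fix i j :: nat and D y assume "i \<noteq> j"
    then show "DelY l S (D(Inr (S, i) := y)) (Y S j (D(Inr (S, i) := y))) * (1 / rbar E S (Y S j (D(Inr (S, i) := y)))) - dS l S (D(Inr (S, i) := y)) = DelY l S D (Y S j D) * (1 / rbar E S (Y S j D)) - dS l S D"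
      by (simp add: up)
  next
    fix j
    have "(\<integral>D. (DelY l S D (Y S j D) * (1 / rbar E S (Y S j D)) - dS l S D)\<^sup>2 \<partial>Q) \<le> (\<integral>D. 2 * (DelY l S D (Y S j D) * (1 / rbar E S (Y S j D)))\<^sup>2 + 2 * (dS l S D)\<^sup>2 \<partial>Q)"
      by (intro Q.bdm_integral_le bdm_power b bdm_add[OF bdm_mult[OF bdm_const bdm_power[OF bW]] bdm_mult[OF bdm_const bdm_power[OF dS_sq(1)[OF l S]]]] diff_square_le)
    also have "\<dots> = 2 * (\<integral>D. (DelY l S D (Y S j D) * (1 / rbar E S (Y S j D)))\<^sup>2 \<partial>Q) + 2 * (\<integral>D. (dS l S D)\<^sup>2 \<partial>Q)"
      using Q.integrable_bdm[OF bdm_power[OF bW, of j 2]] Q.integrable_bdm[OF bdm_power[OF dS_sq(1)[OF l S], of 2]] by simp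
    also have "\<dots> \<le> 2 * (\<rho> * err) + 2 * (\<rho> * err)"
    proof -
      have "1 * err \<le> \<rho> * err" using rho_facts err_facts by (intro mult_right_mono) auto
      then show ?thesis using DelY_weighted(2)[OF l S, of j] dS_sq(2)[OF l S] by linarith
    qed
    finally show "(\<integral>D. (DelY l S D (Y S j D) * (1 / rbar E S (Y S j D)) - dS l S D)\<^sup>2 \<partial>Q) \<le> 4 * \<rho> * err" by simp
  qed
  also have "\<dots> \<le> 4 * \<rho> * err * (3/2 * \<Lambda> / real n)"
    using nS_facts(2)[OF S] inc_set[OF S] err_facts rho_facts by (intro mult_left_mono) auto
  finally show "(\<integral>D. (remB l S D)\<^sup>2 \<partial>Q) \<le> 6 * \<rho> * \<Lambda> * err / real n" by (simp add: mult_ac)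
qed

text \<open>Inverse weighting undoes the density \<open>rbar\<close>, so the population terms at
  incomplete observations are centred because the iterates are.\<close>

lemma pa_weighted: assumes S: "S \<in> \<S>"
  shows "bdm (leb S) (\<lambda>u. pa MM S u * (1 / rbar E S u))"
    "(\<integral>u. pa MM S u * (1 / rbar E S u) \<partial>inc_law S) = 0"
    "(\<integral>u. (pa MM S u * (1 / rbar E S u))\<^sup>2 \<partial>inc_law S) = (\<integral>x. (pa MM S (restrict x S))\<^sup>2 * (1 / rbar E S (restrict x S)) \<partial>P)"
    "(\<integral>x. (pa MM S (restrict x S))\<^sup>2 * (1 / rbar E S (restrict x S)) \<partial>P) \<le> \<rho> * b\<^sup>2"
proof -
  show bs: "bdm (leb S) (\<lambda>u. pa MM S u * (1 / rbar E S u))" by (intro bdm_mult pa(1) S inverse_rbar_bdm(1))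
  have nz: "rbar E S (restrict x S) \<noteq> 0" if "x \<in> space P" for x
    using rbar_pos[OF S restr_space[OF S, of x]] that by simp
  have "(\<integral>u. pa MM S u * (1 / rbar E S u) \<partial>inc_law S) = (\<integral>x. pa MM S (restrict x S) * (1 / rbar E S (restrict x S)) * rbar E S (restrict x S) \<partial>P)"
    by (rule integral_inc_law[OF S bdm_measurable[OF bs]])
  also have "\<dots> = (\<integral>x. pa MM S (restrict x S) \<partial>P)"
    by (rule Bochner_Integration.integral_cong[OF refl]) (simp add: nz)
  finally show "(\<integral>u. pa MM S u * (1 / rbar E S u) \<partial>inc_law S) = 0" by (simp add: pa_mean[OF S])
  have "(\<integral>u. (pa MM S u * (1 / rbar E S u))\<^sup>2 \<partial>inc_law S) = (\<integral>x. (pa MM S (restrict x S) * (1 / rbar E S (restrict x S)))\<^sup>2 * rbar E S (restrict x S) \<partial>P)"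
    by (rule integral_inc_law[OF S bdm_measurable[OF bdm_power[OF bs]]])
  also have "\<dots> = (\<integral>x. (pa MM S (restrict x S))\<^sup>2 * (1 / rbar E S (restrict x S)) \<partial>P)"
    by (rule Bochner_Integration.integral_cong[OF refl]) (simp add: nz power2_eq_square)
  finally show "(\<integral>u. (pa MM S u * (1 / rbar E S u))\<^sup>2 \<partial>inc_law S) = (\<integral>x. (pa MM S (restrict x S))\<^sup>2 * (1 / rbar E S (restrict x S)) \<partial>P)" .
  show "(\<integral>x. (pa MM S (restrict x S))\<^sup>2 * (1 / rbar E S (restrict x S)) \<partial>P) \<le> \<rho> * b\<^sup>2"
  proof (rule P.integral_le_const_bdm)
    show "bdm P (\<lambda>x. (pa MM S (restrict x S))\<^sup>2 * (1 / rbar E S (restrict x S)))"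
      by (rule bdm_restrict[OF S bdm_mult[OF bdm_power[OF pa(1)[OF S]] inverse_rbar_bdm(1)[OF S]]])
    fix x assume "x \<in> space P"
    then have u: "restrict x S \<in> space (leb S)" using restr_space[OF S] by simp
    have "\<bar>pa MM S (restrict x S)\<bar>\<^sup>2 * (1 / rbar E S (restrict x S)) \<le> b\<^sup>2 * \<rho>"
      using inverse_rbar_bdm(2)[OF S u] unfolding b_def by (intro mult_mono power_mono pa S u) auto
    then show "(pa MM S (restrict x S))\<^sup>2 * (1 / rbar E S (restrict x S)) \<le> \<rho> * b\<^sup>2" by (simp only: power2_abs mult.commute)
  qed
qed

lemma average_square_le:
  fixes f :: "'x \<Rightarrow> real"
  assumes "finite J"
  shows "(average J f)\<^sup>2 \<le> average J (\<lambda>i. (f i)\<^sup>2)"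
proof (cases "J = {}")
  case False
  then have k: "0 < real (card J)" using assms by (simp add: card_gt_0_iff)
  have "(sum f J)\<^sup>2 / (real (card J))\<^sup>2 \<le> real (card J) * (\<Sum>i\<in>J. (f i)\<^sup>2) / (real (card J))\<^sup>2"
    by (intro divide_right_mono sum_squared_le_card) simp
  then show ?thesis using k by (simp add: average_def power_divide power2_eq_square)
qed (simp add: average_def)

lemma integral_average_le:
  assumes "finite J" "J \<noteq> {}" "\<And>i. i \<in> J \<Longrightarrow> bdm Q (f i)" "\<And>i. i \<in> J \<Longrightarrow> (\<integral>D. f i D \<partial>Q) \<le> c"
  shows "(\<integral>D. average J (\<lambda>i. f i D) \<partial>Q) \<le> c"
proof -
  have k: "0 < real (card J)" using assms by (simp add: card_gt_0_iff)
  have "(\<integral>D. average J (\<lambda>i. f i D) \<partial>Q) = (\<Sum>i\<in>J. \<integral>D. f i D \<partial>Q) / card J"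
    by (simp add: average_def Q.bdm_integral_sum[OF assms(3)])
  also have "\<dots> \<le> c" using sum_bounded_above[of J "\<lambda>i. \<integral>D. f i D \<partial>Q" c] assms(4) k by (simp add: pos_divide_le_eq mult.commute)
  finally show ?thesis .
qed

text \<open>The average itself is small: its population part is a centred mean of variance at most
  of order \<open>b\<^sup>2 / n\<close>, hence below \<open>err\<close> up to constants, and the
  fitting error is handled by Jensen's inequality.\<close>

lemma remY: assumes l: "l \<in> {1, 2}" and S: "S \<in> \<S>"
  shows "bdm Q (remY l S)" "(\<integral>D. (remY l S D)\<^sup>2 \<partial>Q) \<le> 5 * \<rho> * \<Lambda> * err"
proof -
  let ?J = "{1..nS E S}"
  note J = inc_set[OF S]
  have bW: "bdm Q (\<lambda>D. DelY l S D (Y S j D) * (1 / rbar E S (Y S j D)))" for j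
    using bdm_joint_Y[OF S DelY_weighted(1)[OF l S]] .
  have bp: "bdm Q (\<lambda>D. pa MM S (Y S j D) * (1 / rbar E S (Y S j D)))" for j
    by (rule bdm_comp[OF pa_weighted(1)[OF S] Y_measurable[OF S]])
  let ?p = "\<lambda>D. average ?J (\<lambda>j. pa MM S (Y S j D) * (1 / rbar E S (Y S j D)))"
  let ?d = "\<lambda>D. average ?J (\<lambda>j. DelY l S D (Y S j D) * (1 / rbar E S (Y S j D)))"
  have eq: "remY l S D = ?p D + ?d D" for D
    unfolding remY_def average_def DelY_def by (simp add: diff_divide_distrib sum_subtractf)
  have b1: "bdm Q ?p" unfolding average_def by (intro bdm_divide_const bdm_sum bp)
  have b2: "bdm Q ?d" unfolding average_def by (intro bdm_divide_const bdm_sum bW)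
  show "bdm Q (remY l S)" unfolding eq[abs_def] by (intro bdm_add b1 b2)
  have 1: "(\<integral>D. (?p D)\<^sup>2 \<partial>Q) \<le> \<rho> * b\<^sup>2 * (1 / real (card ?J))"
  proof (rule centred_average_le[where idx="\<lambda>j. Inr (S, j)"])
    fix j assume "j \<in> ?J"
    have "(\<integral>D. (pa MM S (Y S j D) * (1 / rbar E S (Y S j D)))\<^sup>2 \<partial>Q) = (\<integral>u. (pa MM S u * (1 / rbar E S u))\<^sup>2 \<partial>Mf (Inr (S, j)))"
      using bdm_measurable[OF bdm_power[OF pa_weighted(1)[OF S], of 2]] S
      by (intro integral_coord) (simp add: measurable_cong_sets[OF sets_inc_law refl])
    then show "(\<integral>D. (pa MM S (Y S j D) * (1 / rbar E S (Y S j D)))\<^sup>2 \<partial>Q) \<le> \<rho> * b\<^sup>2"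
      using pa_weighted(3,4)[OF S] S by simp
  qed (use J bp pa_weighted(2)[OF S] S in auto)
  have "\<rho> * b\<^sup>2 * (1 / real (card ?J)) \<le> \<rho> * b\<^sup>2 * (3/2 * \<Lambda> / real n)"
    using nS_facts(2)[OF S] J rho_facts by (intro mult_left_mono) auto
  also have "\<dots> = 3/2 * \<rho> * \<Lambda> * (b\<^sup>2 / real n)" by simp
  also have "\<dots> \<le> 3/2 * \<rho> * \<Lambda> * err" using err_facts rho_facts Lambda_facts(1) by (intro mult_left_mono) auto
  finally have p1: "(\<integral>D. (?p D)\<^sup>2 \<partial>Q) \<le> 3/2 * \<rho> * \<Lambda> * err" using 1 by linarith
  have 2: "(\<integral>D. (?d D)\<^sup>2 \<partial>Q) \<le> \<rho> * err"
  proof -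
    have "(\<integral>D. (?d D)\<^sup>2 \<partial>Q) \<le> (\<integral>D. average ?J (\<lambda>j. (DelY l S D (Y S j D) * (1 / rbar E S (Y S j D)))\<^sup>2) \<partial>Q)"
      by (rule Q.bdm_integral_le[OF bdm_power[OF b2] _ average_square_le]) (use J in \<open>unfold average_def, intro bdm_divide_const bdm_sum bdm_power bW | simp\<close>)+
    also have "\<dots> \<le> \<rho> * err" by (rule integral_average_le[OF _ _ bdm_power[OF bW] DelY_weighted(2)[OF l S]]) (use J in auto)
    finally show ?thesis .
  qed
  have "\<rho> * 1 * err \<le> \<rho> * \<Lambda> * err" using rho_facts Lambda_facts(1) err_facts by (intro mult_right_mono mult_left_mono) auto
  moreover have "(\<integral>D. (remY l S D)\<^sup>2 \<partial>Q) \<le> (\<integral>D. 2 * (?p D)\<^sup>2 + 2 * (?d D)\<^sup>2 \<partial>Q)"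
    unfolding eq by (intro Q.bdm_integral_le bdm_add bdm_mult bdm_const bdm_power b1 b2 bdm_power[OF bdm_add[OF b1 b2]] sum_square_le)
  moreover have "(\<integral>D. 2 * (?p D)\<^sup>2 + 2 * (?d D)\<^sup>2 \<partial>Q) = 2 * (\<integral>D. (?p D)\<^sup>2 \<partial>Q) + 2 * (\<integral>D. (?d D)\<^sup>2 \<partial>Q)"
    using Q.integrable_bdm[OF bdm_power[OF b1, of 2]] Q.integrable_bdm[OF bdm_power[OF b2, of 2]] by simp
  ultimately show "(\<integral>D. (remY l S D)\<^sup>2 \<partial>Q) \<le> 5 * \<rho> * \<Lambda> * err" using p1 2 by simp
qed

text \<open>A product of two small factors. \<open>remY\<close> involves the fitting half and the
  incomplete data, \<open>rho_hat\<close> the other half, so \<open>remC\<close> is a centred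
  average over that half and gains a further \<open>1 / n\<close>.\<close>

lemma remC: assumes l: "l \<in> {1, 2}" and S: "S \<in> \<S>"
  shows "bdm Q (remC l S)" "(\<integral>D. (remC l S D)\<^sup>2 \<partial>Q) \<le> 15 * \<rho> ^ 3 * \<Lambda> * err / real n"
proof -
  let ?H = "half E (3 - l)"
  note l' = other_half(1)[OF l] and H = half_facts[OF other_half(1)[OF l]]
  note Yb = remY[OF l S]
  let ?x = "\<lambda>i D. (rbar E S (restrict (X i D) S) - 1) * remY l S D"
  have b: "bdm Q (?x i)" for i by (intro bdm_mult bdm_diff rbar_X_bdm S bdm_const Yb)
  show "bdm Q (remC l S)" unfolding remC_def[abs_def] by (intro bdm_mult bdm_diff rho_hat_bdm S bdm_const Yb)
  have k: "real (card ?H) \<noteq> 0" using half_card(2)[OF l'] by simp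
  have eq: "remC l S D = average ?H (\<lambda>i. ?x i D)" for D
    unfolding remC_def rho_hat_def average_def using k
    by (simp add: sum_distrib_right[symmetric] sum_subtractf diff_divide_distrib left_diff_distrib)
  have up: "remY l S (D(Inl i := y)) = remY l S D" if "i \<in> ?H" for i D y
    unfolding remY_def using ah_upd[OF l other_half(4)[OF l that] order_refl] by simp
  have "(\<integral>D. (remC l S D)\<^sup>2 \<partial>Q) \<le> (cupp K)\<^sup>2 * (5 * \<rho> * \<Lambda> * err) * (1 / real (card ?H))"
    unfolding eq
  proof (rule centred_average_le[where idx=Inl, OF H(3,4) b])
    fix i D assume i: "i \<in> ?H" and D: "D \<in> space Q"
    have rb: "bdm P (\<lambda>x. rbar E S (restrict x S))" by (rule bdm_restrict[OF S rbar_bdm[OF S]])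
    have "(\<integral>y. (rbar E S (restrict y S) - 1) * remY l S D \<partial>P) = 0"
      using P.bdm_integral_diff[OF rb bdm_const, of 1] integral_rbar[OF S] by simp
    then show "(\<integral>y. ?x i (D(Inl i := y)) \<partial>Mf (Inl i)) = 0" by (simp add: up[OF i])
  next
    fix i j D y assume "i \<in> ?H" "j \<in> ?H" "i \<noteq> j"
    then show "?x j (D(Inl i := y)) = ?x j D" by (simp add: up)
  next
    fix i
    have "(\<integral>D. (?x i D)\<^sup>2 \<partial>Q) \<le> (\<integral>D. (cupp K)\<^sup>2 * (remY l S D)\<^sup>2 \<partial>Q)"
    proof (intro Q.bdm_integral_le bdm_power b bdm_mult bdm_const Yb)
      fix D assume D: "D \<in> space Q"
      have "restrict (X i D) S \<in> space (leb S)" by (intro restr_space S X_space D)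
      then have "\<bar>rbar E S (restrict (X i D) S) - 1\<bar> \<le> cupp K"
        using rbar_bounds(2)[OF S] rbar_pos[OF S] C_ge_1 by (auto simp: abs_le_iff) (smt (verit))+
      then have "\<bar>rbar E S (restrict (X i D) S) - 1\<bar>\<^sup>2 \<le> (cupp K)\<^sup>2" by (rule power_mono) simp
      then show "(?x i D)\<^sup>2 \<le> (cupp K)\<^sup>2 * (remY l S D)\<^sup>2" unfolding power_mult_distrib power2_abs by (rule mult_right_mono) simp
    qed
    also have "\<dots> = (cupp K)\<^sup>2 * (\<integral>D. (remY l S D)\<^sup>2 \<partial>Q)" by simp
    also have "\<dots> \<le> (cupp K)\<^sup>2 * (5 * \<rho> * \<Lambda> * err)" using Yb(2) by (intro mult_left_mono) auto
    finally show "(\<integral>D. (?x i D)\<^sup>2 \<partial>Q) \<le> (cupp K)\<^sup>2 * (5 * \<rho> * \<Lambda> * err)" .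
  qed
  also have "\<dots> \<le> \<rho>\<^sup>2 * (5 * \<rho> * \<Lambda> * err) * (3 / real n)"
    using half_card(1)[OF l'] rho_facts err_facts Lambda_facts(1) C_ge_1 by (intro mult_mono power_mono) auto
  finally show "(\<integral>D. (remC l S D)\<^sup>2 \<partial>Q) \<le> 15 * \<rho> ^ 3 * \<Lambda> * err / real n"
    by (simp add: power2_eq_square power3_eq_cube mult_ac)
qed

definition "rem l D = (\<Sum>S\<in>\<S>. remB l S D + remC l S D - remA l S D)"

text \<open>The three parts contribute \<open>3 * (6 + 15 + 12) = 99\<close> per pattern, and
  Cauchy-Schwarz over the patterns gives \<open>N\<^sup>2\<close>.\<close>

lemma rem: assumes l: "l \<in> {1, 2}"
  shows "bdm Q (rem l)" "(\<integral>D. (rem l D)\<^sup>2 \<partial>Q) \<le> 100 * N\<^sup>2 * \<rho> ^ 3 * \<Lambda> * err / real n"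
proof -
  let ?t = "\<lambda>S D. remB l S D + remC l S D - remA l S D"
  have bt: "bdm Q (?t S)" if "S \<in> \<S>" for S by (intro bdm_diff bdm_add remA remB remC l that)
  show br: "bdm Q (rem l)" unfolding rem_def[abs_def] by (intro bdm_sum bt)
  define z where "z = \<Lambda> * err / real n"
  have z: "0 \<le> z" unfolding z_def using Lambda_facts(1) err_facts by simp
  have tE: "(\<integral>D. (?t S D)\<^sup>2 \<partial>Q) \<le> 99 * \<rho> ^ 3 * z" if S: "S \<in> \<S>" for S
  proof -
    note A = remA[OF l S] and B = remB[OF l S] and C = remC[OF l S]
    have three: "(x + y - w)\<^sup>2 \<le> 3 * x\<^sup>2 + 3 * y\<^sup>2 + 3 * w\<^sup>2" for x y w :: real
      using zero_le_power2[of "x - y"] zero_le_power2[of "x + w"] zero_le_power2[of "y + w"] by (simp add: power2_eq_square algebra_simps)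
    have "(\<integral>D. (?t S D)\<^sup>2 \<partial>Q) \<le> (\<integral>D. 3 * (remB l S D)\<^sup>2 + 3 * (remC l S D)\<^sup>2 + 3 * (remA l S D)\<^sup>2 \<partial>Q)"
      by (intro Q.bdm_integral_le bdm_power bt S bdm_add bdm_mult bdm_const A B C three)
    also have "\<dots> = 3 * (\<integral>D. (remB l S D)\<^sup>2 \<partial>Q) + 3 * (\<integral>D. (remC l S D)\<^sup>2 \<partial>Q) + 3 * (\<integral>D. (remA l S D)\<^sup>2 \<partial>Q)"
      using Q.integrable_bdm[OF bdm_power[OF A(1), of 2]] Q.integrable_bdm[OF bdm_power[OF B(1), of 2]] Q.integrable_bdm[OF bdm_power[OF C(1), of 2]] by simp
    also have "\<dots> \<le> 3 * (6 * \<rho> ^ 3 * z) + 3 * (15 * \<rho> ^ 3 * z) + 3 * (12 * \<rho> ^ 3 * z)"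
    proof -
      have r: "1 \<le> \<rho> ^ 3" "\<rho> \<le> \<rho> ^ 3" using rho_facts self_le_power[of \<rho> 3] by simp_all
      have "err * 1 \<le> err * \<Lambda>" using err_facts Lambda_facts(1) by (intro mult_left_mono) auto
      then have "err / real n \<le> z" unfolding z_def by (intro divide_right_mono) (auto simp: mult.commute)
      moreover have "1 * z \<le> \<rho> ^ 3 * z" "\<rho> * z \<le> \<rho> ^ 3 * z" using r z by (intro mult_right_mono; simp)+
      moreover have "6 * \<rho> * \<Lambda> * err / real n = 6 * (\<rho> * z)" "15 * \<rho> ^ 3 * \<Lambda> * err / real n = 15 * (\<rho> ^ 3 * z)" "12 * err / real n = 12 * (err / real n)"
        by (simp_all add: z_def)
      ultimately show ?thesis using A(2) B(2) C(2) by linarith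
    qed
    also have "\<dots> = 99 * \<rho> ^ 3 * z" by algebra
    finally show ?thesis .
  qed
  have "(\<integral>D. (rem l D)\<^sup>2 \<partial>Q) \<le> (\<integral>D. N * (\<Sum>S\<in>\<S>. (?t S D)\<^sup>2) \<partial>Q)"
    by (intro Q.bdm_integral_le bdm_power br bdm_mult bdm_const bdm_sum bt) (auto simp: rem_def sum_squared_le_card)
  also have "\<dots> = N * (\<integral>D. (\<Sum>S\<in>\<S>. (?t S D)\<^sup>2) \<partial>Q)" by (rule Bochner_Integration.integral_mult_right_zero)
  also have "(\<integral>D. (\<Sum>S\<in>\<S>. (?t S D)\<^sup>2) \<partial>Q) = (\<Sum>S\<in>\<S>. \<integral>D. (?t S D)\<^sup>2 \<partial>Q)"
    by (intro Q.bdm_integral_sum bdm_power bt)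
  also have "N * \<dots> \<le> N * (N * (99 * \<rho> ^ 3 * z))"
    using sum_bounded_above[of \<S> "\<lambda>S. \<integral>D. (?t S D)\<^sup>2 \<partial>Q" "99 * \<rho> ^ 3 * z"] tE by (intro mult_left_mono) auto
  also have "\<dots> \<le> N * (N * (100 * \<rho> ^ 3 * z))" using z rho_facts by (intro mult_left_mono mult_right_mono) auto
  finally show "(\<integral>D. (rem l D)\<^sup>2 \<partial>Q) \<le> 100 * N\<^sup>2 * \<rho> ^ 3 * \<Lambda> * err / real n"
    by (simp add: z_def power2_eq_square mult_ac)
qed

definition "psi x = target E x - (\<Sum>S\<in>\<S>. pa MM S (restrict x S)) - theta E"

text \<open>The oracle estimator with the population iterate and the true normaliser, minus its
  mean. \<open>psi\<close> is its influence function for complete observations,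
  \<open>pa / rbar\<close> that for incomplete ones.\<close>

definition "tmain D = (\<Sum>i\<in>{1..n}. psi (X i D)) / real n + (\<Sum>S\<in>\<S>. average {1..nS E S} (\<lambda>j. pa MM S (Y S j D) * (1 / rbar E S (Y S j D))))"

lemma average_add: "average J (\<lambda>i. f i + g i) = average J f + average J g" for f g :: "'x \<Rightarrow> real"
  by (simp add: average_def sum.distrib add_divide_distrib)

lemma average_diff: "average J (\<lambda>i. f i - g i) = average J f - average J g" for f g :: "'x \<Rightarrow> real"
  by (simp add: average_def sum_subtractf diff_divide_distrib)

lemma average_sum: "average J (\<lambda>i. \<Sum>s\<in>I. f s i) = (\<Sum>s\<in>I. average J (f s))" for f :: "'y \<Rightarrow> 'x \<Rightarrow> real"
  unfolding average_def by (subst sum.swap) (simp add: sum_divide_distrib)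

lemma average_const: "finite J \<Longrightarrow> J \<noteq> {} \<Longrightarrow> average J (\<lambda>i. c) = (c::real)"
  by (simp add: average_def)

lemma average_mult_left: "average J (\<lambda>i. c * f i) = c * average J f" for f :: "'x \<Rightarrow> real"
  by (simp add: average_def sum_distrib_left[symmetric])

text \<open>An exact identity. The residuals contribute \<open>- dS\<close> and the incomplete
  averages \<open>+ dS\<close> for every pattern, so the conditional bias disappears and only
  centred terms remain.\<close>

lemma theta_fold_eq:
  assumes l: "l \<in> {1, 2}"
  shows "theta_fold E D l - theta E = average (half E (3 - l)) (\<lambda>i. psi (X i D))
    + (\<Sum>S\<in>\<S>. average {1..nS E S} (\<lambda>j. pa MM S (Y S j D) * (1 / rbar E S (Y S j D)))) + rem l D"
proof -
  let ?H = "half E (3 - l)"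
  note H = half_facts[OF other_half(1)[OF l]]
  have r: "residual E D l x = psi x + theta E - (\<Sum>S\<in>\<S>. Del l MM S D x)" for x
    by (simp add: residual_def psi_def Del_def sum_subtractf)
  have 1: "average ?H (\<lambda>i. residual E D l (Xfull E i D)) = average ?H (\<lambda>i. psi (X i D)) + theta E - (\<Sum>S\<in>\<S>. remA l S D + dS l S D)"
  proof -
    have a: "average ?H (\<lambda>i. Del l MM S D (X i D)) = remA l S D + dS l S D" for S
      unfolding remA_def average_diff average_const[OF H(3,4)] by simp
    show ?thesis unfolding r Xfull_eq average_diff average_add average_const[OF H(3,4)] average_sum a ..
  qed
  have 2: "average {1..nS E S} (\<lambda>j. alpha_fin E D l S (Xinc E S j D) * rhat E D ?H S / ratio E S (Xinc E S j D))
     = average {1..nS E S} (\<lambda>j. pa MM S (Y S j D) * (1 / rbar E S (Y S j D))) + (remB l S D + dS l S D) + remC l S D" if S: "S \<in> \<S>" for S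
  proof -
    have J: "finite {1..nS E S}" "{1..nS E S} \<noteq> {}" using inc_set[OF S] by auto
    have "alpha_fin E D l S (Xinc E S j D) * rhat E D ?H S / ratio E S (Xinc E S j D) = rho_hat ?H S D * (alpha_hat E D l MM S (Y S j D) * (1 / rbar E S (Y S j D)))" for j
      unfolding rhat_eq[OF S] ratio_eq[OF S] Xinc_eq using Rn_pos[OF S] by simp
    then have "average {1..nS E S} (\<lambda>j. alpha_fin E D l S (Xinc E S j D) * rhat E D ?H S / ratio E S (Xinc E S j D)) = rho_hat ?H S D * remY l S D"
      unfolding remY_def average_mult_left[symmetric] by simp
    also have "\<dots> = remY l S D + remC l S D" by (simp add: remC_def algebra_simps)
    also have "remY l S D = average {1..nS E S} (\<lambda>j. pa MM S (Y S j D) * (1 / rbar E S (Y S j D)) + DelY l S D (Y S j D) * (1 / rbar E S (Y S j D)))"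
      unfolding remY_def DelY_def by (simp add: algebra_simps diff_divide_distrib)
    also have "\<dots> = average {1..nS E S} (\<lambda>j. pa MM S (Y S j D) * (1 / rbar E S (Y S j D))) + (remB l S D + dS l S D)"
      unfolding average_add remB_def average_diff average_const[OF J] by simp
    finally show ?thesis .
  qed
  show ?thesis
    unfolding theta_fold_def 1 rem_def using 2
    by (simp add: sum.distrib sum_subtractf)
qed

definition "Rem D = (real (card (half E 2)) * rem 1 D + real (card (half E 1)) * rem 2 D) / real n"

text \<open>Fold \<open>l\<close> averages over the other half and is weighted by the size of that
  half, so the two averages of \<open>psi\<close> merge into the average over all complete
  observations.\<close>

lemma theta_hat_eq: "theta_hat E D - theta E = tmain D + Rem D"
proof -
  define n1 n2 where "n1 = real (card (half E 1))" and "n2 = real (card (half E 2))"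
  have n: "n1 + n2 = real n" using half_partition(3) unfolding n1_def n2_def by (simp flip: of_nat_add)
  have p: "0 < n1" "0 < n2" using half_card(2)[of 1] half_card(2)[of 2] by (simp_all add: n1_def n2_def)
  define Z where "Z = (\<Sum>S\<in>\<S>. average {1..nS E S} (\<lambda>j. pa MM S (Y S j D) * (1 / rbar E S (Y S j D))))"
  have three: "(3::nat) - 2 = 1" by (simp add: One_nat_def)
  have e1: "theta_fold E D 1 = theta E + ((\<Sum>i\<in>half E 2. psi (X i D)) / n2 + Z + rem 1 D)"
    using theta_fold_eq[of 1 D] by (simp add: average_def n2_def Z_def numeral_2_eq_2[symmetric])
  have e2: "theta_fold E D 2 = theta E + ((\<Sum>i\<in>half E 1. psi (X i D)) / n1 + Z + rem 2 D)"
    using theta_fold_eq[of 2 D] unfolding three by (simp add: average_def n1_def Z_def)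
  have s: "(\<Sum>i\<in>{1..n}. psi (X i D)) = (\<Sum>i\<in>half E 1. psi (X i D)) + (\<Sum>i\<in>half E 2. psi (X i D))"
    unfolding half_partition(1)[symmetric] using half_partition(2) half_facts(3) by (intro sum.union_disjoint) auto
  have "theta_hat E D = (n2 * theta_fold E D 1 + n1 * theta_fold E D 2) / real n" by (simp add: theta_hat_def n1_def n2_def)
  also have "\<dots> = ((n1 + n2) * (theta E + Z) + ((\<Sum>i\<in>half E 2. psi (X i D)) + (\<Sum>i\<in>half E 1. psi (X i D))) + (n2 * rem 1 D + n1 * rem 2 D)) / real n"
    unfolding e1 e2 using p by (simp add: algebra_simps)
  also have "\<dots> = theta E + Z + (\<Sum>i\<in>{1..n}. psi (X i D)) / real n + Rem D"
    unfolding s n Rem_def n1_def[symmetric] n2_def[symmetric] using n_pos by (simp add: add_divide_distrib)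
  finally show ?thesis unfolding tmain_def Z_def by simp
qed

lemma Rem: "bdm Q Rem" "(\<integral>D. (Rem D)\<^sup>2 \<partial>Q) \<le> 100 * N\<^sup>2 * \<rho> ^ 3 * \<Lambda> * err / real n"
proof -
  define n1 n2 where "n1 = real (card (half E 1))" and "n2 = real (card (half E 2))"
  have n: "n1 + n2 = real n" using half_partition(3) unfolding n1_def n2_def by (simp flip: of_nat_add)
  have p: "0 < n1" "0 < n2" using half_card(2)[of 1] half_card(2)[of 2] by (simp_all add: n1_def n2_def)
  note r1 = rem[of 1, simplified] and r2 = rem[of 2, simplified]
  show b: "bdm Q Rem" unfolding Rem_def[abs_def] by (intro bdm_divide_const bdm_add bdm_mult bdm_const r1 r2)
  \<comment> \<open>Convexity of the square: the fold weights sum to 1, so the bound for a single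
    fold carries over without loss.\<close>
  have cv: "(Rem D)\<^sup>2 \<le> n2 / real n * (rem 1 D)\<^sup>2 + n1 / real n * (rem 2 D)\<^sup>2" for D
  proof -
    have "n2 / real n + n1 / real n = 1" using n p by (simp add: add_divide_distrib[symmetric] add.commute)
    then have n1e: "n1 / real n = 1 - n2 / real n" by simp
    define t where "t = n2 / real n"
    have t: "0 \<le> t" "t \<le> 1" using p n by (simp_all add: t_def)
    have "Rem D = t * rem 1 D + (1 - t) * rem 2 D"
      unfolding Rem_def n1_def[symmetric] n2_def[symmetric] t_def n1e[symmetric] by (simp add: add_divide_distrib)
    moreover have "t * (rem 1 D)\<^sup>2 + (1 - t) * (rem 2 D)\<^sup>2 = (t * rem 1 D + (1 - t) * rem 2 D)\<^sup>2 + t * (1 - t) * (rem 1 D - rem 2 D)\<^sup>2"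
      by (simp add: power2_eq_square algebra_simps)
    moreover have "0 \<le> t * (1 - t) * (rem 1 D - rem 2 D)\<^sup>2" using t by simp
    ultimately show ?thesis unfolding n1e t_def[symmetric] by simp
  qed
  define c where "c = 100 * N\<^sup>2 * \<rho> ^ 3 * \<Lambda> * err / real n"
  have "(\<integral>D. (Rem D)\<^sup>2 \<partial>Q) \<le> (\<integral>D. n2 / real n * (rem 1 D)\<^sup>2 + n1 / real n * (rem 2 D)\<^sup>2 \<partial>Q)"
    by (intro Q.bdm_integral_le bdm_power b bdm_add bdm_mult bdm_const r1 r2 cv)
  also have "\<dots> = n2 / real n * (\<integral>D. (rem 1 D)\<^sup>2 \<partial>Q) + n1 / real n * (\<integral>D. (rem 2 D)\<^sup>2 \<partial>Q)"
    using Q.integrable_bdm[OF bdm_power[OF r1(1), of 2]] Q.integrable_bdm[OF bdm_power[OF r2(1), of 2]] by simp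
  also have "\<dots> \<le> n2 / real n * c + n1 / real n * c"
    using r1(2) r2(2) p unfolding c_def by (intro add_mono mult_left_mono) auto
  also have "\<dots> = c" using n p by (simp add: add_divide_distrib[symmetric] distrib_right[symmetric] add.commute)
  finally show "(\<integral>D. (Rem D)\<^sup>2 \<partial>Q) \<le> 100 * N\<^sup>2 * \<rho> ^ 3 * \<Lambda> * err / real n" unfolding c_def .
qed

end

section \<open>The leading term\<close>

context model
begin

definition "incvar S = (\<integral>x. (pa MM S (restrict x S))\<^sup>2 * (1 / rbar E S (restrict x S)) \<partial>P)"

text \<open>Variance of \<open>sqrt n * tmain\<close>: the objective at the population iterate, with
  \<open>n / nS E S\<close> in place of \<open>1 / lam E S\<close>.\<close>

definition "asyvar = (\<integral>x. (psi x)\<^sup>2 \<partial>P) + (\<Sum>S\<in>\<S>. real n / real (nS E S) * incvar S)"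

lemma pa_bound: "S \<in> \<S> \<Longrightarrow> u \<in> space (leb S) \<Longrightarrow> \<bar>pa MM S u\<bar> \<le> b"
  unfolding b_def by (rule pa(2))

lemma theta_abs_le: "\<bar>theta E\<bar> \<le> a0"
  unfolding theta_def by (rule P.abs_integral_le_const) (use target_bdm target_abs_le in \<open>auto simp: bdm_law\<close>)

definition "popres x = target E x - (\<Sum>S\<in>\<S>. pa MM S (restrict x S))"

lemma sum_patterns_abs_le:
  assumes "\<And>S. S \<in> \<S> \<Longrightarrow> \<bar>g S\<bar> \<le> c"
  shows "\<bar>\<Sum>S\<in>\<S>. g S :: real\<bar> \<le> N * c"
  using order_trans[OF sum_abs sum_bounded_above[of \<S> "\<lambda>S. \<bar>g S\<bar>" c]] assms by simp

lemma popres: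
  shows "bdm (leb (coords E)) popres" "x \<in> space (leb (coords E)) \<Longrightarrow> \<bar>popres x\<bar> \<le> 2 * N * b"
    "(\<integral>x. popres x \<partial>P) = theta E" "psi x = popres x - theta E"
proof -
  have p: "bdm (leb (coords E)) (\<lambda>x. pa MM S (restrict x S))" if "S \<in> \<S>" for S
    by (rule bdm_comp[OF pa(1)[OF that] restr_measurable[OF that]])
  show "bdm (leb (coords E)) popres" unfolding popres_def[abs_def] by (intro bdm_diff target_bdm bdm_sum p)
  show "psi x = popres x - theta E" by (simp add: psi_def popres_def)
  have t: "bdm P (target E)" "\<And>S. S \<in> \<S> \<Longrightarrow> bdm P (\<lambda>x. pa MM S (restrict x S))" using target_bdm p by (simp_all add: bdm_law)
  have "(\<integral>x. popres x \<partial>P) = theta E - (\<integral>x. (\<Sum>S\<in>\<S>. pa MM S (restrict x S)) \<partial>P)"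
    unfolding popres_def theta_def by (rule P.bdm_integral_diff[OF t(1) bdm_sum[OF t(2)]])
  also have "(\<integral>x. (\<Sum>S\<in>\<S>. pa MM S (restrict x S)) \<partial>P) = 0"
    by (subst P.bdm_integral_sum[OF t(2)]) (auto simp: pa_mean)
  finally show "(\<integral>x. popres x \<partial>P) = theta E" by simp
  assume x: "x \<in> space (leb (coords E))"
  have 1: "\<bar>\<Sum>S\<in>\<S>. pa MM S (restrict x S)\<bar> \<le> N * b"
    using pa_bound restr_space x by (intro sum_patterns_abs_le) auto
  have 2: "1 * b \<le> N * b" using N_ge_1 b_pos by (intro mult_right_mono) auto
  show "\<bar>popres x\<bar> \<le> 2 * N * b"
    using target_abs_le[OF x] 1 2 b_pos unfolding popres_def by (simp only: mult.assoc)
qed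

lemma psi:
  shows "bdm (leb (coords E)) psi" "x \<in> space (leb (coords E)) \<Longrightarrow> \<bar>psi x\<bar> \<le> 3 * N * b" "(\<integral>x. psi x \<partial>P) = 0"
proof -
  have eq: "psi = (\<lambda>x. popres x - theta E)" by (simp add: popres(4) fun_eq_iff)
  show "bdm (leb (coords E)) psi" unfolding eq by (intro bdm_diff popres bdm_const)
  have "bdm P popres" using popres(1) by (simp add: bdm_law)
  from P.bdm_integral_diff[OF this bdm_const, of "theta E"] show "(\<integral>x. psi x \<partial>P) = 0"
    unfolding eq by (simp add: popres(3) P.prob_space)
  have 2: "1 * b \<le> N * b" using N_ge_1 b_pos by (intro mult_right_mono) auto
  assume "x \<in> space (leb (coords E))"
  from popres(2)[OF this] show "\<bar>psi x\<bar> \<le> 3 * N * b" unfolding popres(4) using theta_abs_le b_pos 2 by (simp only: mult.assoc)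
qed

lemma incvar_bdm: assumes S: "S \<in> \<S>"
  shows "bdm (leb S) (\<lambda>u. (pa MM S u)\<^sup>2 * (1 / rbar E S u))" "u \<in> space (leb S) \<Longrightarrow> 0 \<le> (pa MM S u)\<^sup>2 * (1 / rbar E S u)"
    "u \<in> space (leb S) \<Longrightarrow> (pa MM S u)\<^sup>2 * (1 / rbar E S u) \<le> b\<^sup>2 * \<rho>"
    "0 \<le> incvar S" "incvar S \<le> b\<^sup>2 * \<rho>"
proof -
  show bd: "bdm (leb S) (\<lambda>u. (pa MM S u)\<^sup>2 * (1 / rbar E S u))" by (intro bdm_mult bdm_power pa inverse_rbar_bdm S)
  show nn: "u \<in> space (leb S) \<Longrightarrow> 0 \<le> (pa MM S u)\<^sup>2 * (1 / rbar E S u)" for u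
    using inverse_rbar_bdm(2)[OF S] by (intro mult_nonneg_nonneg) (auto simp: less_imp_le)
  show le: "u \<in> space (leb S) \<Longrightarrow> (pa MM S u)\<^sup>2 * (1 / rbar E S u) \<le> b\<^sup>2 * \<rho>" for u
  proof (rule mult_mono)
    assume u: "u \<in> space (leb S)"
    have "\<bar>pa MM S u\<bar>\<^sup>2 \<le> b\<^sup>2" using pa_bound[OF S u] by (intro power_mono) auto
    then show "(pa MM S u)\<^sup>2 \<le> b\<^sup>2" by simp
  qed (use inverse_rbar_bdm(2)[OF S] in \<open>auto simp: less_imp_le\<close>)
  show "0 \<le> incvar S" unfolding incvar_def by (rule Bochner_Integration.integral_nonneg) (use nn restr_space[OF S] in auto)
  show "incvar S \<le> b\<^sup>2 * \<rho>" unfolding incvar_def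
    by (rule P.integral_le_const_bdm[OF bdm_restrict[OF S bd]]) (use le restr_space[OF S] in auto)
qed

lemma pa_in_H: "(\<lambda>S\<in>\<S>. pa m S) \<in> Pi\<^sub>E \<S> (H E)"
proof -
  have "pa m S \<in> H E S" if S: "S \<in> \<S>" for S
  proof -
    have b: "bdm (leb (coords E)) (\<lambda>x. pa m S (restrict x S))" by (rule bdm_comp[OF pa(1)[OF S] restr_measurable[OF S]])
    then have "integrable P (\<lambda>x. (pa m S (restrict x S))\<^sup>2)" by (intro P.integrable_bdm bdm_power) (simp add: bdm_law)
    then show ?thesis using bdm_measurable[OF b] bdm_measurable[OF pa(1)[OF S]] pa_mean[OF S] by (simp add: Defs.H_def Lsq_def)
  qed
  then show ?thesis by auto
qed

text \<open>Supplies the lower bound without which the infimum over centred functions would say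
  nothing about an individual value.\<close>

lemma objective_nonneg: "0 \<le> objective E \<alpha>"
  unfolding objective_def
proof (intro add_nonneg_nonneg sum_nonneg Bochner_Integration.integral_nonneg)
  fix S x assume S: "S \<in> \<S>" and "x \<in> space P"
  then have "0 < lam E S * rbar E S (restrict x S)" using rbar_pos[OF S restr_space[OF S]] lam_pos by simp
  then show "0 \<le> (\<alpha> S (restrict x S))\<^sup>2 / (lam E S * rbar E S (restrict x S))" by simp
qed simp

lemma V0_le_objective: "V0 K \<le> objective E (\<lambda>S\<in>\<S>. pa m S)"
proof -
  have "bdd_below (objective E ` Pi\<^sub>E \<S> (H E))" using objective_nonneg by (intro bdd_belowI[of _ 0]) auto
  from cINF_lower[OF this pa_in_H] show ?thesis using V0(1) by (rule order_trans[rotated])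
qed

lemma objective_pa: "objective E (\<lambda>S\<in>\<S>. pa MM S) = (\<integral>x. (psi x)\<^sup>2 \<partial>P) + (\<Sum>S\<in>\<S>. 1 / lam E S * incvar S)"
proof -
  have e: "(\<lambda>x. target E x - (\<Sum>S\<in>\<S>. (\<lambda>S\<in>\<S>. pa MM S) S (restrict x S))) = popres"
    by (simp add: popres_def fun_eq_iff)
  have i: "(\<integral>x. (pa MM S (restrict x S))\<^sup>2 / (lam E S * rbar E S (restrict x S)) \<partial>P) = 1 / lam E S * incvar S" for S
  proof -
    have "(\<lambda>x. (pa MM S (restrict x S))\<^sup>2 / (lam E S * rbar E S (restrict x S))) = (\<lambda>x. 1 / lam E S * ((pa MM S (restrict x S))\<^sup>2 * (1 / rbar E S (restrict x S))))"
      by (simp add: fun_eq_iff)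
    then show ?thesis unfolding incvar_def by (simp only: Bochner_Integration.integral_mult_right_zero)
  qed
  show ?thesis unfolding objective_def e popres(3) popres(4) using i by (simp add: popres_def)
qed

text \<open>The factor 1/2 comes from \<open>nS_facts\<close>: \<open>n / nS E S\<close> is at least
  half of \<open>1 / lam E S\<close>.\<close>

lemma asyvar_ge: "V0 K / 2 \<le> asyvar"
proof -
  have "V0 K \<le> (\<integral>x. (psi x)\<^sup>2 \<partial>P) + (\<Sum>S\<in>\<S>. 1 / lam E S * incvar S)" using V0_le_objective[of MM] unfolding objective_pa .
  moreover have "(\<Sum>S\<in>\<S>. 1 / 2 * (1 / lam E S * incvar S)) \<le> (\<Sum>S\<in>\<S>. real n / real (nS E S) * incvar S)"
  proof (rule sum_mono)
    fix S assume S: "S \<in> \<S>"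
    have "1 / (2 * lam E S) * incvar S \<le> real n / real (nS E S) * incvar S" by (rule mult_right_mono[OF nS_facts(3)[OF S] incvar_bdm(4)[OF S]])
    then show "1 / 2 * (1 / lam E S * incvar S) \<le> real n / real (nS E S) * incvar S" by simp
  qed
  moreover have "(\<Sum>S\<in>\<S>. 1 / 2 * (1 / lam E S * incvar S)) = 1 / 2 * (\<Sum>S\<in>\<S>. 1 / lam E S * incvar S)" by (simp only: sum_distrib_left)
  moreover have "0 \<le> (\<integral>x. (psi x)\<^sup>2 \<partial>P)" by simp
  ultimately show ?thesis unfolding asyvar_def by linarith
qed

lemma asyvar_pos: "0 < asyvar" using asyvar_ge V0(2) by linarith

text \<open>The zero functions, which are the iterate 0, compete in the infimum; there the objective
  is the variance of the target. This keeps the factor \<open>a0\<^sup>2 / V0 K\<close> of the bound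
  above 1.\<close>

lemma V0_le: "V0 K \<le> a0\<^sup>2"
proof -
  have "V0 K \<le> objective E (\<lambda>S\<in>\<S>. pa 0 S)" by (rule V0_le_objective)
  also have "\<dots> = (\<integral>x. (target E x - (\<integral>x. target E x \<partial>P))\<^sup>2 \<partial>P)" by (simp add: objective_def)
  also have "\<dots> = (\<integral>x. (target E x)\<^sup>2 \<partial>P) - (\<integral>x. target E x \<partial>P)\<^sup>2"
    using target_bdm by (intro P.variance_eq P.integrable_bdm bdm_power) (simp_all add: bdm_law)
  also have "\<dots> \<le> (\<integral>x. (target E x)\<^sup>2 \<partial>P)" by simp
  also have "\<dots> \<le> a0\<^sup>2"
  proof (rule P.integral_le_const_bdm)
    show "bdm P (\<lambda>x. (target E x)\<^sup>2)" using target_bdm by (intro bdm_power) (simp add: bdm_law)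
    fix x assume "x \<in> space P"
    then have "\<bar>target E x\<bar>\<^sup>2 \<le> a0\<^sup>2" using target_abs_le by (intro power_mono) auto
    then show "(target E x)\<^sup>2 \<le> a0\<^sup>2" by simp
  qed
  finally show ?thesis .
qed

lemma asyvar_le: "asyvar \<le> 11 * N\<^sup>2 * \<rho> * \<Lambda> * b\<^sup>2"
proof -
  have 1: "(\<integral>x. (psi x)\<^sup>2 \<partial>P) \<le> (3 * N * b)\<^sup>2"
  proof (rule P.integral_le_const_bdm)
    show "bdm P (\<lambda>x. (psi x)\<^sup>2)" using psi(1) by (intro bdm_power) (simp add: bdm_law)
    fix x assume "x \<in> space P"
    then have "\<bar>psi x\<bar>\<^sup>2 \<le> (3 * N * b)\<^sup>2" using psi(2) by (intro power_mono) auto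
    then show "(psi x)\<^sup>2 \<le> (3 * N * b)\<^sup>2" by simp
  qed
  have 2: "(\<Sum>S\<in>\<S>. real n / real (nS E S) * incvar S) \<le> N * ((3/2 * \<Lambda>) * (b\<^sup>2 * \<rho>))"
  proof (rule sum_bounded_above)
    fix S assume S: "S \<in> \<S>"
    show "real n / real (nS E S) * incvar S \<le> (3/2 * \<Lambda>) * (b\<^sup>2 * \<rho>)"
      using nS_facts(1)[OF S] incvar_bdm(4,5)[OF S] Lambda_facts(1) by (intro mult_mono) auto
  qed
  define z where "z = \<rho> * \<Lambda> * b\<^sup>2"
  have rl: "1 * 1 \<le> \<rho> * \<Lambda>" using rho_facts Lambda_facts(1) by (intro mult_mono) auto
  then have z: "b\<^sup>2 \<le> z" "0 \<le> z" unfolding z_def using mult_right_mono[OF rl, of "b\<^sup>2"] by (simp_all add: rho_facts Lambda_facts(1))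
  have NN: "N * z \<le> N\<^sup>2 * z" using N_ge_1 z by (intro mult_right_mono) (auto simp: power2_eq_square)
  have "N\<^sup>2 * b\<^sup>2 \<le> N\<^sup>2 * z" using z by (intro mult_left_mono) auto
  moreover have "(3 * N * b)\<^sup>2 = 9 * (N\<^sup>2 * b\<^sup>2)" by (simp add: power_mult_distrib)
  moreover have "N * ((3/2 * \<Lambda>) * (b\<^sup>2 * \<rho>)) = 3/2 * (N * z)" by (simp add: z_def)
  moreover have "11 * N\<^sup>2 * \<rho> * \<Lambda> * b\<^sup>2 = 11 * (N\<^sup>2 * z)" by (simp add: z_def)
  moreover have "0 \<le> N\<^sup>2 * z" using z by simp
  ultimately show ?thesis unfolding asyvar_def using 1 2 NN by linarith
qed

section \<open>The leading term as a sum of independent variables\<close>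

definition "idxs = {1..n} <+> (SIGMA S:\<S>. {1..nS E S})"

definition "lin k y = (case k of Inl i \<Rightarrow> psi y / real n | Inr p \<Rightarrow> pa MM (fst p) y * (1 / rbar E (fst p) y) / real (nS E (fst p)))"

lemma lin_simps [simp]: "lin (Inl i) y = psi y / real n" "lin (Inr (S, j)) y = pa MM S y * (1 / rbar E S y) / real (nS E S)"
  by (simp_all add: lin_def)

lemma finite_idxs: "finite idxs" using finite_patterns by (simp add: idxs_def)

lemma sum_idxs: "(\<Sum>k\<in>idxs. f k) = (\<Sum>i\<in>{1..n}. f (Inl i)) + (\<Sum>S\<in>\<S>. \<Sum>j\<in>{1..nS E S}. f (Inr (S, j)))" for f :: "_ \<Rightarrow> real"
  unfolding idxs_def using finite_patterns
  by (subst sum.Plus) (simp_all add: sum.Sigma)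

lemma tmain_eq: "tmain D = (\<Sum>k\<in>idxs. lin k (D k))"
  unfolding sum_idxs tmain_def average_def by (simp add: sum_divide_distrib)

lemma idxs_cases:
  assumes "k \<in> idxs"
  obtains i where "k = Inl i" | S j where "k = Inr (S, j)" "S \<in> \<S>"
  using assms unfolding idxs_def by auto

lemma lin:
  assumes k: "k \<in> idxs"
  shows "bdm (Mf k) (lin k)" "y \<in> space (Mf k) \<Longrightarrow> \<bar>lin k y\<bar> \<le> 3 * N * \<rho> * \<Lambda> * b / real n" "(\<integral>y. lin k y \<partial>Mf k) = 0"
proof -
  have np: "0 < real n" using n_pos by simp
  have NbRL: "3 * N * b * 1 \<le> 3 * N * b * (\<rho> * \<Lambda>)"
    using rho_facts Lambda_facts(1) N_ge_1 b_pos mult_mono[of 1 \<rho> 1 \<Lambda>] by (intro mult_left_mono) auto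
  have "bdm (Mf k) (lin k) \<and> (y \<in> space (Mf k) \<longrightarrow> \<bar>lin k y\<bar> \<le> 3 * N * \<rho> * \<Lambda> * b / real n) \<and> (\<integral>y. lin k y \<partial>Mf k) = 0" for y
    using k
  proof (cases rule: idxs_cases)
    case (1 i)
    have "\<bar>psi y\<bar> / real n \<le> 3 * N * \<rho> * \<Lambda> * b / real n" if "y \<in> space (leb (coords E))"
      using psi(2)[OF that] NbRL np by (intro divide_right_mono) (simp_all add: mult_ac)
    moreover have "bdm P (\<lambda>y. psi y / real n)" using psi(1) by (intro bdm_divide_const) (simp add: bdm_law)
    moreover have l: "lin (Inl i) = (\<lambda>y. psi y / real n)" by (simp add: fun_eq_iff)
    ultimately show ?thesis unfolding 1 l using psi(3) by simp
  next
    case (2 S j)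
    note S = 2(2)
    have b2: "bdm (leb S) (\<lambda>u. pa MM S u * (1 / rbar E S u) / real (nS E S))" by (intro bdm_divide_const bdm_mult pa inverse_rbar_bdm S)
    have "bdm (inc_law S) (\<lambda>u. pa MM S u * (1 / rbar E S u) / real (nS E S))"
      using bdm_cong_sets[OF sets_inc_law] b2 by blast
    moreover have "\<bar>pa MM S y * (1 / rbar E S y) / real (nS E S)\<bar> \<le> 3 * N * \<rho> * \<Lambda> * b / real n" if y: "y \<in> space (leb S)"
    proof -
      have "\<bar>pa MM S y * (1 / rbar E S y) * (1 / real (nS E S))\<bar> = \<bar>pa MM S y\<bar> * (1 / rbar E S y) * (1 / real (nS E S))"
        using inverse_rbar_bdm(2)[OF S y] by (simp add: abs_mult)
      moreover have "\<bar>pa MM S y\<bar> * (1 / rbar E S y) * (1 / real (nS E S)) \<le> b * \<rho> * (3/2 * \<Lambda> / real n)"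
        using pa_bound[OF S y] inverse_rbar_bdm(2)[OF S y] nS_facts(2)[OF S] b_pos rho_facts by (intro mult_mono) auto
      moreover have "b * \<rho> * (3/2 * \<Lambda> / real n) = (3/2 * (1 * (\<rho> * \<Lambda> * b))) / real n" by simp
      moreover have "\<dots> \<le> (3 * (N * (\<rho> * \<Lambda> * b))) / real n"
        using np N_ge_1 rho_facts Lambda_facts(1) b_pos by (intro divide_right_mono mult_mono) auto
      moreover have "(3 * (N * (\<rho> * \<Lambda> * b))) / real n = 3 * N * \<rho> * \<Lambda> * b / real n" by simp
      moreover have "pa MM S y * (1 / rbar E S y) / real (nS E S) = pa MM S y * (1 / rbar E S y) * (1 / real (nS E S))" by simp
      ultimately show ?thesis by linarith
    qed
    moreover have "(\<integral>u. pa MM S u * (1 / rbar E S u) / real (nS E S) \<partial>inc_law S) = 0"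
    proof -
      have "(\<integral>u. pa MM S u * (1 / rbar E S u) / real (nS E S) \<partial>inc_law S)
          = (\<integral>x. pa MM S (restrict x S) * (1 / rbar E S (restrict x S)) / real (nS E S) * rbar E S (restrict x S) \<partial>P)"
        by (rule integral_inc_law[OF S bdm_measurable[OF b2]])
      also have "\<dots> = (\<integral>x. pa MM S (restrict x S) / real (nS E S) \<partial>P)"
      proof (rule Bochner_Integration.integral_cong[OF refl])
        fix x assume "x \<in> space P"
        then have "rbar E S (restrict x S) \<noteq> 0" using rbar_pos[OF S restr_space[OF S]] by fastforce
        then show "pa MM S (restrict x S) * (1 / rbar E S (restrict x S)) / real (nS E S) * rbar E S (restrict x S) = pa MM S (restrict x S) / real (nS E S)" by simp
      qed
      finally show ?thesis using pa_mean[OF S] by simp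
    qed
    moreover have l: "lin (Inr (S, j)) = (\<lambda>u. pa MM S u * (1 / rbar E S u) / real (nS E S))" by (simp add: fun_eq_iff)
    ultimately show ?thesis unfolding 2(1) l using S by simp
  qed
  then show "bdm (Mf k) (lin k)" "y \<in> space (Mf k) \<Longrightarrow> \<bar>lin k y\<bar> \<le> 3 * N * \<rho> * \<Lambda> * b / real n" "(\<integral>y. lin k y \<partial>Mf k) = 0" by blast+
qed

lemma lin_variance: "(\<Sum>k\<in>idxs. \<integral>y. (lin k y)\<^sup>2 \<partial>Mf k) = asyvar / real n"
proof -
  have np: "0 < real n" using n_pos by simp
  have 1: "(\<integral>y. (lin (Inl i) y)\<^sup>2 \<partial>Mf (Inl i)) = (\<integral>x. (psi x)\<^sup>2 \<partial>P) / (real n)\<^sup>2" for i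
    by (simp add: power_divide)
  have 2: "(\<integral>y. (lin (Inr (S, j)) y)\<^sup>2 \<partial>Mf (Inr (S, j))) = incvar S / (real (nS E S))\<^sup>2" if S: "S \<in> \<S>" for S j
  proof -
    have b2: "bdm (leb S) (\<lambda>u. (pa MM S u * (1 / rbar E S u) / real (nS E S))\<^sup>2)" by (intro bdm_power bdm_divide_const bdm_mult pa inverse_rbar_bdm S)
    have "(\<integral>y. (lin (Inr (S, j)) y)\<^sup>2 \<partial>Mf (Inr (S, j))) = (\<integral>u. (pa MM S u * (1 / rbar E S u) / real (nS E S))\<^sup>2 \<partial>inc_law S)"
      using S by (simp only: lin_simps Mf_simps)
    also have "\<dots> = (\<integral>x. (pa MM S (restrict x S) * (1 / rbar E S (restrict x S)) / real (nS E S))\<^sup>2 * rbar E S (restrict x S) \<partial>P)"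
      by (rule integral_inc_law[OF S bdm_measurable[OF b2]])
    also have "\<dots> = (\<integral>x. (pa MM S (restrict x S))\<^sup>2 * (1 / rbar E S (restrict x S)) / (real (nS E S))\<^sup>2 \<partial>P)"
    proof (rule Bochner_Integration.integral_cong[OF refl])
      fix x assume "x \<in> space P"
      then have "rbar E S (restrict x S) \<noteq> 0" using rbar_pos[OF S restr_space[OF S]] by fastforce
      then show "(pa MM S (restrict x S) * (1 / rbar E S (restrict x S)) / real (nS E S))\<^sup>2 * rbar E S (restrict x S)
          = (pa MM S (restrict x S))\<^sup>2 * (1 / rbar E S (restrict x S)) / (real (nS E S))\<^sup>2" by (simp add: power2_eq_square)
    qed
    also have "\<dots> = incvar S / (real (nS E S))\<^sup>2" unfolding incvar_def by (rule Bochner_Integration.integral_divide_zero)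
    finally show ?thesis .
  qed
  have "(\<Sum>k\<in>idxs. \<integral>y. (lin k y)\<^sup>2 \<partial>Mf k) = real n * ((\<integral>x. (psi x)\<^sup>2 \<partial>P) / (real n)\<^sup>2) + (\<Sum>S\<in>\<S>. real (nS E S) * (incvar S / (real (nS E S))\<^sup>2))"
    unfolding sum_idxs 1
  proof (intro arg_cong2[where f="(+)"] sum.cong refl)
    fix S assume S: "S \<in> \<S>"
    show "(\<Sum>j\<in>{1..nS E S}. \<integral>y. (lin (Inr (S, j)) y)\<^sup>2 \<partial>Mf (Inr (S, j))) = real (nS E S) * (incvar S / (real (nS E S))\<^sup>2)"
      by (simp only: 2[OF S]) simp
  qed simp
  also have "\<dots> = (\<integral>x. (psi x)\<^sup>2 \<partial>P) / real n + (\<Sum>S\<in>\<S>. (real n / real (nS E S) * incvar S) / real n)"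
    using np by (intro arg_cong2[where f="(+)"] sum.cong) (auto simp: power2_eq_square dest: nS_facts(4))
  also have "\<dots> = asyvar / real n" unfolding asyvar_def by (simp only: sum_divide_distrib add_divide_distrib)
  finally show ?thesis .
qed

lemma tmain: "bdm Q tmain" "(\<integral>D. (tmain D)\<^sup>2 \<partial>Q) = asyvar / real n"
proof -
  have c: "bdm Q (\<lambda>D. lin k (D k))" if "k \<in> idxs" for k
    by (rule bdm_comp[OF lin(1)[OF that]]) simp
  show "bdm Q tmain" unfolding tmain_eq[abs_def] by (intro bdm_sum c)
  have "(\<integral>D. (tmain D)\<^sup>2 \<partial>Q) = (\<Sum>k\<in>idxs. \<integral>D. (lin k (D k))\<^sup>2 \<partial>Q)"
    unfolding tmain_eq by (rule centred_sum_coords[where idx="\<lambda>k. k", OF finite_idxs c]) (use lin(3) in auto)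
  also have "\<dots> = (\<Sum>k\<in>idxs. \<integral>y. (lin k y)\<^sup>2 \<partial>Mf k)"
    by (rule sum.cong[OF refl], rule integral_coord[where f="\<lambda>y. (lin _ y)\<^sup>2"]) (intro bdm_measurable bdm_power lin)
  finally show "(\<integral>D. (tmain D)\<^sup>2 \<partial>Q) = asyvar / real n" using lin_variance by simp
qed

text \<open>Uniform bound for the summands of the leading term after normalising its variance to 1:
  the bound in \<open>lin\<close> times \<open>sqrt n / sqrt asyvar\<close>.\<close>

definition "\<kappa>L = 3 * N * \<rho> * \<Lambda> * b / (sqrt (real n) * sqrt asyvar)"

lemma tmain_clt:
  "\<bar>measure Q {D \<in> space Q. sqrt (real n) * tmain D / sqrt asyvar \<le> z} - Phi z\<bar> \<le> 12 * \<kappa>L powr (1/4)"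
proof -
  have np: "0 < real n" using n_pos by simp
  define s where "s = sqrt (real n) / sqrt asyvar"
  have s: "0 < s" "s\<^sup>2 = real n / asyvar" unfolding s_def using np asyvar_pos by (simp_all add: power_divide)
  have sk: "s * (3 * N * \<rho> * \<Lambda> * b / real n) = \<kappa>L"
  proof -
    have "s * (z / real n) = z / (sqrt (real n) * sqrt asyvar)" for z
    proof -
      have "sqrt (real n) * (1 / real n) = 1 / sqrt (real n)" using np by (simp add: field_simps)
      moreover have "s * (z / real n) = z / sqrt asyvar * (sqrt (real n) * (1 / real n))" unfolding s_def by simp
      ultimately show ?thesis by simp
    qed
    then show ?thesis unfolding \<kappa>L_def .
  qed
  have "\<bar>measure Q {D \<in> space Q. (\<Sum>k\<in>idxs. s * lin k (D k)) \<le> z} - Phi z\<bar> \<le> 12 * \<kappa>L powr (1/4)"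
  proof (rule clt_rate[OF finite_idxs])
    show "0 < \<kappa>L" unfolding \<kappa>L_def using np asyvar_pos N_ge_1 rho_facts Lambda_facts(1) b_pos by (auto intro!: divide_pos_pos mult_pos_pos)
    show "(\<Sum>k\<in>idxs. \<integral>y. (s * lin k y)\<^sup>2 \<partial>Mf k) = 1"
    proof -
      have "(\<Sum>k\<in>idxs. \<integral>y. (s * lin k y)\<^sup>2 \<partial>Mf k) = (\<Sum>k\<in>idxs. s\<^sup>2 * (\<integral>y. (lin k y)\<^sup>2 \<partial>Mf k))"
        by (simp only: power_mult_distrib Bochner_Integration.integral_mult_right_zero)
      also have "\<dots> = s\<^sup>2 * (asyvar / real n)" unfolding lin_variance[symmetric] by (simp only: sum_distrib_left)
      finally show ?thesis using s(2) np asyvar_pos by simp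
    qed
    fix k assume k: "k \<in> idxs"
    show "bdm (Mf k) (\<lambda>y. s * lin k y)" by (intro bdm_mult bdm_const lin k)
    show "(\<integral>y. s * lin k y \<partial>Mf k) = 0" using lin(3)[OF k] by simp
    fix y assume "y \<in> space (Mf k)"
    from mult_left_mono[OF lin(2)[OF k this], of s] show "\<bar>s * lin k y\<bar> \<le> \<kappa>L" using s sk by (simp add: abs_mult)
  qed
  moreover have "(\<Sum>k\<in>idxs. s * lin k (D k)) = sqrt (real n) * tmain D / sqrt asyvar" for D
    unfolding tmain_eq sum_distrib_left[symmetric] s_def by simp
  ultimately show ?thesis by simp
qed

end

section \<open>The variance estimator\<close>

lemma (in prob_space) abs_expectation_add:
  assumes "bdm M f" "bdm M g"
  shows "(\<integral>x. \<bar>f x + g x\<bar> \<partial>M) \<le> (\<integral>x. \<bar>f x\<bar> \<partial>M) + (\<integral>x. \<bar>g x\<bar> \<partial>M)"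
proof -
  have "(\<integral>x. \<bar>f x + g x\<bar> \<partial>M) \<le> (\<integral>x. \<bar>f x\<bar> + \<bar>g x\<bar> \<partial>M)"
    by (intro bdm_integral_le bdm_abs bdm_add assms) (rule abs_triangle_ineq)
  also have "\<dots> = (\<integral>x. \<bar>f x\<bar> \<partial>M) + (\<integral>x. \<bar>g x\<bar> \<partial>M)"
    by (rule bdm_integral_add[OF bdm_abs[OF assms(1)] bdm_abs[OF assms(2)]])
  finally show ?thesis .
qed

lemma (in prob_space) abs_expectation_sum:
  assumes "\<And>i. i \<in> I \<Longrightarrow> bdm M (f i)" "\<And>i. i \<in> I \<Longrightarrow> (\<integral>x. \<bar>f i x\<bar> \<partial>M) \<le> c"
  shows "(\<integral>x. \<bar>\<Sum>i\<in>I. f i x\<bar> \<partial>M) \<le> real (card I) * c"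
proof -
  have "(\<integral>x. \<bar>\<Sum>i\<in>I. f i x\<bar> \<partial>M) \<le> (\<integral>x. (\<Sum>i\<in>I. \<bar>f i x\<bar>) \<partial>M)"
    by (intro bdm_integral_le bdm_abs bdm_sum assms(1) sum_abs)
  also have "\<dots> = (\<Sum>i\<in>I. \<integral>x. \<bar>f i x\<bar> \<partial>M)" by (intro bdm_integral_sum bdm_abs assms)
  also have "\<dots> \<le> real (card I) * c" using assms(2) by (rule sum_bounded_above)
  finally show ?thesis .
qed

lemma (in prob_space) abs_expectation_cmult: "(\<integral>x. \<bar>c * f x\<bar> \<partial>M) = \<bar>c\<bar> * (\<integral>x. \<bar>f x\<bar> \<partial>M)" for c :: real
  by (simp add: abs_mult)

lemma (in prob_space) abs_expectation_average:
  assumes "finite I" "I \<noteq> {}" "\<And>i. i \<in> I \<Longrightarrow> bdm M (f i)" "\<And>i. i \<in> I \<Longrightarrow> (\<integral>x. \<bar>f i x\<bar> \<partial>M) \<le> c"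
  shows "(\<integral>x. \<bar>average I (\<lambda>i. f i x)\<bar> \<partial>M) \<le> c"
proof -
  have k: "0 < real (card I)" using assms by (simp add: card_gt_0_iff)
  have "(\<integral>x. \<bar>average I (\<lambda>i. f i x)\<bar> \<partial>M) = (\<integral>x. \<bar>\<Sum>i\<in>I. f i x\<bar> \<partial>M) / card I"
    by (simp add: average_def)
  also have "\<dots> \<le> real (card I) * c / card I" using abs_expectation_sum[OF assms(3,4)] k by (intro divide_right_mono) auto
  finally show ?thesis using k by simp
qed

lemma bdm_average: "(\<And>i. i \<in> I \<Longrightarrow> bdm M (f i)) \<Longrightarrow> bdm M (\<lambda>x. average I (\<lambda>i. f i x))"
  unfolding average_def by (intro bdm_divide_const bdm_sum)

context model
begin

text \<open>The variance estimator is treated in mean absolute error, where the fitting error enters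
  linearly through the root of its mean square.\<close>

definition "se = sqrt err"

lemma se: "0 \<le> se" "b / sqrt (real n) \<le> se" "se\<^sup>2 = err"
proof -
  show "0 \<le> se" "se\<^sup>2 = err" using err_facts by (simp_all add: se_def)
  have "sqrt (b\<^sup>2 / real n) \<le> se" unfolding se_def using err_facts by (intro real_sqrt_le_mono) auto
  then show "b / sqrt (real n) \<le> se" using b_pos by (simp add: real_sqrt_divide)
qed

lemma se_scale: assumes "0 \<le> c" shows "c * b / sqrt (real n) \<le> c * se"
  using mult_left_mono[OF se(2) assms] by simp

lemma DelX_abs:
  assumes l: "l \<in> {1, 2}" and S: "S \<in> \<S>" and i: "i \<in> half E (3 - l)"
  shows "bdm Q (\<lambda>D. Del l MM S D (X i D))" "(\<integral>D. \<bar>Del l MM S D (X i D)\<bar> \<partial>Q) \<le> se"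
proof -
  note l' = other_half(1)[OF l] and H = half_facts[OF other_half(1)[OF l]]
  show bD: "bdm Q (\<lambda>D. Del l MM S D (X i D))" by (rule bdm_joint_X[OF Del_bdm[OF l order_refl S]])
  have i0: "i \<noteq> 0" using i H(5) by metis
  have up: "k \<notin> Inl ` half E l \<Longrightarrow> Del l MM S (D(k := y)) = Del l MM S D" for k D y
    using DelY_upd[OF l] by blast
  have "(\<integral>D. (Del l MM S D (X i D))\<^sup>2 \<partial>Q) = (\<integral>D. (Del l MM S D (X 0 D))\<^sup>2 \<partial>Q)"
  proof (rule integral_swap_point[OF Del2_joint[OF l S] i0])
    fix D
    have "Del l MM S (swp i D) = Del l MM S D" using up[OF other_half(4)[OF l i]] up[OF other_half(3)[OF l]] by metis
    then show "(\<lambda>x. (Del l MM S (swp i D) x)\<^sup>2) = (\<lambda>x. (Del l MM S D x)\<^sup>2)" by simp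
  qed
  then have "(\<integral>D. (Del l MM S D (X i D))\<^sup>2 \<partial>Q) \<le> err" using DelX_sq[OF l S] by simp
  from Q.expectation_abs_le_sqrt[OF bD this] show "(\<integral>D. \<bar>Del l MM S D (X i D)\<bar> \<partial>Q) \<le> se" by (simp add: se_def)
qed

text \<open>The variance over a half is at most \<open>3 * (c * b)\<^sup>2 / n\<close>, and
  \<open>b\<^sup>2 / n\<close> is absorbed by \<open>err\<close>.\<close>

lemma average_deviation:
  assumes l: "l \<in> {1, 2}" and g: "bdm (leb (coords E)) g" "\<And>x. x \<in> space (leb (coords E)) \<Longrightarrow> \<bar>g x\<bar> \<le> c * b" and c: "0 \<le> c"
  shows "bdm Q (\<lambda>D. average (half E l) (\<lambda>i. g (X i D)) - (\<integral>x. g x \<partial>P))"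
    "(\<integral>D. \<bar>average (half E l) (\<lambda>i. g (X i D)) - (\<integral>x. g x \<partial>P)\<bar> \<partial>Q) \<le> 2 * c * se"
proof -
  note H = half_facts[OF l]
  define m where "m = (\<integral>x. g x \<partial>P)"
  have gP: "bdm P g" using g(1) by (simp add: bdm_law)
  show bd: "bdm Q (\<lambda>D. average (half E l) (\<lambda>i. g (X i D)) - (\<integral>x. g x \<partial>P))"
    by (intro bdm_diff bdm_average bdm_fixed_X g bdm_const)
  have "(\<integral>x. g x - m \<partial>P) = 0" using P.bdm_integral_diff[OF gP bdm_const, of m] by (simp add: m_def P.prob_space)
  from average_centred[OF H(3,4) bdm_diff[OF g(1) bdm_const] this]
  have "(\<integral>D. (average (half E l) (\<lambda>i. g (X i D) - m))\<^sup>2 \<partial>Q) = (\<integral>x. (g x - m)\<^sup>2 \<partial>P) * (1 / card (half E l))" by simp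
  also have "\<dots> \<le> (c * b)\<^sup>2 * (3 / real n)"
  proof (rule mult_mono)
    have "(\<integral>x. (g x - m)\<^sup>2 \<partial>P) = (\<integral>x. (g x)\<^sup>2 \<partial>P) - m\<^sup>2" unfolding m_def
      by (rule P.variance_eq) (intro P.integrable_bdm bdm_power gP)+
    also have "\<dots> \<le> (\<integral>x. (g x)\<^sup>2 \<partial>P)" by simp
    also have "\<dots> \<le> (c * b)\<^sup>2"
    proof (rule P.integral_le_const_bdm[OF bdm_power[OF gP]])
      fix x assume "x \<in> space P"
      then have "\<bar>g x\<bar>\<^sup>2 \<le> (c * b)\<^sup>2" using g(2) by (intro power_mono) auto
      then show "(g x)\<^sup>2 \<le> (c * b)\<^sup>2" by simp
    qed
    finally show "(\<integral>x. (g x - m)\<^sup>2 \<partial>P) \<le> (c * b)\<^sup>2" .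
  qed (use half_card(1)[OF l] in auto)
  also have "\<dots> \<le> 4 * c\<^sup>2 * (b\<^sup>2 / real n)" by (simp add: power_mult_distrib divide_right_mono)
  also have "\<dots> \<le> 4 * c\<^sup>2 * err" using err_facts by (intro mult_left_mono) auto
  also have "\<dots> = (2 * c * se)\<^sup>2" using se(3) by (simp add: power_mult_distrib)
  finally have 1: "(\<integral>D. (average (half E l) (\<lambda>i. g (X i D) - m))\<^sup>2 \<partial>Q) \<le> (2 * c * se)\<^sup>2" .
  have eq: "average (half E l) (\<lambda>i. g (X i D) - m) = average (half E l) (\<lambda>i. g (X i D)) - m" for D
    by (simp add: average_diff average_const[OF H(3,4)])
  from Q.expectation_abs_le_sqrt[OF bd 1[unfolded eq, unfolded m_def]] show
    "(\<integral>D. \<bar>average (half E l) (\<lambda>i. g (X i D)) - (\<integral>x. g x \<partial>P)\<bar> \<partial>Q) \<le> 2 * c * se"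
    using c se(1) by simp
qed

lemma residual_eq: "residual E D l x = popres x - (\<Sum>S\<in>\<S>. Del l MM S D x)"
  by (simp add: residual_def popres_def Del_def sum_subtractf)

definition "resid2 l D = average (half E (3 - l)) (\<lambda>i. (residual E D l (X i D))\<^sup>2) - (\<integral>x. (popres x)\<^sup>2 \<partial>P)"

text \<open>Fitted and population residuals are bounded, so the difference of their squares is
  linear in the fitting error, via the factorisation into sum and difference; the rest is sampling
  error. The constant is \<open>12 = 4 + 8\<close>.\<close>

lemma resid2: assumes l: "l \<in> {1, 2}"
  shows "bdm Q (resid2 l)" "(\<integral>D. \<bar>resid2 l D\<bar> \<partial>Q) \<le> 12 * N\<^sup>2 * b * se"
proof -
  let ?H = "half E (3 - l)"
  note l' = other_half(1)[OF l] and H = half_facts[OF other_half(1)[OF l]]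
  have bp: "bdm Q (\<lambda>D. popres (X i D))" for i by (rule bdm_fixed_X[OF popres(1)])
  have bD: "bdm Q (\<lambda>D. Del l MM S D (X i D))" if "S \<in> \<S>" for S i by (rule bdm_joint_X[OF Del_bdm[OF l order_refl that]])
  have br: "bdm Q (\<lambda>D. residual E D l (X i D))" for i unfolding residual_eq by (intro bdm_diff bp bdm_sum bD)
  have rb: "\<bar>residual E D l x\<bar> \<le> 2 * N * b" if D: "D \<in> space Q" and x: "x \<in> space (leb (coords E))" for D x
  proof -
    have 1: "\<bar>\<Sum>S\<in>\<S>. alpha_fin E D l S (restrict x S)\<bar> \<le> N * b"
      using ah_bound[OF l D order_refl] restr_space x by (intro sum_patterns_abs_le) (auto simp: b_def)
    have 2: "1 * b \<le> N * b" using N_ge_1 b_pos by (intro mult_right_mono) auto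
    show ?thesis using target_abs_le[OF x] 1 2 b_pos unfolding residual_def by (simp only: mult.assoc)
  qed
  define A where "A D = average ?H (\<lambda>i. (residual E D l (X i D))\<^sup>2 - (popres (X i D))\<^sup>2)" for D
  define B where "B D = average ?H (\<lambda>i. (popres (X i D))\<^sup>2) - (\<integral>x. (popres x)\<^sup>2 \<partial>P)" for D
  have bA: "bdm Q A" unfolding A_def[abs_def] by (intro bdm_average bdm_diff bdm_power br bp)
  have A: "(\<integral>D. \<bar>A D\<bar> \<partial>Q) \<le> 4 * N\<^sup>2 * b * se"
    unfolding A_def
  proof (rule Q.abs_expectation_average[OF H(3,4)])
    fix i assume i: "i \<in> ?H"
    show "bdm Q (\<lambda>D. (residual E D l (X i D))\<^sup>2 - (popres (X i D))\<^sup>2)" by (intro bdm_diff bdm_power br bp)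
    have "(\<integral>D. \<bar>(residual E D l (X i D))\<^sup>2 - (popres (X i D))\<^sup>2\<bar> \<partial>Q) \<le> (\<integral>D. \<bar>4 * N * b * (\<Sum>S\<in>\<S>. Del l MM S D (X i D))\<bar> \<partial>Q)"
    proof (intro Q.bdm_integral_le bdm_abs bdm_diff bdm_power br bp bdm_mult bdm_const bdm_sum bD)
      fix D assume D: "D \<in> space Q"
      let ?r = "residual E D l (X i D)" and ?p = "popres (X i D)" and ?s = "\<Sum>S\<in>\<S>. Del l MM S D (X i D)"
      have "?r\<^sup>2 - ?p\<^sup>2 = (?r + ?p) * (?r - ?p)" by (simp add: power2_eq_square algebra_simps)
      then have e: "?r\<^sup>2 - ?p\<^sup>2 = (?r + ?p) * (- ?s)" unfolding residual_eq by simp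
      have "\<bar>?r + ?p\<bar> \<le> 4 * N * b" using rb[OF D X_space[OF D, of i]] popres(2)[OF X_space[OF D, of i]] by linarith
      then have "\<bar>?r + ?p\<bar> * \<bar>?s\<bar> \<le> \<bar>4 * N * b\<bar> * \<bar>?s\<bar>" by (intro mult_right_mono) auto
      then show "\<bar>?r\<^sup>2 - ?p\<^sup>2\<bar> \<le> \<bar>4 * N * b * ?s\<bar>" unfolding e by (simp only: abs_mult abs_minus_cancel)
    qed
    also have "\<dots> = \<bar>4 * N * b\<bar> * (\<integral>D. \<bar>\<Sum>S\<in>\<S>. Del l MM S D (X i D)\<bar> \<partial>Q)" by (rule Q.abs_expectation_cmult)
    also have "\<dots> \<le> \<bar>4 * N * b\<bar> * (N * se)" by (intro mult_left_mono Q.abs_expectation_sum DelX_abs[OF l _ i]) auto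
    also have "\<dots> = 4 * N\<^sup>2 * b * se" using b_pos by (simp add: power2_eq_square)
    finally show "(\<integral>D. \<bar>(residual E D l (X i D))\<^sup>2 - (popres (X i D))\<^sup>2\<bar> \<partial>Q) \<le> 4 * N\<^sup>2 * b * se" .
  qed
  have sq: "\<bar>(popres x)\<^sup>2\<bar> \<le> (4 * N\<^sup>2 * b) * b" if "x \<in> space (leb (coords E))" for x
  proof -
    have "\<bar>popres x\<bar>\<^sup>2 \<le> (2 * N * b)\<^sup>2" using popres(2)[OF that] by (intro power_mono) auto
    then show ?thesis by (simp add: power2_eq_square mult_ac)
  qed
  have B: "bdm Q B" "(\<integral>D. \<bar>B D\<bar> \<partial>Q) \<le> 2 * (4 * N\<^sup>2 * b) * se"
    unfolding B_def[abs_def] using average_deviation[OF l' bdm_power[OF popres(1)] sq] b_pos by auto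
  have e: "resid2 l = (\<lambda>D. A D + B D)" unfolding resid2_def A_def B_def average_diff by (simp add: fun_eq_iff)
  show "bdm Q (resid2 l)" unfolding e by (intro bdm_add bA B)
  show "(\<integral>D. \<bar>resid2 l D\<bar> \<partial>Q) \<le> 12 * N\<^sup>2 * b * se" unfolding e using Q.abs_expectation_add[OF bA B(1)] A B(2) by simp
qed

definition "incdev l S D = rho_hat (half E l) S D *
  average (half E (3 - l)) (\<lambda>i. (ah l MM S D (restrict (X i D) S))\<^sup>2 * (1 / rbar E S (restrict (X i D) S))) - incvar S"

lemma VS_fold_eq: "S \<in> \<S> \<Longrightarrow> VS_fold E D l S = real n / real (nS E S) * (incdev l S D + incvar S)"
proof -
  assume S: "S \<in> \<S>"
  have "rhat E D (half E l) S * (alpha_fin E D l S (restrict (Xfull E i D) S))\<^sup>2 / (real (nS E S) * ratio E S (restrict (Xfull E i D) S))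
     = (rho_hat (half E l) S D / real (nS E S)) * ((ah l MM S D (restrict (X i D) S))\<^sup>2 * (1 / rbar E S (restrict (X i D) S)))" for i
    unfolding rhat_eq[OF S] ratio_eq[OF S] Xfull_eq using Rn_pos[OF S] by simp
  then show ?thesis unfolding VS_fold_def incdev_def by (simp only: average_mult_left) simp
qed

text \<open>Three sources of error, each costing at most \<open>2 * \<rho>\<^sup>2 * b * se\<close>:
  the estimated normaliser (\<open>A\<close>), the fitted instead of the population function
  (\<open>B\<close>), and the average over the half instead of the integral
  (\<open>C\<close>).\<close>

lemma incdev: assumes l: "l \<in> {1, 2}" and S: "S \<in> \<S>"
  shows "bdm Q (incdev l S)" "(\<integral>D. \<bar>incdev l S D\<bar> \<partial>Q) \<le> 6 * \<rho>\<^sup>2 * b * se"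
proof -
  let ?H = "half E (3 - l)"
  note l' = other_half(1)[OF l] and H = half_facts[OF other_half(1)[OF l]] and Hl = half_facts[OF l]
  let ?r = "\<lambda>i D. 1 / rbar E S (restrict (X i D) S)"
  let ?p = "\<lambda>i D. pa MM S (restrict (X i D) S)"
  let ?a = "\<lambda>i D. ah l MM S D (restrict (X i D) S)"
  have br: "bdm Q (?r i)" for i
    by (rule bdm_comp[OF inverse_rbar_bdm(1)[OF S] measurable_compose[OF X_measurable restr_measurable[OF S]]])
  have bp: "bdm Q (?p i)" for i
    by (rule bdm_comp[OF pa(1)[OF S] measurable_compose[OF X_measurable restr_measurable[OF S]]])
  have ba: "bdm Q (?a i)" for i by (rule bdm_joint_X[OF ah_X_joint[OF l order_refl S]])
  define G where "G D = average ?H (\<lambda>i. (?a i D)\<^sup>2 * ?r i D)" for D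
  define A where "A D = (rho_hat (half E l) S D - 1) * G D" for D
  define B where "B D = average ?H (\<lambda>i. (?a i D)\<^sup>2 * ?r i D - (?p i D)\<^sup>2 * ?r i D)" for D
  define C where "C D = average ?H (\<lambda>i. (?p i D)\<^sup>2 * ?r i D) - incvar S" for D
  have bG: "bdm Q G" unfolding G_def[abs_def] by (intro bdm_average bdm_mult bdm_power ba br)
  have bh: "bdm Q (\<lambda>D. rho_hat (half E l) S D - 1)" by (intro bdm_diff rho_hat_bdm S bdm_const)
  have bA: "bdm Q A" unfolding A_def[abs_def] by (intro bdm_mult bh bG)
  have bB: "bdm Q B" unfolding B_def[abs_def] by (intro bdm_average bdm_diff bdm_mult bdm_power ba br bp)
  have rs: "restrict (X i D) S \<in> space (leb S)" if "D \<in> space Q" for i D by (rule restr_space[OF S X_space[OF that]])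
  have ab: "\<bar>?a i D\<bar> \<le> b" if "D \<in> space Q" for i D
    using ah_bound[OF l that order_refl S rs[OF that]] by (simp add: b_def)
  have pb: "\<bar>?p i D\<bar> \<le> b" if "D \<in> space Q" for i D by (rule pa_bound[OF S rs[OF that]])
  have r: "0 < ?r i D" "?r i D \<le> \<rho>" if "D \<in> space Q" for i D using inverse_rbar_bdm(2)[OF S rs[OF that]] by auto
  have G: "0 \<le> G D" "G D \<le> b\<^sup>2 * \<rho>" if D: "D \<in> space Q" for D
  proof -
    have "(?a i D)\<^sup>2 * ?r i D \<le> b\<^sup>2 * \<rho> \<and> 0 \<le> (?a i D)\<^sup>2 * ?r i D" for i
    proof
      have "\<bar>?a i D\<bar>\<^sup>2 \<le> b\<^sup>2" using ab[OF D] by (intro power_mono) auto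
      then show "(?a i D)\<^sup>2 * ?r i D \<le> b\<^sup>2 * \<rho>" using r[OF D, of i] by (intro mult_mono) auto
      show "0 \<le> (?a i D)\<^sup>2 * ?r i D" using r(1)[OF D, of i] by (intro mult_nonneg_nonneg) auto
    qed
    then show "0 \<le> G D" "G D \<le> b\<^sup>2 * \<rho>" unfolding G_def by (blast intro: average_bounds[OF H(3,4)])+
  qed
  have A: "(\<integral>D. \<bar>A D\<bar> \<partial>Q) \<le> 2 * \<rho>\<^sup>2 * b * se"
  proof -
    have np: "0 < real n" using n_pos by simp
    have "cupp K / card (half E l) = cupp K * (1 / card (half E l))" by simp
    also have "\<dots> \<le> \<rho> * (3 / real n)" using half_card(1)[OF l] rho_facts C_ge_1 by (intro mult_mono) auto
    also have "\<dots> \<le> (2 * \<rho>)\<^sup>2 / real n"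
    proof -
      have "\<rho> * 3 \<le> \<rho> * (\<rho> * 4)" using rho_facts by (intro mult_left_mono) auto
      then have "\<rho> * 3 / real n \<le> \<rho> * (\<rho> * 4) / real n" by (intro divide_right_mono) auto
      then show ?thesis by (simp add: power2_eq_square mult_ac)
    qed
    finally have "(\<integral>D. (rho_hat (half E l) S D - 1)\<^sup>2 \<partial>Q) \<le> (2 * \<rho>)\<^sup>2 / real n" using rho_hat_variance(1)[OF S Hl(3,4)] by linarith
    moreover have "sqrt ((2 * \<rho>)\<^sup>2 / real n) = 2 * \<rho> / sqrt (real n)"
      unfolding real_sqrt_divide real_sqrt_abs using rho_facts by simp
    ultimately have h: "(\<integral>D. \<bar>rho_hat (half E l) S D - 1\<bar> \<partial>Q) \<le> 2 * \<rho> / sqrt (real n)"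
      using Q.expectation_abs_le_sqrt[OF bh] by metis
    have "(\<integral>D. \<bar>A D\<bar> \<partial>Q) \<le> (\<integral>D. \<bar>b\<^sup>2 * \<rho> * (rho_hat (half E l) S D - 1)\<bar> \<partial>Q)"
    proof (intro Q.bdm_integral_le bdm_abs bA bdm_mult bdm_const bh)
      fix D assume D: "D \<in> space Q"
      have "\<bar>G D\<bar> * \<bar>rho_hat (half E l) S D - 1\<bar> \<le> \<bar>b\<^sup>2 * \<rho>\<bar> * \<bar>rho_hat (half E l) S D - 1\<bar>"
        using G[OF D] rho_facts by (intro mult_right_mono) auto
      then show "\<bar>A D\<bar> \<le> \<bar>b\<^sup>2 * \<rho> * (rho_hat (half E l) S D - 1)\<bar>" unfolding A_def by (simp only: abs_mult mult.commute[of "\<bar>rho_hat (half E l) S D - 1\<bar>"])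
    qed
    also have "\<dots> = \<bar>b\<^sup>2 * \<rho>\<bar> * (\<integral>D. \<bar>rho_hat (half E l) S D - 1\<bar> \<partial>Q)" by (rule Q.abs_expectation_cmult)
    also have "\<dots> \<le> \<bar>b\<^sup>2 * \<rho>\<bar> * (2 * \<rho> / sqrt (real n))" using h by (intro mult_left_mono) auto
    also have "\<dots> = (2 * \<rho>\<^sup>2 * b) * b / sqrt (real n)" using rho_facts by (simp add: power2_eq_square)
    also have "\<dots> \<le> (2 * \<rho>\<^sup>2 * b) * se" using b_pos by (intro se_scale) auto
    finally show ?thesis .
  qed
  have B: "(\<integral>D. \<bar>B D\<bar> \<partial>Q) \<le> 2 * \<rho> * b * se"
    unfolding B_def
  proof (rule Q.abs_expectation_average[OF H(3,4)])
    fix i assume i: "i \<in> ?H"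
    show "bdm Q (\<lambda>D. (?a i D)\<^sup>2 * ?r i D - (?p i D)\<^sup>2 * ?r i D)" by (intro bdm_diff bdm_mult bdm_power ba br bp)
    have "(\<integral>D. \<bar>(?a i D)\<^sup>2 * ?r i D - (?p i D)\<^sup>2 * ?r i D\<bar> \<partial>Q) \<le> (\<integral>D. \<bar>2 * b * \<rho> * Del l MM S D (X i D)\<bar> \<partial>Q)"
    proof (intro Q.bdm_integral_le bdm_abs bdm_diff bdm_mult bdm_power ba br bp bdm_const DelX_abs[OF l S i])
      fix D assume D: "D \<in> space Q"
      have e: "(?a i D)\<^sup>2 * ?r i D - (?p i D)\<^sup>2 * ?r i D = (?a i D + ?p i D) * ?r i D * Del l MM S D (X i D)"
        by (simp add: Del_def power2_eq_square algebra_simps diff_divide_distrib)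
      have "\<bar>?a i D + ?p i D\<bar> * \<bar>?r i D\<bar> \<le> (2 * b) * \<rho>" using ab[OF D, of i] pb[OF D, of i] r[OF D, of i] by (intro mult_mono) auto
      then have "\<bar>?a i D + ?p i D\<bar> * \<bar>?r i D\<bar> * \<bar>Del l MM S D (X i D)\<bar> \<le> \<bar>2 * b * \<rho>\<bar> * \<bar>Del l MM S D (X i D)\<bar>"
        using b_pos rho_facts by (intro mult_right_mono) auto
      then show "\<bar>(?a i D)\<^sup>2 * ?r i D - (?p i D)\<^sup>2 * ?r i D\<bar> \<le> \<bar>2 * b * \<rho> * Del l MM S D (X i D)\<bar>"
        unfolding e by (simp only: abs_mult)
    qed
    also have "\<dots> = \<bar>2 * b * \<rho>\<bar> * (\<integral>D. \<bar>Del l MM S D (X i D)\<bar> \<partial>Q)" by (rule Q.abs_expectation_cmult)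
    also have "\<dots> \<le> \<bar>2 * b * \<rho>\<bar> * se" using DelX_abs(2)[OF l S i] by (intro mult_left_mono) auto
    also have "\<dots> = 2 * \<rho> * b * se" using b_pos rho_facts by simp
    finally show "(\<integral>D. \<bar>(?a i D)\<^sup>2 * ?r i D - (?p i D)\<^sup>2 * ?r i D\<bar> \<partial>Q) \<le> 2 * \<rho> * b * se" .
  qed
  have g: "bdm (leb (coords E)) (\<lambda>x. (pa MM S (restrict x S))\<^sup>2 * (1 / rbar E S (restrict x S)))"
    by (rule bdm_comp[OF incvar_bdm(1)[OF S] restr_measurable[OF S]])
  have gb: "\<bar>(pa MM S (restrict x S))\<^sup>2 * (1 / rbar E S (restrict x S))\<bar> \<le> (\<rho> * b) * b" if "x \<in> space (leb (coords E))" for x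
    using incvar_bdm(2,3)[OF S restr_space[OF S that]] by (simp add: power2_eq_square mult_ac)
  have C: "bdm Q C" "(\<integral>D. \<bar>C D\<bar> \<partial>Q) \<le> 2 * (\<rho> * b) * se"
    unfolding C_def[abs_def] incvar_def using average_deviation[OF l' g gb] b_pos rho_facts by simp_all
  have e: "incdev l S = (\<lambda>D. A D + (B D + C D))"
    unfolding incdev_def[abs_def] A_def B_def C_def G_def average_diff by (simp add: fun_eq_iff algebra_simps)
  show "bdm Q (incdev l S)" unfolding e by (intro bdm_add bA bB C)
  have "\<rho> * (b * se) \<le> \<rho>\<^sup>2 * (b * se)" using rho_facts b_pos se(1) by (intro mult_right_mono) (auto simp: power2_eq_square)
  then have "2 * \<rho> * b * se \<le> 2 * \<rho>\<^sup>2 * b * se" "2 * (\<rho> * b) * se \<le> 2 * \<rho>\<^sup>2 * b * se" by simp_all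
  then show "(\<integral>D. \<bar>incdev l S D\<bar> \<partial>Q) \<le> 6 * \<rho>\<^sup>2 * b * se"
    unfolding e using Q.abs_expectation_add[OF bA bdm_add[OF bB C(1)]] Q.abs_expectation_add[OF bB C(1)] A B C(2) by linarith
qed

definition "tdev D = tmain D + Rem D"

text \<open>\<open>122 = 2 * (11 + 50)\<close>; the remainder's constant 100 is halved because
  \<open>n\<close> is at least 2.\<close>

lemma tdev: "bdm Q tdev" "(\<integral>D. (tdev D)\<^sup>2 \<partial>Q) \<le> 122 * N\<^sup>2 * \<rho> ^ 3 * \<Lambda> * err"
proof -
  have np: "2 \<le> real n" using n_pos by simp
  show b: "bdm Q tdev" unfolding tdev_def[abs_def] by (intro bdm_add tmain Rem)
  have "(\<integral>D. (tdev D)\<^sup>2 \<partial>Q) \<le> (\<integral>D. 2 * (tmain D)\<^sup>2 + 2 * (Rem D)\<^sup>2 \<partial>Q)"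
    unfolding tdev_def by (intro Q.bdm_integral_le bdm_power bdm_add tmain Rem bdm_mult bdm_const sum_square_le)
  also have "\<dots> = 2 * (\<integral>D. (tmain D)\<^sup>2 \<partial>Q) + 2 * (\<integral>D. (Rem D)\<^sup>2 \<partial>Q)"
    using Q.integrable_bdm[OF bdm_power[OF tmain(1), of 2]] Q.integrable_bdm[OF bdm_power[OF Rem(1), of 2]] by simp
  also have "\<dots> \<le> 2 * (11 * N\<^sup>2 * \<rho> ^ 3 * \<Lambda> * err) + 2 * (50 * N\<^sup>2 * \<rho> ^ 3 * \<Lambda> * err)"
  proof (intro add_mono mult_left_mono)
    have "asyvar / real n \<le> (11 * N\<^sup>2 * \<rho> * \<Lambda> * b\<^sup>2) / real n" using asyvar_le by (intro divide_right_mono) auto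
    also have "\<dots> = 11 * N\<^sup>2 * (\<rho> * (\<Lambda> * (b\<^sup>2 / real n)))" by simp
    also have "\<dots> \<le> 11 * N\<^sup>2 * (\<rho> ^ 3 * (\<Lambda> * err))"
      using rho_facts self_le_power[of \<rho> 3] err_facts Lambda_facts(1) by (intro mult_left_mono mult_mono) auto
    finally show "(\<integral>D. (tmain D)\<^sup>2 \<partial>Q) \<le> 11 * N\<^sup>2 * \<rho> ^ 3 * \<Lambda> * err" unfolding tmain(2) by (simp only: mult.assoc)
    have "100 * N\<^sup>2 * \<rho> ^ 3 * \<Lambda> * err / real n \<le> 100 * N\<^sup>2 * \<rho> ^ 3 * \<Lambda> * err / 2"
      using np rho_facts err_facts Lambda_facts(1) by (intro divide_left_mono) auto
    then show "(\<integral>D. (Rem D)\<^sup>2 \<partial>Q) \<le> 50 * N\<^sup>2 * \<rho> ^ 3 * \<Lambda> * err" using Rem(2) by linarith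
  qed auto
  finally show "(\<integral>D. (tdev D)\<^sup>2 \<partial>Q) \<le> 122 * N\<^sup>2 * \<rho> ^ 3 * \<Lambda> * err" by linarith
qed

definition "Vraw D = (V_fold E D 1 + V_fold E D 2 + (\<Sum>S\<in>\<S>. VS_fold E D 1 S + VS_fold E D 2 S)) / 2"

lemma V_hat_eq: "V_hat E D = max (Vraw D) 0"
  by (simp add: V_hat_def Vraw_def)

definition "Vdev D = (resid2 1 D + resid2 2 D + (\<Sum>S\<in>\<S>. real n / real (nS E S) * (incdev 1 S D + incdev 2 S D))) / 2
   - ((tdev D)\<^sup>2 + 2 * theta E * tdev D)"

text \<open>The subtracted square of the estimate turns the second moment of the population residual
  into the variance of \<open>psi\<close>, up to
  \<open>(tdev D)\<^sup>2 + 2 * theta E * tdev D\<close>.\<close>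

lemma Vraw_eq: "Vraw D = asyvar + Vdev D"
proof -
  have pP: "bdm P popres" using popres(1) by (simp add: bdm_law)
  have "(\<integral>x. (psi x)\<^sup>2 \<partial>P) = (\<integral>x. (popres x)\<^sup>2 \<partial>P) - (theta E)\<^sup>2"
    using P.variance_eq[OF P.integrable_bdm[OF pP] P.integrable_bdm[OF bdm_power[OF pP]]] unfolding popres(3) popres(4) .
  then have v: "asyvar = (\<integral>x. (popres x)\<^sup>2 \<partial>P) - (theta E)\<^sup>2 + (\<Sum>S\<in>\<S>. real n / real (nS E S) * incvar S)" by (simp add: asyvar_def)
  have t: "(theta_hat E D)\<^sup>2 = (theta E)\<^sup>2 + ((tdev D)\<^sup>2 + 2 * theta E * tdev D)"
  proof -
    have "theta_hat E D = theta E + tdev D" using theta_hat_eq[of D] by (simp add: tdev_def)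
    then show ?thesis by (simp add: power2_eq_square algebra_simps)
  qed
  have f: "V_fold E D l = resid2 l D + (\<integral>x. (popres x)\<^sup>2 \<partial>P) - (theta_hat E D)\<^sup>2" for l
    unfolding V_fold_def resid2_def Xfull_eq by simp
  have s: "(\<Sum>S\<in>\<S>. VS_fold E D 1 S + VS_fold E D 2 S) = (\<Sum>S\<in>\<S>. real n / real (nS E S) * (incdev 1 S D + incdev 2 S D)) + 2 * (\<Sum>S\<in>\<S>. real n / real (nS E S) * incvar S)"
    unfolding sum_distrib_left sum.distrib[symmetric] by (rule sum.cong[OF refl]) (simp add: VS_fold_eq algebra_simps add_divide_distrib)
  show ?thesis unfolding Vraw_def f s t v Vdev_def by (simp add: field_simps)
qed

text \<open>All terms are linear in \<open>se\<close> except the mean of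
  \<open>(tdev D)\<^sup>2\<close>, which is of order \<open>se\<^sup>2\<close>;
  \<open>se \<le> b\<close> makes it linear too. The contributions add up to
  \<open>6 + 6 + 9 + 122 + 24\<close>.\<close>

lemma Vdev: "bdm Q Vdev" "se \<le> b \<Longrightarrow> (\<integral>D. \<bar>Vdev D\<bar> \<partial>Q) \<le> 200 * N\<^sup>2 * \<rho> ^ 3 * \<Lambda> * b * se"
proof -
  note r1 = resid2[of 1, simplified] and r2 = resid2[of 2, simplified] and i1 = incdev[of 1, simplified] and i2 = incdev[of 2, simplified]
  define Z where "Z D = (\<Sum>S\<in>\<S>. real n / real (nS E S) * (incdev 1 S D + incdev 2 S D))" for D
  define z where "z = N\<^sup>2 * \<rho> ^ 3 * \<Lambda> * b * se"
  have bZ: "bdm Q Z" unfolding Z_def[abs_def] by (intro bdm_sum bdm_mult bdm_const bdm_add i1 i2)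
  have bt2: "bdm Q (\<lambda>D. (tdev D)\<^sup>2)" by (rule bdm_power[OF tdev(1)])
  have e: "Vdev D = 1 / 2 * resid2 1 D + (1 / 2 * resid2 2 D + (1 / 2 * Z D + ((-1) * (tdev D)\<^sup>2 + (- 2 * theta E) * tdev D)))" for D
    unfolding Vdev_def Z_def by (simp add: add_divide_distrib)
  have bs: "bdm Q (\<lambda>D. 1 / 2 * resid2 1 D)" "bdm Q (\<lambda>D. 1 / 2 * resid2 2 D)" "bdm Q (\<lambda>D. 1 / 2 * Z D)" "bdm Q (\<lambda>D. (-1) * (tdev D)\<^sup>2)" "bdm Q (\<lambda>D. (- 2 * theta E) * tdev D)"
    by (intro bdm_mult bdm_const r1 r2 bZ bt2 tdev)+
  show "bdm Q Vdev" unfolding e[abs_def] by (intro bdm_add bs)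
  assume assms: "se \<le> b"
  have k: "0 \<le> \<rho>" "1 \<le> N" "N \<le> N\<^sup>2" "1 \<le> N\<^sup>2" "1 \<le> \<rho> ^ 3" "\<rho>\<^sup>2 \<le> \<rho> ^ 3" "1 \<le> \<Lambda>" "0 \<le> b * se"
    using N_ge_1 rho_facts Lambda_facts(1) b_pos se(1) power_increasing[of 2 3 \<rho>] self_le_power[of N 2] by simp_all
  have z0: "0 \<le> z" unfolding z_def using k b_pos se(1) rho_facts by (intro mult_nonneg_nonneg) auto
  have c1: "N\<^sup>2 * b * se \<le> z"
  proof -
    have "1 * 1 \<le> \<rho> ^ 3 * \<Lambda>" using k by (intro mult_mono) auto
    then have "N\<^sup>2 * (b * se) * (1 * 1) \<le> N\<^sup>2 * (b * se) * (\<rho> ^ 3 * \<Lambda>)" using k by (intro mult_left_mono) auto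
    then show ?thesis by (simp add: z_def mult_ac)
  qed
  have "(\<integral>D. \<bar>Z D\<bar> \<partial>Q) \<le> N * (3/2 * \<Lambda> * (12 * \<rho>\<^sup>2 * b * se))"
    unfolding Z_def
  proof (rule Q.abs_expectation_sum)
    fix S assume S: "S \<in> \<S>"
    show "bdm Q (\<lambda>D. real n / real (nS E S) * (incdev 1 S D + incdev 2 S D))" by (intro bdm_mult bdm_const bdm_add i1 i2 S)
    have "(\<integral>D. \<bar>real n / real (nS E S) * (incdev 1 S D + incdev 2 S D)\<bar> \<partial>Q) = \<bar>real n / real (nS E S)\<bar> * (\<integral>D. \<bar>incdev 1 S D + incdev 2 S D\<bar> \<partial>Q)"
      by (rule Q.abs_expectation_cmult)
    also have "\<dots> \<le> 3/2 * \<Lambda> * (12 * \<rho>\<^sup>2 * b * se)"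
    proof (rule mult_mono)
      show "(\<integral>D. \<bar>incdev 1 S D + incdev 2 S D\<bar> \<partial>Q) \<le> 12 * \<rho>\<^sup>2 * b * se"
        using Q.abs_expectation_add[OF i1(1)[OF S] i2(1)[OF S]] i1(2)[OF S] i2(2)[OF S] by linarith
    qed (use nS_facts(1,4)[OF S] k in auto)
    finally show "(\<integral>D. \<bar>real n / real (nS E S) * (incdev 1 S D + incdev 2 S D)\<bar> \<partial>Q) \<le> 3/2 * \<Lambda> * (12 * \<rho>\<^sup>2 * b * se)" .
  qed
  also have "\<dots> = 18 * (N * \<rho>\<^sup>2 * (\<Lambda> * (b * se)))" by simp
  also have "\<dots> \<le> 18 * (N\<^sup>2 * \<rho> ^ 3 * (\<Lambda> * (b * se)))" using k by (intro mult_left_mono mult_right_mono mult_mono) auto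
  also have "\<dots> = 18 * z" by (simp add: z_def)
  finally have EZ: "(\<integral>D. \<bar>Z D\<bar> \<partial>Q) \<le> 18 * z" .
  have Et2: "(\<integral>D. (tdev D)\<^sup>2 \<partial>Q) \<le> 122 * z"
  proof -
    have "err \<le> b * se" using mult_right_mono[OF assms se(1)] se(3) by (simp add: power2_eq_square)
    then have "122 * N\<^sup>2 * \<rho> ^ 3 * \<Lambda> * err \<le> 122 * N\<^sup>2 * \<rho> ^ 3 * \<Lambda> * (b * se)" using k by (intro mult_left_mono) auto
    then show ?thesis using tdev(2) by (simp add: z_def)
  qed
  have Et: "(\<integral>D. \<bar>tdev D\<bar> \<partial>Q) \<le> 12 * N * \<rho>\<^sup>2 * \<Lambda> * se"
  proof -
    have "122 * N\<^sup>2 * \<rho> ^ 3 * \<Lambda> * err \<le> 144 * N\<^sup>2 * \<rho> ^ 4 * \<Lambda>\<^sup>2 * err"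
      using k err_facts rho_facts power_increasing[of 3 4 \<rho>] by (intro mult_right_mono mult_mono) (auto simp: power2_eq_square)
    also have "\<dots> = (12 * N * \<rho>\<^sup>2 * \<Lambda> * se)\<^sup>2" by (simp add: power_mult_distrib se(3) flip: power_mult)
    finally have "(\<integral>D. (tdev D)\<^sup>2 \<partial>Q) \<le> (12 * N * \<rho>\<^sup>2 * \<Lambda> * se)\<^sup>2" using tdev(2) by linarith
    from Q.expectation_abs_le_sqrt[OF tdev(1) this] show ?thesis using k se(1) by simp
  qed
  have "\<bar>- 2 * theta E\<bar> * (\<integral>D. \<bar>tdev D\<bar> \<partial>Q) \<le> (2 * b) * (12 * N * \<rho>\<^sup>2 * \<Lambda> * se)"
    using theta_abs_le b_pos Et by (intro mult_mono) auto
  also have "\<dots> = 24 * (N * \<rho>\<^sup>2 * (\<Lambda> * (b * se)))" by simp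
  also have "\<dots> \<le> 24 * (N\<^sup>2 * \<rho> ^ 3 * (\<Lambda> * (b * se)))" using k by (intro mult_left_mono mult_right_mono mult_mono) auto
  also have "\<dots> = 24 * z" by (simp add: z_def)
  finally have Et1: "\<bar>- 2 * theta E\<bar> * (\<integral>D. \<bar>tdev D\<bar> \<partial>Q) \<le> 24 * z" .
  have t5: "(\<integral>D. \<bar>Vdev D\<bar> \<partial>Q) \<le> 1 / 2 * (\<integral>D. \<bar>resid2 1 D\<bar> \<partial>Q) + (1 / 2 * (\<integral>D. \<bar>resid2 2 D\<bar> \<partial>Q) + (1 / 2 * (\<integral>D. \<bar>Z D\<bar> \<partial>Q)
     + ((\<integral>D. (tdev D)\<^sup>2 \<partial>Q) + \<bar>- 2 * theta E\<bar> * (\<integral>D. \<bar>tdev D\<bar> \<partial>Q))))"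
  proof -
    have c: "(\<integral>D. \<bar>1 / 2 * resid2 1 D\<bar> \<partial>Q) = 1 / 2 * (\<integral>D. \<bar>resid2 1 D\<bar> \<partial>Q)" "(\<integral>D. \<bar>1 / 2 * resid2 2 D\<bar> \<partial>Q) = 1 / 2 * (\<integral>D. \<bar>resid2 2 D\<bar> \<partial>Q)"
      "(\<integral>D. \<bar>1 / 2 * Z D\<bar> \<partial>Q) = 1 / 2 * (\<integral>D. \<bar>Z D\<bar> \<partial>Q)" "(\<integral>D. \<bar>(-1) * (tdev D)\<^sup>2\<bar> \<partial>Q) = (\<integral>D. (tdev D)\<^sup>2 \<partial>Q)"
      "(\<integral>D. \<bar>(- 2 * theta E) * tdev D\<bar> \<partial>Q) = \<bar>- 2 * theta E\<bar> * (\<integral>D. \<bar>tdev D\<bar> \<partial>Q)"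
      by (simp_all only: Q.abs_expectation_cmult) simp_all
    show ?thesis unfolding e
      using Q.abs_expectation_add[OF bs(1) bdm_add[OF bs(2) bdm_add[OF bs(3) bdm_add[OF bs(4,5)]]]]
        Q.abs_expectation_add[OF bs(2) bdm_add[OF bs(3) bdm_add[OF bs(4,5)]]]
        Q.abs_expectation_add[OF bs(3) bdm_add[OF bs(4,5)]] Q.abs_expectation_add[OF bs(4,5)]
      unfolding c by linarith
  qed
  have "12 * N\<^sup>2 * b * se \<le> 12 * z" using c1 by simp
  then have "(\<integral>D. \<bar>Vdev D\<bar> \<partial>Q) \<le> 200 * z" using t5 r1(2) r2(2) EZ Et2 Et1 z0 by linarith
  then show "(\<integral>D. \<bar>Vdev D\<bar> \<partial>Q) \<le> 200 * N\<^sup>2 * \<rho> ^ 3 * \<Lambda> * b * se" by (simp add: z_def)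
qed

end

section \<open>Studentisation\<close>

lemma (in prob_space) markov_bdm:
  assumes "bdm M f" "\<And>x. x \<in> space M \<Longrightarrow> 0 \<le> f x" "0 < c"
  shows "prob {x \<in> space M. c < f x} \<le> (\<integral>x. f x \<partial>M) / c"
proof -
  have [measurable]: "f \<in> borel_measurable M" by (rule bdm_measurable[OF assms(1)])
  have s: "{x \<in> space M. c < f x} \<in> sets M" by measurable
  have "c * prob {x \<in> space M. c < f x} = (\<integral>x. c * indicator {x \<in> space M. c < f x} x \<partial>M)" using s by simp
  also have "\<dots> \<le> (\<integral>x. f x \<partial>M)"
  proof (rule integral_mono)
    show "integrable M (\<lambda>x. c * indicator {x \<in> space M. c < f x} x)"
      using s by (intro integrable_bdm bdmI[where B=c]) (auto simp: indicator_def assms(3) less_imp_le)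
  qed (use assms integrable_bdm in \<open>auto simp: indicator_def\<close>)
  finally show ?thesis using assms(3) by (simp add: pos_le_divide_eq mult.commute)
qed

text \<open>The shift is proportional to \<open>\<bar>x\<bar> + 1\<close>, as it stems from a relative perturbation of the scale; the
  decay of the density compensates for this.\<close>

lemma Phi_shift:
  assumes "0 \<le> q" "q \<le> 1 / 2"
  shows "Phi (x + q * (\<bar>x\<bar> + 1)) \<le> Phi x + 2 * q" "Phi x - 2 * q \<le> Phi (x - q * (\<bar>x\<bar> + 1))"
proof -
  define t where "t = q * (\<bar>x\<bar> + 1)"
  have t: "0 \<le> t" "t \<le> (\<bar>x\<bar> + 1) / 2"
    unfolding t_def using assms mult_right_mono[OF assms(2), of "\<bar>x\<bar> + 1"] by auto
  \<comment> \<open>A point \<open>y\<close> of the interval satisfies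
    \<open>\<bar>x\<bar> + 1 \<le> 2 * (\<bar>y\<bar> + 1)\<close>, because the shift is at most
    half of \<open>\<bar>x\<bar> + 1\<close>; the density at \<open>y\<close> then absorbs this
    factor.\<close>
  have d: "t * std_normal_density y \<le> 2 * q" if "\<bar>y - x\<bar> \<le> t" for y
  proof -
    have "\<bar>x\<bar> \<le> \<bar>y\<bar> + \<bar>y - x\<bar>" by linarith
    then have "\<bar>x\<bar> + 1 \<le> 2 * (\<bar>y\<bar> + 1)" using that t(2) by argo
    then have "t * std_normal_density y \<le> q * (2 * (\<bar>y\<bar> + 1)) * std_normal_density y"
      unfolding t_def using assms by (intro mult_right_mono mult_left_mono) auto
    also have "\<dots> = 2 * q * ((\<bar>y\<bar> + 1) * std_normal_density y)" by simp
    also have "\<dots> \<le> 2 * q * 1" using std_normal_density_bounds(5)[of y] assms by (intro mult_left_mono) auto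
    finally show ?thesis by simp
  qed
  have "Phi (x + t) - Phi x \<le> 2 * q" by (rule Phi_diff_le) (use t assms in \<open>auto intro!: d\<close>)
  moreover have "Phi x - Phi (x - t) \<le> 2 * q" by (rule Phi_diff_le) (use t assms in \<open>auto intro!: d\<close>)
  ultimately show "Phi (x + q * (\<bar>x\<bar> + 1)) \<le> Phi x + 2 * q" "Phi x - 2 * q \<le> Phi (x - q * (\<bar>x\<bar> + 1))"
    unfolding t_def by linarith+
qed

text \<open>Off the events that \<open>R\<close> or \<open>V - 1\<close> exceeds \<open>q\<close>,
  the studentised variable is at most \<open>z\<close> exactly when
  \<open>W + R \<le> z * sqrt V\<close>, and this threshold differs from \<open>z\<close> by at most
  \<open>q * \<bar>z\<bar>\<close>. The event is thus caught between two events for \<open>W\<close>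
  alone, with thresholds shifted by \<open>q * (\<bar>z\<bar> + 1)\<close>.\<close>

lemma (in prob_space) studentised_clt:
  assumes [measurable]: "W \<in> borel_measurable M" "R \<in> borel_measurable M" "V \<in> borel_measurable M"
    and q: "0 \<le> q" "q \<le> 1 / 2"
    and W: "\<And>z. \<bar>prob {x \<in> space M. W x \<le> z} - Phi z\<bar> \<le> e0"
    and R: "prob {x \<in> space M. q < \<bar>R x\<bar>} \<le> e1" and V: "prob {x \<in> space M. q < \<bar>V x - 1\<bar>} \<le> e2"
  shows "\<bar>prob {x \<in> space M. (W x + R x) / sqrt (V x) * of_bool (0 < V x) \<le> z} - Phi z\<bar> \<le> e0 + e1 + e2 + 2 * q"
proof -
  let ?U = "{x \<in> space M. (W x + R x) / sqrt (V x) * of_bool (0 < V x) \<le> z}"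
  let ?B = "{x \<in> space M. q < \<bar>R x\<bar>} \<union> {x \<in> space M. q < \<bar>V x - 1\<bar>}"
  let ?u = "z + q * (\<bar>z\<bar> + 1)" and ?l = "z - q * (\<bar>z\<bar> + 1)"
  have U: "?U \<in> sets M" by measurable
  have B: "?B \<in> sets M" "prob ?B \<le> e1 + e2"
    using measure_Un_le[of "{x \<in> space M. q < \<bar>R x\<bar>}" M "{x \<in> space M. q < \<bar>V x - 1\<bar>}"] R V by auto
  have Ws: "{x \<in> space M. W x \<le> c} \<in> sets M" for c by measurable
  have key: "\<bar>z * sqrt (V x) - z\<bar> \<le> q * \<bar>z\<bar>" "0 < V x" "\<bar>R x\<bar> \<le> q" if "x \<in> space M" "x \<notin> ?B" for x
  proof -
    have v: "\<bar>V x - 1\<bar> \<le> q" and "\<bar>R x\<bar> \<le> q" using that by auto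
    then show p: "0 < V x" "\<bar>R x\<bar> \<le> q" using q by auto
    have "V x - 1 = (sqrt (V x) - 1) * (sqrt (V x) + 1)" using p by (simp add: algebra_simps)
    then have "\<bar>V x - 1\<bar> = \<bar>sqrt (V x) - 1\<bar> * (sqrt (V x) + 1)" using p by (simp add: abs_mult)
    moreover have "\<bar>sqrt (V x) - 1\<bar> * 1 \<le> \<bar>sqrt (V x) - 1\<bar> * (sqrt (V x) + 1)" using p by (intro mult_left_mono) auto
    ultimately have "\<bar>sqrt (V x) - 1\<bar> \<le> q" using v by simp
    then have "\<bar>z\<bar> * \<bar>sqrt (V x) - 1\<bar> \<le> \<bar>z\<bar> * q" by (intro mult_left_mono) auto
    moreover have "z * sqrt (V x) - z = z * (sqrt (V x) - 1)" by (simp add: algebra_simps)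
    ultimately show "\<bar>z * sqrt (V x) - z\<bar> \<le> q * \<bar>z\<bar>" by (simp only: abs_mult mult.commute)
  qed
  have iff: "(W x + R x) / sqrt (V x) * of_bool (0 < V x) \<le> z \<longleftrightarrow> W x + R x \<le> z * sqrt (V x)" if "0 < V x" for x
    using that by (simp add: pos_divide_le_eq)
  have "?U \<subseteq> {x \<in> space M. W x \<le> ?u} \<union> ?B"
  proof
    fix x assume x: "x \<in> ?U"
    show "x \<in> {x \<in> space M. W x \<le> ?u} \<union> ?B"
    proof (cases "x \<in> ?B")
      case False
      have sp: "x \<in> space M" using x by simp
      note k = key[OF sp False]
      have "W x + R x \<le> z * sqrt (V x)" using x iff[OF k(2)] by simp
      then have "W x \<le> ?u" using k(1,3) by (simp add: distrib_left)
      then show ?thesis using sp by simp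
    qed simp
  qed
  then have "prob ?U \<le> prob ({x \<in> space M. W x \<le> ?u} \<union> ?B)" by (intro finite_measure_mono sets.Un Ws B)
  also have "\<dots> \<le> prob {x \<in> space M. W x \<le> ?u} + prob ?B" by (intro measure_Un_le Ws B)
  finally have up: "prob ?U \<le> prob {x \<in> space M. W x \<le> ?u} + (e1 + e2)" using B(2) by linarith
  have "{x \<in> space M. W x \<le> ?l} \<subseteq> ?U \<union> ?B"
  proof
    fix x assume x: "x \<in> {x \<in> space M. W x \<le> ?l}"
    show "x \<in> ?U \<union> ?B"
    proof (cases "x \<in> ?B")
      case False
      have sp: "x \<in> space M" using x by simp
      note k = key[OF sp False]
      have "z - q * \<bar>z\<bar> \<le> z * sqrt (V x)" "R x \<le> q" using k(1,3) by linarith+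
      then have "W x + R x \<le> z * sqrt (V x)" using x by (simp add: distrib_left)
      then show ?thesis using sp iff[OF k(2)] by simp
    qed simp
  qed
  then have "prob {x \<in> space M. W x \<le> ?l} \<le> prob (?U \<union> ?B)" by (intro finite_measure_mono sets.Un U B)
  also have "\<dots> \<le> prob ?U + prob ?B" by (intro measure_Un_le U B)
  finally have lo: "prob {x \<in> space M. W x \<le> ?l} \<le> prob ?U + (e1 + e2)" using B(2) by linarith
  show ?thesis using up lo W[of ?u] W[of ?l] Phi_shift[OF q, of z] by linarith
qed

context model
begin

section \<open>Comparison of all error terms with the bound\<close>

definition "q = A_const E K powr (real MM / 2) * D_const E K / V0 K * \<delta> powr (1 / 4)"

lemma error_bound_eq: "error_bound E K = 7 * q"
  by (simp add: error_bound_def q_def \<delta>_def \<beta>_def \<tau>_def)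

lemma target_norm_nonneg: "0 \<le> target_norm E"
proof -
  obtain x where x: "x \<in> space (leb (coords E))" using leb_space_ne by blast
  have "\<bar>target E x\<bar> \<le> target_norm E" unfolding target_norm_def by (rule cSUP_upper[OF x target_bdd])
  then show ?thesis by linarith
qed

lemma D_const_eq: "D_const E K = 3200 * (N\<^sup>2 * \<rho> * \<Lambda>) * a0\<^sup>2 * \<mu>max"
proof -
  have "max ((target_norm E)\<^sup>2) 1 = a0\<^sup>2"
  proof (cases "target_norm E \<le> 1")
    case True
    then show ?thesis using power_le_one[OF target_norm_nonneg True, of 2] by (simp add: a0_def)
  next
    case False
    then show ?thesis using one_le_power[of "target_norm E" 2] by (simp add: a0_def)
  qed
  then show ?thesis
    unfolding D_const_def B_const_def \<rho>_def[symmetric] LL_def[symmetric] \<mu>max_def[symmetric] \<Lambda>_def[symmetric] by simp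
qed

text \<open>Factors of \<open>q\<close>, which is \<open>3200 * wt * \<mu>max * v * g * r\<close>
  with \<open>3200 = 200 * 16\<close>. All of them except \<open>r\<close> are at least 1, so their
  exponents may be raised freely when an error term is compared with a power of
  \<open>q\<close>.\<close>

definition "g = sqrt (A_const E K ^ MM)"
definition "r = \<delta> powr (1 / 4)"
definition "v = a0\<^sup>2 / V0 K"
definition "wt = N\<^sup>2 * \<rho> * \<Lambda>"

lemma constants_ge_1: "1 \<le> g" "1 \<le> v" "1 \<le> wt" "1 \<le> \<mu>max" "0 < r"
proof -
  have "1 \<le> A_const E K ^ MM" using A_facts(2) by (intro one_le_power) auto
  then show "1 \<le> g" by (simp add: g_def)
  show "1 \<le> v" using V0_le V0(2) by (simp add: v_def)
  have "1 * 1 * 1 \<le> N\<^sup>2 * \<rho> * \<Lambda>" using N_ge_1 rho_facts Lambda_facts(1) by (intro mult_mono one_le_power) auto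
  then show "1 \<le> wt" by (simp add: wt_def)
  show "1 \<le> \<mu>max" by (rule mumax_facts(4))
  show "0 < r" using delta_facts(8) by (simp add: r_def)
qed

lemma g_facts: "g\<^sup>2 = A_const E K ^ MM" "3 ^ MM \<le> g" "A_const E K powr (real MM / 2) = g"
proof -
  have A: "0 < A_const E K" using A_facts(2) by simp
  then show 1: "g\<^sup>2 = A_const E K ^ MM" by (simp add: g_def)
  have "(3 ^ MM)\<^sup>2 = (9::real) ^ MM" by (simp flip: power_mult_distrib add: power2_eq_square)
  also have "\<dots> \<le> g\<^sup>2" unfolding 1 using A_facts(2) by (intro power_mono) auto
  finally show "3 ^ MM \<le> g" by (rule power2_le_imp_le) (use constants_ge_1 in simp)
  have "(A_const E K powr (real MM / 2))\<^sup>2 = A_const E K powr (real MM)" using A by (simp add: power2_eq_square flip: powr_add)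
  also have "\<dots> = g\<^sup>2" unfolding 1 using A by (simp add: powr_realpow)
  finally show "A_const E K powr (real MM / 2) = g" by (rule power2_eq_imp_eq) (use constants_ge_1 in auto)
qed

lemma r4: "r ^ 4 = \<delta>"
proof -
  have "r ^ 4 = r powr 4" using constants_ge_1(5) by (simp add: powr_numeral)
  also have "\<dots> = \<delta> powr (1 / 4 * 4)" unfolding r_def by (simp only: powr_powr)
  finally show ?thesis using delta_facts(8) by simp
qed

lemma q_eq: "q = 3200 * wt * \<mu>max * v * g * r"
  unfolding q_def g_facts(3) D_const_eq r_def[symmetric] v_def wt_def by simp

lemma mult_ge_left: "1 \<le> x \<Longrightarrow> 0 \<le> y \<Longrightarrow> y \<le> x * y" for x y :: real
  using mult_right_mono[of 1 x y] by simp

lemma q_ge: "3200 * (g * \<mu>max * r) \<le> q" "r \<le> q" "0 < q"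
proof -
  note c = constants_ge_1
  have 1: "1 * 1 \<le> wt * v" using c by (intro mult_mono) auto
  have p: "0 < g * \<mu>max * r" using c by simp
  have "3200 * (g * \<mu>max * r) \<le> (wt * v) * (3200 * (g * \<mu>max * r))" using 1 p by (intro mult_ge_left) auto
  also have "\<dots> = q" by (simp add: q_eq)
  finally show a: "3200 * (g * \<mu>max * r) \<le> q" .
  have "1 * 1 \<le> g * \<mu>max" using c by (intro mult_mono) auto
  then have "r \<le> g * \<mu>max * r" using c by (intro mult_ge_left) auto
  then show "r \<le> q" "0 < q" using a p c(5) by linarith+
qed

text \<open>Arithmetic-geometric mean inequality: as the dimension is at least 2, the bandwidth at
  most 1 and \<open>\<beta>\<close> at most 1, \<open>\<delta>\<close> is at least
  \<open>1 / (n * h\<^sup>2) + h\<^sup>2\<close>, hence at least \<open>2 / sqrt n\<close>.\<close>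

lemma delta_ge: "1 / sqrt (real n) \<le> \<delta>"
proof -
  have np: "0 < real n" using n_pos by simp
  have hh: "0 < h" "h \<le> 1" using h_pos h_le by auto
  have "h powr 2 \<le> h powr (2 * \<beta>)" using hh beta_facts by (intro powr_mono') auto
  then have 1: "h\<^sup>2 \<le> h powr (2 * \<beta>)" using hh by (simp add: powr_numeral)
  have "1 / (real n * h\<^sup>2) \<le> real (nsteps E) * T ^ ndim E / (real n * h ^ ndim E)"
  proof (rule frac_le)
    have "1 * 1 \<le> real (nsteps E) * T ^ ndim E" using nsteps_pos trunc_ge by (intro mult_mono one_le_power) auto
    then show "1 \<le> real (nsteps E) * T ^ ndim E" by simp
    show "real n * h ^ ndim E \<le> real n * h\<^sup>2" using hh ndim by (intro mult_left_mono power_decreasing) auto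
  qed (use np hh nsteps_pos trunc_ge in auto)
  then have 2: "1 / (real n * h\<^sup>2) + h\<^sup>2 \<le> \<delta>" unfolding \<delta>_def using 1 delta_facts(1) by linarith
  have "0 \<le> (1 / (sqrt (real n) * h) - h)\<^sup>2" by simp
  also have "\<dots> = 1 / (real n * h\<^sup>2) + h\<^sup>2 - 2 * (1 / sqrt (real n))"
    using np hh by (simp add: power2_diff power_mult_distrib power_divide)
  finally have "2 * (1 / sqrt (real n)) \<le> \<delta>" using 2 by linarith
  moreover have "0 \<le> 1 / sqrt (real n)" using np by simp
  ultimately show ?thesis by linarith
qed

text \<open>\<open>\<kappa>L\<close> is of order \<open>1 / sqrt n\<close>, thus at most a constant
  times \<open>\<delta> = r ^ 4\<close>, and the crude fourth-root rate of \<open>clt_rate\<close>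
  returns exactly the order of \<open>r\<close>.\<close>

lemma clt_error: "12 * \<kappa>L powr (1/4) \<le> q"
proof -
  note c = constants_ge_1
  have np: "0 < real n" using n_pos by simp
  have sV: "sqrt (V0 K) / 2 \<le> sqrt asyvar"
  proof -
    have "sqrt (V0 K) / 2 = sqrt (V0 K / 4)" by (simp add: real_sqrt_divide)
    also have "\<dots> \<le> sqrt asyvar" using asyvar_ge V0(2) by (intro real_sqrt_le_mono) linarith
    finally show ?thesis .
  qed
  have sv: "a0 / sqrt (V0 K) \<le> v"
  proof -
    have "a0 / sqrt (V0 K) = sqrt v" using a0_ge_1 by (simp add: v_def real_sqrt_divide)
    also have "\<dots> \<le> sqrt (v\<^sup>2)" using c by (intro real_sqrt_le_mono) (simp add: power2_eq_square)
    finally show ?thesis using c by simp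
  qed
  have NN: "N \<le> N\<^sup>2" using N_ge_1 by (simp add: power2_eq_square)
  have "\<kappa>L = 3 * (N * \<rho> * \<Lambda>) * b * (1 / sqrt (real n)) * (1 / sqrt asyvar)" by (simp add: \<kappa>L_def)
  also have "\<dots> \<le> 3 * wt * (g * a0) * r ^ 4 * (2 / sqrt (V0 K))"
  proof (intro mult_mono)
    show "N * \<rho> * \<Lambda> \<le> wt" unfolding wt_def using NN rho_facts Lambda_facts(1) by (intro mult_right_mono) auto
    show "b \<le> g * a0" unfolding b_def bnd_def using g_facts(2) a0_ge_1 by (intro mult_right_mono) auto
    show "1 / sqrt (real n) \<le> r ^ 4" unfolding r4 by (rule delta_ge)
    have "1 / sqrt asyvar \<le> 1 / (sqrt (V0 K) / 2)" using sV V0(2) asyvar_pos by (intro divide_left_mono) auto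
    then show "1 / sqrt asyvar \<le> 2 / sqrt (V0 K)" by simp
  qed (use c a0_ge_1 b_pos asyvar_pos V0(2) rho_facts Lambda_facts(1) in \<open>auto intro!: mult_nonneg_nonneg\<close>)
  also have "\<dots> = 6 * wt * g * r ^ 4 * (a0 / sqrt (V0 K))" by simp
  also have "\<dots> \<le> 6 * wt * g * r ^ 4 * v" using sv c by (intro mult_left_mono) auto
  also have "\<dots> = 6 * (wt * g * v * 1) * r ^ 4" by simp
  \<comment> \<open>266 is admissible since \<open>12 * 266 = 3192\<close> stays below 3200.\<close>
  also have "\<dots> \<le> 266 ^ 4 * (wt ^ 4 * g ^ 4 * v ^ 4 * \<mu>max ^ 4) * r ^ 4"
  proof -
    have "wt \<le> wt ^ 4" "g \<le> g ^ 4" "v \<le> v ^ 4" "1 \<le> \<mu>max ^ 4" using c by (simp_all add: self_le_power)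
    then have "wt * g * v * 1 \<le> wt ^ 4 * g ^ 4 * v ^ 4 * \<mu>max ^ 4" using c by (intro mult_mono) simp_all
    moreover have "0 \<le> wt * g * v * 1" using c by simp
    ultimately have "6 * (wt * g * v * 1) \<le> 266 ^ 4 * (wt ^ 4 * g ^ 4 * v ^ 4 * \<mu>max ^ 4)" by - (rule mult_mono, simp_all)
    then show ?thesis using c by (intro mult_right_mono) simp_all
  qed
  also have "\<dots> = (266 * wt * \<mu>max * v * g * r) ^ 4" by (simp add: power_mult_distrib)
  also have "\<dots> \<le> (q / 12) ^ 4"
  proof (rule power_mono)
    have "0 < wt * \<mu>max * v * g * r" using c by simp
    then show "266 * wt * \<mu>max * v * g * r \<le> q / 12" "0 \<le> 266 * wt * \<mu>max * v * g * r" unfolding q_eq by linarith+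
  qed
  finally have k: "\<kappa>L \<le> (q / 12) ^ 4" .
  have k0: "0 \<le> \<kappa>L" unfolding \<kappa>L_def using N_ge_1 rho_facts Lambda_facts(1) b_pos asyvar_pos by simp
  have "\<kappa>L powr (1/4) \<le> ((q / 12) ^ 4) powr (1/4)" using k k0 by (intro powr_mono2) auto
  also have "(q / 12) ^ 4 = (q / 12) powr 4" using q_ge(3) by (simp add: powr_numeral)
  also have "\<dots> powr (1/4) = q / 12" unfolding powr_powr using q_ge(3) by simp
  finally show ?thesis by simp
qed

lemma err_eq: "err = 14 * (g * a0 * \<mu>max * r\<^sup>2)\<^sup>2"
  unfolding err_def g_facts(1)[symmetric] r4[symmetric] by (simp add: power_mult_distrib flip: power_mult)

lemma se_le: "se \<le> 4 * (g * a0 * \<mu>max * r\<^sup>2)"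
proof (rule power2_le_imp_le)
  show "se\<^sup>2 \<le> (4 * (g * a0 * \<mu>max * r\<^sup>2))\<^sup>2" unfolding se(3) err_eq power_mult_distrib[of 4] by simp
qed (use constants_ge_1 a0_ge_1 in simp)

text \<open>When \<open>q\<close> is at most 1, \<open>g * \<mu>max * r\<close> is at most 1/3200,
  so the fitting error is far below the bound of the iterates and squares of \<open>se\<close> are
  dominated by \<open>b * se\<close>.\<close>

lemma se_le_b: assumes "q \<le> 1" shows "se \<le> b"
proof -
  note c = constants_ge_1
  have r: "r \<le> 1" "3200 * (g * \<mu>max * r) \<le> 1" using q_ge assms by linarith+
  have p: "0 < g * \<mu>max * r" using c by simp
  have "(g * \<mu>max * r) * r \<le> (g * \<mu>max * r) * 1" using r p by (intro mult_left_mono) auto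
  then have "4 * ((g * \<mu>max * r) * r) \<le> 1" using r p by linarith
  then have "a0 * (4 * ((g * \<mu>max * r) * r)) \<le> a0 * 1" using a0_ge_1 by (intro mult_left_mono) auto
  then have "4 * (g * a0 * \<mu>max * r\<^sup>2) \<le> a0" by (simp add: power2_eq_square mult_ac)
  then show ?thesis using se_le b_pos(2) by linarith
qed

lemma rho_wt: "N\<^sup>2 * \<rho> ^ 3 * \<Lambda> \<le> wt * \<mu>max"
proof -
  have "wt * \<rho>\<^sup>2 \<le> wt * \<mu>max" using mumax_facts(1) constants_ge_1 by (intro mult_left_mono) auto
  then show ?thesis by (simp add: wt_def power2_eq_square power3_eq_cube mult_ac)
qed

lemma asyvar_inverse: "1 / asyvar \<le> 2 / V0 K"
proof -
  have "1 / asyvar \<le> 1 / (V0 K / 2)" using asyvar_ge V0(2) asyvar_pos by (intro divide_left_mono) auto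
  then show ?thesis by simp
qed

text \<open>Chebyshev's inequality at threshold \<open>q\<close>: the second moment, of order
  \<open>\<delta> = r ^ 4\<close>, is at most \<open>q ^ 3\<close> because one factor
  \<open>r\<close> may be dropped.\<close>

lemma Rem_tail:
  assumes "q \<le> 1"
  shows "measure Q {D \<in> space Q. q < \<bar>sqrt (real n) * Rem D / sqrt asyvar\<bar>} \<le> q"
proof -
  note c = constants_ge_1
  have np: "0 < real n" using n_pos by simp
  define f where "f D = (sqrt (real n) * Rem D / sqrt asyvar)\<^sup>2" for D
  have bf: "bdm Q f" unfolding f_def[abs_def] by (intro bdm_power bdm_divide_const bdm_mult bdm_const Rem)
  have f: "f D = real n * (1 / asyvar) * (Rem D)\<^sup>2" for D unfolding f_def using np asyvar_pos by (simp add: power_mult_distrib power_divide)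
  have "q < \<bar>y\<bar> \<longleftrightarrow> q\<^sup>2 < y\<^sup>2" for y
    using power_strict_mono[of q "\<bar>y\<bar>" 2] power2_less_imp_less[of q "\<bar>y\<bar>"] q_ge(3) by auto
  then have "{D \<in> space Q. q < \<bar>sqrt (real n) * Rem D / sqrt asyvar\<bar>} = {D \<in> space Q. q\<^sup>2 < f D}"
    unfolding f_def by blast
  then have "measure Q {D \<in> space Q. q < \<bar>sqrt (real n) * Rem D / sqrt asyvar\<bar>} \<le> (\<integral>D. f D \<partial>Q) / q\<^sup>2"
    using Q.markov_bdm[OF bf, of "q\<^sup>2"] q_ge(3) by (simp add: f_def)
  also have "(\<integral>D. f D \<partial>Q) = real n * (1 / asyvar) * (\<integral>D. (Rem D)\<^sup>2 \<partial>Q)" unfolding f by (rule Bochner_Integration.integral_mult_right_zero)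
  also have "\<dots> / q\<^sup>2 \<le> (2800 * wt * \<mu>max ^ 3 * g\<^sup>2 * v * r ^ 4) / q\<^sup>2"
  proof (rule divide_right_mono)
    define y where "y = N\<^sup>2 * \<rho> ^ 3 * \<Lambda>"
    have y: "0 \<le> y" "y \<le> wt * \<mu>max" using rho_wt rho_facts Lambda_facts(1) by (simp_all add: y_def)
    have "real n * (1 / asyvar) * (\<integral>D. (Rem D)\<^sup>2 \<partial>Q) \<le> real n * (1 / asyvar) * (100 * N\<^sup>2 * \<rho> ^ 3 * \<Lambda> * err / real n)"
      using Rem(2) np asyvar_pos by (intro mult_left_mono) auto
    also have "\<dots> = 100 * y * err * (1 / asyvar)" using np by (simp add: y_def)
    also have "\<dots> \<le> 100 * (wt * \<mu>max) * err * (2 / V0 K)"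
      using y asyvar_inverse err_facts(1) asyvar_pos c by (intro mult_mono) auto
    also have "\<dots> = 2800 * wt * \<mu>max ^ 3 * g\<^sup>2 * v * r ^ 4"
      unfolding err_eq v_def by (simp add: power_mult_distrib power3_eq_cube power2_eq_square power4_eq_xxxx)
    finally show "real n * (1 / asyvar) * (\<integral>D. (Rem D)\<^sup>2 \<partial>Q) \<le> 2800 * wt * \<mu>max ^ 3 * g\<^sup>2 * v * r ^ 4" .
  qed simp
  also have "\<dots> \<le> q ^ 3 / q\<^sup>2"
  proof (rule divide_right_mono)
    have "2800 * wt * \<mu>max ^ 3 * g\<^sup>2 * v * r ^ 4 = 2800 * (wt * \<mu>max ^ 3 * v * g\<^sup>2 * (r ^ 3 * r))" by (simp add: power3_eq_cube power4_eq_xxxx)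
    also have "\<dots> \<le> 3200 ^ 3 * (wt ^ 3 * \<mu>max ^ 3 * v ^ 3 * g ^ 3 * (r ^ 3 * 1))"
    proof -
      have "wt \<le> wt ^ 3" "v \<le> v ^ 3" "g\<^sup>2 \<le> g ^ 3" "r \<le> 1" using c q_ge(2) assms by (simp_all add: self_le_power power_increasing)
      then have "wt * \<mu>max ^ 3 * v * g\<^sup>2 * (r ^ 3 * r) \<le> wt ^ 3 * \<mu>max ^ 3 * v ^ 3 * g ^ 3 * (r ^ 3 * 1)" using c by (intro mult_mono) simp_all
      moreover have "0 \<le> wt * \<mu>max ^ 3 * v * g\<^sup>2 * (r ^ 3 * r)" using c by simp
      ultimately show ?thesis by - (rule mult_mono, simp_all)
    qed
    also have "\<dots> = q ^ 3" unfolding q_eq by (simp add: power_mult_distrib)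
    finally show "2800 * wt * \<mu>max ^ 3 * g\<^sup>2 * v * r ^ 4 \<le> q ^ 3" .
  qed simp
  also have "q ^ 3 / q\<^sup>2 = q" using q_ge(3) by (simp add: power3_eq_cube power2_eq_square)
  finally show ?thesis .
qed

text \<open>Markov's inequality at threshold \<open>q\<close>: the first moment is of order
  \<open>r\<^sup>2\<close> and at most \<open>q\<^sup>2\<close>. Here the exponents match exactly,
  which fixes the exponent 1/4 of the theorem.\<close>

lemma V_tail:
  assumes "q \<le> 1"
  shows "measure Q {D \<in> space Q. q < \<bar>V_hat E D / asyvar - 1\<bar>} \<le> q"
proof -
  note c = constants_ge_1
  note Vd = Vdev(1) Vdev(2)[OF se_le_b[OF assms]]
  define f where "f D = 1 / asyvar * \<bar>Vdev D\<bar>" for D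
  have bf: "bdm Q f" unfolding f_def[abs_def] by (intro bdm_mult bdm_const bdm_abs Vd)
  have [measurable]: "f \<in> borel_measurable Q" by (rule bdm_measurable[OF bf])
  have le: "\<bar>V_hat E D / asyvar - 1\<bar> \<le> f D" for D
  proof -
    have "V_hat E D / asyvar - 1 = (V_hat E D - asyvar) * (1 / asyvar)" using asyvar_pos by (simp add: diff_divide_distrib)
    \<comment> \<open>Clipping at 0 can only move the estimator towards the positive number
      \<open>asyvar\<close>.\<close>
    moreover have "\<bar>V_hat E D - asyvar\<bar> \<le> \<bar>Vdev D\<bar>" unfolding V_hat_eq Vraw_eq using asyvar_pos by (simp add: max_def)
    ultimately show ?thesis unfolding f_def using asyvar_pos by (simp add: abs_mult divide_right_mono)
  qed
  have "measure Q {D \<in> space Q. q < \<bar>V_hat E D / asyvar - 1\<bar>} \<le> measure Q {D \<in> space Q. q < f D}"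
  proof (rule Q.finite_measure_mono)
    show "{D \<in> space Q. q < \<bar>V_hat E D / asyvar - 1\<bar>} \<subseteq> {D \<in> space Q. q < f D}" using le by (auto intro: less_le_trans)
  qed measurable
  also have "\<dots> \<le> (\<integral>D. f D \<partial>Q) / q" by (rule Q.markov_bdm[OF bf _ q_ge(3)]) (use asyvar_pos in \<open>simp add: f_def\<close>)
  also have "(\<integral>D. f D \<partial>Q) = 1 / asyvar * (\<integral>D. \<bar>Vdev D\<bar> \<partial>Q)" unfolding f_def by (rule Bochner_Integration.integral_mult_right_zero)
  also have "\<dots> / q \<le> (1600 * wt * \<mu>max\<^sup>2 * g\<^sup>2 * v * r\<^sup>2) / q"
  proof (rule divide_right_mono)
    define y where "y = N\<^sup>2 * \<rho> ^ 3 * \<Lambda>"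
    have y: "0 \<le> y" "y \<le> wt * \<mu>max" using rho_wt rho_facts Lambda_facts(1) by (simp_all add: y_def)
    have "1 / asyvar * (\<integral>D. \<bar>Vdev D\<bar> \<partial>Q) \<le> 2 / V0 K * (200 * N\<^sup>2 * \<rho> ^ 3 * \<Lambda> * b * se)"
      using Vd(2) asyvar_inverse V0(2) by (intro mult_mono) auto
    also have "\<dots> = 400 * y * b * se * (1 / V0 K)" by (simp add: y_def)
    also have "\<dots> \<le> 400 * (wt * \<mu>max) * (g * a0) * (4 * (g * a0 * \<mu>max * r\<^sup>2)) * (1 / V0 K)"
    proof (intro mult_right_mono mult_mono)
      show "b \<le> g * a0" unfolding b_def bnd_def using g_facts(2) a0_ge_1 by (intro mult_right_mono) auto
    qed (use y se_le se(1) c a0_ge_1 b_pos V0(2) in auto)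
    also have "\<dots> = 1600 * wt * \<mu>max\<^sup>2 * g\<^sup>2 * v * r\<^sup>2" by (simp add: v_def power2_eq_square)
    finally show "1 / asyvar * (\<integral>D. \<bar>Vdev D\<bar> \<partial>Q) \<le> 1600 * wt * \<mu>max\<^sup>2 * g\<^sup>2 * v * r\<^sup>2" .
  qed (use q_ge in simp)
  also have "\<dots> \<le> q\<^sup>2 / q"
  proof (rule divide_right_mono)
    have "1600 * wt * \<mu>max\<^sup>2 * g\<^sup>2 * v * r\<^sup>2 = 1600 * (wt * \<mu>max\<^sup>2 * v * g\<^sup>2 * r\<^sup>2)" by simp
    also have "\<dots> \<le> 3200\<^sup>2 * (wt\<^sup>2 * \<mu>max\<^sup>2 * v\<^sup>2 * g\<^sup>2 * r\<^sup>2)"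
    proof -
      have "wt \<le> wt\<^sup>2" "v \<le> v\<^sup>2" using c by (simp_all add: self_le_power)
      then have "wt * \<mu>max\<^sup>2 * v * g\<^sup>2 * r\<^sup>2 \<le> wt\<^sup>2 * \<mu>max\<^sup>2 * v\<^sup>2 * g\<^sup>2 * r\<^sup>2" using c by (intro mult_mono) simp_all
      moreover have "0 \<le> wt * \<mu>max\<^sup>2 * v * g\<^sup>2 * r\<^sup>2" using c by simp
      ultimately show ?thesis by - (rule mult_mono, simp_all)
    qed
    also have "\<dots> = q\<^sup>2" unfolding q_eq by (simp add: power_mult_distrib)
    finally show "1600 * wt * \<mu>max\<^sup>2 * g\<^sup>2 * v * r\<^sup>2 \<le> q\<^sup>2" .
  qed (use q_ge in simp)
  also have "q\<^sup>2 / q = q" using q_ge(3) by (simp add: power2_eq_square)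
  finally show ?thesis .
qed

text \<open>The decompositions express the estimators through bounded measurable statistics, so the
  iteration need not be inspected again.\<close>

lemma estimators_measurable: shows "theta_hat E \<in> borel_measurable Q" "V_hat E \<in> borel_measurable Q"
proof -
  have "theta_hat E = (\<lambda>D. theta E + (tmain D + Rem D))" using theta_hat_eq by (simp add: fun_eq_iff algebra_simps)
  moreover have "bdm Q (\<lambda>D. theta E + (tmain D + Rem D))" by (intro bdm_add bdm_const tmain Rem)
  ultimately show "theta_hat E \<in> borel_measurable Q" using bdm_measurable by metis
  have [measurable]: "Vdev \<in> borel_measurable Q" by (rule bdm_measurable[OF Vdev(1)])
  have "V_hat E = (\<lambda>D. max (asyvar + Vdev D) 0)" by (simp add: V_hat_eq Vraw_eq fun_eq_iff)
  then show "V_hat E \<in> borel_measurable Q" by simp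
qed

lemma studentised_measurable: "studentised E \<in> borel_measurable Q"
proof -
  note [measurable] = estimators_measurable
  have "studentised E = (\<lambda>D. sqrt (real n) * (theta_hat E D - theta E) / sqrt (V_hat E D) * of_bool (0 < V_hat E D))"
    by (simp add: studentised_def fun_eq_iff)
  then show ?thesis by simp
qed

text \<open>The central limit error, two exceptional events and the shift of the thresholds cost
  \<open>q + q + q + 2 * q\<close>, which is below \<open>7 * q\<close>. If \<open>7 * q\<close>
  exceeds 1 the bound is trivial; otherwise \<open>q \<le> 1 / 2\<close>, as
  \<open>Phi_shift\<close> requires.\<close>

lemma studentised_bound:
  shows "\<bar>measure Q {D \<in> space Q. studentised E D \<le> z} - Phi z\<bar> \<le> error_bound E K"
proof (cases "7 * q \<le> 1")
  case assms: True
  have np: "0 < real n" using n_pos by simp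
  have q1: "q \<le> 1" "q \<le> 1 / 2" "0 \<le> q" using assms q_ge(3) by linarith+
  define s where "s = sqrt asyvar"
  have s: "0 < s" using asyvar_pos by (simp add: s_def)
  have eq: "studentised E D = (sqrt (real n) * tmain D / s + sqrt (real n) * Rem D / s) / sqrt (V_hat E D / asyvar) * of_bool (0 < V_hat E D / asyvar)" for D
  proof -
    have "(sqrt (real n) * tmain D / s + sqrt (real n) * Rem D / s) / sqrt (V_hat E D / asyvar)
       = (sqrt (real n) * (tmain D + Rem D) / s) / (sqrt (V_hat E D) / s)"
      by (simp add: real_sqrt_divide s_def add_divide_distrib distrib_left)
    also have "\<dots> = sqrt (real n) * (tmain D + Rem D) / sqrt (V_hat E D)" using s by simp
    finally show ?thesis unfolding studentised_def theta_hat_eq using asyvar_pos by (simp add: zero_less_divide_iff)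
  qed
  have "\<bar>measure Q {D \<in> space Q. studentised E D \<le> z} - Phi z\<bar> \<le> 12 * \<kappa>L powr (1/4) + q + q + 2 * q"
    unfolding eq
  proof (rule Q.studentised_clt)
    show "(\<lambda>D. sqrt (real n) * tmain D / s) \<in> borel_measurable Q" "(\<lambda>D. sqrt (real n) * Rem D / s) \<in> borel_measurable Q"
      by (intro bdm_measurable bdm_divide_const bdm_mult bdm_const tmain Rem)+
    show "(\<lambda>D. V_hat E D / asyvar) \<in> borel_measurable Q" using estimators_measurable(2) by simp
  qed (use q1 tmain_clt Rem_tail V_tail s_def in auto)
  then show ?thesis using clt_error q1 unfolding error_bound_eq by linarith
next
  case False
  then show ?thesis
    using Phi_nonneg[of z] Phi_le_1[of z] Q.prob_le_1[of "{D \<in> space Q. studentised E D \<le> z}"]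
      measure_nonneg[of Q "{D \<in> space Q. studentised E D \<le> z}"] unfolding error_bound_eq by linarith
qed

end

section \<open>Transfer from the product space\<close>

text \<open>The same population, sample sizes and tuning parameters with the observations turned
  into coordinate projections; probabilities for it are taken under \<open>Q\<close>. The estimators
  of \<open>E\<close> are those of \<open>canon E\<close> evaluated at the family
  \<open>dat E \<omega>\<close> of observations.\<close>

definition canon :: "'w design \<Rightarrow> (nat + nat set \<times> nat \<Rightarrow> point) design" where
  "canon E = \<lparr>ndim = ndim E, dens = dens E, patterns = patterns E, ratio = ratio E, target = target E, lam = lam E,
    ssize = ssize E, ssize_inc = ssize_inc E, nsteps = nsteps E, bandwidth = bandwidth E, trunc = trunc E, piece = piece E,
    Omega = count_space UNIV, Xfull = \<lambda>i D. D (Inl i), Xinc = \<lambda>S j D. D (Inr (S, j))\<rparr>"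

definition dat :: "'w design \<Rightarrow> 'w \<Rightarrow> nat + nat set \<times> nat \<Rightarrow> point" where
  "dat E \<omega> = case_sum (\<lambda>i. Xfull E i \<omega>) (\<lambda>(S, j). Xinc E S j \<omega>)"

lemma dat_simps [simp]: "dat E \<omega> (Inl i) = Xfull E i \<omega>" "dat E \<omega> (Inr (S, j)) = Xinc E S j \<omega>"
  by (simp_all add: dat_def)

lemma canon_fields [simp]:
  "ndim (canon E) = ndim E" "dens (canon E) = dens E" "patterns (canon E) = patterns E" "ratio (canon E) = ratio E"
  "target (canon E) = target E" "lam (canon E) = lam E" "ssize (canon E) = ssize E" "ssize_inc (canon E) = ssize_inc E"
  "nsteps (canon E) = nsteps E" "bandwidth (canon E) = bandwidth E" "trunc (canon E) = trunc E" "piece (canon E) = piece E"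
  "Xfull (canon E) = (\<lambda>i D. D (Inl i))" "Xinc (canon E) = (\<lambda>S j D. D (Inr (S, j)))"
  by (simp_all add: canon_def)

lemma canon_population [simp]:
  "law (canon E) = law E" "marg (canon E) = marg E" "rbar (canon E) = rbar E" "theta (canon E) = theta E"
  "target_norm (canon E) = target_norm E" "half (canon E) = half E"
  by (simp_all add: law_def marg_def rbar_def theta_def target_norm_def half_def fun_eq_iff)

lemma canon_objective [simp]: "Defs.H (canon E) = Defs.H E" "objective (canon E) = objective E"
  by (simp_all add: Defs.H_def Lsq_def objective_def fun_eq_iff)

lemma canon_hypotheses [simp]: "hypotheses (canon E) K = hypotheses E K"
  by (simp add: hypotheses_def A1_def A2_def A3_def regular_cond_dist_def)

lemma canon_error_bound [simp]: "error_bound (canon E) K = error_bound E K"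
  by (simp add: error_bound_def A_const_def D_const_def B_const_def)

lemma canon_rhat [simp]: "rhat (canon E) (dat E \<omega>) I S = rhat E \<omega> I S"
  by (simp add: rhat_def)

lemma canon_weights [simp]: "what (canon E) (dat E \<omega>) I S = what E \<omega> I S" "fhat (canon E) (dat E \<omega>) I S = fhat E \<omega> I S"
  by (simp_all add: what_def fhat_def fun_eq_iff)

lemma canon_update [simp]: "update (canon E) (dat E \<omega>) I \<alpha> = update E \<omega> I \<alpha>"
  unfolding update_def Let_def fun_eq_iff by simp

lemma canon_alpha_hat [simp]: "alpha_hat (canon E) (dat E \<omega>) l m = alpha_hat E \<omega> l m"
  by (induction m) simp_all

lemma canon_theta_hat [simp]: "theta_hat (canon E) (dat E \<omega>) = theta_hat E \<omega>"
  by (simp add: theta_hat_def theta_fold_def residual_def)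

lemma canon_V_hat [simp]: "V_hat (canon E) (dat E \<omega>) = V_hat E \<omega>"
  by (simp add: V_hat_def V_fold_def VS_fold_def residual_def)

lemma canon_studentised [simp]: "studentised (canon E) (dat E \<omega>) = studentised E \<omega>"
  by (simp add: studentised_def)

lemma settingD:
  assumes "setting E"
  shows "2 \<le> ndim E" "dens E \<in> borel_measurable (leb (coords E))" "\<forall>x\<in>space (leb (coords E)). 0 \<le> dens E x"
    "prob_space (law E)" "patterns E \<noteq> {}" "patterns E \<subseteq> Pow (coords E) - {coords E}"
    "\<forall>S\<in>patterns E. ratio E S \<in> borel_measurable (leb S) \<and> (\<forall>u\<in>space (leb S). 0 < ratio E S u)"
    "target E \<in> borel_measurable (leb (coords E))"
    "\<forall>S\<in>patterns E. 0 < lam E S \<and> (\<lambda>k. real (ssize_inc E k S) / real k) \<longlonglongrightarrow> lam E S"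
    "\<forall>S\<in>patterns E. 1 \<le> nS E S" "1 \<le> nsteps E" "2 * nsteps E \<le> ssize E" "0 < bandwidth E" "1 \<le> trunc E"
    "\<forall>l\<in>{1,2}. disjoint_family_on (piece E l) {1..nsteps E} \<and>
        (\<Union>m\<in>{1..nsteps E}. piece E l m) = half E l \<and>
        (\<forall>m\<in>{1..nsteps E}. \<forall>m'\<in>{1..nsteps E}. card (piece E l m) \<le> card (piece E l m') + 1)"
    "prob_space (Omega E)"
    "\<forall>i\<in>{1..ssize E}. distributed (Omega E) (leb (coords E)) (Xfull E i) (\<lambda>x. ennreal (dens E x))"
    "\<forall>S\<in>patterns E. \<forall>j\<in>{1..nS E S}. distributed (Omega E) (leb S) (Xinc E S j) (\<lambda>u. ennreal (rbar E S u * marg E S u))"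
    "prob_space.indep_vars (Omega E) (case_sum (\<lambda>i. leb (coords E)) (\<lambda>(S, j). leb S))
       (case_sum (Xfull E) (\<lambda>(S, j). Xinc E S j)) ({1..ssize E} <+> (SIGMA S:patterns E. {1..nS E S}))"
  using assms unfolding setting_def by - (elim conjE; assumption)+

lemma canon_model:
  assumes s: "setting E" and h: "hypotheses E K"
  shows "model (canon E) K"
proof (rule model.intro)
  note S = settingD[OF s]
  show "Xfull (canon E) = (\<lambda>i D. D (Inl i))" "Xinc (canon E) = (\<lambda>S j D. D (Inr (S, j)))" by simp_all
  show "2 \<le> ndim (canon E)" unfolding canon_fields by (rule S(1))
  show "dens (canon E) \<in> borel_measurable (leb (coords (canon E)))" unfolding canon_fields by (rule S(2))
  show "0 \<le> dens (canon E) x" if "x \<in> space (leb (coords (canon E)))" for x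
    using that unfolding canon_fields by (rule bspec[OF S(3)])
  show "prob_space (law (canon E))" unfolding canon_population by (rule S(4))
  show "patterns (canon E) \<noteq> {}" unfolding canon_fields by (rule S(5))
  show "patterns (canon E) \<subseteq> Pow (coords (canon E)) - {coords (canon E)}" unfolding canon_fields by (rule S(6))
  show "ratio (canon E) A \<in> borel_measurable (leb A)" if "A \<in> patterns (canon E)" for A
    using that unfolding canon_fields by (rule bspec[OF S(7), THEN conjunct1])
  show "0 < ratio (canon E) A u" if "A \<in> patterns (canon E)" "u \<in> space (leb A)" for A u
    using that unfolding canon_fields by (rule bspec[OF bspec[OF S(7), THEN conjunct2]])
  show "target (canon E) \<in> borel_measurable (leb (coords (canon E)))" unfolding canon_fields by (rule S(8))
  show "0 < lam (canon E) A" if "A \<in> patterns (canon E)" for A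
    using that unfolding canon_fields by (rule bspec[OF S(9), THEN conjunct1])
  show "1 \<le> nS (canon E) A" if "A \<in> patterns (canon E)" for A
    using that unfolding canon_fields by (rule bspec[OF S(10)])
  show "1 \<le> nsteps (canon E)" "2 * nsteps (canon E) \<le> ssize (canon E)" "0 < bandwidth (canon E)" "1 \<le> trunc (canon E)"
    unfolding canon_fields by (rule S(11), rule S(12), rule S(13), rule S(14))
  show "hypotheses (canon E) K" unfolding canon_hypotheses by (rule h)
  fix l :: nat assume l: "l \<in> {1, 2}"
  note p = bspec[OF S(15) l]
  show "disjoint_family_on (piece (canon E) l) {1..nsteps (canon E)}" unfolding canon_fields by (rule conjunct1[OF p])
  show "(\<Union>m\<in>{1..nsteps (canon E)}. piece (canon E) l m) = half (canon E) l"
    unfolding canon_fields canon_population by (rule conjunct1[OF conjunct2[OF p]])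
  show "card (piece (canon E) l m) \<le> card (piece (canon E) l m') + 1"
    if "m \<in> {1..nsteps (canon E)}" "m' \<in> {1..nsteps (canon E)}" for m m'
    using that unfolding canon_fields by (rule bspec[OF bspec[OF conjunct2[OF conjunct2[OF p]]]])
qed

context model
begin

text \<open>The assumptions on a design fix the joint law of the actual observations only, while
  \<open>Q\<close> lives on all coordinates; the estimators must therefore be seen to ignore the
  coordinates outside \<open>idxs\<close>.\<close>

lemma estimators_cong:
  assumes "\<And>k. k \<in> idxs \<Longrightarrow> D k = D' k"
  shows "theta_hat E D = theta_hat E D'" "V_hat E D = V_hat E D'" "studentised E D = studentised E D'"
proof -
  have X: "X i D = X i D'" if "i \<in> half E l" "l \<in> {1, 2}" for i l
    using assms[of "Inl i"] half_facts(1)[OF that(2)] that(1) by (auto simp: idxs_def)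
  have Y: "Y S j D = Y S j D'" if "S \<in> \<S>" "j \<in> {1..nS E S}" for S j
    by (rule assms) (unfold idxs_def, intro InrI SigmaI that)
  have a: "alpha_hat E D l MM = alpha_hat E D' l MM" if l: "l \<in> {1, 2}" for l
    by (rule ah_cong[OF l _ order_refl]) (rule X[OF _ l])
  have res: "residual E D l = residual E D' l" if "l \<in> {1, 2}" for l
    by (simp add: residual_def[abs_def] a[OF that])
  have av: "average (half E l) (\<lambda>i. f (X i D)) = average (half E l) (\<lambda>i. f (X i D'))" if "l \<in> {1, 2}" for l and f :: "point \<Rightarrow> real"
    unfolding average_def by (intro arg_cong2[where f="(/)"] sum.cong refl) (simp add: X[OF _ that])
  have rh: "rhat E D (half E l) S = rhat E D' (half E l) S" if "l \<in> {1, 2}" for l S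
    unfolding rhat_def Xfull_eq by (rule av[OF that])
  have t: "theta_fold E D l = theta_fold E D' l" if l: "l \<in> {1, 2}" for l
  proof -
    note l' = other_half(1)[OF l]
    show ?thesis unfolding theta_fold_def res[OF l] a[OF l] rh[OF l'] Xfull_eq Xinc_eq
    proof (intro arg_cong2[where f="(+)"] av[OF l'] sum.cong refl)
      fix S assume S: "S \<in> \<S>"
      show "average {1..nS E S} (\<lambda>j. ah l MM S D' (Y S j D) * rhat E D' (half E (3 - l)) S / ratio E S (Y S j D))
        = average {1..nS E S} (\<lambda>j. ah l MM S D' (Y S j D') * rhat E D' (half E (3 - l)) S / ratio E S (Y S j D'))"
        unfolding average_def by (rule arg_cong2[where f="(/)", OF sum.cong[OF refl] refl]) (simp only: Y[OF S])
    qed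
  qed
  show th: "theta_hat E D = theta_hat E D'" unfolding theta_hat_def by (simp add: t)
  have vf: "V_fold E D l = V_fold E D' l" if l: "l \<in> {1, 2}" for l
    unfolding V_fold_def th res[OF l] Xfull_eq using av[OF other_half(1)[OF l]] by simp
  have vs: "VS_fold E D l S = VS_fold E D' l S" if l: "l \<in> {1, 2}" for l S
    unfolding VS_fold_def a[OF l] rh[OF l] Xfull_eq using av[OF other_half(1)[OF l], of "\<lambda>x. rhat E D' (half E l) S * (alpha_fin E D' l S (restrict x S))\<^sup>2 / (real (nS E S) * ratio E S (restrict x S))"] by simp
  show v: "V_hat E D = V_hat E D'" unfolding V_hat_def by (simp add: vf vs)
  show "studentised E D = studentised E D'" unfolding studentised_def th v ..
qed

text \<open>A function ignoring the coordinates outside \<open>idxs\<close> can be evaluated on the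
  smaller product after filling these with fixed points \<open>d0\<close>. Its law is then the image
  of that product under either source, the data or \<open>Q\<close>.\<close>

lemma transfer:
  fixes Om :: "'v measure"
  assumes Z: "Z \<in> measurable Om (PiM idxs Mf)" and dZ: "distr Om (PiM idxs Mf) Z = PiM idxs Mf"
    and F: "F \<in> borel_measurable Q" "\<And>D D'. (\<And>k. k \<in> idxs \<Longrightarrow> D k = D' k) \<Longrightarrow> F D = F D'"
  shows "(\<lambda>\<omega>. F (Z \<omega>)) \<in> borel_measurable Om" "distr Om borel (\<lambda>\<omega>. F (Z \<omega>)) = distr Q borel (F :: _ \<Rightarrow> real)"
proof -
  define d0 where "d0 k = (SOME y. y \<in> space (Mf k))" for k
  have d0: "d0 k \<in> space (Mf k)" for k
    unfolding d0_def using prob_space.not_empty[OF prob_Mf[of k]] by (simp add: some_in_eq)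
  define fill where "fill D k = (if k \<in> idxs then D k else d0 k)" for D :: "nat + nat set \<times> nat \<Rightarrow> point" and k
  have fill: "fill \<in> measurable (PiM idxs Mf) Q"
  proof (rule measurable_PiM_single')
    fix k
    show "(\<lambda>D. fill D k) \<in> measurable (PiM idxs Mf) (Mf k)"
      unfolding fill_def using d0[of k] by (cases "k \<in> idxs") auto
  qed (auto simp: fill_def space_PiM PiE_iff d0)
  have Ff: "F (fill D) = F D" for D by (rule F(2)) (simp add: fill_def)
  have G: "F \<in> borel_measurable (PiM idxs Mf)"
    using measurable_compose[OF fill F(1)] by (simp add: Ff)
  show "(\<lambda>\<omega>. F (Z \<omega>)) \<in> borel_measurable Om" by (rule measurable_compose[OF Z G])
  have r: "distr Q (PiM idxs Mf) (\<lambda>D. \<lambda>k\<in>idxs. D k) = PiM idxs Mf"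
    using distr_PiM_reindex[of UNIV Mf "\<lambda>k. k" idxs] prob_Mf by simp
  have rm: "(\<lambda>D. \<lambda>k\<in>idxs. D k) \<in> measurable Q (PiM idxs Mf)" by (rule measurable_restrict_subset) simp
  have "distr Om borel (\<lambda>\<omega>. F (Z \<omega>)) = distr (distr Om (PiM idxs Mf) Z) borel F"
    using distr_distr[OF G Z] by (simp add: comp_def)
  also have "\<dots> = distr (distr Q (PiM idxs Mf) (\<lambda>D. \<lambda>k\<in>idxs. D k)) borel F" unfolding dZ r ..
  also have "\<dots> = distr Q borel (\<lambda>D. F (\<lambda>k\<in>idxs. D k))" using distr_distr[OF G rm] by (simp add: comp_def)
  also have "(\<lambda>D. F (\<lambda>k\<in>idxs. D k)) = F" by (rule ext, rule F(2)) simp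
  finally show "distr Om borel (\<lambda>\<omega>. F (Z \<omega>)) = distr Q borel F" .
qed

end

text \<open>Mutual independence is equivalent to the joint law being the product of the marginal
  laws, and these are the factors \<open>Mf\<close> by the assumed densities.\<close>

lemma data_distribution:
  assumes s: "setting E" and h: "hypotheses E K"
  defines "I \<equiv> model.idxs (canon E)" and "F \<equiv> model.Mf (canon E)"
  shows "(\<lambda>\<omega>. \<lambda>k\<in>I. dat E \<omega> k) \<in> measurable (Omega E) (PiM I F)"
    "distr (Omega E) (PiM I F) (\<lambda>\<omega>. \<lambda>k\<in>I. dat E \<omega> k) = PiM I F"
proof -
  interpret model "canon E" K by (rule canon_model[OF s h])
  interpret O: prob_space "Omega E" using s by (simp add: setting_def)
  have I: "I = {1..ssize E} <+> (SIGMA S:patterns E. {1..nS E S})" by (simp add: I_def idxs_def)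
  define M' where "M' = (case_sum (\<lambda>i. leb (coords E)) (\<lambda>(S, j). leb S) :: nat + nat set \<times> nat \<Rightarrow> point measure)"
  define Xs where "Xs = case_sum (Xfull E) (\<lambda>(S, j). Xinc E S j)"
  have Xs: "Xs k \<omega> = dat E \<omega> k" for k \<omega> unfolding Xs_def dat_def by (cases k) auto
  have ind: "O.indep_vars M' Xs I" unfolding I M'_def Xs_def by (rule settingD(19)[OF s])
  have d: "distributed (Omega E) (leb (coords E)) (Xfull E i) (\<lambda>x. ennreal (dens E x))" if "i \<in> {1..ssize E}" for i
    using settingD(17)[OF s] that by (rule bspec)
  have dS: "distributed (Omega E) (leb S) (Xinc E S j) (\<lambda>u. ennreal (rbar E S u * marg E S u))" if "S \<in> patterns E" "j \<in> {1..nS E S}" for S j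
    by (rule bspec[OF bspec[OF settingD(18)[OF s] that(1)] that(2)])
  have k: "Xs k \<in> measurable (Omega E) (M' k) \<and> distr (Omega E) (M' k) (Xs k) = F k" if "k \<in> I" for k
  proof (cases k)
    case (Inl i)
    then have i: "i \<in> {1..ssize E}" using that by (auto simp: I)
    have e: "M' k = leb (coords E)" "Xs k = Xfull E i" "F k = law E" by (simp_all add: Inl M'_def Xs_def F_def)
    have "distr (Omega E) (leb (coords E)) (Xfull E i) = law E"
      unfolding law_def by (rule distributed_distr_eq_density[OF d[OF i]])
    then show ?thesis unfolding e using distributed_measurable[OF d[OF i]] by blast
  next
    case (Inr p)
    then have "p \<in> (SIGMA S:patterns E. {1..nS E S})" using that unfolding I Plus_def by auto
    then obtain S j where p: "p = (S, j)" "S \<in> patterns E" "j \<in> {1..nS E S}" by auto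
    have e: "M' k = leb S" "Xs k = Xinc E S j" "F k = inc_law S" using Inr p by (simp_all add: M'_def Xs_def F_def)
    have "distr (Omega E) (leb S) (Xinc E S j) = inc_law S"
      unfolding inc_law_def canon_fields canon_population by (rule distributed_distr_eq_density[OF dS[OF p(2,3)]])
    then show ?thesis unfolding e using distributed_measurable[OF dS[OF p(2,3)]] by blast
  qed
  have ne: "I \<noteq> {}"
  proof -
    have "Inl 1 \<in> I" unfolding I using n_pos by (intro InlI) simp
    then show ?thesis by blast
  qed
  have "sets (F k) = sets (M' k)" if "k \<in> I" for k unfolding conjunct2[OF k[OF that], symmetric] by (rule sets_distr)
  then have sF: "sets (PiM I F) = sets (PiM I M')" by (rule sets_PiM_cong[OF refl])
  have "distr (Omega E) (PiM I M') (\<lambda>\<omega>. \<lambda>k\<in>I. Xs k \<omega>) = PiM I (\<lambda>k. distr (Omega E) (M' k) (Xs k))"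
  proof (rule iffD1[OF O.indep_vars_iff_distr_eq_PiM' ind])
    show "Xs k \<in> measurable (Omega E) (M' k)" if "k \<in> I" for k using k[OF that] by (rule conjunct1)
  qed (rule ne)
  also have "\<dots> = PiM I F" by (rule PiM_cong[OF refl]) (rule conjunct2[OF k])
  finally have "distr (Omega E) (PiM I M') (\<lambda>\<omega>. \<lambda>k\<in>I. dat E \<omega> k) = PiM I F" unfolding Xs .
  moreover have "distr (Omega E) (PiM I F) (\<lambda>\<omega>. \<lambda>k\<in>I. dat E \<omega> k) = distr (Omega E) (PiM I M') (\<lambda>\<omega>. \<lambda>k\<in>I. dat E \<omega> k)"
    by (rule distr_cong[OF refl sF refl])
  ultimately show "distr (Omega E) (PiM I F) (\<lambda>\<omega>. \<lambda>k\<in>I. dat E \<omega> k) = PiM I F" by (rule trans[rotated])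
  have m: "(\<lambda>\<omega>. \<lambda>k\<in>I. dat E \<omega> k) \<in> measurable (Omega E) (PiM I M')"
  proof (rule measurable_restrict)
    fix k assume "k \<in> I"
    then have "Xs k \<in> measurable (Omega E) (M' k)" by (rule conjunct1[OF k])
    then show "(\<lambda>\<omega>. dat E \<omega> k) \<in> measurable (Omega E) (M' k)" unfolding Xs[symmetric] .
  qed
  have eq: "measurable (Omega E) (PiM I F) = measurable (Omega E) (PiM I M')" by (rule measurable_cong_sets[OF refl sF])
  show "(\<lambda>\<omega>. \<lambda>k\<in>I. dat E \<omega> k) \<in> measurable (Omega E) (PiM I F)"
    by (rule subsetD[OF equalityD2[OF eq] m])
qed

lemma measure_distr_atMost:
  fixes f :: "'x \<Rightarrow> real"
  assumes "f \<in> borel_measurable M"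
  shows "measure (distr M borel f) {..z} = measure M {x \<in> space M. f x \<le> z}"
proof -
  have "f -` {..z} \<inter> space M = {x \<in> space M. f x \<le> z}" by auto
  then show ?thesis using measure_distr[OF assms, of "{..z}"] by simp
qed

lemma design_estimators:
  assumes s: "setting E" and h: "hypotheses E K"
  shows "theta_hat E \<in> borel_measurable (Omega E)" "V_hat E \<in> borel_measurable (Omega E)" "studentised E \<in> borel_measurable (Omega E)"
    "\<bar>measure (Omega E) {\<omega> \<in> space (Omega E). studentised E \<omega> \<le> z} - Phi z\<bar> \<le> error_bound E K"
proof -
  interpret model "canon E" K by (rule canon_model[OF s h])
  let ?Z = "\<lambda>\<omega>. \<lambda>k\<in>idxs. dat E \<omega> k"
  note Z = data_distribution[OF s h]
  have r: "theta_hat (canon E) (?Z \<omega>) = theta_hat E \<omega>" "V_hat (canon E) (?Z \<omega>) = V_hat E \<omega>" "studentised (canon E) (?Z \<omega>) = studentised E \<omega>" for \<omega>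
    using estimators_cong[of "?Z \<omega>" "dat E \<omega>"] by simp_all
  show "theta_hat E \<in> borel_measurable (Omega E)" "V_hat E \<in> borel_measurable (Omega E)"
    using transfer(1)[OF Z estimators_measurable(1) estimators_cong(1)] transfer(1)[OF Z estimators_measurable(2) estimators_cong(2)]
    unfolding r by simp_all
  show m: "studentised E \<in> borel_measurable (Omega E)"
    using transfer(1)[OF Z studentised_measurable estimators_cong(3)] unfolding r by simp
  have d: "distr (Omega E) borel (studentised E) = distr Q borel (studentised (canon E))"
    using transfer(2)[OF Z studentised_measurable estimators_cong(3)] unfolding r by simp
  have "measure (Omega E) {\<omega> \<in> space (Omega E). studentised E \<omega> \<le> z} = measure (distr (Omega E) borel (studentised E)) {..z}"
    by (rule measure_distr_atMost[OF m, symmetric])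
  also have "\<dots> = measure Q {D \<in> space Q. studentised (canon E) D \<le> z}"
    unfolding d by (rule measure_distr_atMost[OF studentised_measurable])
  finally show "\<bar>measure (Omega E) {\<omega> \<in> space (Omega E). studentised E \<omega> \<le> z} - Phi z\<bar> \<le> error_bound E K"
    using studentised_bound[of z] unfolding canon_error_bound by linarith
qed

section \<open>Coverage\<close>

lemma Phi_strict_mono: assumes "a < b" shows "Phi a < Phi b"
proof (rule DERIV_pos_imp_increasing[OF assms])
  fix x
  have "0 < std_normal_density x" by (rule normal_density_pos) simp
  then show "\<exists>y. (Phi has_real_derivative y) (at x) \<and> 0 < y" using Phi_deriv[of x] by (intro exI conjI)
qed

text \<open>\<open>Phi x + Phi (- x)\<close> has derivative 0, hence is constant, and the tail
  bounds identify the constant as 1.\<close>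

lemma Phi_symmetric: "Phi (- x) = 1 - Phi x"
proof -
  define f where "f x = Phi x + Phi (- x)" for x
  have f: "f x = f 0" for x
  proof (rule DERIV_isconst_all[where f=f], rule allI)
    fix x
    have "(f has_real_derivative std_normal_density x - std_normal_density (- x)) (at x)"
      unfolding f_def[abs_def] by (auto intro!: derivative_eq_intros)
    then show "(f has_real_derivative 0) (at x)" by (simp add: std_normal_density_def)
  qed
  have "\<bar>f 0 - 1\<bar> \<le> e" if e: "0 < e" for e
  proof -
    define t where "t = 1 / sqrt e"
    have "0 < t" "1 / t\<^sup>2 = e" using e by (simp_all add: t_def power_divide)
    from Phi_tails[OF this(1)] this(2) have "\<bar>f t - 1\<bar> \<le> e" unfolding f_def using Phi_le_1[of t] Phi_nonneg[of "- t"] by linarith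
    then show ?thesis using f[of t] by simp
  qed
  then have "\<bar>f 0 - 1\<bar> \<le> 0" by (rule field_le_epsilon) simp
  then show ?thesis using f[of x] by (simp add: f_def)
qed

text \<open>The quantile is a definite description, so existence and uniqueness are needed: the
  former by the intermediate value theorem on an interval ending at
  \<open>t = 2 / sqrt \<alpha>\<close>, where the tail is at most \<open>\<alpha> / 4\<close>, the
  latter by strict monotonicity.\<close>

lemma normal_quantile:
  assumes "0 < \<alpha>" "\<alpha> < 1"
  defines "z \<equiv> normal_quantile (1 - \<alpha> / 2)"
  shows "0 < z" "Phi z - Phi (- z) = 1 - \<alpha>"
proof -
  define t where "t = 2 / sqrt \<alpha>"
  have t: "0 < t" "1 / t\<^sup>2 = \<alpha> / 4" using assms by (simp_all add: t_def power_divide)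
  have h: "Phi 0 = 1 / 2" using Phi_symmetric[of 0] by simp
  have "continuous_on {0..t} Phi" using Phi_deriv by (meson DERIV_isCont continuous_at_imp_continuous_on)
  moreover have "Phi 0 \<le> 1 - \<alpha> / 2" "1 - \<alpha> / 2 \<le> Phi t" using h assms Phi_tails(1)[OF t(1)] t(2) by linarith+
  ultimately obtain y where y: "Phi y = 1 - \<alpha> / 2" using IVT'[of Phi 0 "1 - \<alpha> / 2" t] t(1) by auto
  have "normal_quantile (1 - \<alpha> / 2) = y"
    unfolding normal_quantile_def
  proof (rule the_equality[where P="\<lambda>z. Phi z = 1 - \<alpha> / 2"])
    fix z assume "Phi z = 1 - \<alpha> / 2"
    then show "z = y" using y Phi_strict_mono[of z y] Phi_strict_mono[of y z] by (cases z y rule: linorder_cases) auto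
  qed (rule y)
  then have z: "Phi z = 1 - \<alpha> / 2" using y by (simp add: z_def)
  then show "Phi z - Phi (- z) = 1 - \<alpha>" by (simp add: Phi_symmetric)
  show "0 < z"
  proof (rule ccontr)
    assume "\<not> 0 < z"
    then have "Phi z \<le> Phi 0" by (intro Phi_mono) simp
    then show False using z h assms by simp
  qed
qed

text \<open>If the scale vanishes then so does the studentised variable, and this has small probability since
  the normal distribution has no atom at \<open>0\<close>.\<close>

lemma (in prob_space) coverage:
  assumes [measurable]: "\<Theta> \<in> borel_measurable M" "V \<in> borel_measurable M"
    and V: "\<And>x. 0 \<le> V x" and z: "0 < z"
  defines "U \<equiv> \<lambda>x. \<Theta> x / sqrt (V x) * of_bool (0 < V x)"
  assumes e: "\<And>z. \<bar>prob {x \<in> space M. U x \<le> z} - Phi z\<bar> \<le> e"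
  shows "\<bar>prob {x \<in> space M. \<bar>\<Theta> x\<bar> \<le> sqrt (V x) * z} - (Phi z - Phi (- z))\<bar> \<le> 4 * e"
proof -
  have [measurable]: "U \<in> borel_measurable M" unfolding U_def by measurable
  have ivl: "prob {x \<in> space M. a < U x \<and> U x \<le> c} = prob {x \<in> space M. U x \<le> c} - prob {x \<in> space M. U x \<le> a}" if "a \<le> c" for a c
  proof -
    have "{x \<in> space M. a < U x \<and> U x \<le> c} = {x \<in> space M. U x \<le> c} - {x \<in> space M. U x \<le> a}" by auto
    then show ?thesis using that by (simp add: finite_measure_Diff subset_eq)
  qed
  have ivl_le: "prob {x \<in> space M. a < U x \<and> U x \<le> c} \<le> Phi c - Phi a + 2 * e" "Phi c - Phi a - 2 * e \<le> prob {x \<in> space M. a < U x \<and> U x \<le> c}" if "a \<le> c" for a c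
    using ivl[OF that] e[of a] e[of c] by linarith+
  \<comment> \<open>The law of \<open>U\<close> may have atoms, so the left endpoint is included by
    moving it to the left by an arbitrarily small amount; continuity of \<open>Phi\<close> makes
    this free.\<close>
  have closed: "prob {x \<in> space M. a \<le> U x \<and> U x \<le> c} \<le> Phi c - Phi a + 2 * e" if "a \<le> c" for a c
  proof (rule field_le_epsilon)
    fix t :: real assume t: "0 < t"
    have "prob {x \<in> space M. a \<le> U x \<and> U x \<le> c} \<le> prob {x \<in> space M. a - t < U x \<and> U x \<le> c}"
      by (rule finite_measure_mono) (use t in auto)
    also have "\<dots> \<le> Phi c - Phi (a - t) + 2 * e" using that t by (intro ivl_le) auto
    also have "\<dots> \<le> Phi c - Phi a + 2 * e + t" using Phi_lipschitz[of "a - t" a] t by simp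
    finally show "prob {x \<in> space M. a \<le> U x \<and> U x \<le> c} \<le> Phi c - Phi a + 2 * e + t" .
  qed
  have iff: "\<bar>\<Theta> x\<bar> \<le> sqrt (V x) * z \<longleftrightarrow> - z \<le> U x \<and> U x \<le> z" if "0 < V x" for x
  proof -
    have "\<bar>U x\<bar> = \<bar>\<Theta> x\<bar> / sqrt (V x)" using that by (simp add: U_def abs_divide)
    then have "\<bar>U x\<bar> \<le> z \<longleftrightarrow> \<bar>\<Theta> x\<bar> \<le> sqrt (V x) * z" using that by (simp add: pos_divide_le_eq mult.commute)
    then show ?thesis by (simp add: abs_le_iff) linarith
  qed
  have zero: "U x = 0" if "\<not> 0 < V x" for x using that by (simp add: U_def)
  have "prob {x \<in> space M. \<bar>\<Theta> x\<bar> \<le> sqrt (V x) * z} \<le> prob {x \<in> space M. - z \<le> U x \<and> U x \<le> z}"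
  proof (rule finite_measure_mono)
    show "{x \<in> space M. \<bar>\<Theta> x\<bar> \<le> sqrt (V x) * z} \<subseteq> {x \<in> space M. - z \<le> U x \<and> U x \<le> z}"
      using iff zero z by (smt (verit) Collect_mono)
  qed measurable
  also have "\<dots> \<le> Phi z - Phi (- z) + 2 * e" using z by (intro closed) simp
  finally have up: "prob {x \<in> space M. \<bar>\<Theta> x\<bar> \<le> sqrt (V x) * z} \<le> Phi z - Phi (- z) + 2 * e" .
  \<comment> \<open>Where \<open>V\<close> vanishes the interval is a single point and may miss,
    although \<open>U = 0\<close> lies in range. These points are covered by the event
    \<open>U = 0\<close>, whose probability is at most \<open>2 * e\<close>.\<close>
  have "prob {x \<in> space M. - z < U x \<and> U x \<le> z} \<le> prob ({x \<in> space M. \<bar>\<Theta> x\<bar> \<le> sqrt (V x) * z} \<union> {x \<in> space M. 0 \<le> U x \<and> U x \<le> 0})"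
  proof (rule finite_measure_mono)
    show "{x \<in> space M. - z < U x \<and> U x \<le> z} \<subseteq> {x \<in> space M. \<bar>\<Theta> x\<bar> \<le> sqrt (V x) * z} \<union> {x \<in> space M. 0 \<le> U x \<and> U x \<le> 0}"
      using iff zero by fastforce
  qed measurable
  also have "\<dots> \<le> prob {x \<in> space M. \<bar>\<Theta> x\<bar> \<le> sqrt (V x) * z} + prob {x \<in> space M. 0 \<le> U x \<and> U x \<le> 0}"
    by (rule measure_Un_le) measurable
  finally have "Phi z - Phi (- z) - 4 * e \<le> prob {x \<in> space M. \<bar>\<Theta> x\<bar> \<le> sqrt (V x) * z}"
    using ivl_le(2)[of "- z" z] closed[of 0 0] z by simp
  with up show ?thesis using e[of 0] by linarith
qed

lemma design_coverage:
  assumes s: "setting E" and h: "hypotheses E K" and \<alpha>: "\<alpha> \<in> {0<..<1}"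
  shows "\<bar>measure (Omega E) {\<omega> \<in> space (Omega E). theta E \<in> conf_int E \<alpha> \<omega>} - (1 - \<alpha>)\<bar> \<le> 4 * error_bound E K"
proof -
  interpret O: prob_space "Omega E" using s by (simp add: setting_def)
  note m [measurable] = design_estimators(1,2)[OF s h]
  have "0 < ssize E" using s by (auto simp: setting_def)
  then have n: "0 < sqrt (real (ssize E))" by simp
  define z where "z = normal_quantile (1 - \<alpha> / 2)"
  have z: "0 < z" "Phi z - Phi (- z) = 1 - \<alpha>" using normal_quantile[of \<alpha>] \<alpha> by (simp_all add: z_def)
  define \<Theta> where "\<Theta> \<omega> = sqrt (real (ssize E)) * (theta_hat E \<omega> - theta E)" for \<omega>
  have [measurable]: "\<Theta> \<in> borel_measurable (Omega E)" unfolding \<Theta>_def[abs_def] by measurable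
  have st: "studentised E = (\<lambda>\<omega>. \<Theta> \<omega> / sqrt (V_hat E \<omega>) * of_bool (0 < V_hat E \<omega>))" by (simp add: studentised_def \<Theta>_def fun_eq_iff)
  note e = design_estimators(4)[OF s h, unfolded st]
  have iff: "theta E \<in> conf_int E \<alpha> \<omega> \<longleftrightarrow> \<bar>\<Theta> \<omega>\<bar> \<le> sqrt (V_hat E \<omega>) * z" for \<omega>
  proof -
    have "theta E \<in> conf_int E \<alpha> \<omega> \<longleftrightarrow> \<bar>theta_hat E \<omega> - theta E\<bar> \<le> sqrt (V_hat E \<omega>) * z / sqrt (real (ssize E))"
      unfolding conf_int_def Let_def z_def[symmetric] by (auto simp: abs_le_iff)
    then show ?thesis unfolding \<Theta>_def using n by (simp add: abs_mult pos_le_divide_eq mult.commute)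
  qed
  have "\<bar>O.prob {\<omega> \<in> space (Omega E). \<bar>\<Theta> \<omega>\<bar> \<le> sqrt (V_hat E \<omega>) * z} - (Phi z - Phi (- z))\<bar> \<le> 4 * error_bound E K"
    by (rule O.coverage[OF _ m(2) _ z(1) e]) (simp_all add: V_hat_def)
  then show ?thesis unfolding iff z(2) .
qed

text \<open>Uniformity in the level is immediate because the coverage error is at most
  \<open>4 * error_bound\<close>, an expression free of the level. Designs and constants may change
  along the sequence.\<close>

theorem proposition16:
  shows "(\<forall>(E :: 'w design) (K :: constants). setting E \<longrightarrow> hypotheses E K \<longrightarrow>
            kolmogorov_dist (distr (Omega E) borel (studentised E)) std_normal_distribution
              \<le> error_bound E K) \<and>
         (\<forall>(E :: nat \<Rightarrow> 'w design) (K :: nat \<Rightarrow> constants).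
            (\<forall>k. setting (E k) \<and> hypotheses (E k) (K k)) \<longrightarrow>
            (\<lambda>k. error_bound (E k) (K k)) \<longlonglongrightarrow> 0 \<longrightarrow>
            uniform_limit {0<..<1}
              (\<lambda>k \<alpha>. measure (Omega (E k))
                 {\<omega> \<in> space (Omega (E k)). theta (E k) \<in> conf_int (E k) \<alpha> \<omega>})
              (\<lambda>\<alpha>. 1 - \<alpha>) sequentially)"
proof (intro conjI allI impI)
  fix E :: "'w design" and K :: constants
  assume s: "setting E" and h: "hypotheses E K"
  have "cdf (distr (Omega E) borel (studentised E)) z = measure (Omega E) {\<omega> \<in> space (Omega E). studentised E \<omega> \<le> z}" for z
    unfolding cdf_def by (rule measure_distr_atMost[OF design_estimators(3)[OF s h]])
  then show "kolmogorov_dist (distr (Omega E) borel (studentised E)) std_normal_distribution \<le> error_bound E K"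
    unfolding kolmogorov_dist_def using design_estimators(4)[OF s h] by (intro cSUP_least) auto
next
  fix E :: "nat \<Rightarrow> 'w design" and K :: "nat \<Rightarrow> constants"
  assume sh: "\<forall>k. setting (E k) \<and> hypotheses (E k) (K k)" and lim: "(\<lambda>k. error_bound (E k) (K k)) \<longlonglongrightarrow> 0"
  show "uniform_limit {0<..<1}
      (\<lambda>k \<alpha>. measure (Omega (E k)) {\<omega> \<in> space (Omega (E k)). theta (E k) \<in> conf_int (E k) \<alpha> \<omega>})
      (\<lambda>\<alpha>. 1 - \<alpha>) sequentially"
  proof (rule uniform_limitI)
    fix e :: real assume "0 < e"
    then have "\<forall>\<^sub>F k in sequentially. error_bound (E k) (K k) < e / 4" using lim by (intro order_tendstoD(2)) auto
    then show "\<forall>\<^sub>F k in sequentially. \<forall>\<alpha>\<in>{0<..<1}.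
        dist (measure (Omega (E k)) {\<omega> \<in> space (Omega (E k)). theta (E k) \<in> conf_int (E k) \<alpha> \<omega>}) (1 - \<alpha>) < e"
    proof eventually_elim
      case (elim k)
      show ?case using design_coverage[of "E k" "K k"] sh elim unfolding dist_real_def by fastforce
    qed
  qed
qed

end
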